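(* For every $n$-node weighted graph and every sufficiently small constant $\epsilon>0$, there exists a distributed algorithm in the $\mathsf{CONGEST}+\mathsf{NCC}$ model which, with high probability, computes a $(1+\epsilon)$-approximation of the minimum cut within $\mathcal{O}(\mathrm{polylog}(n))$ rounds.
   Context: Distributed setting: $n$ nodes with unique IDs in $\{1,\dots,n\}$; local communication graph $G=(V,E,w)$, undirected, integer edge weights in $\{1,\dots,W\}$ with $W=\mathrm{poly}(n)$; each node initially knows only its neighbors' IDs and incident edge weights; synchronous rounds, unlimited local computation. In the $\mathsf{CONGEST}+\mathsf{NCC}$ model, in each round every node may send an $\mathcal{O}(\log n)$-bit message to each neighbor in $G$ (local mode), and additionally may send and receive $\mathcal{O}(\log n)$-bit messages to/from up to $\mathcal{O}(\log n)$ arbitrary nodes of the network (global mode, node-capacitated clique); excess messages are dropped arbitrarily. For $S\subset V$, $\mathrm{cut}_G(S)=\sum_{u\in S, v\in V\setminus S} w(u,v)$; the minimum cut problem asks for a partition $(S, V\setminus S)$ minimizing $\mathrm{cut}_G(S)$, and the output requirement is that every node knows on which side of the computed cut it lies. A $(1+\epsilon)$-approximation is a cut of weight at most $(1+\epsilon)$ times the minimum. "With high probability" means with probability at least $1-1/n^c$ for some constant $c>0$. *)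

theory Defs
  imports "HOL-Probability.Probability" "HOL-Library.Sublist"
begin

text \<open>Nodes are 0..n-1 (IDs shifted by one). A weighted graph is a symmetric
  weight function w with w u v = 0 meaning no edge; edge weights are positive
  integers bounded by W = n^d (W = poly(n)).\<close>

definition weighted_graph :: "nat \<Rightarrow> (nat \<Rightarrow> nat \<Rightarrow> nat) \<Rightarrow> nat \<Rightarrow> bool" where
  "weighted_graph n w d \<longleftrightarrow>
     (\<forall>u v. w u v = w v u) \<and> (\<forall>v. w v v = 0) \<and>
     (\<forall>u v. (n \<le> u \<or> n \<le> v) \<longrightarrow> w u v = 0) \<and>
     (\<forall>u v. w u v \<le> n ^ d)"

definition cut_weight :: "nat \<Rightarrow> (nat \<Rightarrow> nat \<Rightarrow> nat) \<Rightarrow> nat set \<Rightarrow> nat" where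
  "cut_weight n w S = (\<Sum>u\<in>S. \<Sum>v\<in>{0..<n} - S. w u v)"

definition proper_cut :: "nat \<Rightarrow> nat set \<Rightarrow> bool" where
  "proper_cut n S \<longleftrightarrow> S \<subseteq> {0..<n} \<and> S \<noteq> {} \<and> S \<noteq> {0..<n}"

definition min_cut :: "nat \<Rightarrow> (nat \<Rightarrow> nat \<Rightarrow> nat) \<Rightarrow> nat" where
  "min_cut n w = Min {cut_weight n w S | S. proper_cut n S}"

text \<open>Full-information node state (unlimited local computation): the number of
  nodes n, own ID, incident weights (row of w), own random number, and the history of
  received messages per round: local messages (by neighbour) and global messages
  (sender, message).\<close>

record knowledge =
  k_n :: nat
  k_id :: nat
  k_row :: "nat \<Rightarrow> nat"
  k_rand :: nat
  k_hist :: "((nat \<Rightarrow> nat option) \<times> (nat \<times> nat) list) list"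

record algorithm =
  local_send :: "knowledge \<Rightarrow> nat \<Rightarrow> nat option"
  global_send :: "knowledge \<Rightarrow> (nat \<times> nat) list"     \<comment> \<open>(target, message) pairs\<close>
  cut_side :: "knowledge \<Rightarrow> bool"
  num_rounds :: "nat \<Rightarrow> nat"
  rand_bits :: "nat \<Rightarrow> nat"

text \<open>Adversary choosing which excess global messages are dropped: given round,
  receiver, the whole configuration and the incoming list, returns the kept sublist.\<close>
type_synonym adversary =
  "nat \<Rightarrow> nat \<Rightarrow> (nat \<Rightarrow> knowledge) \<Rightarrow> (nat \<times> nat) list \<Rightarrow> (nat \<times> nat) list"

definition ncc_cap :: "nat \<Rightarrow> nat \<Rightarrow> nat" where
  "ncc_cap \<kappa> n = \<kappa> * nat \<lceil>log 2 (real n + 1)\<rceil>"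

text \<open>Messages of O(log n) bits: natural numbers below (n+1)^kappa.\<close>
definition msg_bound :: "nat \<Rightarrow> nat \<Rightarrow> nat" where
  "msg_bound \<kappa> n = (n + 1) ^ \<kappa>"

definition valid_algorithm :: "nat \<Rightarrow> algorithm \<Rightarrow> bool" where
  "valid_algorithm \<kappa> A \<longleftrightarrow>
     (\<forall>k. length (global_send A k) \<le> ncc_cap \<kappa> (k_n k) \<and>
          (\<forall>(t, m) \<in> set (global_send A k). m < msg_bound \<kappa> (k_n k)) \<and>
          (\<forall>u m. local_send A k u = Some m \<longrightarrow> m < msg_bound \<kappa> (k_n k)))"

definition initial_conf :: "nat \<Rightarrow> (nat \<Rightarrow> nat \<Rightarrow> nat) \<Rightarrow> (nat \<Rightarrow> nat) \<Rightarrow> nat \<Rightarrow> knowledge" where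
  "initial_conf n w r v = \<lparr>k_n = n, k_id = v, k_row = w v, k_rand = r v, k_hist = []\<rparr>"

definition local_in :: "algorithm \<Rightarrow> nat \<Rightarrow> (nat \<Rightarrow> nat \<Rightarrow> nat) \<Rightarrow> (nat \<Rightarrow> knowledge) \<Rightarrow> nat
    \<Rightarrow> nat \<Rightarrow> nat option" where
  "local_in A n w conf v = (\<lambda>u. if u < n \<and> u \<noteq> v \<and> 0 < w v u
                                 then local_send A (conf u) v else None)"

definition incoming_global :: "algorithm \<Rightarrow> nat \<Rightarrow> (nat \<Rightarrow> knowledge) \<Rightarrow> nat \<Rightarrow> (nat \<times> nat) list" where
  "incoming_global A n conf v =
     concat (map (\<lambda>u. map (\<lambda>(t, m). (u, m)) (filter (\<lambda>(t, m). t = v) (global_send A (conf u))))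
                 [0..<n])"

definition received :: "nat \<Rightarrow> adversary \<Rightarrow> nat \<Rightarrow> nat \<Rightarrow> (nat \<Rightarrow> knowledge) \<Rightarrow> nat
    \<Rightarrow> (nat \<times> nat) list \<Rightarrow> (nat \<times> nat) list" where
  "received \<kappa> adv i n conf v inc =
     (if length inc \<le> ncc_cap \<kappa> n then inc
      else (let d = adv i v conf inc in
            if subseq d inc \<and> length d \<le> ncc_cap \<kappa> n then d else take (ncc_cap \<kappa> n) inc))"

definition step :: "nat \<Rightarrow> algorithm \<Rightarrow> adversary \<Rightarrow> nat \<Rightarrow> (nat \<Rightarrow> nat \<Rightarrow> nat) \<Rightarrow> nat
    \<Rightarrow> (nat \<Rightarrow> knowledge) \<Rightarrow> nat \<Rightarrow> knowledge" where
  "step \<kappa> A adv n w i conf v =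
     conf v \<lparr>k_hist := k_hist (conf v) @
        [(local_in A n w conf v, received \<kappa> adv i n conf v (incoming_global A n conf v))]\<rparr>"

fun exec :: "nat \<Rightarrow> algorithm \<Rightarrow> adversary \<Rightarrow> nat \<Rightarrow> (nat \<Rightarrow> nat \<Rightarrow> nat) \<Rightarrow> (nat \<Rightarrow> nat)
    \<Rightarrow> nat \<Rightarrow> nat \<Rightarrow> knowledge" where
  "exec \<kappa> A adv n w r 0 = initial_conf n w r"
| "exec \<kappa> A adv n w r (Suc i) = step \<kappa> A adv n w i (exec \<kappa> A adv n w r i)"

definition random_inputs :: "nat \<Rightarrow> nat \<Rightarrow> (nat \<Rightarrow> nat) pmf" where
  "random_inputs n b = pmf_of_set {r. (\<forall>v<n. r v < 2 ^ b) \<and> (\<forall>v\<ge>n. r v = 0)}"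

definition computed_cut :: "nat \<Rightarrow> algorithm \<Rightarrow> adversary \<Rightarrow> nat \<Rightarrow> (nat \<Rightarrow> nat \<Rightarrow> nat)
    \<Rightarrow> (nat \<Rightarrow> nat) \<Rightarrow> nat set" where
  "computed_cut \<kappa> A adv n w r =
     {v. v < n \<and> cut_side A (exec \<kappa> A adv n w r (num_rounds A n) v)}"

definition approx_min_cut :: "real \<Rightarrow> nat \<Rightarrow> (nat \<Rightarrow> nat \<Rightarrow> nat) \<Rightarrow> nat set \<Rightarrow> bool" where
  "approx_min_cut \<epsilon> n w S \<longleftrightarrow>
     proper_cut n S \<and> real (cut_weight n w S) \<le> (1 + \<epsilon>) * real (min_cut n w)"

end

theory Submission
  imports Defs
begin

text \<open>
  Think of an edge of weight \<open>w\<close> as \<open>w\<close> parallel unit copies and keep every copy with probability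
  \<open>2\<^sup>-\<^sup>j\<close>, where \<open>j\<close> is such that the minimum cut \<open>\<lambda>\<close> shrinks to \<open>O(log n)\<close>. By Chernoff bounds and a
  bound on the sum of \<open>exp (-t cut(S))\<close> over all cuts, no cut of this skeleton falls below its
  expectation by a factor \<open>1 - \<delta>\<close>, while a minimum cut keeps about its expected weight. Pack
  \<open>O(log\<^sup>2 n)\<close> spanning trees greedily in the skeleton, each one a minimum spanning tree with respect to
  the loads so far. Then either some tree crosses a given minimum cut in exactly one edge, so that the
  cut is one of the \<open>n - 1\<close> sides of this tree, or the lightly loaded edges of some iteration span a
  component whose boundary is already almost minimum. Hence a near-minimum cut occurs among the sides
  of a tree or the components of a subforest.

  To pick it, sample the unit copies \<open>K = O(log n)\<close> times at rate \<open>2\<^sup>-\<^sup>l \<approx> 1 / (4\<lambda>)\<close>; the number of odd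
  samples of a cut estimates its weight well enough to separate \<open>(1 + \<epsilon>/2) \<lambda>\<close> from \<open>(1 + \<epsilon>) \<lambda>\<close>. The
  parity vector of a cut is the sum over its side of the parity vectors of the vertices, and these
  sums are computed for all sides at once by pointer doubling along Euler tours. The spanning trees are
  obtained with Boruvka's method. Since \<open>\<lambda>\<close> is unknown, all pairs \<open>(j, l)\<close> are tried, and a new cut
  replaces the current one only if its exact weight is smaller.
\<close>

section \<open>Protocols and distributed knowledge\<close>

text \<open>Parities replace counts because they are linear over GF(2): an edge inside a side is
  seen from both ends and cancels, so summing \<open>K\<close> bits per vertex over a side tells
  something about its boundary. The price is that a parity is informative only while the expected
  number of sampled copies is bounded, hence a second rate besides that of the skeleton. Two union
  bounds follow. The skeleton must be good for all cuts at once, exponentially many, which is why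
  the sum over all cuts is needed. The candidates are fixed by the skeleton alone and polynomial in
  number, and the sketches use independent coins, so \<open>K = O(log n)\<close> samples suffice.
  The dichotomy for the packing is a multiplicative-weights argument: if every tree crossed the cut
  twice, some copy would carry more load than the exponential potential admits. On the network side
  the obstacle is the receiving capacity: every global exchange follows an injection between darts
  with few darts per host, so nothing is ever dropped and the adversary has no influence.\<close>

definition proto :: "(knowledge \<Rightarrow> nat \<Rightarrow> nat option) \<Rightarrow> (knowledge \<Rightarrow> (nat \<times> nat) list) \<Rightarrow> algorithm" where
  "proto ls gs = \<lparr>local_send = ls, global_send = gs, cut_side = (\<lambda>_. False),
     num_rounds = (\<lambda>_. 0), rand_bits = (\<lambda>_. 0)\<rparr>"

lemma proto_sel [simp]: "local_send (proto ls gs) = ls" "global_send (proto ls gs) = gs"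
  by (simp_all add: proto_def)

lemma exec_sel [simp]:
  "k_n (exec \<kappa> A adv n w r i v) = n" "k_id (exec \<kappa> A adv n w r i v) = v"
  "k_row (exec \<kappa> A adv n w r i v) = w v" "k_rand (exec \<kappa> A adv n w r i v) = r v"
  "length (k_hist (exec \<kappa> A adv n w r i v)) = i"
  by (induction i) (simp_all add: initial_conf_def step_def)

text \<open>An execution consults the send functions only at views with \<open>k_n k = n\<close> and
  a shorter history. This permits changing a protocol from some round on, and gluing protocols for
  different \<open>n\<close> into one algorithm.\<close>

lemma exec_cong:
  assumes "\<And>k. k_n k = n \<Longrightarrow> length (k_hist k) < R \<Longrightarrow> local_send A k = local_send B k"
    and "\<And>k. k_n k = n \<Longrightarrow> length (k_hist k) < R \<Longrightarrow> global_send A k = global_send B k"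
    and "i \<le> R"
  shows "exec \<kappa> A adv n w r i = exec \<kappa> B adv n w r i"
  using \<open>i \<le> R\<close>
proof (induction i)
  case (Suc i)
  have "exec \<kappa> A adv n w r i = exec \<kappa> B adv n w r i" using Suc by simp
  moreover have "local_in A n w (exec \<kappa> B adv n w r i) v = local_in B n w (exec \<kappa> B adv n w r i) v" for v
    using Suc.prems by (auto simp: local_in_def assms(1) fun_eq_iff)
  moreover have "incoming_global A n (exec \<kappa> B adv n w r i) v = incoming_global B n (exec \<kappa> B adv n w r i) v" for v
    using Suc.prems by (simp add: incoming_global_def assms(2))
  ultimately show ?case by (intro ext) (simp add: step_def)
qed simp

datatype inst = Inst (wt: "nat \<Rightarrow> nat \<Rightarrow> nat") (rn: "nat \<Rightarrow> nat")

locale network =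
  fixes n d \<kappa> :: nat
  assumes n2: "2 \<le> n"
begin

definition ok :: "inst \<Rightarrow> bool" where "ok z \<longleftrightarrow> weighted_graph n (wt z) d"

text \<open>The bounds are demanded for every \<open>k\<close>, even for views that occur in no
  execution, and with the fixed \<open>n\<close> in place of \<open>k_n k\<close>.\<close>

definition valid_proto where
  "valid_proto ls gs \<longleftrightarrow> (\<forall>k. length (gs k) \<le> ncc_cap \<kappa> n \<and>
     (\<forall>(t, m) \<in> set (gs k). m < msg_bound \<kappa> n) \<and>
     (\<forall>u m. ls k u = Some m \<longrightarrow> m < msg_bound \<kappa> n))"

abbreviation view where
  "view ls gs adv z R v \<equiv> exec \<kappa> (proto ls gs) adv n (wt z) (rn z) R v"

text \<open>The distributed value \<open>X\<close> (\<open>X z v\<close> is held by node \<open>v\<close> on the instance \<open>z\<close>) is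
  computable in \<open>R\<close> rounds when some protocol makes the view of \<open>v\<close> determine it. Since a node
  remembers everything and knows \<open>n\<close>, the protocol may depend on \<open>n\<close>.\<close>

definition known :: "nat \<Rightarrow> (inst \<Rightarrow> nat \<Rightarrow> 'a) \<Rightarrow> bool" where
  "known R X \<longleftrightarrow> (\<exists>ls gs. valid_proto ls gs \<and>
     (\<forall>z z' v adv adv'. ok z \<longrightarrow> ok z' \<longrightarrow> v < n \<longrightarrow>
        view ls gs adv z R v = view ls gs adv' z' R v \<longrightarrow> X z v = X z' v))"

text \<open>Free local computation: a node holding \<open>X\<close> can evaluate \<open>Y\<close>
  from it, its own weights and its own random number. Comparing two instances avoids naming the
  function that does so.\<close>

definition det :: "(inst \<Rightarrow> nat \<Rightarrow> 'a) \<Rightarrow> (inst \<Rightarrow> nat \<Rightarrow> 'b) \<Rightarrow> bool" where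
  "det X Y \<longleftrightarrow> (\<forall>z z' v. ok z \<longrightarrow> ok z' \<longrightarrow> v < n \<longrightarrow> wt z v = wt z' v \<longrightarrow>
     rn z v = rn z' v \<longrightarrow> X z v = X z' v \<longrightarrow> Y z v = Y z' v)"

lemma detI:
  assumes "\<And>z z' v. ok z \<Longrightarrow> ok z' \<Longrightarrow> v < n \<Longrightarrow> wt z v = wt z' v \<Longrightarrow>
     rn z v = rn z' v \<Longrightarrow> X z v = X z' v \<Longrightarrow> Y z v = Y z' v"
  shows "det X Y"
  using assms unfolding det_def by blast

lemma detD:
  assumes "det X Y" "ok z" "ok z'" "v < n" "wt z v = wt z' v" "rn z v = rn z' v" "X z v = X z' v"
  shows "Y z v = Y z' v"
  using assms unfolding det_def by blast

lemma det_via: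
  assumes "det X Y" "\<And>z z' v. ok z \<Longrightarrow> ok z' \<Longrightarrow> v < n \<Longrightarrow> wt z v = wt z' v \<Longrightarrow> rn z v = rn z' v \<Longrightarrow>
    Y z v = Y z' v \<Longrightarrow> Z z v = Z z' v"
  shows "det X Z"
  using assms unfolding det_def by blast

lemma det_trans: "det X Y \<Longrightarrow> det Y Z \<Longrightarrow> det X Z"
  unfolding det_def by blast

lemma known_det:
  assumes "known R X" "det X Y"
  shows "known R Y"
proof -
  obtain ls gs where v: "valid_proto ls gs" and
    k: "\<And>z z' v adv adv'. ok z \<Longrightarrow> ok z' \<Longrightarrow> v < n \<Longrightarrow>
        view ls gs adv z R v = view ls gs adv' z' R v \<Longrightarrow> X z v = X z' v"
    using assms(1) unfolding known_def by blast
  have "Y z v = Y z' v" if h: "ok z" "ok z'" "v < n" "view ls gs adv z R v = view ls gs adv' z' R v"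
    for z z' v adv adv'
  proof (rule detD[OF assms(2)])
    show "wt z v = wt z' v" using h(4) exec_sel(3) by metis
    show "rn z v = rn z' v" using h(4) exec_sel(4) by metis
  qed (use h k in blast)+
  then show ?thesis using v unfolding known_def by blast
qed

lemma known_via:
  assumes "known R X" "\<And>z z' v. ok z \<Longrightarrow> ok z' \<Longrightarrow> v < n \<Longrightarrow> wt z v = wt z' v \<Longrightarrow> rn z v = rn z' v \<Longrightarrow>
    X z v = X z' v \<Longrightarrow> Z z v = Z z' v"
  shows "known R Z"
  using known_det[OF assms(1) detI] assms(2) by blast

lemma known_0: "known 0 (\<lambda>z v. ())"
  unfolding known_def valid_proto_def by (rule exI[of _ "\<lambda>_ _. None"], rule exI[of _ "\<lambda>_. []"]) simp

lemma length_incoming: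
  "length (incoming_global A n conf v) =
     (\<Sum>u<n. length (filter (\<lambda>(t, m). t = v) (global_send A (conf u))))"
  by (simp add: incoming_global_def length_concat o_def case_prod_unfold interv_sum_list_conv_sum_set_nat
      lessThan_atLeast0)

lemma set_incoming:
  "set (incoming_global A n conf v) = {(u, m). u < n \<and> (v, m) \<in> set (global_send A (conf u))}"
  by (auto simp: incoming_global_def)

text \<open>The place where a communication round becomes send functions. What to send is determined
  by \<open>X\<close>, hence by the view, and arbitrary finite message types are encoded injectively
  below \<open>msg_bound\<close>.\<close>

lemma known_round:
  fixes SL :: "inst \<Rightarrow> nat \<Rightarrow> nat \<Rightarrow> 'l option" and SG :: "inst \<Rightarrow> nat \<Rightarrow> (nat \<times> 'g) set"
  assumes X: "known R X" and dL: "det X SL" and dG: "det X SG"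
    and LM: "finite LM" "card LM \<le> msg_bound \<kappa> n"
      "\<And>z v u m. ok z \<Longrightarrow> v < n \<Longrightarrow> SL z v u = Some m \<Longrightarrow> m \<in> LM"
    and GM: "finite GM" "card GM \<le> msg_bound \<kappa> n"
      "\<And>z v u m. ok z \<Longrightarrow> v < n \<Longrightarrow> (u, m) \<in> SG z v \<Longrightarrow> m \<in> GM"
    and fin: "\<And>z v. ok z \<Longrightarrow> v < n \<Longrightarrow> finite (SG z v)"
    and out: "\<And>z v. ok z \<Longrightarrow> v < n \<Longrightarrow> card (SG z v) \<le> ncc_cap \<kappa> n"
    and inc: "\<And>z v. ok z \<Longrightarrow> v < n \<Longrightarrow> card {(u, m). u < n \<and> (v, m) \<in> SG z u} \<le> ncc_cap \<kappa> n"
  shows "known (Suc R) (\<lambda>z v. (X z v, \<lambda>u. if u < n \<and> 0 < wt z v u then SL z u v else None,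
           {(u, m). u < n \<and> (v, m) \<in> SG z u}))"
proof -
  obtain ls gs where val: "valid_proto ls gs" and
    k: "\<And>z z' v adv adv'. ok z \<Longrightarrow> ok z' \<Longrightarrow> v < n \<Longrightarrow>
        view ls gs adv z R v = view ls gs adv' z' R v \<Longrightarrow> X z v = X z' v"
    using X unfolding known_def by blast
  have kSL: "SL z v = SL z' v" and kSG: "SG z v = SG z' v"
    if "ok z" "ok z'" "v < n" "view ls gs adv z R v = view ls gs adv' z' R v" for z z' v adv adv'
  proof -
    have "wt z v = wt z' v" "rn z v = rn z' v" using that(4) exec_sel(3,4) by metis+
    then show "SL z v = SL z' v" "SG z v = SG z' v" using that k detD[OF dL] detD[OF dG] by metis+
  qed
  obtain eL :: "'l \<Rightarrow> nat" where eL: "inj_on eL LM" "eL ` LM \<subseteq> {..<msg_bound \<kappa> n}"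
    using card_le_inj[of LM "{..<msg_bound \<kappa> n}"] LM by auto
  obtain eG :: "'g \<Rightarrow> nat" where eG: "inj_on eG GM" "eG ` GM \<subseteq> {..<msg_bound \<kappa> n}"
    using card_le_inj[of GM "{..<msg_bound \<kappa> n}"] GM by auto
  define ofview where "ofview kn z v adv \<longleftrightarrow> ok z \<and> v < n \<and> view ls gs adv z R v = kn" for kn z v adv
  \<comment> \<open>A view is decoded by choosing any instance and node that produce it under some
    adversary; by \<open>kSL\<close> and \<open>kSG\<close> the choice does not affect what is
    sent.\<close>
  define pick where "pick kn = (SOME (z, v). \<exists>adv. ofview kn z v adv)" for kn
  define possible where "possible kn \<longleftrightarrow> (\<exists>z v adv. ofview kn z v adv)" for kn
  have pick: "\<exists>adv. ofview kn (fst (pick kn)) (snd (pick kn)) adv" if ps: "possible kn" for kn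
  proof -
    obtain z v where "\<exists>adv. ofview kn z v adv" using ps possible_def by blast
    then have "case (z, v) of (z, v) \<Rightarrow> \<exists>adv. ofview kn z v adv" by simp
    then have "case pick kn of (z, v) \<Rightarrow> \<exists>adv. ofview kn z v adv" unfolding pick_def by (rule someI)
    then show ?thesis by (simp add: case_prod_unfold)
  qed
  \<comment> \<open>Impossible views send nothing, so that \<open>valid_proto\<close> holds for them
    as well.\<close>
  define L where "L kn = (if possible kn then SL (fst (pick kn)) (snd (pick kn)) else (\<lambda>_. None))" for kn
  define G where "G kn = (if possible kn then SG (fst (pick kn)) (snd (pick kn)) else {})" for kn
  have LG: "L (view ls gs adv z R v) = SL z v" "G (view ls gs adv z R v) = SG z v"
    if h: "ok z" "v < n" for z v adv
  proof -
    let ?k = "view ls gs adv z R v"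
    have p: "possible ?k" using h ofview_def possible_def by blast
    obtain adv' where a: "ofview ?k (fst (pick ?k)) (snd (pick ?k)) adv'" using pick[OF p] by blast
    have "snd (pick ?k) = k_id ?k" using a exec_sel(2) ofview_def by metis
    then have v: "snd (pick ?k) = v" by simp
    have "view ls gs adv' (fst (pick ?k)) R v = ?k" "ok (fst (pick ?k))" using a v by (auto simp: ofview_def)
    then have "SL (fst (pick ?k)) v = SL z v" "SG (fst (pick ?k)) v = SG z v" using kSL kSG h by blast+
    then show "L ?k = SL z v" "G ?k = SG z v" using p v by (simp_all add: L_def G_def)
  qed
  have Lin: "m \<in> LM" if "L kn u = Some m" for kn u m
  proof (cases "possible kn")
    case True
    then show ?thesis using pick[OF True] that LM(3)[of "fst (pick kn)" "snd (pick kn)" u m] unfolding ofview_def L_def by auto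
  qed (use that L_def in simp)
  have Gin: "m \<in> GM" if "(u, m) \<in> G kn" for kn u m
  proof (cases "possible kn")
    case True
    then show ?thesis using pick[OF True] that GM(3)[of "fst (pick kn)" "snd (pick kn)" u m] unfolding ofview_def G_def by auto
  qed (use that G_def in simp)
  have Gf: "finite (G kn)" and Gc: "card (G kn) \<le> ncc_cap \<kappa> n" for kn
  proof -
    show "finite (G kn)"
    proof (cases "possible kn")
      case True
      then show ?thesis using pick[OF True] fin unfolding ofview_def G_def by auto
    qed (simp add: G_def)
    show "card (G kn) \<le> ncc_cap \<kappa> n"
    proof (cases "possible kn")
      case True
      then show ?thesis using pick[OF True] out unfolding ofview_def G_def by auto
    qed (simp add: G_def)
  qed
  define Gl where "Gl kn = (SOME xs. set xs = G kn \<and> distinct xs)" for kn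
  have Gl: "set (Gl kn) = G kn" "distinct (Gl kn)" for kn
    using someI_ex[OF finite_distinct_list[OF Gf[of kn]]] unfolding Gl_def by auto
  \<comment> \<open>The length of the history identifies the new round; all other rounds keep the
    old protocol.\<close>
  define ls' where "ls' kn u = (if length (k_hist kn) = R then map_option eL (L kn u) else ls kn u)" for kn u
  define gs' where "gs' kn = (if length (k_hist kn) = R then map (\<lambda>(t, m). (t, eG m)) (Gl kn) else gs kn)" for kn
  have "valid_proto ls' gs'"
    unfolding valid_proto_def
  proof (intro allI conjI)
    fix kn
    show "length (gs' kn) \<le> ncc_cap \<kappa> n"
      using val Gc[of kn] distinct_card[OF Gl(2)[of kn]] by (auto simp: gs'_def valid_proto_def Gl)
    show "\<forall>(t, m)\<in>set (gs' kn). m < msg_bound \<kappa> n"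
    proof (cases "length (k_hist kn) = R")
      case True
      then show ?thesis using Gin eG by (fastforce simp: gs'_def Gl)
    next
      case False
      then show ?thesis using val unfolding gs'_def valid_proto_def by simp
    qed
    fix u m
    show "ls' kn u = Some m \<longrightarrow> m < msg_bound \<kappa> n"
    proof (cases "length (k_hist kn) = R")
      case True
      then show ?thesis using Lin eL by (fastforce simp: ls'_def)
    next
      case False
      then show ?thesis using val unfolding ls'_def valid_proto_def by simp
    qed
  qed
  moreover have "(X z v, (\<lambda>u. if u < n \<and> 0 < wt z v u then SL z u v else None),
           {(u, m). u < n \<and> (v, m) \<in> SG z u}) = (X z' v, (\<lambda>u. if u < n \<and> 0 < wt z' v u then SL z' u v else None),
           {(u, m). u < n \<and> (v, m) \<in> SG z' u})"
    if h: "ok z" "ok z'" "v < n" "view ls' gs' adv z (Suc R) v = view ls' gs' adv' z' (Suc R) v"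
    for z z' v adv adv'
  proof -
    have pre: "exec \<kappa> (proto ls' gs') adv n w r R = exec \<kappa> (proto ls gs) adv n w r R" for adv w r
      by (rule exec_cong[of _ R]) (auto simp: ls'_def gs'_def fun_eq_iff)
    have row: "wt z v = wt z' v" using h(4) exec_sel(3) by metis
    \<comment> \<open>\<open>local_in\<close> excludes \<open>u = v\<close> explicitly, the claim
      only through a positive weight; the zero diagonal reconciles them.\<close>
    have diag: "wt z v v = 0" if "ok z" for z using that by (simp add: ok_def weighted_graph_def)
    let ?c = "\<lambda>z adv. exec \<kappa> (proto ls gs) adv n (wt z) (rn z) R"
    have lin: "local_in (proto ls' gs') n (wt z) (?c z adv) v =
        (\<lambda>u. if u < n \<and> 0 < wt z v u then map_option eL (SL z u v) else None)" if "ok z" for z adv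
      using that diag[OF that] by (auto simp: local_in_def ls'_def fun_eq_iff LG)
    have gin_set: "set (incoming_global (proto ls' gs') n (?c z adv) v)
        = (\<lambda>(u, m). (u, eG m)) ` {(u, m). u < n \<and> (v, m) \<in> SG z u}" if "ok z" for z adv
      using that by (auto simp: set_incoming gs'_def Gl LG image_iff) (rule bexI[rotated], assumption, simp)
    have gin_len: "length (incoming_global (proto ls' gs') n (?c z adv) v) \<le> ncc_cap \<kappa> n" if o: "ok z" for z adv
    proof -
      have "length (filter (\<lambda>(t, m). t = v) (global_send (proto ls' gs') (?c z adv u)))
         = card {m. (v, m) \<in> SG z u}" if u: "u < n" for u
      proof -
        have "length (filter (\<lambda>(t, m). t = v) (global_send (proto ls' gs') (?c z adv u)))
          = length (filter (\<lambda>(t, m). t = v) (Gl (?c z adv u)))"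
          by (simp add: gs'_def filter_map o_def case_prod_unfold)
        also have "\<dots> = card (set (filter (\<lambda>(t, m). t = v) (Gl (?c z adv u))))"
          using distinct_card distinct_filter Gl(2) by metis
        also have "set (filter (\<lambda>(t, m). t = v) (Gl (?c z adv u))) = Pair v ` {m. (v, m) \<in> SG z u}"
          using u o by (auto simp: Gl LG)
        also have "card \<dots> = card {m. (v, m) \<in> SG z u}" by (simp add: card_image inj_on_def)
        finally show ?thesis .
      qed
      then have "length (incoming_global (proto ls' gs') n (?c z adv) v) = (\<Sum>u<n. card {m. (v, m) \<in> SG z u})"
        by (simp add: length_incoming)
      also have "\<dots> = card (Sigma {..<n} (\<lambda>u. {m. (v, m) \<in> SG z u}))"
      proof (rule card_SigmaI[symmetric])
        show "\<forall>u\<in>{..<n}. finite {m. (v, m) \<in> SG z u}"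
        proof
          fix u assume "u \<in> {..<n}"
          then have "finite (SG z u)" using fin o by blast
          then have "finite (snd ` SG z u)" by blast
          then show "finite {m. (v, m) \<in> SG z u}" by (rule rev_finite_subset) force
        qed
      qed simp
      also have "Sigma {..<n} (\<lambda>u. {m. (v, m) \<in> SG z u}) = {(u, m). u < n \<and> (v, m) \<in> SG z u}" by auto
      finally show ?thesis using inc[OF o h(3)] by simp
    qed
    \<comment> \<open>The adversary disappears here: the incoming list fits into the capacity, so
      \<open>received\<close> returns it unchanged.\<close>
    have hist: "k_hist (view ls' gs' adv z (Suc R) v) = k_hist (?c z adv v) @
       [(\<lambda>u. if u < n \<and> 0 < wt z v u then map_option eL (SL z u v) else None,
         incoming_global (proto ls' gs') n (?c z adv) v)]" if o: "ok z" for z adv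
      using lin[OF o] gin_len[OF o] by (simp add: step_def pre received_def)
    have hist_eq: "k_hist (view ls' gs' adv z (Suc R) v) = k_hist (view ls' gs' adv' z' (Suc R) v)"
      using h(4) by simp
    have hist_eqs: "k_hist (?c z adv v) = k_hist (?c z' adv' v)"
       "(\<lambda>u. if u < n \<and> 0 < wt z v u then map_option eL (SL z u v) else None)
         = (\<lambda>u. if u < n \<and> 0 < wt z' v u then map_option eL (SL z' u v) else None)"
       "incoming_global (proto ls' gs') n (?c z adv) v = incoming_global (proto ls' gs') n (?c z' adv') v"
      using hist_eq unfolding hist[OF h(1)] hist[OF h(2)] by auto
    have "rn z v = rn z' v" using h(4) exec_sel(4) by metis
    then have "?c z adv v = ?c z' adv' v" using hist_eqs(1) row by (intro knowledge.equality) auto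
    then have "X z v = X z' v" using k h by blast
    moreover have "(if u < n \<and> 0 < wt z v u then SL z u v else None)
        = (if u < n \<and> 0 < wt z' v u then SL z' u v else None)" for u
    proof (cases "u < n \<and> 0 < wt z v u")
      case True
      then have e: "map_option eL (SL z u v) = map_option eL (SL z' u v)"
        using fun_cong[OF hist_eqs(2), of u] row by simp
      have "SL z u v = SL z' u v"
      proof (cases "SL z u v")
        case None then show ?thesis using e by simp
      next
        case (Some a)
        then obtain b where b: "SL z' u v = Some b" "eL a = eL b"
          using e by (cases "SL z' u v") auto
        then show ?thesis using Some eL(1) LM(3) h True unfolding inj_on_def by metis
      qed
      then show ?thesis using True row by simp
    qed (use row in auto)
    moreover have "{(u, m). u < n \<and> (v, m) \<in> SG z u} = {(u, m). u < n \<and> (v, m) \<in> SG z' u}"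
    proof -
      have inj: "inj_on (\<lambda>(u, m). (u, eG m)) (UNIV \<times> GM)" using eG(1) by (auto simp: inj_on_def)
      have sub: "{(u, m). u < n \<and> (v, m) \<in> SG z u} \<subseteq> UNIV \<times> GM" if "ok z" for z
        using GM(3) that by blast
      show ?thesis
        using inj_on_image_eq_iff[OF inj sub[OF h(1)] sub[OF h(2)]] gin_set[OF h(1), of adv]
          gin_set[OF h(2), of adv'] hist_eqs(3) by metis
    qed
    ultimately show ?thesis by (simp add: fun_eq_iff)
  qed
  ultimately show ?thesis unfolding known_def by blast
qed

text \<open>The sender itself suppresses messages to non-neighbours, because \<open>LM\<close> is
  only assumed to contain the messages along edges; symmetry of the weights makes its test agree
  with that of the receiver.\<close>

lemma known_local:
  fixes SL :: "inst \<Rightarrow> nat \<Rightarrow> nat \<Rightarrow> 'l"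
  assumes X: "known R X" and dL: "det X SL"
    and LM: "finite LM" "card LM \<le> msg_bound \<kappa> n"
      "\<And>z v u. ok z \<Longrightarrow> v < n \<Longrightarrow> u < n \<Longrightarrow> 0 < wt z v u \<Longrightarrow> SL z v u \<in> LM"
  shows "known (Suc R) (\<lambda>z v. (X z v, \<lambda>u. if u < n \<and> 0 < wt z v u then Some (SL z u v) else None))"
proof -
  have lt: "u < n" if "ok z" "0 < wt z v u" for z v u
    using that unfolding ok_def weighted_graph_def by (metis not_le less_irrefl)
  have sy: "wt z v u = wt z u v" if "ok z" for z v u
    using that unfolding ok_def weighted_graph_def by blast
  have "known (Suc R) (\<lambda>z v. (X z v, \<lambda>u. if u < n \<and> 0 < wt z v u then
         (if 0 < wt z u v then Some (SL z u v) else None) else None,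
           {(u, m). u < n \<and> (v, m) \<in> ({} :: (nat \<times> unit) set)}))"
    using X
  proof (rule known_round[where LM = LM and GM = "{}"])
    show "det X (\<lambda>z u v. if 0 < wt z u v then Some (SL z u v) else None)"
      using detD[OF dL] by (intro detI) (metis (lifting))
    show "det X (\<lambda>z u. {})" by (intro detI) simp
    show "m \<in> LM" if "ok z" "v < n" "(if 0 < wt z v u then Some (SL z v u) else None) = Some m" for z v u m
      using that(3) LM(3)[OF that(1,2)] lt[OF that(1)] by (cases "0 < wt z v u") fastforce+
  qed (use LM in auto)
  then show ?thesis
  proof (rule known_det, intro detI)
    fix z z' :: inst and v
    let ?P = "\<lambda>z. (X z v, \<lambda>u. if u < n \<and> 0 < wt z v u then
         (if 0 < wt z u v then Some (SL z u v) else None) else None,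
           {(u, m). u < n \<and> (v, m) \<in> ({} :: (nat \<times> unit) set)})"
    let ?Q = "\<lambda>z. (X z v, \<lambda>u. if u < n \<and> 0 < wt z v u then Some (SL z u v) else None)"
    assume o: "ok z" "ok z'" and e: "?P z = ?P z'"
    have "?Q z = (fst (?P z), fst (snd (?P z)))" "?Q z' = (fst (?P z'), fst (snd (?P z')))"
      using sy[OF o(1), of v] sy[OF o(2), of v] by (auto simp: fun_eq_iff)
    then show "?Q z = ?Q z'" using e by (metis (no_types, lifting))
  qed
qed

lemma known_global:
  fixes SG :: "inst \<Rightarrow> nat \<Rightarrow> (nat \<times> 'g) set"
  assumes X: "known R X" and dG: "det X SG"
    and GM: "finite GM" "card GM \<le> msg_bound \<kappa> n"
      "\<And>z v u m. ok z \<Longrightarrow> v < n \<Longrightarrow> (u, m) \<in> SG z v \<Longrightarrow> m \<in> GM"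
    and fin: "\<And>z v. ok z \<Longrightarrow> v < n \<Longrightarrow> finite (SG z v)"
    and out: "\<And>z v. ok z \<Longrightarrow> v < n \<Longrightarrow> card (SG z v) \<le> ncc_cap \<kappa> n"
    and inc: "\<And>z v. ok z \<Longrightarrow> v < n \<Longrightarrow> card {(u, m). u < n \<and> (v, m) \<in> SG z u} \<le> ncc_cap \<kappa> n"
  shows "known (Suc R) (\<lambda>z v. (X z v, {(u, m). u < n \<and> (v, m) \<in> SG z u}))"
proof -
  have "known (Suc R) (\<lambda>z v. (X z v, \<lambda>u. if u < n \<and> 0 < wt z v u then None :: unit option else None,
           {(u, m). u < n \<and> (v, m) \<in> SG z u}))"
    using X
  proof (rule known_round[where LM = "{}" and GM = GM])
    show "det X (\<lambda>z u v. None)" by (intro detI) simp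
  qed (use assms in auto)
  then show ?thesis by (rule known_det) (intro detI, auto)
qed

end

section \<open>Darts hosted by nodes\<close>

type_synonym dart = "nat \<times> nat"

section \<open>Pointer doubling along partial injections\<close>

fun dbl_next :: "('d \<Rightarrow> 'd option) \<Rightarrow> nat \<Rightarrow> 'd \<Rightarrow> 'd option" where
  "dbl_next nx 0 e = nx e"
| "dbl_next nx (Suc i) e = Option.bind (dbl_next nx i e) (dbl_next nx i)"

text \<open>Aggregates the first \<open>2 ^ i\<close> elements of the path from \<open>e\<close>,
  fewer if it ends earlier. On a closed orbit elements recur, which is harmless only for an
  idempotent operation.\<close>

fun dbl_fold :: "('a \<Rightarrow> 'a \<Rightarrow> 'a) \<Rightarrow> ('d \<Rightarrow> 'd option) \<Rightarrow> ('d \<Rightarrow> 'a) \<Rightarrow> nat \<Rightarrow> 'd \<Rightarrow> 'a" where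
  "dbl_fold f nx g 0 e = g e"
| "dbl_fold f nx g (Suc i) e = (case dbl_next nx i e of None \<Rightarrow> dbl_fold f nx g i e
     | Some e' \<Rightarrow> f (dbl_fold f nx g i e) (dbl_fold f nx g i e'))"

text \<open>Injectivity bounds the receiving load: every dart is asked by at most one other dart,
  and doubling preserves this.\<close>

definition partial_inj :: "'d set \<Rightarrow> ('d \<Rightarrow> 'd option) \<Rightarrow> bool" where
  "partial_inj D J \<longleftrightarrow> (\<forall>e e'. e \<in> D \<longrightarrow> J e = Some e' \<longrightarrow> e' \<in> D) \<and>
     (\<forall>e1 e2 e'. e1 \<in> D \<longrightarrow> e2 \<in> D \<longrightarrow> J e1 = Some e' \<longrightarrow> J e2 = Some e' \<longrightarrow> e1 = e2)"

lemma partial_inj_dbl_next: "partial_inj D nx \<Longrightarrow> partial_inj D (dbl_next nx i)"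
proof (induction i)
  case (Suc i)
  then have ih: "partial_inj D (dbl_next nx i)" by simp
  note c = ih[unfolded partial_inj_def, THEN conjunct1, rule_format]
    and u = ih[unfolded partial_inj_def, THEN conjunct2, rule_format]
  show ?case unfolding partial_inj_def
  proof (intro conjI allI impI)
    fix e e' assume e: "e \<in> D" "dbl_next nx (Suc i) e = Some e'"
    then obtain a where a: "dbl_next nx i e = Some a" "dbl_next nx i a = Some e'"
      by (auto simp: bind_eq_Some_conv)
    show "e' \<in> D" by (rule c[OF c[OF e(1) a(1)] a(2)])
  next
    fix e1 e2 e' assume e: "e1 \<in> D" "e2 \<in> D" "dbl_next nx (Suc i) e1 = Some e'" "dbl_next nx (Suc i) e2 = Some e'"
    obtain a where a: "dbl_next nx i e1 = Some a" "dbl_next nx i a = Some e'"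
      using e(3) by (auto simp: bind_eq_Some_conv)
    obtain b where b: "dbl_next nx i e2 = Some b" "dbl_next nx i b = Some e'"
      using e(4) by (auto simp: bind_eq_Some_conv)
    have "a = b" by (rule u[OF c[OF e(1) a(1)] c[OF e(2) b(1)] a(2) b(2)])
    then show "e1 = e2" using u[OF e(1,2) a(1)] b(1) by simp
  qed
next
  case 0
  moreover have "dbl_next nx 0 = nx" by (rule ext) simp
  ultimately show ?case by simp
qed

lemma dbl_fold_mem:
  assumes "partial_inj D nx" "\<And>e. e \<in> D \<Longrightarrow> f e \<in> M" "\<And>a b. a \<in> M \<Longrightarrow> b \<in> M \<Longrightarrow> op a b \<in> M" "e \<in> D"
  shows "dbl_fold op nx f i e \<in> M"
  using assms(4)
proof (induction i arbitrary: e)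
  case (Suc i)
  show ?case
  proof (cases "dbl_next nx i e")
    case (Some e')
    then have "e' \<in> D" using partial_inj_dbl_next[OF assms(1), of i] Suc.prems unfolding partial_inj_def by blast
    then show ?thesis using Suc Some assms(3) by simp
  qed (use Suc in simp)
qed (use assms in simp)

section \<open>Distributed computation on hosted darts\<close>

context network
begin

lemma det_map: "det X Y \<Longrightarrow> (\<And>z v. ok z \<Longrightarrow> v < n \<Longrightarrow> Z z v = f (Y z v)) \<Longrightarrow> det X Z"
  unfolding det_def by metis

text \<open>Each value is stored together with its dart, so a node knowing this set also knows which
  darts it hosts.\<close>

definition hosted :: "(inst \<Rightarrow> dart set) \<Rightarrow> (inst \<Rightarrow> dart \<Rightarrow> nat) \<Rightarrow> (inst \<Rightarrow> dart \<Rightarrow> 'a) \<Rightarrow>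
    inst \<Rightarrow> nat \<Rightarrow> (dart \<times> 'a) set" where
  "hosted D host f z v = (\<lambda>e. (e, f z e)) ` {e \<in> D z. host z e = v}"

definition hosting :: "(inst \<Rightarrow> dart set) \<Rightarrow> (inst \<Rightarrow> dart \<Rightarrow> nat) \<Rightarrow> bool" where
  "hosting D host \<longleftrightarrow> (\<forall>z. ok z \<longrightarrow> D z \<subseteq> {..<n} \<times> {..<n} \<and> (\<forall>e\<in>D z. host z e < n) \<and>
     (\<forall>v<n. card {e \<in> D z. host z e = v} \<le> ncc_cap \<kappa> n))"

lemma hostingD:
  assumes "hosting D host" "ok z"
  shows "D z \<subseteq> {..<n} \<times> {..<n}" "finite (D z)" "e \<in> D z \<Longrightarrow> host z e < n"
    "v < n \<Longrightarrow> card {e \<in> D z. host z e = v} \<le> ncc_cap \<kappa> n"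
  using assms finite_subset[of "D z" "{..<n} \<times> {..<n}"] unfolding hosting_def by blast+

lemma hosted_comp: "hosted D host (\<lambda>z e. g (f z e)) z v = (\<lambda>(e, x). (e, g x)) ` hosted D host f z v"
  by (simp add: hosted_def image_image)

lemma det_hosted: "det X (hosted D host f) \<Longrightarrow> det X (hosted D host (\<lambda>z e. g (f z e)))"
  by (erule det_map) (rule hosted_comp)

lemma hosted_iff: "(e, x) \<in> hosted D host f z v \<longleftrightarrow> e \<in> D z \<and> host z e = v \<and> x = f z e"
  unfolding hosted_def by blast

lemma hosted_mem: "e \<in> D z \<Longrightarrow> host z e = v \<Longrightarrow> (e, f z e) \<in> hosted D host f z v"
  unfolding hosted_def by blast

text \<open>Fetching information along a partial injection \<open>J\<close> costs two rounds: each dart announces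
  itself to its target, which answers. Injectivity bounds the load of every host.\<close>

lemma known_pull:
  fixes J :: "inst \<Rightarrow> dart \<Rightarrow> dart option" and f :: "inst \<Rightarrow> dart \<Rightarrow> 'a"
  assumes X: "known R X"
    and det: "det X (hosted D host (\<lambda>z e. (J z e, map_option (host z) (J z e), f z e)))"
    and h: "hosting D host" and inj: "\<And>z. ok z \<Longrightarrow> partial_inj (D z) (J z)"
    and M: "finite M" "n ^ 2 * card M \<le> msg_bound \<kappa> n" "n ^ 4 \<le> msg_bound \<kappa> n"
    and f: "\<And>z e. ok z \<Longrightarrow> e \<in> D z \<Longrightarrow> f z e \<in> M"
  shows "known (R + 2) (\<lambda>z v. (X z v, hosted D host (\<lambda>z e. map_option (f z) (J z e)) z v))"
proof -
  let ?V = "{..<n} \<times> {..<n}"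
  let ?H = "hosted D host (\<lambda>z e. (J z e, map_option (host z) (J z e), f z e))"
  define S1 where "S1 z v = {(host z e', (e', e)) | e e'. e \<in> D z \<and> host z e = v \<and> J z e = Some e'}" for z v
  define I1 where "I1 z v = {(u, m). u < n \<and> (v, m) \<in> S1 z u}" for z v
  define S2 where "S2 z v = {(u, (e, x)) | u e e' x. (u, (e', e)) \<in> I1 z v \<and> (e', x) \<in> hosted D host f z v}" for z v
  define I2 where "I2 z v = {(u, m). u < n \<and> (v, m) \<in> S2 z u}" for z v
  have hD: "D z \<subseteq> ?V" "finite (D z)" "\<And>e. e \<in> D z \<Longrightarrow> host z e < n"
    "\<And>v. v < n \<Longrightarrow> card {e \<in> D z. host z e = v} \<le> ncc_cap \<kappa> n" if "ok z" for z
    using hostingD[OF h that] by blast+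
  have J: "e' \<in> D z" if "ok z" "e \<in> D z" "J z e = Some e'" for z e e'
    using inj[OF that(1)] that unfolding partial_inj_def by blast
  have J': "e1 = e2" if "ok z" "e1 \<in> D z" "J z e1 = Some e'" "e2 \<in> D z" "J z e2 = Some e'" for z e1 e2 e'
    using inj[OF that(1)] that unfolding partial_inj_def by metis
  have S1_alt: "S1 z v = (\<lambda>e. (host z (the (J z e)), (the (J z e), e))) ` {e \<in> D z. host z e = v \<and> J z e \<noteq> None}" for z v
    unfolding S1_def by force
  have S1_det: "S1 z v = {(h, (e', e)) | e e' h x. (e, (Some e', Some h, x)) \<in> ?H z v}" for z v
  proof (intro set_eqI iffI)
    fix y assume "y \<in> S1 z v"
    then obtain e e' where "y = (host z e', (e', e))" "e \<in> D z" "host z e = v" "J z e = Some e'"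
      unfolding S1_def by blast
    then show "y \<in> {(h, (e', e)) | e e' h x. (e, (Some e', Some h, x)) \<in> ?H z v}"
      using hosted_mem[of e D z host v "\<lambda>z e. (J z e, map_option (host z) (J z e), f z e)"] by fastforce
  next
    fix y assume "y \<in> {(h, (e', e)) | e e' h x. (e, (Some e', Some h, x)) \<in> ?H z v}"
    then obtain e e' h x where y: "y = (h, (e', e))" "(e, (Some e', Some h, x)) \<in> ?H z v" by blast
    then have "e \<in> D z" "host z e = v" "Some e' = J z e" "Some h = map_option (host z) (J z e)"
      unfolding hosted_iff by simp_all
    then have "e \<in> D z" "host z e = v" "J z e = Some e'" "h = host z e'" by (cases "J z e"; simp)+
    then show "y \<in> S1 z v" using y(1) unfolding S1_def by blast
  qed
  have I1_alt: "I1 z v = {(host z e, (e', e)) | e e'. e \<in> D z \<and> J z e = Some e' \<and> host z e' = v}" if "ok z" for z v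
    using hD[OF that] unfolding I1_def S1_def by blast
  have I1_fin: "finite (I1 z v)" if "ok z" for z v
  proof -
    have "I1 z v \<subseteq> {..<n} \<times> (D z \<times> D z)" using hD[OF that] J[OF that] unfolding I1_alt[OF that] by auto
    then show ?thesis using hD[OF that] by (meson finite_SigmaI finite_lessThan finite_subset)
  qed
  \<comment> \<open>An announcement is determined by its target dart, so a host receives no more of
    them than it hosts darts.\<close>
  have I1_card: "card (I1 z v) \<le> card {e \<in> D z. host z e = v}" if "ok z" for z v
  proof (rule card_inj_on_le[where f = "\<lambda>(u, (e', e)). e'"])
    show "inj_on (\<lambda>(u, e', e). e') (I1 z v)"
      unfolding I1_alt[OF that]
    proof (rule inj_onI)
      fix x y
      assume "x \<in> {(host z e, (e', e)) | e e'. e \<in> D z \<and> J z e = Some e' \<and> host z e' = v}"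
        "y \<in> {(host z e, (e', e)) | e e'. e \<in> D z \<and> J z e = Some e' \<and> host z e' = v}"
        and eq: "(case x of (u, e', e) \<Rightarrow> e') = (case y of (u, e', e) \<Rightarrow> e')"
      then obtain e1 e1' e2 e2' where e: "x = (host z e1, e1', e1)" "e1 \<in> D z" "J z e1 = Some e1'"
        "y = (host z e2, e2', e2)" "e2 \<in> D z" "J z e2 = Some e2'" by blast
      then show "x = y" using eq J'[OF that e(2,3) e(5)] by simp
    qed
    show "(\<lambda>(u, e', e). e') ` I1 z v \<subseteq> {e \<in> D z. host z e = v}"
      using J[OF that] unfolding I1_alt[OF that] by auto
  qed (use hD[OF that] in simp)
  have K1: "known (Suc R) (\<lambda>z v. (X z v, I1 z v))"
    unfolding I1_def using X
  proof (rule known_global[where GM = "?V \<times> ?V"])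
    show "det X S1" using det by (rule det_map) (rule S1_det)
    show "card (?V \<times> ?V) \<le> msg_bound \<kappa> n"
      using M(3) by (simp add: card_cartesian_product power4_eq_xxxx mult.assoc)
    show "m \<in> ?V \<times> ?V" if "ok z" "v < n" "(u, m) \<in> S1 z v" for z v u m
      using that hD[OF that(1)] J[OF that(1)] unfolding S1_def by blast
    show "finite (S1 z v)" if "ok z" "v < n" for z v using hD[OF that(1)] unfolding S1_alt by simp
    show "card (S1 z v) \<le> ncc_cap \<kappa> n" if "ok z" "v < n" for z v
    proof -
      have "card (S1 z v) \<le> card {e \<in> D z. host z e = v \<and> J z e \<noteq> None}"
        unfolding S1_alt by (rule card_image_le) (use hD[OF that(1)] in simp)
      also have "\<dots> \<le> card {e \<in> D z. host z e = v}" by (rule card_mono) (use hD[OF that(1)] in auto)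
      finally show ?thesis using hD(4)[OF that] by simp
    qed
    show "card {(u, m). u < n \<and> (v, m) \<in> S1 z u} \<le> ncc_cap \<kappa> n" if "ok z" "v < n" for z v
      using I1_card[OF that(1), of v] hD(4)[OF that] unfolding I1_def by simp
  qed simp
  have I1_iff: "(u, (e', e)) \<in> I1 z v \<longleftrightarrow> e \<in> D z \<and> J z e = Some e' \<and> host z e' = v \<and> u = host z e"
    if "ok z" for z v u e e'
    unfolding I1_alt[OF that] by blast
  have S2_iff: "(u, (e, x)) \<in> S2 z v \<longleftrightarrow> (\<exists>e'. e \<in> D z \<and> J z e = Some e' \<and> host z e' = v \<and> u = host z e \<and> x = f z e')"
    if "ok z" for z v u e x
    using J[OF that] unfolding S2_def mem_Collect_eq prod.inject I1_iff[OF that] hosted_iff by blast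
  have I2_iff: "(u, (e, x)) \<in> I2 z v \<longleftrightarrow> (\<exists>e'. e \<in> D z \<and> J z e = Some e' \<and> host z e = v \<and> u = host z e' \<and> x = f z e')"
    if "ok z" for z v u e x
    using J[OF that] hD(3)[OF that] unfolding I2_def mem_Collect_eq prod.case S2_iff[OF that] by blast
  have K2: "known (Suc (Suc R)) (\<lambda>z v. ((X z v, I1 z v), I2 z v))"
    unfolding I2_def using K1
  proof (rule known_global[where GM = "?V \<times> M"])
    have df: "det X (hosted D host f)" using det_hosted[OF det, of "\<lambda>(j, k, x). x"] by simp
    show "det (\<lambda>z v. (X z v, I1 z v)) S2"
    proof (rule detI)
      fix z z' :: inst and v
      assume a: "ok z" "ok z'" "v < n" "wt z v = wt z' v" "rn z v = rn z' v" "(X z v, I1 z v) = (X z' v, I1 z' v)"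
      then have "hosted D host f z v = hosted D host f z' v" by (intro detD[OF df]) auto
      then show "S2 z v = S2 z' v" using a(6) unfolding S2_def by simp
    qed
    show "finite (?V \<times> M)" using M by simp
    show "card (?V \<times> M) \<le> msg_bound \<kappa> n" using M by (simp add: card_cartesian_product power2_eq_square)
    show "m \<in> ?V \<times> M" if h1: "ok z" and h2: "v < n" and h3: "(u, m) \<in> S2 z v" for z v u m
    proof -
      obtain e x where m: "m = (e, x)" by (cases m)
      then obtain e' where "e \<in> D z" "J z e = Some e'" "x = f z e'"
        using h3 S2_iff[OF h1, of u e x v] by auto
      then have "e \<in> ?V" "x \<in> M" using hD(1)[OF h1] J[OF h1, of e e'] f[OF h1, of e'] by auto
      then show ?thesis unfolding m by (rule SigmaI)
    qed
    have S2_sub: "S2 z v \<subseteq> (\<lambda>(u, e', e). (u, (e, f z e'))) ` I1 z v" if "ok z" for z v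
    proof
      fix y assume "y \<in> S2 z v"
      then obtain u e e' x where "y = (u, (e, x))" "(u, (e', e)) \<in> I1 z v" "x = f z e'"
        unfolding S2_def hosted_iff by blast
      then show "y \<in> (\<lambda>(u, e', e). (u, (e, f z e'))) ` I1 z v"
        by (intro image_eqI[of _ _ "(u, (e', e))"]) simp_all
    qed
    show "finite (S2 z v)" if "ok z" "v < n" for z v
      using finite_subset[OF S2_sub[OF that(1)]] I1_fin[OF that(1)] by blast
    show "card (S2 z v) \<le> ncc_cap \<kappa> n" if "ok z" "v < n" for z v
      using surj_card_le[OF I1_fin[OF that(1), of v] S2_sub[OF that(1), of v]] I1_card[OF that(1), of v] hD(4)[OF that]
      by linarith
    show "card {(u, m). u < n \<and> (v, m) \<in> S2 z u} \<le> ncc_cap \<kappa> n" if "ok z" "v < n" for z v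
    proof -
      have "I2 z v \<subseteq> (\<lambda>e. (host z (the (J z e)), (e, f z (the (J z e))))) ` {e \<in> D z. host z e = v}"
      proof
        fix y assume y: "y \<in> I2 z v"
        obtain u e x where "y = (u, (e, x))" by (cases y)
        then show "y \<in> (\<lambda>e. (host z (the (J z e)), (e, f z (the (J z e))))) ` {e \<in> D z. host z e = v}"
          using y I2_iff[OF that(1), of u e x v] by (intro image_eqI[of _ _ e]) (simp, elim exE conjE, simp)+
      qed
      then have "card (I2 z v) \<le> card {e \<in> D z. host z e = v}"
        using hD(2)[OF that(1)] by (intro surj_card_le) auto
      then show ?thesis using hD(4)[OF that] unfolding I2_def by simp
    qed
  qed
  have "det (\<lambda>z v. ((X z v, I1 z v), I2 z v)) (\<lambda>z v. (X z v, hosted D host (\<lambda>z e. map_option (f z) (J z e)) z v))"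
  proof (rule detI)
    fix z z' :: inst and v
    assume a: "ok z" "ok z'" "v < n" "wt z v = wt z' v" "rn z v = rn z' v"
      "((X z v, I1 z v), I2 z v) = ((X z' v, I1 z' v), I2 z' v)"
    have H: "?H z v = ?H z' v" using a by (intro detD[OF det]) auto
    have sub: "hosted D host (\<lambda>z e. map_option (f z) (J z e)) z v \<subseteq> hosted D host (\<lambda>z e. map_option (f z) (J z e)) z' v"
      if b: "ok z" "ok z'" "?H z v = ?H z' v" "I2 z v = I2 z' v" for z z'
    proof
      fix y assume y: "y \<in> hosted D host (\<lambda>z e. map_option (f z) (J z e)) z v"
      obtain e x where ex: "y = (e, x)" by fastforce
      have e: "e \<in> D z" "host z e = v" "x = map_option (f z) (J z e)" using y unfolding ex hosted_iff by simp_all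
      then have "(e, (J z e, map_option (host z) (J z e), f z e)) \<in> ?H z' v"
        using b(3) hosted_iff[of e _ D host "\<lambda>z e. (J z e, map_option (host z) (J z e), f z e)" z v] by simp
      then have e': "e \<in> D z'" "host z' e = v" "J z' e = J z e" unfolding hosted_iff by simp_all
      have "x = map_option (f z') (J z' e)"
      proof (cases "J z e")
        case (Some e1)
        then have "(host z e1, (e, f z e1)) \<in> I2 z' v" using e b I2_iff by blast
        then have "f z e1 = f z' e1" using Some e' unfolding I2_iff[OF b(2)] by simp
        then show ?thesis using Some e e' by simp
      qed (use e e' in simp)
      then show "y \<in> hosted D host (\<lambda>z e. map_option (f z) (J z e)) z' v" using e' unfolding ex hosted_iff by simp
    qed
    show "(X z v, hosted D host (\<lambda>z e. map_option (f z) (J z e)) z v) = (X z' v, hosted D host (\<lambda>z e. map_option (f z) (J z e)) z' v)"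
      using sub[of z z'] sub[of z' z] H a by simp
  qed
  then show ?thesis using known_det[OF K2] by simp
qed

text \<open>Each doubling is one pull along \<open>dbl_next\<close>. The pulled state contains the
  pointer, the host of its target and the partial aggregate; the host has to travel along because a
  node cannot compute the host of a remote dart.\<close>

lemma known_double:
  fixes nx :: "inst \<Rightarrow> dart \<Rightarrow> dart option" and f :: "inst \<Rightarrow> dart \<Rightarrow> 'a"
  assumes X: "known R X"
    and det: "det X (hosted D host (\<lambda>z e. (nx z e, map_option (host z) (nx z e), f z e)))"
    and h: "hosting D host" and inj: "\<And>z. ok z \<Longrightarrow> partial_inj (D z) (nx z)"
    and M: "finite M" "n ^ 6 * card M \<le> msg_bound \<kappa> n" "n ^ 4 \<le> msg_bound \<kappa> n"
    and fM: "\<And>z i e. ok z \<Longrightarrow> e \<in> D z \<Longrightarrow> dbl_fold op (nx z) (f z) i e \<in> M"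
  shows "known (R + 2 * i) (\<lambda>z v. (X z v, hosted D host (\<lambda>z e. dbl_fold op (nx z) (f z) i e) z v))"
proof -
  define St where "St i z e = (dbl_next (nx z) i e, map_option (host z) (dbl_next (nx z) i e), dbl_fold op (nx z) (f z) i e)"
    for i z e
  have hD: "D z \<subseteq> {..<n} \<times> {..<n}" "\<And>e. e \<in> D z \<Longrightarrow> host z e < n" if "ok z" for z
    using hostingD[OF h that] by blast+
  have pin: "partial_inj (D z) (dbl_next (nx z) i)" if "ok z" for z i
    using inj[OF that] by (rule partial_inj_dbl_next)
  let ?O = "insert None (Some ` ({..<n} \<times> {..<n}))"
  let ?M = "?O \<times> insert None (Some ` {..<n}) \<times> M"
  have cO: "card ?O = n ^ 2 + 1"
    by (subst card_insert_disjoint) (auto simp: card_image card_cartesian_product power2_eq_square)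
  have cO': "card (insert None (Some ` {..<n})) = n + 1"
    by (subst card_insert_disjoint) (auto simp: card_image)
  \<comment> \<open>A message names a dart (\<open>n ^ 2\<close>) and carries an optional dart, an
    optional host and a value.\<close>
  have b1: "n ^ 2 * ((n ^ 2 + 1) * ((n + 1) * c)) \<le> n ^ 6 * c" for c
  proof -
    \<comment> \<open>Nearly tight for \<open>n = 2\<close>, where it reads
      \<open>15 \<le> 16\<close>; hence the separate case.\<close>
    have q: "(n ^ 2 + 1) * (n + 1) \<le> n ^ 4"
    proof (cases "n = 2")
      case False
      then have n3: "3 \<le> n" using n2 by simp
      have "1 \<le> n ^ 2" using n2 by simp
      then have "n ^ 2 + 1 \<le> 2 * n ^ 2" by simp
      moreover have "3 * (n + 1) \<le> 4 * n" using n3 by simp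
      ultimately have "(n ^ 2 + 1) * (3 * (n + 1)) \<le> (2 * n ^ 2) * (4 * n)" by (rule mult_le_mono)
      also have "\<dots> = 8 * n ^ 3" by (simp add: power2_eq_square power3_eq_cube)
      also have "\<dots> \<le> 3 * n * n ^ 3" using n3 by (intro mult_le_mono1) simp
      also have "\<dots> = 3 * n ^ 4" by (simp add: power4_eq_xxxx power3_eq_cube)
      finally have "3 * ((n ^ 2 + 1) * (n + 1)) \<le> 3 * n ^ 4" by (simp only: mult.left_commute[of "n ^ 2 + 1" 3])
      then show ?thesis using nat_mult_le_cancel1[of 3 "(n ^ 2 + 1) * (n + 1)" "n ^ 4"] by linarith
    qed simp
    have "n ^ 2 * ((n ^ 2 + 1) * ((n + 1) * c)) = n ^ 2 * ((n ^ 2 + 1) * (n + 1)) * c" by (simp only: mult.assoc)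
    also have "\<dots> \<le> n ^ 2 * n ^ 4 * c" using q by (intro mult_le_mono1 mult_le_mono2)
    also have "\<dots> = n ^ 6 * c" by (simp flip: power_add)
    finally show ?thesis .
  qed
  have "known (R + 2 * i) (\<lambda>z v. (X z v, hosted D host (St i) z v))"
  proof (induction i)
    case 0
    have "det X (\<lambda>z v. (X z v, hosted D host (St 0) z v))"
    proof (rule detI)
      fix z z' :: inst and v
      assume a: "ok z" "ok z'" "v < n" "wt z v = wt z' v" "rn z v = rn z' v" "X z v = X z' v"
      have "St 0 = (\<lambda>z e. (nx z e, map_option (host z) (nx z e), f z e))" unfolding St_def by simp
      then show "(X z v, hosted D host (St 0) z v) = (X z' v, hosted D host (St 0) z' v)"
        using detD[OF det a] a(6) by simp
    qed
    then show ?case using X known_det by auto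
  next
    case (Suc i)
    have "known (R + 2 * i + 2) (\<lambda>z v. ((X z v, hosted D host (St i) z v),
        hosted D host (\<lambda>z e. map_option (St i z) (dbl_next (nx z) i e)) z v))"
      using Suc
    proof (rule known_pull[where M = ?M])
      show "det (\<lambda>z v. (X z v, hosted D host (St i) z v)) (hosted D host
         (\<lambda>z e. (dbl_next (nx z) i e, map_option (host z) (dbl_next (nx z) i e), St i z e)))"
      proof (rule detI)
        fix z z' :: inst and v
        assume "(X z v, hosted D host (St i) z v) = (X z' v, hosted D host (St i) z' v)"
        then show "hosted D host (\<lambda>z e. (dbl_next (nx z) i e, map_option (host z) (dbl_next (nx z) i e), St i z e)) z v =
          hosted D host (\<lambda>z e. (dbl_next (nx z) i e, map_option (host z) (dbl_next (nx z) i e), St i z e)) z' v"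
          using hosted_comp[of D host "\<lambda>s. (fst s, fst (snd s), s)" "St i"] by (simp add: St_def)
      qed
      show "finite ?M" using M by simp
      have "card ?M = (n ^ 2 + 1) * ((n + 1) * card M)" using cO cO' by (simp only: card_cartesian_product)
      then show "n ^ 2 * card ?M \<le> msg_bound \<kappa> n" using b1[of "card M"] M(2) by simp
      show "St i z e \<in> ?M" if "ok z" "e \<in> D z" for z e
      proof (cases "dbl_next (nx z) i e")
        case (Some e')
        then have "e' \<in> D z" using pin[OF that(1), of i] that unfolding partial_inj_def by blast
        then show ?thesis using Some hD[OF that(1)] fM[OF that] unfolding St_def by auto
      qed (use fM[OF that] St_def in auto)
    qed (use h pin M in auto)
    then have k: "known (R + 2 * Suc i) (\<lambda>z v. ((X z v, hosted D host (St i) z v),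
        hosted D host (\<lambda>z e. map_option (St i z) (dbl_next (nx z) i e)) z v))" by simp
    show ?case
    proof (rule known_det[OF k], rule detI)
      fix z z' :: inst and v
      let ?A = "hosted D host (St i)" and ?B = "hosted D host (\<lambda>z e. map_option (St i z) (dbl_next (nx z) i e))"
      define comb where "comb A B = {(e, case b of None \<Rightarrow> (None, None, snd (snd a))
           | Some c \<Rightarrow> (fst c, fst (snd c), op (snd (snd a)) (snd (snd c)))) | e a b. (e, a) \<in> A \<and> (e, b) \<in> B}"
        for A :: "(dart \<times> (dart option \<times> nat option \<times> 'a)) set" and B :: "(dart \<times> (dart option \<times> nat option \<times> 'a) option) set"
      assume "((X z v, ?A z v), ?B z v) = ((X z' v, ?A z' v), ?B z' v)"
      then have "X z v = X z' v" "comb (?A z v) (?B z v) = comb (?A z' v) (?B z' v)" by simp_all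
      moreover have "comb (?A z v) (?B z v) = hosted D host (St (Suc i)) z v" for z
      proof -
        let ?c = "\<lambda>e. case map_option (St i z) (dbl_next (nx z) i e) of None \<Rightarrow> (None, None, snd (snd (St i z e)))
           | Some c \<Rightarrow> (fst c, fst (snd c), op (snd (snd (St i z e))) (snd (snd c)))"
        have "comb (?A z v) (?B z v) = (\<lambda>e. (e, ?c e)) ` {e \<in> D z. host z e = v}"
          unfolding comb_def hosted_iff by blast
        moreover have "?c e = St (Suc i) z e" for e
          by (simp add: St_def split: option.split)
        ultimately show ?thesis unfolding hosted_def by (simp only:)
      qed
      ultimately show "(X z v, hosted D host (St (Suc i)) z v) = (X z' v, hosted D host (St (Suc i)) z' v)" by simp
    qed
  qed
  then show ?thesis
  proof (rule known_det, intro detI)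
    fix z z' :: inst and v
    assume "(X z v, hosted D host (St i) z v) = (X z' v, hosted D host (St i) z' v)"
    then show "(X z v, hosted D host (\<lambda>z e. dbl_fold op (nx z) (f z) i e) z v)
       = (X z' v, hosted D host (\<lambda>z e. dbl_fold op (nx z) (f z) i e) z' v)"
      using hosted_comp[of D host "\<lambda>s. snd (snd s)" "St i"] by (simp add: St_def)
  qed
qed

end

section \<open>Global aggregation\<close>

lemma dbl_next_total: "dbl_next (\<lambda>e. Some (p e)) i e = Some ((p ^^ (2 ^ i)) e)"
  by (induction i arbitrary: e) (simp_all add: funpow_add mult_2)

lemma dbl_fold_inf:
  fixes g :: "'d \<Rightarrow> 'a::complete_lattice"
  shows "dbl_fold inf (\<lambda>e. Some (p e)) g i e = (INF k\<in>{..<2 ^ i}. g ((p ^^ k) e))"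
proof (induction i arbitrary: e)
  case (Suc i)
  have "{..<(2::nat) ^ Suc i} = {..<2 ^ i} \<union> (\<lambda>k. k + 2 ^ i) ` {..<2 ^ i}"
  proof (intro set_eqI iffI)
    fix k :: nat assume "k \<in> {..<2 ^ Suc i}"
    then show "k \<in> {..<2 ^ i} \<union> (\<lambda>k. k + 2 ^ i) ` {..<2 ^ i}"
      by (cases "k < 2 ^ i") (auto intro!: image_eqI[of _ _ "k - 2 ^ i"])
  qed auto
  then show ?case by (simp add: Suc dbl_next_total INF_union image_image funpow_add)
qed (simp add: lessThan_Suc)

text \<open>\<open>None\<close> is absorbing, so that a path which has ended contributes nothing to
  later sums.\<close>

definition walk :: "('d \<Rightarrow> 'd option) \<Rightarrow> nat \<Rightarrow> 'd \<Rightarrow> 'd option" where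
  "walk nx k e = ((\<lambda>x. Option.bind x nx) ^^ k) (Some e)"

lemma walk_0 [simp]: "walk nx 0 e = Some e"
  by (simp add: walk_def)

lemma walk_Suc: "walk nx (Suc k) e = Option.bind (walk nx k e) nx"
  by (simp add: walk_def)

lemma walk_add: "walk nx (j + k) e = Option.bind (walk nx j e) (walk nx k)"
proof (induction k)
  case 0
  show ?case by (cases "walk nx j e") simp_all
next
  case (Suc k)
  then show ?case by (cases "walk nx j e") (simp_all add: walk_Suc)
qed

lemma dbl_next_walk: "dbl_next nx i e = walk nx (2 ^ i) e"
proof (induction i arbitrary: e)
  case (Suc i)
  then have "dbl_next nx i = walk nx (2 ^ i)" by (rule ext)
  then show ?case by (simp add: mult_2 walk_add)
qed (simp add: walk_Suc)

context comm_monoid_set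
begin

text \<open>The index is the number of steps, so an element visited twice counts twice; steps beyond
  the end contribute the neutral element.\<close>

lemma dbl_fold_walk:
  "dbl_fold f nx g i e = F (\<lambda>k. case walk nx k e of None \<Rightarrow> \<^bold>1 | Some e' \<Rightarrow> g e') {..<2 ^ i}"
proof (induction i arbitrary: e)
  case (Suc i)
  let ?h = "\<lambda>e k. case walk nx k e of None \<Rightarrow> \<^bold>1 | Some e' \<Rightarrow> g e'"
  have "{..<(2::nat) ^ Suc i} = {..<2 ^ i} \<union> {2 ^ i..<2 ^ i + 2 ^ i}" by (auto simp: mult_2)
  then have "F (?h e) {..<2 ^ Suc i} = F (?h e) {..<2 ^ i} \<^bold>* F (?h e) {2 ^ i..<2 ^ i + 2 ^ i}"
    by (simp add: union_disjoint ivl_disj_int)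
  also have "F (?h e) {2 ^ i..<2 ^ i + 2 ^ i} = F (\<lambda>k. ?h e (2 ^ i + k)) {..<2 ^ i}"
    by (rule reindex_bij_witness[of _ "\<lambda>k. 2 ^ i + k" "\<lambda>k. k - 2 ^ i"]) auto
  also have "\<dots> = (case walk nx (2 ^ i) e of None \<Rightarrow> \<^bold>1 | Some e' \<Rightarrow> F (?h e') {..<2 ^ i})"
    by (cases "walk nx (2 ^ i) e") (simp_all add: walk_add)
  finally show ?case by (cases "walk nx (2 ^ i) e") (simp_all add: Suc dbl_next_walk)
qed (simp add: lessThan_Suc)

end

text \<open>With \<open>4 \<le> \<kappa>\<close> a node may host \<open>4 * lg\<close> darts and a
  message may name two darts.\<close>

locale big_network = network +
  assumes kap: "4 \<le> \<kappa>"
begin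

definition lg :: nat where "lg = nat \<lceil>log 2 (real n + 1)\<rceil>"

lemma lg_pow: "n + 1 \<le> 2 ^ lg"
proof -
  have "real n + 1 = 2 powr log 2 (real n + 1)" by simp
  also have "\<dots> \<le> 2 powr real lg" unfolding lg_def by (intro powr_mono) linarith+
  also have "\<dots> = real (2 ^ lg)" by (simp add: powr_realpow)
  finally show ?thesis by (metis of_nat_Suc of_nat_le_iff Suc_eq_plus1 add.commute)
qed

lemma lg_pos: "2 \<le> lg"
proof (rule ccontr)
  assume "\<not> 2 \<le> lg"
  then have "(2::nat) ^ lg \<le> 2 ^ 1" by (intro power_increasing) auto
  then show False using lg_pow n2 by simp
qed

lemma cap: "4 * lg \<le> ncc_cap \<kappa> n"
  using kap unfolding ncc_cap_def lg_def[symmetric] by simp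

lemma msg4: "n ^ 4 \<le> msg_bound \<kappa> n"
proof -
  have "n ^ 4 \<le> (n + 1) ^ 4" by (intro power_mono) auto
  also have "\<dots> \<le> (n + 1) ^ \<kappa>" using kap by (intro power_increasing) auto
  finally show ?thesis by (simp add: msg_bound_def)
qed

text \<open>There are at most \<open>n ^ 2\<close> darts, so \<open>2 * lg\<close> doublings
  traverse any tour; the same number is used for all aggregations.\<close>

lemma pow_2lg: "n ^ 2 \<le> 2 ^ (2 * lg)"
proof -
  have "n ^ 2 \<le> (2 ^ lg) ^ 2" using lg_pow by (intro power_mono) auto
  then show ?thesis by (simp add: power_mult mult.commute flip: power_mult)
qed

lemma n_le_pow_2lg: "n \<le> 2 ^ (2 * lg)"
  using pow_2lg n2 by (metis power2_nat_le_imp_le le_trans)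

text \<open>Nodes appear as loop darts so that doubling along darts also serves global
  aggregation.\<close>

definition nodes :: "inst \<Rightarrow> dart set" where "nodes z = (\<lambda>v. (v, v)) ` {..<n}"

lemma hosting_nodes: "hosting nodes (\<lambda>z e. fst e)"
  unfolding hosting_def
proof (intro allI impI conjI)
  fix z v assume "v < n"
  have "{e \<in> nodes z. fst e = v} \<subseteq> {(v, v)}" by (auto simp: nodes_def)
  then have "card {e \<in> nodes z. fst e = v} \<le> card {(v, v)}" by (intro card_mono) auto
  then show "card {e \<in> nodes z. fst e = v} \<le> ncc_cap \<kappa> n" using cap lg_pos by simp
qed (auto simp: nodes_def)

lemma hosted_nodes: "v < n \<Longrightarrow> hosted nodes (\<lambda>z e. fst e) f z v = {((v, v), f z (v, v))}"
  unfolding hosted_def nodes_def by auto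

text \<open>Doubling around the ring of all nodes. The \<open>2 ^ (2 * lg)\<close> steps may go
  around repeatedly, which a minimum tolerates.\<close>

lemma known_min:
  fixes f :: "inst \<Rightarrow> nat \<Rightarrow> enat"
  assumes X: "known R X" and det: "det X f"
    and M: "finite M" "n ^ 6 * card M \<le> msg_bound \<kappa> n" "\<And>z v. ok z \<Longrightarrow> v < n \<Longrightarrow> f z v \<in> M"
  shows "known (R + 4 * lg) (\<lambda>z v. (X z v, INF u\<in>{..<n}. f z u))"
proof -
  define p where "p e = (let v = (fst e + 1) mod n in (v, v))" for e :: dart
  have pin: "partial_inj (nodes z) (\<lambda>e. Some (p e))" for z
    unfolding partial_inj_def
  proof (intro conjI allI impI)
    fix e e' assume "e \<in> nodes z" "Some (p e) = Some e'"
    then show "e' \<in> nodes z" using n2 by (auto simp: nodes_def p_def Let_def)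
  next
    fix e1 e2 e' assume "e1 \<in> nodes z" "e2 \<in> nodes z" "Some (p e1) = Some e'" "Some (p e2) = Some e'"
    then obtain a b where "e1 = (a, a)" "e2 = (b, b)" "a < n" "b < n" "(a + 1) mod n = (b + 1) mod n"
      by (auto simp: nodes_def p_def Let_def)
    then show "e1 = e2" using mod_Suc[of a n] mod_Suc[of b n] n2 by (auto split: if_splits)
  qed
  have "known (R + 2 * (2 * lg)) (\<lambda>z v. (X z v,
     hosted nodes (\<lambda>z e. fst e) (\<lambda>z e. dbl_fold inf (\<lambda>e. Some (p e)) (\<lambda>e. f z (fst e)) (2 * lg) e) z v))"
    using X
  proof (rule known_double[where M = M])
    show "det X (hosted nodes (\<lambda>z e. fst e) (\<lambda>z e. (Some (p e), map_option fst (Some (p e)), f z (fst e))))"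
      using det by (rule det_via) (simp add: hosted_nodes)
    show "dbl_fold inf (\<lambda>e. Some (p e)) (\<lambda>e. f z (fst e)) i e \<in> M" if "ok z" "e \<in> nodes z" for z i e
    proof (rule dbl_fold_mem[OF pin])
      show "e \<in> nodes z" by fact
    qed (use M(3)[OF that(1)] in \<open>auto simp: nodes_def inf_min min_def\<close>)
  qed (use pin M hosting_nodes msg4 in auto)
  moreover have "dbl_fold inf (\<lambda>e. Some (p e)) (\<lambda>e. f z (fst e)) (2 * lg) (v, v) = (INF u\<in>{..<n}. f z u)"
    if v: "v < n" for z v
  proof -
    have it: "(p ^^ k) (v, v) = ((v + k) mod n, (v + k) mod n)" for k
      by (induction k) (use v in \<open>auto simp: p_def Let_def mod_simps\<close>)
    have im: "(\<lambda>k. (v + k) mod n) ` {..<2 ^ (2 * lg)} = {..<n}"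
    proof (intro set_eqI iffI)
      fix u assume "u \<in> {..<n}"
      then have u: "u < n" by simp
      obtain k where k: "k < n" "(v + k) mod n = u"
      proof (cases "v \<le> u")
        case True
        show ?thesis by (rule that[of "u - v"]) (use True u in auto)
      next
        case False
        have "v + (u + n - v) = u + n" using v by simp
        then have "(v + (u + n - v)) mod n = u" using u by (simp only: mod_add_self2 mod_less)
        then show ?thesis using False v by (intro that[of "u + n - v"]) linarith+
      qed
      then show "u \<in> (\<lambda>k. (v + k) mod n) ` {..<2 ^ (2 * lg)}"
        using less_le_trans[OF k(1) n_le_pow_2lg] by blast
    qed (use v in auto)
    have "(INF u\<in>{..<n}. f z u) = (INF k\<in>{..<2 ^ (2 * lg)}. f z ((v + k) mod n))"
      unfolding im[symmetric] image_image ..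
    then show ?thesis by (simp only: dbl_fold_inf it fst_conv)
  qed
  ultimately show ?thesis by (simp, elim known_via) (simp add: hosted_nodes)
qed

text \<open>Addition does not tolerate repetitions, so the ring is cut open into a path. Only node
  \<open>0\<close> then obtains the full sum; it is broadcast as a minimum with
  \<open>\<infinity>\<close> at all other nodes.\<close>

lemma known_sum:
  fixes f :: "inst \<Rightarrow> nat \<Rightarrow> nat"
  assumes X: "known R X" and det: "det X f"
    and B: "n ^ 6 * (B + 2) \<le> msg_bound \<kappa> n" "\<And>z. ok z \<Longrightarrow> (\<Sum>u<n. f z u) \<le> B"
  shows "known (R + 8 * lg) (\<lambda>z v. (X z v, \<Sum>u<n. f z u))"
proof -
  define nx where "nx e = (if fst e + 1 < n then Some (fst e + 1, fst e + 1) else None)" for e :: dart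
  have pin: "partial_inj (nodes z) nx" for z
    unfolding partial_inj_def by (auto simp: nodes_def nx_def split: if_splits)
  have wk: "walk nx k (v, v) = (if v + k < n then Some (v + k, v + k) else None)" if "v < n" for k v
    by (induction k) (use that in \<open>auto simp: walk_Suc nx_def\<close>)
  have fold: "dbl_fold (+) nx (\<lambda>e. f z (fst e)) i (v, v) = (\<Sum>k<2 ^ i. if v + k < n then f z (v + k) else 0)"
    if "v < n" for z i v
    unfolding sum.dbl_fold_walk by (rule sum.cong) (simp_all add: wk[OF that])
  have le: "dbl_fold (+) nx (\<lambda>e. f z (fst e)) i (v, v) \<le> B" if "ok z" "v < n" for z i v
  proof -
    have "(\<Sum>k<2 ^ i. if v + k < n then f z (v + k) else 0) = sum (f z) ((\<lambda>k. v + k) ` {k. k < 2 ^ i \<and> v + k < n})"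
      by (subst sum.reindex) (auto simp: sum.If_cases intro!: sum.cong)
    also have "\<dots> \<le> (\<Sum>u<n. f z u)" by (rule sum_mono2) auto
    finally show ?thesis using fold[OF that(2)] B(2)[OF that(1)] by simp
  qed
  let ?S = "\<lambda>z v. dbl_fold (+) nx (\<lambda>e. f z (fst e)) (2 * lg) (v, v)"
  have "known (R + 2 * (2 * lg)) (\<lambda>z v. (X z v,
     hosted nodes (\<lambda>z e. fst e) (\<lambda>z e. dbl_fold (+) nx (\<lambda>e. f z (fst e)) (2 * lg) e) z v))"
    using X
  proof (rule known_double[where M = "{..B}"])
    show "det X (hosted nodes (\<lambda>z e. fst e) (\<lambda>z e. (nx e, map_option fst (nx e), f z (fst e))))"
      using det by (rule det_via) (simp add: hosted_nodes)
    show "dbl_fold (+) nx (\<lambda>e. f z (fst e)) i e \<in> {..B}" if "ok z" "e \<in> nodes z" for z i e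
      using that le by (auto simp: nodes_def)
    show "n ^ 6 * card {..B} \<le> msg_bound \<kappa> n" by (rule le_trans[OF _ B(1)]) simp
  qed (use pin hosting_nodes msg4 in auto)
  then have k: "known (R + 4 * lg) (\<lambda>z v. (X z v, ?S z v))"
    by (simp, elim known_via) (simp add: hosted_nodes)
  have "known (R + 4 * lg + 4 * lg) (\<lambda>z v. ((X z v, ?S z v), INF u\<in>{..<n}. if u = 0 then enat (?S z u) else \<infinity>))"
    using k
  proof (rule known_min[where M = "insert \<infinity> (enat ` {..B})"])
    have "card (insert \<infinity> (enat ` {..B})) \<le> B + 2"
      by (simp add: card_insert_if card_image inj_on_def)
    then show "n ^ 6 * card (insert \<infinity> (enat ` {..B})) \<le> msg_bound \<kappa> n"
      using B(1) by (meson le_trans mult_le_mono2)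
  qed (auto simp: le intro!: detI)
  moreover have "(INF u\<in>{..<n}. if u = 0 then enat (?S z u) else \<infinity>) = enat (\<Sum>u<n. f z u)" for z
  proof -
    have "(INF u\<in>{..<n}. if u = 0 then enat (?S z u) else \<infinity>) = enat (?S z 0)"
      using n2 by (intro antisym INF_lower2[of 0] INF_greatest) auto
    also have "?S z 0 = (\<Sum>k<2 ^ (2 * lg). if k < n then f z k else 0)" using fold[of 0 z] n2 by (simp cong: if_cong)
    also have "\<dots> = (\<Sum>u<n. f z u)"
      using n_le_pow_2lg by (intro sum.mono_neutral_cong_right) auto
    finally show ?thesis .
  qed
  moreover have "R + 8 * lg = R + 4 * lg + 4 * lg" by simp
  ultimately show ?thesis by (simp only:) (erule known_via, simp)
qed

end

section \<open>Forests and Euler tours\<close>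

definition cmp :: "('v \<times> 'v) set \<Rightarrow> 'v \<Rightarrow> 'v set" where
  "cmp R x = R\<^sup>* `` {x}"

text \<open>Acyclicity is expressed without cycles: deleting an edge, in both directions, separates
  its endpoints.\<close>

definition forest :: "('v \<times> 'v) set \<Rightarrow> bool" where
  "forest R \<longleftrightarrow> sym R \<and> (\<forall>x. (x, x) \<notin> R) \<and>
     (\<forall>u v. (u, v) \<in> R \<longrightarrow> (u, v) \<notin> (R - {(u, v), (v, u)})\<^sup>*)"

text \<open>\<open>side R u v\<close> is the component of \<open>v\<close> after deleting the edge \<open>uv\<close>; for \<open>u = v\<close> it is the
  whole component, so that one notion covers both kinds of candidate cuts.\<close>

definition side :: "('v \<times> 'v) set \<Rightarrow> 'v \<Rightarrow> 'v \<Rightarrow> 'v set" where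
  "side R u v = cmp (R - {(u, v), (v, u)}) v"

lemma cmp_self [simp]: "x \<in> cmp R x"
  by (simp add: cmp_def)

lemma cmp_iff: "y \<in> cmp R x \<longleftrightarrow> (x, y) \<in> R\<^sup>*"
  by (simp add: cmp_def)

lemma cmp_mono: "R \<subseteq> S \<Longrightarrow> cmp R x \<subseteq> cmp S x"
  using rtrancl_mono unfolding cmp_def by blast

lemma rtrancl_symD: "sym R \<Longrightarrow> (x, y) \<in> R\<^sup>* \<Longrightarrow> (y, x) \<in> R\<^sup>*"
  using sym_rtrancl[of R] unfolding sym_def by blast

lemma cmp_eq: "sym R \<Longrightarrow> (x, y) \<in> R\<^sup>* \<Longrightarrow> cmp R x = cmp R y"
  using rtrancl_symD[of R] unfolding cmp_def by (auto intro: rtrancl_trans)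

lemma cmp_subset: "R \<subseteq> A \<times> A \<Longrightarrow> x \<in> A \<Longrightarrow> cmp R x \<subseteq> A"
proof
  fix y assume "R \<subseteq> A \<times> A" "x \<in> A" "y \<in> cmp R x"
  then have "(x, y) \<in> R\<^sup>*" by (simp add: cmp_def)
  then show "y \<in> A" by (induction rule: rtrancl_induct) (use \<open>R \<subseteq> A \<times> A\<close> \<open>x \<in> A\<close> in auto)
qed

lemma forestD:
  assumes "forest R"
  shows "sym R" "(x, x) \<notin> R" "(u, v) \<in> R \<Longrightarrow> (u, v) \<notin> (R - {(u, v), (v, u)})\<^sup>*"
  using assms unfolding forest_def by blast+

lemma sym_minus: "sym R \<Longrightarrow> sym (R - {(u, v), (v, u)})"
  unfolding sym_def by blast

lemma forest_subset:
  assumes "forest R" "S \<subseteq> R" "sym S"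
  shows "forest S"
proof -
  have "(u, v) \<notin> (S - {(u, v), (v, u)})\<^sup>*" if "(u, v) \<in> S" for u v
    using forestD(3)[OF assms(1), of u v] that assms(2) rtrancl_mono[of "S - {(u, v), (v, u)}" "R - {(u, v), (v, u)}"]
    by blast
  then show ?thesis using assms forestD(2)[OF assms(1)] unfolding forest_def by blast
qed

lemma side_self [simp]: "v \<in> side R u v"
  by (simp add: side_def)

lemma not_in_side: "forest R \<Longrightarrow> (u, v) \<in> R \<Longrightarrow> u \<notin> side R u v"
  using forestD(3)[of R u v] rtrancl_symD[OF sym_minus[OF forestD(1)], of R v u u v]
  unfolding side_def cmp_iff by (auto simp: insert_commute)

lemma side_refl: "forest R \<Longrightarrow> side R v v = cmp R v"
  using forestD(2)[of R v] unfolding side_def by simp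

text \<open>By acyclicity a walk from \<open>s\<close> avoiding the edge \<open>vs\<close> never
  reaches \<open>v\<close>, so it cannot use \<open>uv\<close> either.\<close>

lemma side_child_subset:
  assumes F: "forest R" and e: "(v, s) \<in> R" and ne: "s \<noteq> u"
  shows "side R v s \<subseteq> side R u v - {v}"
proof
  fix x assume "x \<in> side R v s"
  then have "(s, x) \<in> (R - {(v, s), (s, v)})\<^sup>*" by (simp add: side_def cmp_iff)
  then show "x \<in> side R u v - {v}"
  proof (induction rule: rtrancl_induct)
    case base
    have "(v, s) \<in> R - {(u, v), (v, u)}" using e ne forestD(2)[OF F] by auto
    then show ?case using forestD(2)[OF F] e by (auto simp: side_def cmp_iff)
  next
    case (step x y)
    have "y \<noteq> v"
    proof
      assume "y = v"
      then have "(s, v) \<in> (R - {(v, s), (s, v)})\<^sup>*" using step by (meson rtrancl.simps)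
      then show False using not_in_side[OF F e] by (simp add: side_def cmp_iff)
    qed
    then have "(x, y) \<in> R - {(u, v), (v, u)}" using step by auto
    moreover have "(v, x) \<in> (R - {(u, v), (v, u)})\<^sup>*" using step.IH by (simp add: side_def cmp_iff)
    ultimately have "(v, y) \<in> (R - {(u, v), (v, u)})\<^sup>*" by (rule rtrancl_into_rtrancl[rotated])
    then show ?case using \<open>y \<noteq> v\<close> by (simp add: side_def cmp_iff)
  qed
qed

text \<open>The recursion for rooted subtrees, with \<open>u\<close> as parent of \<open>v\<close>
  and \<open>s\<close> ranging over its children. For \<open>u = v\<close> it splits a whole
  component at \<open>v\<close>.\<close>

lemma side_split:
  assumes F: "forest R"
  shows "side R u v = {v} \<union> (\<Union>s\<in>R `` {v} - {u}. side R v s)"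
proof
  show "{v} \<union> (\<Union>s\<in>R `` {v} - {u}. side R v s) \<subseteq> side R u v"
    using side_child_subset[OF F] by fastforce
  show "side R u v \<subseteq> {v} \<union> (\<Union>s\<in>R `` {v} - {u}. side R v s)"
  proof
    fix x assume "x \<in> side R u v"
    then have "(v, x) \<in> (R - {(u, v), (v, u)})\<^sup>*" by (simp add: side_def cmp_iff)
    then show "x \<in> {v} \<union> (\<Union>s\<in>R `` {v} - {u}. side R v s)"
    proof (induction rule: rtrancl_induct)
      case (step x y)
      show ?case
      proof (cases "x = v")
        case True
        then show ?thesis using step.hyps side_self by fastforce
      next
        case False
        then obtain s where s: "(v, s) \<in> R" "s \<noteq> u" "x \<in> side R v s" using step.IH by blast
        show ?thesis
        proof (cases "y = v")
          case False
          then have "(x, y) \<in> R - {(v, s), (s, v)}" using step.hyps \<open>x \<noteq> v\<close> by auto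
          then have "y \<in> side R v s" using s(3) unfolding side_def cmp_iff by (auto intro: rtrancl_into_rtrancl)
          then show ?thesis using s by blast
        qed simp
      qed
    qed simp
  qed
qed

lemma add_edge_rtrancl:
  assumes "(x, y) \<in> (R \<union> {(a, b), (b, a)})\<^sup>*"
  shows "(x, y) \<in> R\<^sup>* \<or> (x, a) \<in> R\<^sup>* \<and> (b, y) \<in> R\<^sup>* \<or> (x, b) \<in> R\<^sup>* \<and> (a, y) \<in> R\<^sup>*"
  using assms by (induction rule: rtrancl_induct) (auto intro: rtrancl_into_rtrancl)

lemma side_Un:
  assumes F: "forest R" and e: "(u, v) \<in> R"
  shows "cmp R u = side R u v \<union> side R v u" "side R u v \<inter> side R v u = {}"
proof -
  let ?R = "R - {(u, v), (v, u)}"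
  have s: "sym ?R" using forestD(1)[OF F] by (rule sym_minus)
  have v: "side R v u = cmp ?R u" by (simp add: side_def insert_commute)
  have "cmp R u \<subseteq> cmp ?R v \<union> cmp ?R u"
  proof
    fix x assume "x \<in> cmp R u"
    moreover have "R = ?R \<union> {(u, v), (v, u)}" using e forestD(1)[OF F] unfolding sym_def by blast
    ultimately have "(u, x) \<in> (?R \<union> {(u, v), (v, u)})\<^sup>*" by (simp add: cmp_iff)
    from add_edge_rtrancl[OF this] show "x \<in> cmp ?R v \<union> cmp ?R u" by (auto simp: cmp_iff)
  qed
  moreover have "cmp ?R u \<subseteq> cmp R u" by (rule cmp_mono) blast
  moreover have "cmp ?R v \<subseteq> cmp R v" by (rule cmp_mono) blast
  moreover have "cmp R u = cmp R v" using cmp_eq[OF forestD(1)[OF F]] e by blast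
  ultimately show "cmp R u = side R u v \<union> side R v u" unfolding v unfolding side_def by blast
  show "side R u v \<inter> side R v u = {}"
  proof (rule ccontr)
    assume "side R u v \<inter> side R v u \<noteq> {}"
    then obtain x where "(v, x) \<in> ?R\<^sup>*" "(u, x) \<in> ?R\<^sup>*" unfolding v unfolding side_def cmp_iff[symmetric] by blast
    then have "(u, v) \<in> ?R\<^sup>*" using rtrancl_symD[OF s] by (meson rtrancl_trans)
    then show False using forestD(3)[OF F e] by blast
  qed
qed

text \<open>A choice depending on the set alone: a node that knows its neighbourhood knows its
  rotation without communication.\<close>

definition cyc :: "'v set \<Rightarrow> 'v \<Rightarrow> 'v" where
  "cyc A = (SOME p. bij_betw p A A \<and> (\<forall>x\<in>A. \<forall>y\<in>A. \<exists>k. (p ^^ k) x = y))"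

lemma cyc:
  assumes "finite A" "A \<noteq> {}"
  shows "bij_betw (cyc A) A A" "x \<in> A \<Longrightarrow> y \<in> A \<Longrightarrow> \<exists>k. (cyc A ^^ k) x = y"
proof -
  define m where "m = card A"
  have m: "0 < m" using assms by (simp add: m_def card_gt_0_iff)
  obtain f where f: "bij_betw f {..<m} A"
    using ex_bij_betw_nat_finite[OF assms(1)] unfolding m_def atLeast0LessThan by blast
  define g where "g = inv_into {..<m} f"
  have g: "bij_betw g A {..<m}" unfolding g_def by (rule bij_betw_inv_into[OF f])
  have fg: "f (g x) = x" if "x \<in> A" for x using f that unfolding g_def by (simp add: bij_betw_inv_into_right)
  have gf: "g (f i) = i" if "i < m" for i using f that unfolding g_def by (simp add: bij_betw_inv_into_left)
  define s where "s i = (i + 1) mod m" for i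
  have s: "bij_betw s {..<m} {..<m}"
    unfolding bij_betw_def
  proof
    show "inj_on s {..<m}" by (auto simp: inj_on_def s_def mod_Suc split: if_splits)
    moreover have "s ` {..<m} \<subseteq> {..<m}" using m by (auto simp: s_def)
    ultimately show "s ` {..<m} = {..<m}" by (simp add: endo_inj_surj)
  qed
  define p where "p = f \<circ> s \<circ> g"
  have "bij_betw p A A" unfolding p_def by (intro bij_betw_trans[OF g] bij_betw_trans[OF s] f)
  moreover have "\<exists>k. (p ^^ k) x = y" if "x \<in> A" "y \<in> A" for x y
  proof -
    have gx: "g x < m" "g y < m" using g that by (auto dest: bij_betwE)
    have "(p ^^ k) x = f ((g x + k) mod m)" for k
      by (induction k) (use gx m that in \<open>simp_all add: fg p_def gf s_def mod_Suc_eq\<close>)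
    then have "(p ^^ (m - g x + g y)) x = f ((g x + (m - g x + g y)) mod m)" by simp
    also have "g x + (m - g x + g y) = g y + m" using gx by simp
    finally show ?thesis using gx that fg by auto
  qed
  ultimately have "\<exists>p. bij_betw p A A \<and> (\<forall>x\<in>A. \<forall>y\<in>A. \<exists>k. (p ^^ k) x = y)" by blast
  from someI_ex[OF this] have c: "bij_betw (cyc A) A A \<and> (\<forall>x\<in>A. \<forall>y\<in>A. \<exists>k. (cyc A ^^ k) x = y)"
    unfolding cyc_def .
  then show "bij_betw (cyc A) A A" by blast
  show "x \<in> A \<Longrightarrow> y \<in> A \<Longrightarrow> \<exists>k. (cyc A ^^ k) x = y" using c by blast
qed

lemma cyc_in: "finite A \<Longrightarrow> x \<in> A \<Longrightarrow> cyc A x \<in> A"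
  using cyc(1)[of A] bij_betwE by blast

lemma cyc_pow_in: "finite A \<Longrightarrow> x \<in> A \<Longrightarrow> (cyc A ^^ k) x \<in> A"
  by (induction k) (auto intro: cyc_in)

lemma cyc_period:
  assumes "finite A" "x \<in> A"
  shows "\<exists>M. 0 < M \<and> (cyc A ^^ M) x = x \<and> (\<forall>i. 0 < i \<longrightarrow> i < M \<longrightarrow> (cyc A ^^ i) x \<noteq> x) \<and>
    A = (\<lambda>i. (cyc A ^^ i) x) ` {..<M}"
proof -
  have ne: "A \<noteq> {}" using assms by blast
  obtain k where "(cyc A ^^ k) (cyc A x) = x" using cyc(2)[OF assms(1) ne] cyc_in[OF assms] assms by blast
  then have ex: "\<exists>M. 0 < M \<and> (cyc A ^^ M) x = x" by (intro exI[of _ "Suc k"]) (simp add: funpow_swap1)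
  define M where "M = (LEAST M. 0 < M \<and> (cyc A ^^ M) x = x)"
  have M: "0 < M" "(cyc A ^^ M) x = x" using LeastI_ex[OF ex] unfolding M_def by blast+
  have "A \<subseteq> (\<lambda>i. (cyc A ^^ i) x) ` {..<M}"
  proof
    fix y assume "y \<in> A"
    then obtain k where "(cyc A ^^ k) x = y" using cyc(2)[OF assms(1) ne] assms by blast
    then have "y = (cyc A ^^ (k mod M)) x" using funpow_mod_eq[OF M(2)] by simp
    then show "y \<in> (\<lambda>i. (cyc A ^^ i) x) ` {..<M}" using M by auto
  qed
  then show ?thesis
    using cyc_pow_in[OF assms] not_less_Least[of _ "\<lambda>M. 0 < M \<and> (cyc A ^^ M) x = x"] M
    by (intro exI[of _ M]) (auto simp flip: M_def)
qed

text \<open>Euler tours. Every vertex \<open>v\<close> also carries the loop dart \<open>(v, v)\<close>, which represents \<open>v\<close> on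
  the tour; isolated vertices need no special treatment.\<close>

definition nbh :: "('v \<times> 'v) set \<Rightarrow> 'v \<Rightarrow> 'v set" where
  "nbh R v = insert v (R `` {v})"

definition euler :: "('v \<times> 'v) set \<Rightarrow> 'v \<times> 'v \<Rightarrow> 'v \<times> 'v" where
  "euler R e = (snd e, cyc (nbh R (snd e)) (fst e))"

text \<open>Records the vertices whose loop darts are met on a stretch of the tour, which translates
  stretches into vertex sets.\<close>

definition visits :: "('v \<times> 'v) set \<Rightarrow> 'v \<times> 'v \<Rightarrow> 'v set \<Rightarrow> 'v \<times> 'v \<Rightarrow> bool" where
  "visits R a S b \<longleftrightarrow> (\<exists>k. (euler R ^^ k) a = b \<and> S = {x. \<exists>j<k. (euler R ^^ j) a = (x, x)})"

lemma visits_step: "visits R a {x. a = (x, x)} (euler R a)"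
  unfolding visits_def by (rule exI[of _ 1]) auto

lemma visits_trans:
  assumes "visits R a S b" "visits R b T c"
  shows "visits R a (S \<union> T) c"
proof -
  obtain k where k: "(euler R ^^ k) a = b" "S = {x. \<exists>j<k. (euler R ^^ j) a = (x, x)}"
    using assms(1) unfolding visits_def by blast
  obtain l where l: "(euler R ^^ l) b = c" "T = {x. \<exists>j<l. (euler R ^^ j) b = (x, x)}"
    using assms(2) unfolding visits_def by blast
  have ak: "(euler R ^^ (j + k)) a = (euler R ^^ j) b" for j using k(1) by (simp add: funpow_add)
  have "S \<union> T = {x. \<exists>j<l + k. (euler R ^^ j) a = (x, x)}"
  proof (intro set_eqI iffI)
    fix x assume "x \<in> S \<union> T"
    then show "x \<in> {x. \<exists>j<l + k. (euler R ^^ j) a = (x, x)}"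
    proof
      assume "x \<in> T"
      then obtain j where "j < l" "(euler R ^^ j) b = (x, x)" using l by blast
      then show ?thesis using ak[of j] by (intro CollectI exI[of _ "j + k"]) simp
    next
      assume "x \<in> S"
      then obtain j where "j < k" "(euler R ^^ j) a = (x, x)" using k by blast
      then show ?thesis by (intro CollectI exI[of _ j]) simp
    qed
  next
    fix x assume "x \<in> {x. \<exists>j<l + k. (euler R ^^ j) a = (x, x)}"
    then obtain j where j: "j < l + k" "(euler R ^^ j) a = (x, x)" by blast
    show "x \<in> S \<union> T"
    proof (cases "j < k")
      case False
      then have "(euler R ^^ (j - k)) b = (x, x)" "j - k < l" using ak[of "j - k"] j by auto
      then show ?thesis using l by blast
    qed (use j k in blast)
  qed
  then show ?thesis unfolding visits_def using ak[of l] l(1) by blast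
qed

text \<open>One full turn of the rotation at \<open>v\<close>, entered from \<open>c\<close>: each
  other neighbour \<open>s\<close> triggers an excursion into its subtree, which returns by
  \<open>(s, v)\<close>. The case \<open>c = v\<close> is the tour starting at a root.\<close>

lemma visits_around:
  assumes fin: "finite (R `` {v})" and c: "c \<in> nbh R v"
    and sub: "\<And>s. (v, s) \<in> R \<Longrightarrow> s \<noteq> c \<Longrightarrow> s \<noteq> v \<Longrightarrow> visits R (v, s) (side R v s) (s, v)"
  shows "visits R (c, v) ({v} \<union> (\<Union>s\<in>R `` {v} - {c, v}. side R v s)) (v, c)"
proof -
  let ?N = "nbh R v"
  have finN: "finite ?N" using fin by (simp add: nbh_def)
  obtain M where "0 < M \<and> (cyc ?N ^^ M) c = c \<and> (\<forall>i. 0 < i \<longrightarrow> i < M \<longrightarrow> (cyc ?N ^^ i) c \<noteq> c) \<and>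
    ?N = (\<lambda>i. (cyc ?N ^^ i) c) ` {..<M}"
    using cyc_period[OF finN c] ..
  then have M: "0 < M" "(cyc ?N ^^ M) c = c" "\<And>i. 0 < i \<Longrightarrow> i < M \<Longrightarrow> (cyc ?N ^^ i) c \<noteq> c"
    "?N = (\<lambda>i. (cyc ?N ^^ i) c) ` {..<M}" by blast+
  define s where "s i = (cyc ?N ^^ i) c" for i
  \<comment> \<open>\<open>c\<close> contributes nothing unless it is \<open>v\<close>: the turn
    ends as soon as \<open>c\<close> comes up again.\<close>
  define vis where "vis x = (if x = v then {v} else if x = c then {} else side R v x)" for x
  have sN: "s i \<in> ?N" for i using cyc_pow_in[OF finN c] unfolding s_def .
  have walk: "visits R (c, v) (\<Union>i\<le>m. vis (s i)) (v, s (Suc m))" if "m < M" for m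
    using that
  proof (induction m)
    case 0
    have "visits R (c, v) {x. (c, v) = (x, x)} (euler R (c, v))" by (rule visits_step)
    moreover have "{x. (c, v) = (x, x)} = vis (s 0)" by (auto simp: vis_def s_def)
    ultimately show ?case by (simp add: euler_def s_def)
  next
    case (Suc m)
    have "visits R (v, s (Suc m)) (vis (s (Suc m))) (v, s (Suc (Suc m)))"
    proof (cases "s (Suc m) = v")
      case True
      have "visits R (v, v) {x. (v, v) = (x, x)} (euler R (v, v))" by (rule visits_step)
      moreover have "euler R (v, v) = (v, s (Suc (Suc m)))" using True by (simp add: euler_def s_def)
      ultimately show ?thesis using True by (simp add: vis_def)
    next
      case False
      have c: "s (Suc m) \<noteq> c" using M(3)[of "Suc m"] Suc.prems by (simp add: s_def)
      have "(v, s (Suc m)) \<in> R" using sN[of "Suc m"] False by (simp add: nbh_def)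
      then have vs: "visits R (v, s (Suc m)) (side R v (s (Suc m))) (s (Suc m), v)" using sub c False by blast
      have "{x. (s (Suc m), v) = (x, x)} = {}" using False by auto
      with visits_trans[OF vs visits_step]
      have "visits R (v, s (Suc m)) (side R v (s (Suc m))) (euler R (s (Suc m), v))"
        by (simp only: Un_empty_right)
      then show ?thesis using False c by (simp add: vis_def euler_def s_def)
    qed
    from visits_trans[OF Suc.IH this] show ?case using Suc.prems by (simp add: atMost_Suc Un_commute)
  qed
  have "visits R (c, v) (\<Union>i\<le>M - 1. vis (s i)) (v, c)"
    using walk[of "M - 1"] M(1,2) by (simp add: s_def)
  moreover have "(\<Union>i\<le>M - 1. vis (s i)) = (\<Union>x\<in>?N. vis x)"
  proof -
    have "{..M - 1} = {..<M}" using M(1) by auto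
    then have "(\<Union>i\<le>M - 1. vis (s i)) = \<Union> (vis ` (s ` {..<M}))" by (simp add: image_image)
    also have "s ` {..<M} = ?N" using M(4) unfolding s_def by simp
    finally show ?thesis .
  qed
  moreover have "(\<Union>x\<in>?N. vis x) = {v} \<union> (\<Union>s\<in>R `` {v} - {c, v}. side R v s)"
    by (auto simp: nbh_def vis_def split: if_splits)
  ultimately show ?thesis by simp
qed

text \<open>Induction on the size of the subtree, since the excursions in
  \<open>visits_around\<close> lead into strictly smaller ones.\<close>

lemma visits_side:
  assumes F: "forest R" and fin: "finite R" and e: "(u, v) \<in> R"
  shows "visits R (u, v) (side R u v) (v, u)"
  using e
proof (induction "card (side R u v)" arbitrary: u v rule: less_induct)
  case less
  have img: "finite (R `` {x})" for x using fin by (rule finite_Image)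
  have "R \<subseteq> Field R \<times> Field R" by (auto simp: Field_def)
  then have "R - {(u, v), (v, u)} \<subseteq> Field R \<times> Field R" for u v by blast
  moreover have "finite (Field R)" using fin by (rule finite_Field)
  ultimately have fs: "finite (side R u v)" if "(u, v) \<in> R" for u v
    using cmp_subset[of "R - {(u, v), (v, u)}" "Field R" v] that finite_subset unfolding side_def
    by (metis FieldI2)
  have uv: "u \<noteq> v" using less.prems forestD(2)[OF F] by blast
  have "(v, u) \<in> R" using less.prems forestD(1)[OF F] unfolding sym_def by blast
  then have "visits R (u, v) ({v} \<union> (\<Union>s\<in>R `` {v} - {u, v}. side R v s)) (v, u)"
  proof (intro visits_around img)
    show "u \<in> nbh R v" using \<open>(v, u) \<in> R\<close> by (simp add: nbh_def)
    fix s assume s: "(v, s) \<in> R" "s \<noteq> u" "s \<noteq> v"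
    have "side R v s \<subset> side R u v" using side_child_subset[OF F s(1,2)] side_self[of v R u] by blast
    then have "card (side R v s) < card (side R u v)" by (rule psubset_card_mono[OF fs[OF less.prems]])
    then show "visits R (v, s) (side R v s) (s, v)" using less.hyps s(1) by blast
  qed
  moreover have "R `` {v} - {u, v} = R `` {v} - {u}" using forestD(2)[OF F] by blast
  ultimately show ?case using side_split[OF F, of u v] by simp
qed

lemma visits_cmp:
  assumes F: "forest R" and fin: "finite R"
  shows "visits R (v, v) (cmp R v) (v, v)"
proof -
  have "visits R (v, v) ({v} \<union> (\<Union>s\<in>R `` {v} - {v, v}. side R v s)) (v, v)"
    by (rule visits_around) (use fin visits_side[OF F fin] in \<open>auto simp: nbh_def finite_Image\<close>)
  then show ?thesis using side_split[OF F, of v v] side_refl[OF F] by simp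
qed

section \<open>Orbits of an injection on a finite set\<close>

lemma funpow_in: "p ` D \<subseteq> D \<Longrightarrow> e \<in> D \<Longrightarrow> (p ^^ k) e \<in> D"
  by (induction k) auto

lemma inj_on_funpow: "inj_on p D \<Longrightarrow> p ` D \<subseteq> D \<Longrightarrow> inj_on (p ^^ k) D"
proof (induction k)
  case (Suc k)
  have "inj_on (p \<circ> (p ^^ k)) D"
    using Suc funpow_in[OF Suc.prems(2)] by (intro comp_inj_on) (auto intro: inj_on_subset)
  then show ?case by (simp add: comp_def)
qed simp

lemma orbit_period:
  assumes "finite D" "inj_on p D" "p ` D \<subseteq> D" "e \<in> D"
  shows "\<exists>L. 0 < L \<and> L \<le> card D \<and> (p ^^ L) e = e \<and> (\<forall>i. 0 < i \<longrightarrow> i < L \<longrightarrow> (p ^^ i) e \<noteq> e)"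
proof -
  have "(\<lambda>j. (p ^^ j) e) ` {..card D} \<subseteq> D" using funpow_in[OF assms(3,4)] by auto
  then have "card ((\<lambda>j. (p ^^ j) e) ` {..card D}) \<le> card D" using assms(1) by (rule card_mono[rotated])
  then have "\<not> inj_on (\<lambda>j. (p ^^ j) e) {..card D}" using card_image by fastforce
  then obtain i j where ij: "i < j" "j \<le> card D" "(p ^^ i) e = (p ^^ j) e"
    unfolding inj_on_def by (metis atMost_iff linorder_neqE_nat)
  have "(p ^^ i) e = (p ^^ i) ((p ^^ (j - i)) e)"
    using ij by (simp flip: funpow_add comp_apply[of "p ^^ i" "p ^^ (j - i)" e])
  then have "(p ^^ (j - i)) e = e"
    using inj_on_funpow[OF assms(2,3), of i] funpow_in[OF assms(3,4)] assms(4) unfolding inj_on_def by metis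
  then have ex: "\<exists>L. 0 < L \<and> (p ^^ L) e = e" using ij by (intro exI[of _ "j - i"]) simp
  define L where "L = (LEAST L. 0 < L \<and> (p ^^ L) e = e)"
  have "0 < L \<and> (p ^^ L) e = e" unfolding L_def by (rule LeastI_ex[OF ex])
  moreover have "L \<le> j - i" unfolding L_def using ij \<open>(p ^^ (j - i)) e = e\<close> by (intro Least_le) simp
  moreover have "\<forall>i. 0 < i \<longrightarrow> i < L \<longrightarrow> (p ^^ i) e \<noteq> e" using not_less_Least unfolding L_def by blast
  ultimately show ?thesis using ij by (intro exI[of _ L]) auto
qed

lemma orbit_bounded:
  assumes "finite D" "inj_on p D" "p ` D \<subseteq> D" "e \<in> D" "card D \<le> K"
  shows "\<exists>j<K. (p ^^ k) e = (p ^^ j) e"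
proof -
  obtain L where "0 < L" "L \<le> card D" "(p ^^ L) e = e" using orbit_period[OF assms(1-4)] by blast
  then show ?thesis using funpow_mod_eq[of L p e k] assms(5)
    by (intro exI[of _ "k mod L"]) (simp add: less_le_trans[OF mod_less_divisor])
qed

lemma orbit_sym:
  assumes "finite D" "inj_on p D" "p ` D \<subseteq> D" "e \<in> D"
  shows "\<exists>t. (p ^^ t) ((p ^^ k) e) = e"
proof -
  obtain L where L: "0 < L" "(p ^^ L) e = e" using orbit_period[OF assms] by blast
  have "(p ^^ (k * L - k)) ((p ^^ k) e) = (p ^^ (k * L)) e"
  proof -
    have "k * L - k + k = k * L" using L(1) by simp
    moreover have "(p ^^ (k * L - k + k)) e = (p ^^ (k * L - k)) ((p ^^ k) e)" by (simp only: funpow_add comp_apply)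
    ultimately show ?thesis by (simp only:)
  qed
  also have "\<dots> = e" using funpow_mod_eq[OF L(2), of "k * L"] by simp
  finally show ?thesis by blast
qed

text \<open>Opens a cycle just before \<open>h\<close>, turning it into a path from \<open>h\<close>
  on which every element occurs once; operations that are not idempotent need this.\<close>

definition brk :: "('d \<Rightarrow> 'd) \<Rightarrow> 'd \<Rightarrow> 'd \<Rightarrow> 'd option" where
  "brk p h e = (if p e = h then None else Some (p e))"

lemma walk_brk:
  assumes L: "(p ^^ L) h = h" "\<And>i. 0 < i \<Longrightarrow> i < L \<Longrightarrow> (p ^^ i) h \<noteq> h" and i: "i < L"
  shows "walk (brk p h) k ((p ^^ i) h) = (if i + k < L then Some ((p ^^ (i + k)) h) else None)"
proof (induction k)
  case (Suc k)
  show ?case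
  proof (cases "i + k < L")
    case True
    then have "walk (brk p h) (Suc k) ((p ^^ i) h) = brk p h ((p ^^ (i + k)) h)" using Suc by (simp add: walk_Suc)
    moreover have "p ((p ^^ (i + k)) h) = h \<longleftrightarrow> Suc (i + k) = L"
      using L(2)[of "Suc (i + k)"] True L(1) by (cases "Suc (i + k) = L") auto
    ultimately show ?thesis using True unfolding brk_def by (cases "Suc (i + k) = L") simp_all
  qed (use Suc in \<open>simp add: walk_Suc\<close>)
qed (use i in simp)

lemma orbit_distinct:
  assumes L: "(p ^^ L) h = h" "\<And>i. 0 < i \<Longrightarrow> i < L \<Longrightarrow> (p ^^ i) h \<noteq> h"
  shows "inj_on (\<lambda>i. (p ^^ i) h) {..<L}"
proof -
  have "(p ^^ i) h \<noteq> (p ^^ j) h" if "i < j" "j < L" for i j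
  proof
    assume "(p ^^ i) h = (p ^^ j) h"
    then have "(p ^^ (L - j)) ((p ^^ i) h) = (p ^^ (L - j)) ((p ^^ j) h)" by simp
    also have "\<dots> = (p ^^ L) h" using that by (simp flip: funpow_add comp_apply[of "p ^^ (L - j)" "p ^^ j" h])
    finally have c: "(p ^^ (L - j + i)) h = h" using L(1) by (simp add: funpow_add)
    have "0 < L - j + i" "L - j + i < L" using that by linarith+
    from L(2)[OF this] c show False by contradiction
  qed
  then show ?thesis unfolding inj_on_def by (metis lessThan_iff linorder_neqE_nat)
qed

text \<open>Index sets under symmetric difference are vectors over GF(2), so parity sketches fall
  under the aggregation lemmas for commutative monoids.\<close>

interpretation symdiff: comm_monoid_set "sym_diff :: 'k set \<Rightarrow> 'k set \<Rightarrow> 'k set" "{}"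
  by unfold_locales auto

lemma symdiff_mem:
  "finite A \<Longrightarrow> k \<in> symdiff.F g A \<longleftrightarrow> odd (card {a \<in> A. k \<in> g a})"
proof (induction A rule: finite_induct)
  case (insert x A)
  have "{a \<in> insert x A. k \<in> g a} = (if k \<in> g x then insert x {a \<in> A. k \<in> g a} else {a \<in> A. k \<in> g a})" by auto
  then show ?case using insert by auto
qed simp

definition darts :: "'v set \<Rightarrow> ('v \<times> 'v) set \<Rightarrow> ('v \<times> 'v) set" where
  "darts A R = (\<lambda>v. (v, v)) ` A \<union> R"

text \<open>Only the loop dart of a vertex carries its value, so a vertex counts once although the
  tour enters it several times.\<close>

definition loopval :: "('v \<Rightarrow> 'k set) \<Rightarrow> 'v \<times> 'v \<Rightarrow> 'k set" where
  "loopval b e = (if fst e = snd e then b (fst e) else {})"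

context
  fixes A :: "'v set" and R :: "('v \<times> 'v) set"
  assumes A: "finite A" and RA: "R \<subseteq> A \<times> A" and F: "forest R"
begin

lemma finite_forest: "finite R"
  using A RA by (meson finite_SigmaI finite_subset)

lemma finite_darts: "finite (darts A R)"
  using A finite_forest unfolding darts_def by blast

lemma dart_iff: "(x, y) \<in> (darts A R) \<longleftrightarrow> y \<in> A \<and> x \<in> nbh R y"
  using RA forestD(1)[OF F] unfolding darts_def nbh_def sym_def by blast

lemma finite_nbh: "finite (nbh R y)"
  unfolding nbh_def using finite_forest by (simp add: finite_Image)

lemma euler_darts: "euler R ` (darts A R) \<subseteq> (darts A R)"
proof
  fix e assume "e \<in> euler R ` (darts A R)"
  then obtain x y where e: "(x, y) \<in> (darts A R)" "e = euler R (x, y)" by auto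
  then have "cyc (nbh R y) x \<in> nbh R y" using cyc_in[OF finite_nbh] dart_iff by blast
  then have "e = (y, cyc (nbh R y) x)" "y \<in> A" "cyc (nbh R y) x = y \<or> (y, cyc (nbh R y) x) \<in> R"
    using e dart_iff unfolding euler_def nbh_def by auto
  then show "e \<in> (darts A R)" unfolding darts_def by auto
qed

lemma inj_euler: "inj_on (euler R) (darts A R)"
proof (rule inj_onI)
  fix a b assume ab: "a \<in> (darts A R)" "b \<in> (darts A R)" "euler R a = euler R b"
  obtain x y x' y' where xy: "a = (x, y)" "b = (x', y')" by fastforce
  then have y: "y' = y" "cyc (nbh R y) x = cyc (nbh R y) x'" using ab(3) by (auto simp: euler_def)
  have "x \<in> nbh R y" "x' \<in> nbh R y" using ab xy y dart_iff by auto
  then have "x = x'" using y(2) cyc(1)[OF finite_nbh, of y] unfolding bij_betw_def inj_on_def nbh_def by blast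
  then show "a = b" using xy y by simp
qed

text \<open>Consecutive darts stay within one component. Conversely every dart reaches the loop of
  its second vertex, from where \<open>visits_cmp\<close> exhausts the component.\<close>

lemma orbit_loops:
  assumes e: "(u, v) \<in> (darts A R)"
  shows "{x. \<exists>k. (euler R ^^ k) (u, v) = (x, x)} = cmp R v"
proof
  have s: "sym R" using F by (rule forestD)
  have step: "snd (euler R a) \<in> cmp R (snd a)" if a: "a \<in> (darts A R)" for a
  proof -
    have "euler R a \<in> (darts A R)" using euler_darts a by blast
    moreover have "euler R a = (snd a, snd (euler R a))" by (simp add: euler_def)
    ultimately have "(snd a, snd (euler R a)) \<in> (darts A R)" by simp
    then show ?thesis unfolding darts_def cmp_iff by auto
  qed
  have "snd ((euler R ^^ k) (u, v)) \<in> cmp R v" for k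
  proof (induction k)
    case (Suc k)
    have "(euler R ^^ k) (u, v) \<in> (darts A R)" using funpow_in[OF euler_darts e] .
    from step[OF this] Suc show ?case unfolding cmp_iff by (auto intro: rtrancl_trans)
  qed simp
  then have "x \<in> cmp R v" if "(euler R ^^ k) (u, v) = (x, x)" for x k
    using that snd_conv by metis
  then show "{x. \<exists>k. (euler R ^^ k) (u, v) = (x, x)} \<subseteq> cmp R v" by blast
  have vv: "cmp R v \<subseteq> {x. \<exists>k. (euler R ^^ k) (v, v) = (x, x)}"
    using visits_cmp[OF F finite_forest, of v] unfolding visits_def by blast
  have "\<exists>j. (euler R ^^ j) (u, v) = (v, v)"
  proof (cases "u = v")
    case False
    then have "(u, v) \<in> R" using e unfolding darts_def by auto
    then have "visits R (u, v) (side R u v) (v, u)" by (rule visits_side[OF F finite_forest])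
    then show ?thesis using side_self[of v R u] unfolding visits_def by blast
  qed (auto intro: exI[of _ 0])
  then obtain j where "(euler R ^^ j) (u, v) = (v, v)" ..
  then have kj: "(euler R ^^ (k + j)) (u, v) = (euler R ^^ k) (v, v)" for k by (simp add: funpow_add)
  show "cmp R v \<subseteq> {x. \<exists>k. (euler R ^^ k) (u, v) = (x, x)}"
  proof
    fix x assume "x \<in> cmp R v"
    then obtain k where "(euler R ^^ k) (v, v) = (x, x)" using vv by blast
    then have "(euler R ^^ (k + j)) (u, v) = (x, x)" using kj by simp
    then show "x \<in> {x. \<exists>k. (euler R ^^ k) (u, v) = (x, x)}" by blast
  qed
qed

lemma orbit_loops_bounded:
  assumes e: "(u, v) \<in> (darts A R)" and K: "card (darts A R) \<le> K"
  shows "{x. \<exists>k<K. (euler R ^^ k) (u, v) = (x, x)} = cmp R v"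
proof -
  have "(\<exists>k. (euler R ^^ k) (u, v) = (x, x)) \<longleftrightarrow> (\<exists>k<K. (euler R ^^ k) (u, v) = (x, x))" for x
    using orbit_bounded[OF finite_darts inj_euler euler_darts e K] by metis
  then show ?thesis using orbit_loops[OF e] by simp
qed

text \<open>Prefix aggregation along the tour cut open at a vertex \<open>h\<close>: the difference of the values at the
  two darts of a tree edge is the aggregate over one side of that edge.\<close>

context
  fixes h :: 'v and b :: "'v \<Rightarrow> 'k set" and I :: nat
  assumes h: "h \<in> A" and I: "card (darts A R) \<le> 2 ^ I"
begin

abbreviation "suf e \<equiv> dbl_fold sym_diff (brk (euler R) (h, h)) (loopval b) I e"

definition tour_length where
  "tour_length L \<longleftrightarrow> 0 < L \<and>
    (\<forall>i<L. suf ((euler R ^^ i) (h, h)) = symdiff.F (\<lambda>j. (loopval b) ((euler R ^^ j) (h, h))) {i..<L}) \<and>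
    inj_on (\<lambda>i. (euler R ^^ i) (h, h)) {..<L} \<and>
    (\<forall>k. (euler R ^^ k) (h, h) = (euler R ^^ (k mod L)) (h, h))"

lemma tour_lengthD:
  assumes "tour_length L"
  shows "0 < L" "i < L \<Longrightarrow> suf ((euler R ^^ i) (h, h)) = symdiff.F (\<lambda>j. (loopval b) ((euler R ^^ j) (h, h))) {i..<L}"
    "inj_on (\<lambda>i. (euler R ^^ i) (h, h)) {..<L}" "(euler R ^^ k) (h, h) = (euler R ^^ (k mod L)) (h, h)"
  using assms unfolding tour_length_def by blast+

lemma tour: "\<exists>L. tour_length L"
proof -
  let ?e = "\<lambda>i. (euler R ^^ i) (h, h)"
  have hD: "(h, h) \<in> (darts A R)" using h unfolding darts_def by blast
  obtain L where L: "0 < L" "L \<le> card (darts A R)" "?e L = (h, h)" "\<And>i. 0 < i \<Longrightarrow> i < L \<Longrightarrow> ?e i \<noteq> (h, h)"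
    using orbit_period[OF finite_darts inj_euler euler_darts hD] by blast
  have "suf (?e i) = symdiff.F (\<lambda>j. (loopval b) (?e j)) {i..<L}" if i: "i < L" for i
  proof -
    have "suf (?e i) = symdiff.F (\<lambda>k. if i + k < L then (loopval b) (?e (i + k)) else {}) {..<2 ^ I}"
      unfolding symdiff.dbl_fold_walk by (rule symdiff.cong) (simp_all add: walk_brk[OF L(3,4) i])
    also have "\<dots> = symdiff.F (\<lambda>k. (loopval b) (?e (i + k))) {..<L - i}"
      using L(2) I by (intro symdiff.mono_neutral_cong_right) auto
    also have "\<dots> = symdiff.F (\<lambda>j. (loopval b) (?e j)) {i..<L}"
      by (rule symdiff.reindex_bij_witness[of _ "\<lambda>j. j - i" "\<lambda>k. i + k"]) (use i in auto)
    finally show ?thesis .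
  qed
  moreover have "?e k = ?e (k mod L)" for k using funpow_mod_eq[OF L(3)] by simp
  ultimately show ?thesis using L(1) orbit_distinct[OF L(3,4)] unfolding tour_length_def by blast
qed

lemma loopval_sum:
  assumes "inj_on e J" "finite J"
  shows "symdiff.F (\<lambda>j. (loopval b) (e j)) J = symdiff.F b {x. \<exists>j\<in>J. e j = (x, x)}"
proof -
  have "symdiff.F (\<lambda>j. (loopval b) (e j)) J = symdiff.F (\<lambda>j. (loopval b) (e j)) {j \<in> J. fst (e j) = snd (e j)}"
    using assms(2) by (intro symdiff.mono_neutral_right) (auto simp: loopval_def)
  also have "\<dots> = symdiff.F (\<lambda>j. b (fst (e j))) {j \<in> J. fst (e j) = snd (e j)}"
    by (rule symdiff.cong) (auto simp: loopval_def)
  also have "\<dots> = symdiff.F b ((\<lambda>j. fst (e j)) ` {j \<in> J. fst (e j) = snd (e j)})"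
  proof (subst symdiff.reindex)
    show "inj_on (\<lambda>j. fst (e j)) {j \<in> J. fst (e j) = snd (e j)}"
      using assms(1) by (auto simp: inj_on_def prod_eq_iff)
  qed (simp add: comp_def)
  also have "(\<lambda>j. fst (e j)) ` {j \<in> J. fst (e j) = snd (e j)} = {x. \<exists>j\<in>J. e j = (x, x)}"
    by (force simp: image_iff prod_eq_iff)
  finally show ?thesis .
qed

text \<open>The tour is opened at \<open>(h, h)\<close>, so the suffix from there is the whole
  tour.\<close>

lemma suf_head: "suf (h, h) = symdiff.F b (cmp R h)"
proof -
  obtain L where tl: "tour_length L" using tour ..
  note L = tour_lengthD[OF tl]
  have hD: "(h, h) \<in> (darts A R)" using h unfolding darts_def by blast
  have "suf (h, h) = symdiff.F (\<lambda>j. (loopval b) ((euler R ^^ j) (h, h))) {..<L}"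
    using L(2)[of 0] L(1) by (simp add: atLeast0LessThan)
  also have "\<dots> = symdiff.F b {x. \<exists>j\<in>{..<L}. (euler R ^^ j) (h, h) = (x, x)}"
    using L(3) by (intro loopval_sum) auto
  also have "{x. \<exists>j\<in>{..<L}. (euler R ^^ j) (h, h) = (x, x)} = {x. \<exists>k. (euler R ^^ k) (h, h) = (x, x)}"
  proof (intro set_eqI iffI)
    fix x assume "x \<in> {x. \<exists>k. (euler R ^^ k) (h, h) = (x, x)}"
    then obtain k where "(euler R ^^ k) (h, h) = (x, x)" by blast
    then show "x \<in> {x. \<exists>j\<in>{..<L}. (euler R ^^ j) (h, h) = (x, x)}"
      using L(4)[of k] L(1) by (intro CollectI bexI[of _ "k mod L"]) simp_all
  qed blast
  also have "\<dots> = cmp R h" by (rule orbit_loops[OF hD])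
  finally show ?thesis .
qed

text \<open>The subtree beyond \<open>uv\<close> occupies the stretch between \<open>(u, v)\<close>
  and \<open>(v, u)\<close>. If \<open>(u, v)\<close> comes first on the opened tour, the difference
  of the two suffixes is the aggregate of this stretch.\<close>

lemma suf_edge_aux:
  assumes tl: "tour_length L"
    and e: "(u, v) \<in> R" and hu: "u \<in> cmp R h"
    and ij: "i < j" "j < L" "(euler R ^^ i) (h, h) = (u, v)" "(euler R ^^ j) (h, h) = (v, u)"
  shows "sym_diff (suf (u, v)) (suf (v, u)) = symdiff.F b (side R u v)"
proof -
  let ?e = "\<lambda>i. (euler R ^^ i) (h, h)"
  note L = tour_lengthD[OF tl]
  have hD: "(h, h) \<in> (darts A R)" using h unfolding darts_def by blast
  obtain k where k: "(euler R ^^ k) (u, v) = (v, u)" "side R u v = {x. \<exists>j<k. (euler R ^^ j) (u, v) = (x, x)}"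
    using visits_side[OF F finite_forest e] unfolding visits_def by blast
  have sh: "(euler R ^^ t) (u, v) = ?e (i + t)" for t
    using ij(3) by (simp add: funpow_add add.commute[of i t])
  have "u \<in> {x. \<exists>k. (euler R ^^ k) (h, h) = (x, x)}" using orbit_loops[OF hD] hu by simp
  then obtain q' where "?e q' = (u, u)" by blast
  then obtain q where q: "q < L" "?e q = (u, u)" using L(1) L(4)[of q'] mod_less_divisor by metis
  \<comment> \<open>A stretch of length \<open>L\<close> or more would pass the loop of
    \<open>u\<close>, which lies outside the side.\<close>
  have "k < L"
  proof (rule ccontr)
    assume "\<not> k < L"
    define t where "t = (if i \<le> q then q - i else q + L - i)"
    have t: "t < L" "(i + t) mod L = q" using q ij unfolding t_def by (auto split: if_splits)
    then have "?e (i + t) = (u, u)" using L(4)[of "i + t"] q by simp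
    then have "u \<in> side R u v" using k(2) sh[of t] t \<open>\<not> k < L\<close> by auto
    then show False using not_in_side[OF F e] by blast
  qed
  have "?e ((i + k) mod L) = ?e j" using L(4)[of "i + k"] sh[of k] k(1) ij by simp
  then have "(i + k) mod L = j" using L(3) ij L(1) unfolding inj_on_def by auto
  then have ik: "i + k = j" using \<open>k < L\<close> ij
    by (cases "i + k < L") (auto simp: mod_if split: if_splits)
  have "side R u v = {x. \<exists>m\<in>{i..<j}. ?e m = (x, x)}"
  proof (intro set_eqI iffI)
    fix x assume "x \<in> side R u v"
    then obtain t where "t < k" "?e (i + t) = (x, x)" using k(2) sh by auto
    then show "x \<in> {x. \<exists>m\<in>{i..<j}. ?e m = (x, x)}" using ik by (intro CollectI bexI[of _ "i + t"]) auto
  next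
    fix x assume "x \<in> {x. \<exists>m\<in>{i..<j}. ?e m = (x, x)}"
    then obtain m where m: "i \<le> m" "m < j" "?e m = (x, x)" by auto
    then have "(euler R ^^ (m - i)) (u, v) = (x, x)" using sh[of "m - i"] by simp
    then show "x \<in> side R u v" using k(2) m ik by (auto intro!: exI[of _ "m - i"])
  qed
  moreover have "symdiff.F b {x. \<exists>m\<in>{i..<j}. ?e m = (x, x)} = symdiff.F (\<lambda>j. (loopval b) (?e j)) {i..<j}"
    using L(3) ij by (intro loopval_sum[symmetric]) (auto intro: inj_on_subset)
  moreover have "suf (u, v) = sym_diff (symdiff.F (\<lambda>j. (loopval b) (?e j)) {i..<j}) (suf (v, u))"
  proof -
    have "{i..<L} = {i..<j} \<union> {j..<L}" using ij by auto
    then have "suf (?e i) = sym_diff (symdiff.F (\<lambda>j. (loopval b) (?e j)) {i..<j}) (symdiff.F (\<lambda>j. (loopval b) (?e j)) {j..<L})"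
      using L(2)[of i] ij symdiff.union_disjoint[of "{i..<j}" "{j..<L}"] by (simp add: ivl_disj_int)
    then show ?thesis using L(2)[of j] ij by simp
  qed
  ultimately show ?thesis by auto
qed

text \<open>If \<open>(v, u)\<close> comes first, the difference is the aggregate of the opposite
  side. As the total over \<open>A\<close> vanishes, both sides have the same aggregate.\<close>

lemma suf_edge:
  assumes e: "(u, v) \<in> R" and conn: "cmp R h = A" and bA: "symdiff.F b A = {}"
  shows "sym_diff (suf (u, v)) (suf (v, u)) = symdiff.F b (side R u v)"
proof -
  let ?e = "\<lambda>i. (euler R ^^ i) (h, h)"
  obtain L where tl: "tour_length L" using tour ..
  note L = tour_lengthD[OF tl]
  have hD: "(h, h) \<in> (darts A R)" using h unfolding darts_def by blast
  have pos: "\<exists>i<L. ?e i = (x, y)" if "(x, y) \<in> R" for x y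
  proof -
    have xy: "(x, y) \<in> (darts A R)" using that unfolding darts_def by blast
    have yA: "y \<in> A" using that RA by blast
    have "y \<in> {x. \<exists>k. (euler R ^^ k) (x', y) = (x, x)}" if "(x', y) \<in> (darts A R)" for x'
      using orbit_loops[OF that] by simp
    then obtain j where j: "(euler R ^^ j) (x, y) = (y, y)" using xy by blast
    obtain t where t: "(euler R ^^ t) (y, y) = (x, y)"
      using orbit_sym[OF finite_darts inj_euler euler_darts xy, of j] j by auto
    obtain s where "?e s = (y, y)" using orbit_loops[OF hD] conn yA by blast
    then have "?e (t + s) = (x, y)" using t by (simp add: funpow_add)
    then show ?thesis using L(1,4) by (metis mod_less_divisor)
  qed
  have e': "(v, u) \<in> R" using e forestD(1)[OF F] unfolding sym_def by blast
  have uA: "u \<in> A" "v \<in> A" using e RA by auto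
  obtain i j where i: "i < L" "?e i = (u, v)" and j: "j < L" "?e j = (v, u)" using pos[OF e] pos[OF e'] by blast
  have uv: "u \<noteq> v" using e forestD(2)[OF F] by blast
  then have "i \<noteq> j" using i j by auto
  then consider "i < j" | "j < i" by linarith
  then show ?thesis
  proof cases
    case 1
    then show ?thesis using suf_edge_aux[OF tl e _ 1 j(1) i(2) j(2)] conn uA by blast
  next
    case 2
    have "sym_diff (suf (v, u)) (suf (u, v)) = symdiff.F b (side R v u)"
      using suf_edge_aux[OF tl e' _ 2 i(1) j(2) i(2)] conn uA by blast
    moreover have A_eq: "A = side R u v \<union> side R v u" "side R u v \<inter> side R v u = {}"
      using side_Un[OF F e] cmp_eq[OF forestD(1)[OF F], of h u] conn uA by (auto simp: cmp_iff[symmetric])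
    moreover have "sym_diff (symdiff.F b (side R u v)) (symdiff.F b (side R v u)) = {}"
    proof -
      have "finite (side R u v)" "finite (side R v u)" using A A_eq(1) by (metis finite_Un)+
      then show ?thesis using symdiff.union_disjoint[OF _ _ A_eq(2), of b] A_eq(1) bA by simp
    qed
    ultimately show ?thesis by fast
  qed
qed

end

end

section \<open>Tours of oriented forests in the network\<close>

context big_network
begin

text \<open>Forests are stored through an orientation \<open>Q\<close> of bounded outdegree; the tail of an edge hosts
  both of its darts. This keeps the global communication within the capacity although degrees in
  the forest are unbounded.\<close>

definition fr :: "(inst \<Rightarrow> (nat \<times> nat) set) \<Rightarrow> inst \<Rightarrow> (nat \<times> nat) set" where
  "fr Q z = Q z \<union> (Q z)\<inverse>"

text \<open>Both endpoints may have selected the same edge; the smaller one then hosts both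
  darts.\<close>

definition owner :: "(inst \<Rightarrow> (nat \<times> nat) set) \<Rightarrow> inst \<Rightarrow> dart \<Rightarrow> nat" where
  "owner Q z e = (if (fst e, snd e) \<in> Q z \<and> (snd e, fst e) \<in> Q z then min (fst e) (snd e)
     else if (snd e, fst e) \<in> Q z then snd e else fst e)"

text \<open>\<open>lg\<close> is the number of Boruvka phases, each of which adds at most one
  outgoing edge per vertex.\<close>

definition oriented :: "(inst \<Rightarrow> (nat \<times> nat) set) \<Rightarrow> bool" where
  "oriented Q \<longleftrightarrow> (\<forall>z. ok z \<longrightarrow> forest (fr Q z) \<and> (\<forall>u v. (u, v) \<in> Q z \<longrightarrow> 0 < wt z u v) \<and>
     (\<forall>v<n. card (Q z `` {v}) \<le> lg))"

text \<open>Incoming edges are included although their number is unbounded: they are learnt over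
  edges of the graph, where no capacity applies.\<close>

definition links :: "(inst \<Rightarrow> (nat \<times> nat) set) \<Rightarrow> inst \<Rightarrow> nat \<Rightarrow> nat set \<times> nat set" where
  "links Q z v = (Q z `` {v}, (Q z)\<inverse> `` {v})"

definition tdarts :: "(inst \<Rightarrow> (nat \<times> nat) set) \<Rightarrow> inst \<Rightarrow> dart set" where
  "tdarts Q z = darts {..<n} (fr Q z)"

lemma wt_lt: "ok z \<Longrightarrow> 0 < wt z u v \<Longrightarrow> u < n \<and> v < n"
  unfolding ok_def weighted_graph_def by (metis not_le less_irrefl)

lemma wt_sym: "ok z \<Longrightarrow> wt z u v = wt z v u"
  unfolding ok_def weighted_graph_def by blast

context
  fixes Q :: "inst \<Rightarrow> (nat \<times> nat) set"
  assumes Q: "oriented Q"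
begin

lemma fr_props:
  assumes "ok z"
  shows "forest (fr Q z)" "fr Q z \<subseteq> {..<n} \<times> {..<n}" "(u, v) \<in> fr Q z \<Longrightarrow> 0 < wt z u v"
proof -
  show "forest (fr Q z)" using Q assms unfolding oriented_def by blast
  show w: "0 < wt z u v" if "(u, v) \<in> fr Q z" for u v
  proof -
    have "(u, v) \<in> Q z \<or> (v, u) \<in> Q z" using that unfolding fr_def by blast
    then show ?thesis using Q assms wt_sym[OF assms, of v u] unfolding oriented_def by metis
  qed
  show "fr Q z \<subseteq> {..<n} \<times> {..<n}" using w wt_lt[OF assms] by auto
qed

lemma tdarts_iff: "(x, y) \<in> tdarts Q z \<longleftrightarrow> x < n \<and> x = y \<or> (x, y) \<in> fr Q z"
  unfolding tdarts_def darts_def by auto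

lemma owner_in: "ok z \<Longrightarrow> e \<in> tdarts Q z \<Longrightarrow> owner Q z e < n"
  using fr_props(2)[of z] by (cases e) (auto simp: owner_def tdarts_iff min_def)

lemma owner_swap: "(x, y) \<in> fr Q z \<Longrightarrow> owner Q z (y, x) = owner Q z (x, y)"
  unfolding owner_def fr_def by (auto simp: min_def)

lemma owner_end: "owner Q z (x, y) = x \<or> owner Q z (x, y) = y"
  unfolding owner_def by (auto simp: min_def)

text \<open>A node hosts at most its own loop and both darts of each outgoing edge, so
  \<open>1 + 2 * lg\<close> darts.\<close>

lemma hosting_tour: "hosting (tdarts Q) (owner Q)"
  unfolding hosting_def
proof (intro allI impI conjI ballI)
  fix z assume z: "ok z"
  show "tdarts Q z \<subseteq> {..<n} \<times> {..<n}" using fr_props(2)[OF z] by (auto simp: tdarts_iff)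
  show "owner Q z e < n" if "e \<in> tdarts Q z" for e using owner_in[OF z that] .
  fix v assume v: "v < n"
  let ?N = "Q z `` {v}"
  have "Q z \<subseteq> {..<n} \<times> {..<n}" using fr_props(2)[OF z] unfolding fr_def by blast
  then have fin: "finite ?N" by (meson finite_Image finite_SigmaI finite_lessThan finite_subset)
  have "{e \<in> tdarts Q z. owner Q z e = v} \<subseteq> {(v, v)} \<union> Pair v ` ?N \<union> (\<lambda>y. (y, v)) ` ?N"
  proof
    fix e assume "e \<in> {e \<in> tdarts Q z. owner Q z e = v}"
    then obtain x y where e: "e = (x, y)" "(x, y) \<in> tdarts Q z" "owner Q z (x, y) = v" by (cases e) auto
    show "e \<in> {(v, v)} \<union> Pair v ` ?N \<union> (\<lambda>y. (y, v)) ` ?N"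
    proof (cases "x = y")
      case False
      then have "(x, y) \<in> Q z \<or> (y, x) \<in> Q z" using e(2) by (auto simp: tdarts_iff fr_def)
      then have "(x = v \<and> (v, y) \<in> Q z) \<or> (y = v \<and> (v, x) \<in> Q z)"
        using e(3) unfolding owner_def by (auto simp: min_def split: if_splits)
      then show ?thesis using e(1) by auto
    qed (use e owner_end[of z x y] in auto)
  qed
  then have "card {e \<in> tdarts Q z. owner Q z e = v} \<le> card ({(v, v)} \<union> Pair v ` ?N \<union> (\<lambda>y. (y, v)) ` ?N)"
    using fin by (intro card_mono) auto
  also have "\<dots> \<le> card ({(v, v)} \<union> Pair v ` ?N) + card ((\<lambda>y. (y, v)) ` ?N)" by (rule card_Un_le)
  also have "\<dots> \<le> (card {(v, v)} + card (Pair v ` ?N)) + card ((\<lambda>y. (y, v)) ` ?N)"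
    by (intro add_right_mono card_Un_le)
  also have "\<dots> \<le> 1 + card ?N + card ?N" using fin by (intro add_mono card_image_le) auto
  also have "\<dots> \<le> 4 * lg" using Q z v lg_pos unfolding oriented_def by fastforce
  also have "\<dots> \<le> ncc_cap \<kappa> n" by (rule cap)
  finally show "card {e \<in> tdarts Q z. owner Q z e = v} \<le> ncc_cap \<kappa> n" .
qed

lemma nbh_links: "nbh (fr Q z) v = insert v (fst (links Q z v) \<union> snd (links Q z v))"
  unfolding nbh_def fr_def links_def by auto

lemma owner_links: "owner Q z (v, s) = (if s \<in> fst (links Q z v) \<and> s \<in> snd (links Q z v) then min v s
    else if s \<in> snd (links Q z v) then s else v)"
  unfolding owner_def links_def by auto

lemma euler_tdarts: "ok z \<Longrightarrow> e \<in> tdarts Q z \<Longrightarrow> euler (fr Q z) e \<in> tdarts Q z"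
  using euler_darts[OF finite_lessThan fr_props(2,1)] unfolding tdarts_def by blast

text \<open>The successor of \<open>(x, y)\<close> and its host depend only on the links of
  \<open>y\<close>. The dart itself is hosted by \<open>x\<close> or \<open>y\<close>; in case it is
  \<open>x\<close>, the vertex \<open>y\<close> sends the information over the graph edge. One local
  round thus suffices whatever the degrees.\<close>

lemma known_euler:
  assumes X: "known R X" and L: "det X (links Q)"
  shows "known (Suc R) (\<lambda>z v. (X z v, hosted (tdarts Q) (owner Q)
     (\<lambda>z e. (euler (fr Q z) e, owner Q z (euler (fr Q z) e))) z v))"
proof -
  define SL where "SL z y x = (if x \<in> nbh (fr Q z) y then (snd (euler (fr Q z) (x, y)), owner Q z (euler (fr Q z) (x, y)))
      else (0, 0))" for z y x
  have SL_links: "SL z y x = SL z' y x" if "links Q z y = links Q z' y" for z z' y x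
    using that unfolding SL_def euler_def fst_conv snd_conv nbh_links owner_links by simp
  have K: "known (Suc R) (\<lambda>z v. (X z v, \<lambda>u. if u < n \<and> 0 < wt z v u then Some (SL z u v) else None))"
    using X
  proof (rule known_local[where LM = "{..<n} \<times> {..<n}"])
    show "det X SL" using L by (rule det_via) (use SL_links in blast)
    have "n * n \<le> n ^ 4" using n2 power_increasing[of 2 4 n] by (simp add: power2_eq_square)
    then show "card ({..<n} \<times> {..<n}) \<le> msg_bound \<kappa> n" using msg4 by (simp add: card_cartesian_product)
    fix z v u assume z: "ok z" and v: "v < n" "u < n"
    show "SL z v u \<in> {..<n} \<times> {..<n}"
    proof (cases "u \<in> nbh (fr Q z) v")
      case True
      then have "(u, v) \<in> tdarts Q z" using v forestD(1)[OF fr_props(1)[OF z]]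
        by (auto simp: tdarts_iff nbh_def sym_def)
      from euler_tdarts[OF z this] have e: "euler (fr Q z) (u, v) \<in> tdarts Q z" .
      moreover have "tdarts Q z \<subseteq> {..<n} \<times> {..<n}" using hostingD(1)[OF hosting_tour z] .
      ultimately show ?thesis using True owner_in[OF z e] by (auto simp: SL_def)
    qed (use n2 in \<open>simp add: SL_def\<close>)
  qed simp
  let ?Y = "\<lambda>z v. (X z v, \<lambda>u. if u < n \<and> 0 < wt z v u then Some (SL z u v) else None)"
  let ?f = "\<lambda>z e. (euler (fr Q z) e, owner Q z (euler (fr Q z) e))"
  have sub: "hosted (tdarts Q) (owner Q) ?f z v \<subseteq> hosted (tdarts Q) (owner Q) ?f z' v"
    if a: "ok z" "ok z'" "v < n" "?Y z v = ?Y z' v" "links Q z v = links Q z' v" for z z' v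
  proof
    fix p assume p: "p \<in> hosted (tdarts Q) (owner Q) ?f z v"
    obtain x y q where pq: "p = ((x, y), q)" by (cases p) auto
    then have e: "(x, y) \<in> tdarts Q z" "owner Q z (x, y) = v" "q = ?f z (x, y)" using p by (simp_all add: hosted_iff)
    have fr_v: "(v, t) \<in> fr Q z \<longleftrightarrow> (v, t) \<in> fr Q z'" "(t, v) \<in> fr Q z \<longleftrightarrow> (t, v) \<in> fr Q z'" for t
      using a(5) unfolding links_def fr_def by auto
    have own: "owner Q z (v, t) = owner Q z' (v, t)" "owner Q z (t, v) = owner Q z' (t, v)" for t
    proof -
      show "owner Q z (v, t) = owner Q z' (v, t)" unfolding owner_links a(5) ..
      show "owner Q z (t, v) = owner Q z' (t, v)" using a(5) unfolding owner_def links_def by auto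
    qed
    have e': "(x, y) \<in> tdarts Q z'" "owner Q z' (x, y) = v"
      using e owner_end[of z x y] fr_v own by (auto simp: tdarts_iff)
    have fst_eu: "?f w (x, y) = ((y, fst (SL w y x)), snd (SL w y x))" if "(x, y) \<in> tdarts Q w" "ok w" for w
    proof -
      have "x \<in> nbh (fr Q w) y" using that forestD(1)[OF fr_props(1)[OF that(2)]]
        by (auto simp: tdarts_iff nbh_def sym_def)
      then show ?thesis by (simp add: SL_def euler_def)
    qed
    have "SL z y x = SL z' y x"
    proof (cases "y = v")
      case True
      then show ?thesis using SL_links[of z y z' x] a(5) by simp
    next
      case False
      then have xv: "x = v" using e(2) owner_end[of z x y] by auto
      then have "(x, y) \<in> fr Q z" using e(1) False by (auto simp: tdarts_iff)
      then have "0 < wt z v y" "y < n" using fr_props[OF a(1)] xv by auto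
      moreover have "(if y < n \<and> 0 < wt z v y then Some (SL z y v) else None)
         = (if y < n \<and> 0 < wt z' v y then Some (SL z' y v) else None)"
        using a(4) by (simp add: fun_eq_iff)
      ultimately show ?thesis using xv by (auto split: if_splits)
    qed
    then have "q = ?f z' (x, y)" by (simp only: e(3) fst_eu[OF e(1) a(1)] fst_eu[OF e'(1) a(2)])
    then show "p \<in> hosted (tdarts Q) (owner Q) ?f z' v" using e' pq by (simp add: hosted_iff)
  qed
  show ?thesis
  proof (rule known_via[OF K])
    fix z z' :: inst and v
    assume a: "ok z" "ok z'" "v < n" "wt z v = wt z' v" "rn z v = rn z' v" "?Y z v = ?Y z' v"
    then have "links Q z v = links Q z' v" by (intro detD[OF L]) auto
    then show "(X z v, hosted (tdarts Q) (owner Q) ?f z v) = (X z' v, hosted (tdarts Q) (owner Q) ?f z' v)"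
      using sub[of z z' v] sub[of z' z v] a by auto
  qed
qed

end

lemma card_tdarts: "oriented Q \<Longrightarrow> ok z \<Longrightarrow> card (tdarts Q z) \<le> 2 ^ (2 * lg)"
proof -
  assume "oriented Q" "ok z"
  then have "tdarts Q z \<subseteq> {..<n} \<times> {..<n}" using hostingD(1)[OF hosting_tour] by blast
  then have "card (tdarts Q z) \<le> card ({..<n} \<times> {..<n})" by (intro card_mono) auto
  then show ?thesis using pow_2lg by (simp add: power2_eq_square)
qed

definition cmin :: "(inst \<Rightarrow> (nat \<times> nat) set) \<Rightarrow> (inst \<Rightarrow> nat \<Rightarrow> enat) \<Rightarrow> inst \<Rightarrow> nat \<Rightarrow> enat" where
  "cmin Q f z v = (INF x\<in>cmp (fr Q z) v. f z x)"

text \<open>The doubling goes around the whole tour of the component, non-loop darts carrying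
  \<open>\<infinity>\<close>. Successors and their hosts are kept in the result because the opened
  tours need them again.\<close>

lemma known_tour_min:
  fixes f :: "inst \<Rightarrow> nat \<Rightarrow> enat"
  assumes X: "known R X" and Q: "oriented Q" and L: "det X (links Q)" and f: "det X f"
    and M: "finite M" "n ^ 6 * (card M + 1) \<le> msg_bound \<kappa> n" "\<And>z v. ok z \<Longrightarrow> v < n \<Longrightarrow> f z v \<in> M"
  shows "known (R + 1 + 4 * lg) (\<lambda>z v. (X z v, hosted (tdarts Q) (owner Q)
     (\<lambda>z e. (euler (fr Q z) e, owner Q z (euler (fr Q z) e), cmin Q f z (snd e))) z v))"
proof -
  let ?h = "hosted (tdarts Q) (owner Q)"
  let ?g = "\<lambda>z e. (euler (fr Q z) e, owner Q z (euler (fr Q z) e))"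
  let ?f = "\<lambda>z e. if fst e = snd e then f z (fst e) else \<infinity>"
  have props: "finite {..<n}" "fr Q z \<subseteq> {..<n} \<times> {..<n}" "forest (fr Q z)" if "ok z" for z
    using fr_props[OF Q that] by auto
  have pin: "partial_inj (tdarts Q z) (\<lambda>e. Some (euler (fr Q z) e))" if z: "ok z" for z
    unfolding partial_inj_def
  proof (intro conjI allI impI)
    fix e e' assume "e \<in> tdarts Q z" and "Some (euler (fr Q z) e) = Some e'"
    then show "e' \<in> tdarts Q z" using euler_tdarts[OF Q z, of e] by simp
  next
    fix e1 e2 e' assume "e1 \<in> tdarts Q z" "e2 \<in> tdarts Q z" "Some (euler (fr Q z) e1) = Some e'" "Some (euler (fr Q z) e2) = Some e'"
    then show "e1 = e2" using inj_onD[OF inj_euler[OF props[OF z]], of e1 e2] by (simp add: tdarts_def)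
  qed
  have mem: "dbl_fold inf (\<lambda>e. Some (euler (fr Q z) e)) (?f z) i e \<in> insert \<infinity> M" if "ok z" "e \<in> tdarts Q z" for z i e
  proof (rule dbl_fold_mem[OF pin[OF that(1)]])
    show "e \<in> tdarts Q z" by fact
    fix e assume "e \<in> tdarts Q z"
    then show "?f z e \<in> insert \<infinity> M" using M(3)[OF that(1), of "fst e"] hostingD(1)[OF hosting_tour[OF Q] that(1)] by auto
  qed (auto simp: inf_min min_def)
  have det1: "det (\<lambda>z v. (X z v, ?h ?g z v)) (?h (\<lambda>z e. (Some (euler (fr Q z) e), map_option (owner Q z) (Some (euler (fr Q z) e)), ?f z e)))"
  proof (rule detI)
    fix z z' :: inst and v
    assume a: "ok z" "ok z'" "v < n" "wt z v = wt z' v" "rn z v = rn z' v" "(X z v, ?h ?g z v) = (X z' v, ?h ?g z' v)"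
    then have fv: "f z v = f z' v" by (intro detD[OF f]) auto
    have H: "?h ?g z v = ?h ?g z' v" using a(6) by simp
    have img: "?h (\<lambda>z e. (Some (euler (fr Q z) e), map_option (owner Q z) (Some (euler (fr Q z) e)), ?f z e)) w v
       = (\<lambda>(e, g). (e, (Some (fst g), Some (snd g), if fst e = snd e then f w v else \<infinity>))) ` ?h ?g w v" for w
    proof -
      have fe: "fst e = v" if "fst e = snd e" "owner Q w e = v" for e using that by (simp add: owner_def split: if_splits)
      show ?thesis unfolding hosted_def image_image prod.case
      proof (rule image_cong[OF refl])
        fix e assume "e \<in> {e \<in> tdarts Q w. owner Q w e = v}"
        then show "(e, Some (euler (fr Q w) e), map_option (owner Q w) (Some (euler (fr Q w) e)), ?f w e) =
          (e, Some (fst (?g w e)), Some (snd (?g w e)), if fst e = snd e then f w v else \<infinity>)"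
          using fe[of e] by (cases "fst e = snd e") simp_all
      qed
    qed
    show "?h (\<lambda>z e. (Some (euler (fr Q z) e), map_option (owner Q z) (Some (euler (fr Q z) e)), ?f z e)) z v
       = ?h (\<lambda>z e. (Some (euler (fr Q z) e), map_option (owner Q z) (Some (euler (fr Q z) e)), ?f z e)) z' v"
      by (simp only: img H fv)
  qed
  have "known (Suc R + 2 * (2 * lg)) (\<lambda>z v. ((X z v, ?h ?g z v),
      ?h (\<lambda>z e. dbl_fold inf (\<lambda>e. Some (euler (fr Q z) e)) (?f z) (2 * lg) e) z v))"
    using known_euler[OF Q X L] det1 hosting_tour[OF Q] pin
  proof (rule known_double[where M = "insert \<infinity> M"])
    show "n ^ 6 * card (insert \<infinity> M) \<le> msg_bound \<kappa> n"
    proof -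
      have "card (insert \<infinity> M) \<le> card M + 1" using M(1) by (simp add: card_insert_if)
      then show ?thesis using M(2) by (meson le_trans mult_le_mono2)
    qed
  qed (use M msg4 mem in auto)
  moreover have "dbl_fold inf (\<lambda>e. Some (euler (fr Q z) e)) (?f z) (2 * lg) e = cmin Q f z (snd e)"
    if z: "ok z" and e: "e \<in> tdarts Q z" for z e
  proof -
    obtain u v where uv: "e = (u, v)" by (cases e)
    let ?p = "\<lambda>k. (euler (fr Q z) ^^ k) (u, v)"
    have cm: "{x. \<exists>k<2 ^ (2 * lg). ?p k = (x, x)} = cmp (fr Q z) v"
      using orbit_loops_bounded[OF props[OF z], of u v "2 ^ (2 * lg)"] e uv card_tdarts[OF Q z] unfolding tdarts_def by simp
    have "(INF k\<in>{..<2 ^ (2 * lg)}. ?f z (?p k)) = (INF x\<in>cmp (fr Q z) v. f z x)"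
    proof (rule antisym)
      show "(INF k\<in>{..<2 ^ (2 * lg)}. ?f z (?p k)) \<le> (INF x\<in>cmp (fr Q z) v. f z x)"
      proof (rule INF_greatest)
        fix x assume "x \<in> cmp (fr Q z) v"
        then obtain k where "k < 2 ^ (2 * lg)" "?p k = (x, x)" using cm by blast
        then show "(INF k\<in>{..<2 ^ (2 * lg)}. ?f z (?p k)) \<le> f z x" by (intro INF_lower2[of k]) auto
      qed
      show "(INF x\<in>cmp (fr Q z) v. f z x) \<le> (INF k\<in>{..<2 ^ (2 * lg)}. ?f z (?p k))"
      proof (rule INF_greatest)
        fix k :: nat assume k: "k \<in> {..<2 ^ (2 * lg)}"
        show "(INF x\<in>cmp (fr Q z) v. f z x) \<le> ?f z (?p k)"
        proof (cases "fst (?p k) = snd (?p k)")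
          case True
          then have "?p k = (fst (?p k), fst (?p k))" by (simp add: prod_eq_iff)
          then have "fst (?p k) \<in> cmp (fr Q z) v" using cm k by blast
          then show ?thesis using True by (simp add: INF_lower)
        qed simp
      qed
    qed
    then show ?thesis unfolding uv dbl_fold_inf cmin_def snd_conv .
  qed
  ultimately have k: "known (Suc R + 2 * (2 * lg)) (\<lambda>z v. ((X z v, ?h ?g z v),
      ?h (\<lambda>z e. dbl_fold inf (\<lambda>e. Some (euler (fr Q z) e)) (?f z) (2 * lg) e) z v))"
    and v: "\<And>z e. ok z \<Longrightarrow> e \<in> tdarts Q z \<Longrightarrow> dbl_fold inf (\<lambda>e. Some (euler (fr Q z) e)) (?f z) (2 * lg) e = cmin Q f z (snd e)"
    by blast+
  have "Suc R + 2 * (2 * lg) = R + 1 + 4 * lg" by simp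
  with k have k: "known (R + 1 + 4 * lg) (\<lambda>z v. ((X z v, ?h ?g z v),
      ?h (\<lambda>z e. dbl_fold inf (\<lambda>e. Some (euler (fr Q z) e)) (?f z) (2 * lg) e) z v))" by simp
  show ?thesis
  proof (rule known_via[OF k])
    fix z z' :: inst and v
    assume a: "ok z" "ok z'" "v < n" and e: "((X z v, ?h ?g z v), ?h (\<lambda>z e. dbl_fold inf (\<lambda>e. Some (euler (fr Q z) e)) (?f z) (2 * lg) e) z v)
      = ((X z' v, ?h ?g z' v), ?h (\<lambda>z e. dbl_fold inf (\<lambda>e. Some (euler (fr Q z) e)) (?f z) (2 * lg) e) z' v)"
    have "?h (\<lambda>z e. (euler (fr Q z) e, owner Q z (euler (fr Q z) e), cmin Q f z (snd e))) w v =
       {(e, (fst g, snd g, x)) | e g x. (e, g) \<in> ?h ?g w v \<and> (e, x) \<in> ?h (\<lambda>z e. dbl_fold inf (\<lambda>e. Some (euler (fr Q z) e)) (?f z) (2 * lg) e) w v}"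
      if w: "ok w" for w
    proof (intro set_eqI iffI)
      fix p assume "p \<in> ?h (\<lambda>z e. (euler (fr Q z) e, owner Q z (euler (fr Q z) e), cmin Q f z (snd e))) w v"
      then obtain e where e: "e \<in> tdarts Q w" "owner Q w e = v" "p = (e, (euler (fr Q w) e, owner Q w (euler (fr Q w) e), cmin Q f w (snd e)))"
        unfolding hosted_def by blast
      have "(e, ?g w e) \<in> ?h ?g w v" "(e, cmin Q f w (snd e)) \<in> ?h (\<lambda>z e. dbl_fold inf (\<lambda>e. Some (euler (fr Q z) e)) (?f z) (2 * lg) e) w v"
        using e v[OF w] by (simp_all add: hosted_iff)
      then show "p \<in> {(e, (fst g, snd g, x)) | e g x. (e, g) \<in> ?h ?g w v \<and> (e, x) \<in> ?h (\<lambda>z e. dbl_fold inf (\<lambda>e. Some (euler (fr Q z) e)) (?f z) (2 * lg) e) w v}"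
        unfolding e(3) by force
    next
      fix p assume "p \<in> {(e, (fst g, snd g, x)) | e g x. (e, g) \<in> ?h ?g w v \<and> (e, x) \<in> ?h (\<lambda>z e. dbl_fold inf (\<lambda>e. Some (euler (fr Q z) e)) (?f z) (2 * lg) e) w v}"
      then obtain e g x where e: "p = (e, (fst g, snd g, x))" "(e, g) \<in> ?h ?g w v"
         "(e, x) \<in> ?h (\<lambda>z e. dbl_fold inf (\<lambda>e. Some (euler (fr Q z) e)) (?f z) (2 * lg) e) w v" by blast
      then show "p \<in> ?h (\<lambda>z e. (euler (fr Q z) e, owner Q z (euler (fr Q z) e), cmin Q f z (snd e))) w v"
        using v[OF w] by (simp add: hosted_iff)
    qed
    then show "(X z v, ?h (\<lambda>z e. (euler (fr Q z) e, owner Q z (euler (fr Q z) e), cmin Q f z (snd e))) z v)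
      = (X z' v, ?h (\<lambda>z e. (euler (fr Q z) e, owner Q z (euler (fr Q z) e), cmin Q f z (snd e))) z' v)"
      using e a by simp
  qed
qed

text \<open>The loop of \<open>v\<close> is hosted by \<open>v\<close> itself, which thereby learns
  the minimum.\<close>

lemma known_cmin:
  fixes f :: "inst \<Rightarrow> nat \<Rightarrow> enat"
  assumes X: "known R X" and Q: "oriented Q" and L: "det X (links Q)" and f: "det X f"
    and M: "finite M" "n ^ 6 * (card M + 1) \<le> msg_bound \<kappa> n" "\<And>z v. ok z \<Longrightarrow> v < n \<Longrightarrow> f z v \<in> M"
  shows "known (R + 1 + 4 * lg) (\<lambda>z v. (X z v, cmin Q f z v))"
proof (rule known_via[OF known_tour_min[OF assms]])
  let ?H = "hosted (tdarts Q) (owner Q) (\<lambda>z e. (euler (fr Q z) e, owner Q z (euler (fr Q z) e), cmin Q f z (snd e)))"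
  fix z z' :: inst and v
  assume a: "v < n" "(X z v, ?H z v) = (X z' v, ?H z' v)"
  have "((v, v), (euler (fr Q z) (v, v), owner Q z (euler (fr Q z) (v, v)), cmin Q f z v)) \<in> ?H z v"
    using a(1) owner_end[OF Q, of z v v] by (simp add: hosted_iff tdarts_iff[OF Q])
  moreover have "?H z v = ?H z' v" using a(2) by blast
  ultimately have "((v, v), (euler (fr Q z) (v, v), owner Q z (euler (fr Q z) (v, v)), cmin Q f z v)) \<in> ?H z' v"
    by (simp only:)
  then have "cmin Q f z v = cmin Q f z' v" by (simp add: hosted_iff)
  then show "(X z v, cmin Q f z v) = (X z' v, cmin Q f z' v)" using a by simp
qed

end

section \<open>Selecting a candidate cut of a forest\<close>

lemma walk_cong:
  assumes "e \<in> D" "\<And>a. a \<in> D \<Longrightarrow> nx a = nx' a" "\<And>a a'. a \<in> D \<Longrightarrow> nx a = Some a' \<Longrightarrow> a' \<in> D"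
  shows "walk nx k e = walk nx' k e \<and> (\<forall>a. walk nx k e = Some a \<longrightarrow> a \<in> D)"
proof (induction k)
  case (Suc k)
  show ?case
  proof (cases "walk nx k e")
    case (Some a)
    then have "walk nx' k e = Some a" "a \<in> D" using Suc by auto
    then show ?thesis using Some assms(2)[of a] assms(3)[of a] by (auto simp: walk_Suc)
  qed (use Suc in \<open>simp add: walk_Suc\<close>)
qed (use assms(1) in simp)

lemma (in comm_monoid_set) dbl_fold_cong:
  assumes "e \<in> D" "\<And>a. a \<in> D \<Longrightarrow> nx a = nx' a" "\<And>a a'. a \<in> D \<Longrightarrow> nx a = Some a' \<Longrightarrow> a' \<in> D"
  shows "dbl_fold f nx g i e = dbl_fold f nx' g i e"
proof -
  have "walk nx k e = walk nx' k e" for k using walk_cong[of e D nx nx' k] assms by blast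
  then show ?thesis unfolding dbl_fold_walk by simp
qed

context big_network
begin

definition head :: "(inst \<Rightarrow> (nat \<times> nat) set) \<Rightarrow> inst \<Rightarrow> nat \<Rightarrow> nat" where
  "head Q z v = (LEAST x. x \<in> cmp (fr Q z) v)"

text \<open>Every tour is opened at the loop of the least vertex of its component, found from the
  current dart, so one doubling serves all components simultaneously.\<close>

definition sufd :: "(inst \<Rightarrow> (nat \<times> nat) set) \<Rightarrow> (inst \<Rightarrow> nat \<Rightarrow> nat set) \<Rightarrow> inst \<Rightarrow> dart \<Rightarrow> nat set" where
  "sufd Q b z e = dbl_fold sym_diff (\<lambda>e. brk (euler (fr Q z)) (head Q z (snd e), head Q z (snd e)) e)
      (loopval (b z)) (2 * lg) e"

lemma cmin_id: "cmin Q (\<lambda>z v. enat v) z v = enat (head Q z v)"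
  unfolding cmin_def head_def
  by (intro antisym INF_lower INF_greatest) (auto intro: LeastI Least_le cmp_self)

context
  fixes Q :: "inst \<Rightarrow> (nat \<times> nat) set"
  assumes Q: "oriented Q"
begin

lemma head_in: "head Q z v \<in> cmp (fr Q z) v"
  unfolding head_def by (rule LeastI[of _ v]) simp

lemma cmp_sub: "ok z \<Longrightarrow> v < n \<Longrightarrow> cmp (fr Q z) v \<subseteq> {..<n}"
  using cmp_subset[OF fr_props(2)[OF Q]] by blast

lemma head_lt: "ok z \<Longrightarrow> v < n \<Longrightarrow> head Q z v < n"
  using head_in cmp_sub by blast

lemma cmp_cong: "ok z \<Longrightarrow> y \<in> cmp (fr Q z) v \<Longrightarrow> cmp (fr Q z) y = cmp (fr Q z) v"
  using cmp_eq[OF forestD(1)[OF fr_props(1)[OF Q]], of z v y] by (simp add: cmp_iff)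

lemma head_cong: "ok z \<Longrightarrow> y \<in> cmp (fr Q z) v \<Longrightarrow> head Q z y = head Q z v"
  unfolding head_def by (simp add: cmp_cong)

text \<open>\<open>head\<close> is constant along a tour, so the opening that depends on the dart
  agrees with the fixed one in \<open>suf_head\<close> and \<open>suf_edge\<close>.\<close>

lemma sufd_eq:
  assumes z: "ok z" and e: "e \<in> tdarts Q z"
  shows "sufd Q b z e = dbl_fold sym_diff (brk (euler (fr Q z)) (head Q z (snd e), head Q z (snd e))) (loopval (b z)) (2 * lg) e"
proof -
  let ?D = "{a \<in> tdarts Q z. snd a \<in> cmp (fr Q z) (snd e)}"
  have "snd (euler (fr Q z) a) \<in> cmp (fr Q z) (snd a)" if "a \<in> tdarts Q z" for a
  proof -
    have "(snd a, snd (euler (fr Q z) a)) \<in> tdarts Q z"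
      using euler_tdarts[OF Q z that] by (simp add: euler_def)
    then show ?thesis by (auto simp: tdarts_iff[OF Q] cmp_iff)
  qed
  then have cl: "euler (fr Q z) a \<in> ?D" if "a \<in> ?D" for a
    using that euler_tdarts[OF Q z] cmp_cong[OF z, of "snd a" "snd e"] by blast
  show ?thesis unfolding sufd_def
  proof (rule symdiff.dbl_fold_cong[where D = ?D])
    show "brk (euler (fr Q z)) (head Q z (snd a), head Q z (snd a)) a = brk (euler (fr Q z)) (head Q z (snd e), head Q z (snd e)) a"
      if "a \<in> ?D" for a using that head_cong[OF z, of "snd a" "snd e"] by simp
    show "a' \<in> ?D" if "a \<in> ?D" "brk (euler (fr Q z)) (head Q z (snd a), head Q z (snd a)) a = Some a'" for a a'
      using cl[OF that(1)] that(2) unfolding brk_def by (metis option.distinct(1) option.inject)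
  qed (use e in simp)
qed

lemma sufd_head:
  assumes z: "ok z" and m: "m < n" "head Q z m = m"
  shows "sufd Q b z (m, m) = symdiff.F (b z) (cmp (fr Q z) m)"
  using suf_head[OF finite_lessThan fr_props(2,1)[OF Q z], of m "2 * lg" "b z"] card_tdarts[OF Q z] m
    sufd_eq[OF z, of "(m, m)" b] tdarts_iff[OF Q, of m m z] unfolding tdarts_def by simp

lemma sufd_edge:
  assumes z: "ok z" and e: "(u, v) \<in> fr Q z" and conn: "cmp (fr Q z) 0 = {..<n}" and b: "symdiff.F (b z) {..<n} = {}"
  shows "sym_diff (sufd Q b z (u, v)) (sufd Q b z (v, u)) = symdiff.F (b z) (side (fr Q z) u v)"
proof -
  have lt: "u < n" "v < n" using fr_props(2)[OF Q z] e by auto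
  have e': "(v, u) \<in> fr Q z" using e forestD(1)[OF fr_props(1)[OF Q z]] unfolding sym_def by blast
  have hd: "head Q z y = 0" if "y < n" for y
    using head_cong[OF z, of y 0] conn that unfolding head_def by (simp add: Least_eq_0)
  have t: "(u, v) \<in> tdarts Q z" "(v, u) \<in> tdarts Q z" using e e' tdarts_iff[OF Q] by blast+
  show ?thesis
    using suf_edge[OF finite_lessThan fr_props(2,1)[OF Q z], of 0 "2 * lg" u v "b z"] card_tdarts[OF Q z] n2
      conn e b sufd_eq[OF z t(1), of b] sufd_eq[OF z t(2), of b] hd lt unfolding tdarts_def by simp
qed

lemma known_head:
  assumes X: "known R X" and L: "det X (links Q)" and M: "n ^ 6 * (n + 1) \<le> msg_bound \<kappa> n"
  shows "known (R + 1 + 4 * lg) (\<lambda>z v. (X z v, hosted (tdarts Q) (owner Q)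
     (\<lambda>z e. (euler (fr Q z) e, owner Q z (euler (fr Q z) e), head Q z (snd e))) z v))"
proof -
  have "known (R + 1 + 4 * lg) (\<lambda>z v. (X z v, hosted (tdarts Q) (owner Q)
     (\<lambda>z e. (euler (fr Q z) e, owner Q z (euler (fr Q z) e), cmin Q (\<lambda>z v. enat v) z (snd e))) z v))"
    using X Q L
  proof (rule known_tour_min[where M = "enat ` {..<n}"])
    show "det X (\<lambda>z v. enat v)" by (rule detI) simp
    show "n ^ 6 * (card (enat ` {..<n}) + 1) \<le> msg_bound \<kappa> n" using M by (simp add: card_image inj_on_def)
  qed auto
  then show ?thesis
  proof (rule known_det)
    let ?H = "\<lambda>z v. hosted (tdarts Q) (owner Q) (\<lambda>z e. (euler (fr Q z) e, owner Q z (euler (fr Q z) e), cmin Q (\<lambda>z v. enat v) z (snd e))) z v"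
    let ?H' = "\<lambda>z v. hosted (tdarts Q) (owner Q) (\<lambda>z e. (euler (fr Q z) e, owner Q z (euler (fr Q z) e), head Q z (snd e))) z v"
    have H: "?H' z v = (\<lambda>(e, x). (e, (fst x, fst (snd x), the_enat (snd (snd x))))) ` ?H z v" for z v
      by (simp add: hosted_def image_image cmin_id)
    show "det (\<lambda>z v. (X z v, ?H z v)) (\<lambda>z v. (X z v, ?H' z v))"
      unfolding H by (rule detI) simp
  qed
qed

lemma nx_props:
  assumes z: "ok z"
  defines "nx \<equiv> \<lambda>e. brk (euler (fr Q z)) (head Q z (snd e), head Q z (snd e)) e"
  shows "partial_inj (tdarts Q z) nx"
proof -
  have nx_Some: "euler (fr Q z) e = e'" if "nx e = Some e'" for e e'
    using that unfolding nx_def brk_def by (metis option.distinct(1) option.inject)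
  show ?thesis
    unfolding partial_inj_def
  proof (intro conjI allI impI)
    fix e e' assume "e \<in> tdarts Q z" "nx e = Some e'"
    then show "e' \<in> tdarts Q z" using euler_tdarts[OF Q z, of e] nx_Some by metis
  next
    fix e1 e2 e' assume a: "e1 \<in> tdarts Q z" "e2 \<in> tdarts Q z" "nx e1 = Some e'" "nx e2 = Some e'"
    have "euler (fr Q z) e1 = euler (fr Q z) e2" using nx_Some[OF a(3)] nx_Some[OF a(4)] by simp
    then show "e1 = e2"
      using inj_onD[OF inj_euler[OF finite_lessThan fr_props(2,1)[OF Q z]], of e1 e2] a by (simp add: tdarts_def)
  qed
qed

lemma sufd_sub:
  assumes z: "ok z" and e: "e \<in> tdarts Q z" and bK: "\<And>v. v < n \<Longrightarrow> b z v \<subseteq> {..<K}"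
  shows "dbl_fold sym_diff (\<lambda>e. brk (euler (fr Q z)) (head Q z (snd e), head Q z (snd e)) e)
      (loopval (b z)) i e \<in> Pow {..<K}"
proof (rule dbl_fold_mem[OF nx_props[OF z]])
  show "e \<in> tdarts Q z" by fact
  fix e assume "e \<in> tdarts Q z"
  then have "e \<in> {..<n} \<times> {..<n}" using hostingD(1)[OF hosting_tour[OF Q] z] by blast
  then have "fst e < n" by auto
  then show "loopval (b z) e \<in> Pow {..<K}" using bK[of "fst e"] unfolding loopval_def
    by (cases "fst e = snd e") auto
qed auto

lemma known_suf:
  fixes b :: "inst \<Rightarrow> nat \<Rightarrow> nat set"
  assumes X: "known R X" and L: "det X (links Q)" and b: "det X b"
    and bK: "\<And>z v. ok z \<Longrightarrow> v < n \<Longrightarrow> b z v \<subseteq> {..<K}"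
    and M: "n ^ 6 * (n + 1) \<le> msg_bound \<kappa> n" "n ^ 6 * 2 ^ K \<le> msg_bound \<kappa> n"
  shows "known (R + 1 + 8 * lg) (\<lambda>z v. (X z v, hosted (tdarts Q) (owner Q) (\<lambda>z e. (head Q z (snd e), sufd Q b z e)) z v))"
proof -
  let ?h = "hosted (tdarts Q) (owner Q)"
  let ?g = "\<lambda>z e. (euler (fr Q z) e, owner Q z (euler (fr Q z) e), head Q z (snd e))"
  define nx where "nx z e = brk (euler (fr Q z)) (head Q z (snd e), head Q z (snd e)) e" for z e
  have pin: "partial_inj (tdarts Q z) (nx z)" if "ok z" for z
    unfolding nx_def using nx_props[OF that] .
  have K1: "known (R + 1 + 4 * lg) (\<lambda>z v. (X z v, ?h ?g z v))" by (rule known_head[OF X L M(1)])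
  have det1: "det (\<lambda>z v. (X z v, ?h ?g z v)) (?h (\<lambda>z e. (nx z e, map_option (owner Q z) (nx z e), loopval (b z) e)))"
  proof (rule detI)
    fix z z' :: inst and v
    assume a: "ok z" "ok z'" "v < n" "wt z v = wt z' v" "rn z v = rn z' v" "(X z v, ?h ?g z v) = (X z' v, ?h ?g z' v)"
    have bv: "b z v = b z' v" using a by (intro detD[OF b]) auto
    have H: "?h ?g z v = ?h ?g z' v" using a(6) by simp
    have img: "?h (\<lambda>z e. (nx z e, map_option (owner Q z) (nx z e), loopval (b z) e)) w v =
       (\<lambda>(e, g). (e, (if fst g = (snd (snd g), snd (snd g)) then None else Some (fst g),
          if fst g = (snd (snd g), snd (snd g)) then None else Some (fst (snd g)),
          if fst e = snd e then b w v else {}))) ` ?h ?g w v" for w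
    proof -
      have fe: "fst e = v" if "fst e = snd e" "owner Q w e = v" for e using that by (simp add: owner_def split: if_splits)
      show ?thesis unfolding hosted_def image_image prod.case
      proof (rule image_cong[OF refl])
        fix e assume "e \<in> {e \<in> tdarts Q w. owner Q w e = v}"
        then have "loopval (b w) e = (if fst e = snd e then b w v else {})" using fe[of e] by (simp add: loopval_def)
        then show "(e, nx w e, map_option (owner Q w) (nx w e), loopval (b w) e) =
          (e, if fst (?g w e) = (snd (snd (?g w e)), snd (snd (?g w e))) then None else Some (fst (?g w e)),
          if fst (?g w e) = (snd (snd (?g w e)), snd (snd (?g w e))) then None else Some (fst (snd (?g w e))),
          if fst e = snd e then b w v else {})"
          by (simp add: nx_def brk_def)
      qed
    qed
    show "?h (\<lambda>z e. (nx z e, map_option (owner Q z) (nx z e), loopval (b z) e)) z v =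
       ?h (\<lambda>z e. (nx z e, map_option (owner Q z) (nx z e), loopval (b z) e)) z' v"
      by (simp only: img H bv)
  qed
  have "known (R + 1 + 4 * lg + 2 * (2 * lg)) (\<lambda>z v. ((X z v, ?h ?g z v),
     ?h (\<lambda>z e. dbl_fold sym_diff (nx z) (loopval (b z)) (2 * lg) e) z v))"
    using K1 det1 hosting_tour[OF Q] pin
  proof (rule known_double[where M = "Pow {..<K}"])
    show "n ^ 6 * card (Pow {..<K}) \<le> msg_bound \<kappa> n" using M(2) by (simp add: card_Pow)
    show "dbl_fold sym_diff (nx z) (loopval (b z)) i e \<in> Pow {..<K}" if "ok z" "e \<in> tdarts Q z" for z i e
      unfolding nx_def using sufd_sub[OF that] bK[OF that(1)] by blast
  qed (use msg4 in auto)
  moreover have "R + 1 + 4 * lg + 2 * (2 * lg) = R + 1 + 8 * lg" by simp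
  moreover have "(\<lambda>z e. dbl_fold sym_diff (nx z) (loopval (b z)) (2 * lg) e) = (\<lambda>z e. sufd Q b z e)"
    unfolding sufd_def nx_def ..
  ultimately have K2: "known (R + 1 + 8 * lg) (\<lambda>z v. ((X z v, ?h ?g z v), ?h (\<lambda>z e. sufd Q b z e) z v))" by (simp add: ac_simps)
  show ?thesis
  proof (rule known_via[OF K2])
    fix z z' :: inst and v
    assume a: "((X z v, ?h ?g z v), ?h (\<lambda>z e. sufd Q b z e) z v) = ((X z' v, ?h ?g z' v), ?h (\<lambda>z e. sufd Q b z e) z' v)"
    have sub: "?h (\<lambda>z e. (head Q z (snd e), sufd Q b z e)) z v \<subseteq> ?h (\<lambda>z e. (head Q z (snd e), sufd Q b z e)) z' v"
      if H: "?h ?g z v = ?h ?g z' v" "?h (\<lambda>z e. sufd Q b z e) z v = ?h (\<lambda>z e. sufd Q b z e) z' v" for z z'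
    proof
      fix p assume p: "p \<in> ?h (\<lambda>z e. (head Q z (snd e), sufd Q b z e)) z v"
      obtain e q where eq: "p = (e, q)" by (cases p)
      have e: "e \<in> tdarts Q z" "owner Q z e = v" "q = (head Q z (snd e), sufd Q b z e)"
        using p unfolding eq hosted_iff by blast+
      have "(e, ?g z e) \<in> ?h ?g z' v" unfolding H(1)[symmetric] hosted_iff using e by blast
      moreover have "(e, sufd Q b z e) \<in> ?h (\<lambda>z e. sufd Q b z e) z' v" unfolding H(2)[symmetric] hosted_iff using e by blast
      ultimately show "p \<in> ?h (\<lambda>z e. (head Q z (snd e), sufd Q b z e)) z' v"
        unfolding eq hosted_iff using e(3) by simp
    qed
    show "(X z v, ?h (\<lambda>z e. (head Q z (snd e), sufd Q b z e)) z v) = (X z' v, ?h (\<lambda>z e. (head Q z (snd e), sufd Q b z e)) z' v)"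
      using sub[of z z'] sub[of z' z] a by simp
  qed
qed

end

text \<open>All heads are \<open>0\<close> iff the forest is connected. Otherwise its components are the candidates,
  represented by loops at their heads.\<close>

definition cand :: "(inst \<Rightarrow> (nat \<times> nat) set) \<Rightarrow> inst \<Rightarrow> dart set" where
  "cand Q z = (if \<forall>v<n. head Q z v = 0 then fr Q z else {(m, m) | m. m < n \<and> head Q z m = m})"

text \<open>For a tree edge the difference of two suffixes is the parity vector of a side, for a
  component the suffix at its head is; the cardinality counts the odd samples.\<close>

definition est :: "(inst \<Rightarrow> (nat \<times> nat) set) \<Rightarrow> (inst \<Rightarrow> nat \<Rightarrow> nat set) \<Rightarrow> inst \<Rightarrow> dart \<Rightarrow> nat" where
  "est Q b z e = card (if fst e = snd e then sufd Q b z e else sym_diff (sufd Q b z e) (sufd Q b z (snd e, fst e)))"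

definition code :: "dart \<Rightarrow> nat" where "code e = fst e * n + snd e"

text \<open>Estimate and name of a candidate are packed into one number. As
  \<open>code e < n ^ 2\<close>, its minimum is lexicographic and also names a minimizer, so one
  \<open>known_min\<close> finds both.\<close>

definition best :: "(inst \<Rightarrow> (nat \<times> nat) set) \<Rightarrow> (inst \<Rightarrow> nat \<Rightarrow> nat set) \<Rightarrow> inst \<Rightarrow> enat" where
  "best Q b z = (INF e\<in>cand Q z. enat (est Q b z e * n ^ 2 + code e))"

definition pick :: "(inst \<Rightarrow> (nat \<times> nat) set) \<Rightarrow> (inst \<Rightarrow> nat \<Rightarrow> nat set) \<Rightarrow> inst \<Rightarrow> dart" where
  "pick Q b z = (let c = the_enat (best Q b z) mod n ^ 2 in (c div n, c mod n))"

definition chosen :: "(inst \<Rightarrow> (nat \<times> nat) set) \<Rightarrow> (inst \<Rightarrow> nat \<Rightarrow> nat set) \<Rightarrow> inst \<Rightarrow> nat set" where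
  "chosen Q b z = side (fr Q z) (fst (pick Q b z)) (snd (pick Q b z))"

lemma code_decode:
  assumes "e \<in> {..<n} \<times> {..<n}"
  shows "code e < n ^ 2" "(code e div n, code e mod n) = e"
proof -
  obtain x y where e: "e = (x, y)" "x < n" "y < n" using assms by auto
  have "x * n + y < x * n + n" using e by simp
  also have "\<dots> = (x + 1) * n" by simp
  also have "\<dots> \<le> n * n" using e by (intro mult_le_mono1) simp
  finally show "code e < n ^ 2" using e by (simp add: code_def power2_eq_square)
  show "(code e div n, code e mod n) = e" using e by (simp add: code_def)
qed

context
  fixes Q :: "inst \<Rightarrow> (nat \<times> nat) set"
  assumes Q: "oriented Q"
begin

lemma cand_sub: "ok z \<Longrightarrow> cand Q z \<subseteq> tdarts Q z" "ok z \<Longrightarrow> cand Q z \<subseteq> {..<n} \<times> {..<n}"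
  using fr_props(2)[OF Q, of z] tdarts_iff[OF Q] unfolding cand_def by (auto split: if_splits)

lemma conn_iff: "ok z \<Longrightarrow> (\<forall>v<n. head Q z v = 0) \<longleftrightarrow> cmp (fr Q z) 0 = {..<n}"
proof -
  assume z: "ok z"
  have h0: "head Q z 0 = 0" unfolding head_def by (simp add: Least_eq_0)
  have c0: "cmp (fr Q z) 0 \<subseteq> {..<n}" using cmp_sub[OF Q z, of 0] n2 by simp
  show ?thesis
  proof
    assume a: "\<forall>v<n. head Q z v = 0"
    have "v \<in> cmp (fr Q z) 0" if "v < n" for v
      using head_in[OF Q, of z v] a that cmp_cong[OF Q z, of 0 v] cmp_self[of v "fr Q z"] by simp
    then show "cmp (fr Q z) 0 = {..<n}" using c0 by blast
  next
    assume "cmp (fr Q z) 0 = {..<n}"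
    then show "\<forall>v<n. head Q z v = 0" using head_cong[OF Q z, of _ 0] h0 by auto
  qed
qed

lemma cand_nonempty: "ok z \<Longrightarrow> cand Q z \<noteq> {}"
proof (cases "\<forall>v<n. head Q z v = 0")
  case True
  assume z: "ok z"
  then have "(0, 1) \<in> (fr Q z)\<^sup>*" using True conn_iff[OF z] n2 unfolding cmp_iff[symmetric] by simp
  then have "fr Q z \<noteq> {}" by auto
  then show ?thesis using True by (simp add: cand_def)
next
  case False
  assume z: "ok z"
  then have "head Q z (head Q z 0) = head Q z 0" using head_cong[OF Q z head_in[OF Q]] by blast
  moreover have "head Q z 0 < n" using head_lt[OF Q z] n2 by simp
  ultimately show ?thesis using False unfolding cand_def by auto
qed

lemma pick_props:
  assumes z: "ok z"
  shows "pick Q b z \<in> cand Q z" "e \<in> cand Q z \<Longrightarrow> est Q b z (pick Q b z) \<le> est Q b z e"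
proof -
  let ?v = "\<lambda>e. est Q b z e * n ^ 2 + code e"
  have fin: "finite (cand Q z)" using cand_sub(2)[OF z] finite_subset by blast
  have "best Q b z \<in> (\<lambda>e. enat (?v e)) ` cand Q z"
    unfolding best_def using fin cand_nonempty[OF z] by (intro finite_Inf_in) (auto simp: inf_min min_def)
  then obtain e0 where e0: "e0 \<in> cand Q z" "best Q b z = enat (?v e0)" by blast
  have dec: "code e < n ^ 2" "(code e div n, code e mod n) = e" if "e \<in> cand Q z" for e
    using code_decode[of e] cand_sub(2)[OF z] that by blast+
  have "pick Q b z = e0" using dec[OF e0(1)] unfolding pick_def e0(2) by (simp add: Let_def)
  then show "pick Q b z \<in> cand Q z" using e0 by simp
  show "est Q b z (pick Q b z) \<le> est Q b z e" if e: "e \<in> cand Q z"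
  proof -
    have "best Q b z \<le> enat (?v e)" unfolding best_def using e by (rule INF_lower)
    then have le: "?v e0 \<le> ?v e" using e0 by simp
    have "?v e0 div n ^ 2 \<le> ?v e div n ^ 2" using le by (rule div_le_mono)
    moreover have "(a * n ^ 2 + c) div n ^ 2 = a" if "c < n ^ 2" for a c
      using that n2 by (subst div_mult_self3) auto
    ultimately show ?thesis using dec(1)[OF e0(1)] dec(1)[OF e] \<open>pick Q b z = e0\<close> by simp
  qed
qed

lemma cand_conn: "ok z \<Longrightarrow> cmp (fr Q z) 0 = {..<n} \<Longrightarrow> cand Q z = fr Q z"
  using conn_iff unfolding cand_def by simp

lemma cand_disconn: "ok z \<Longrightarrow> cmp (fr Q z) 0 \<noteq> {..<n} \<Longrightarrow> cand Q z = {(m, m) | m. m < n \<and> head Q z m = m}"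
  using conn_iff unfolding cand_def by simp

lemma est_cand:
  assumes z: "ok z" and e: "(u, v) \<in> cand Q z" and b: "symdiff.F (b z) {..<n} = {}"
  shows "est Q b z (u, v) = card (symdiff.F (b z) (side (fr Q z) u v))"
proof (cases "cmp (fr Q z) 0 = {..<n}")
  case True
  then have uv: "(u, v) \<in> fr Q z" using e cand_conn[OF z] by simp
  then have "u \<noteq> v" using forestD(2)[OF fr_props(1)[OF Q z]] by blast
  then show ?thesis using sufd_edge[where b = b, OF Q z uv True b] by (simp add: est_def)
next
  case False
  then have "u = v" "v < n" "head Q z v = v" using e cand_disconn[OF z] by auto
  then show ?thesis using sufd_head[OF Q z] side_refl[OF fr_props(1)[OF Q z]] by (simp add: est_def)
qed

lemma cand_proper:
  assumes z: "ok z" and e: "(u, v) \<in> cand Q z"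
  shows "side (fr Q z) u v \<subseteq> {..<n}" "side (fr Q z) u v \<noteq> {}" "side (fr Q z) u v \<noteq> {..<n}"
proof -
  have uv: "u < n" "v < n" using cand_sub(2)[OF z] e by auto
  show sub: "side (fr Q z) u v \<subseteq> {..<n}" unfolding side_def
    using fr_props(2)[OF Q z] uv by (intro cmp_subset) auto
  show "side (fr Q z) u v \<noteq> {}" using side_self[of v "fr Q z" u] by blast
  show "side (fr Q z) u v \<noteq> {..<n}"
  proof (cases "cmp (fr Q z) 0 = {..<n}")
    case True
    then have "(u, v) \<in> fr Q z" using e cand_conn[OF z] by simp
    then show ?thesis using not_in_side[OF fr_props(1)[OF Q z]] uv by blast
  next
    case False
    then have "u = v" using e cand_disconn[OF z] by auto
    then have "side (fr Q z) u v = cmp (fr Q z) v" using side_refl[OF fr_props(1)[OF Q z]] by simp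
    moreover have "cmp (fr Q z) v \<noteq> {..<n}"
    proof
      assume a: "cmp (fr Q z) v = {..<n}"
      then have "0 \<in> cmp (fr Q z) v" using n2 by simp
      then show False using cmp_cong[OF Q z] a False by metis
    qed
    ultimately show ?thesis by simp
  qed
qed

lemma chosen_proper: "ok z \<Longrightarrow> proper_cut n (chosen Q b z)"
  using cand_proper[of z "fst (pick Q b z)" "snd (pick Q b z)"] pick_props(1)[of z b]
  unfolding chosen_def proper_cut_def by (simp add: atLeast0LessThan)

text \<open>A first global minimum tells whether all heads are \<open>0\<close>. With this flag a
  host recognises its candidates, and it can evaluate them since it also hosts the reversed darts. A
  second global minimum yields \<open>best\<close>.\<close>

lemma known_best:
  fixes b :: "inst \<Rightarrow> nat \<Rightarrow> nat set"
  assumes X: "known R X" and L: "det X (links Q)" and b: "det X b"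
    and bK: "\<And>z v. ok z \<Longrightarrow> v < n \<Longrightarrow> b z v \<subseteq> {..<K}"
    and M: "n ^ 6 * (n + 1) \<le> msg_bound \<kappa> n" "n ^ 6 * 2 ^ K \<le> msg_bound \<kappa> n"
      "n ^ 6 * ((K + 1) * n ^ 2 + 1) \<le> msg_bound \<kappa> n"
  shows "known (R + 1 + 16 * lg) (\<lambda>z v. (X z v, best Q b z))"
proof -
  let ?H = "hosted (tdarts Q) (owner Q) (\<lambda>z e. (head Q z (snd e), sufd Q b z e))"
  define FL where "FL z = (INF u\<in>{..<n}. if head Q z u = 0 then 1 else 0 :: enat)" for z
  have sufK: "sufd Q b z e \<subseteq> {..<K}" if "ok z" "e \<in> tdarts Q z" for z e
    using sufd_sub[OF Q that, of b K "2 * lg"] bK[OF that(1)] unfolding sufd_def by blast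
  have K1: "known (R + 1 + 8 * lg) (\<lambda>z v. (X z v, ?H z v))" by (rule known_suf[OF Q X L b bK M(1,2)])
  have two: "n ^ 6 * 2 \<le> msg_bound \<kappa> n"
    by (rule order_trans[OF _ M(1)], rule mult_le_mono2) (use n2 in simp)
  have K2: "known (R + 1 + 8 * lg + 4 * lg) (\<lambda>z v. ((X z v, ?H z v), FL z))"
    unfolding FL_def using K1
  proof (rule known_min[where M = "{0, 1}"])
    show "det (\<lambda>z v. (X z v, ?H z v)) (\<lambda>z v. if head Q z v = 0 then 1 else 0 :: enat)"
    proof (rule detI)
      fix z z' :: inst and v
      assume a: "v < n" "(X z v, ?H z v) = (X z' v, ?H z' v)"
      have "((v, v), (head Q z v, sufd Q b z (v, v))) \<in> ?H z v"
        using a(1) owner_end[OF Q, of z v v] by (simp add: hosted_iff tdarts_iff[OF Q])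
      then have "((v, v), (head Q z v, sufd Q b z (v, v))) \<in> ?H z' v" using a(2) by simp
      then have "head Q z v = head Q z' v" unfolding hosted_iff by simp
      then show "(if head Q z v = 0 then 1 else 0 :: enat) = (if head Q z' v = 0 then 1 else 0)" by simp
    qed
    show "n ^ 6 * card {0, 1 :: enat} \<le> msg_bound \<kappa> n" using two by simp
  qed auto
  have flag: "FL z = (if \<forall>v<n. head Q z v = 0 then 1 else 0)" for z
  proof (cases "\<forall>v<n. head Q z v = 0")
    case True
    then show ?thesis using n2 by (auto simp: FL_def intro!: antisym INF_greatest INF_lower2[of 0])
  next
    case False
    then obtain v where "v < n" "head Q z v \<noteq> 0" by blast
    then have "FL z \<le> 0" unfolding FL_def by (intro INF_lower2[of v]) auto
    then show ?thesis using False by simp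
  qed
  let ?val = "\<lambda>z e. enat (est Q b z e * n ^ 2 + code e)"
  let ?loc = "\<lambda>z v. {e \<in> cand Q z. owner Q z e = v}"
  let ?f = "\<lambda>z v. INF e\<in>?loc z v. ?val z e"
  let ?M = "insert \<infinity> (enat ` {..<(K + 1) * n ^ 2})"
  have valM: "est Q b z e * n ^ 2 + code e < (K + 1) * n ^ 2" if z: "ok z" and e: "e \<in> cand Q z" for z e
  proof -
    obtain x y where xy: "e = (x, y)" by (cases e)
    have t: "e \<in> tdarts Q z" using cand_sub(1)[OF z] e by blast
    then have t': "(y, x) \<in> tdarts Q z"
      using forestD(1)[OF fr_props(1)[OF Q z]] unfolding xy tdarts_iff[OF Q] sym_def by auto
    have "est Q b z e \<le> card {..<K}" unfolding est_def
      using sufK[OF z t] sufK[OF z t'] by (intro card_mono) (auto simp: xy)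
    then have "est Q b z e \<le> K" by simp
    then have "est Q b z e * n ^ 2 \<le> K * n ^ 2" by (rule mult_le_mono1)
    moreover have "code e < n ^ 2" using code_decode(1)[of e] cand_sub(2)[OF z] e by blast
    ultimately show ?thesis unfolding add_mult_distrib mult_1 by linarith
  qed
  have "known (R + 1 + 8 * lg + 4 * lg + 4 * lg) (\<lambda>z v. (((X z v, ?H z v), FL z), INF u\<in>{..<n}. ?f z u))"
    using K2
  proof (rule known_min[where M = ?M])
    \<comment> \<open>Recomputes the candidate values at a host from its hosted suffixes and the
      flag alone.\<close>
    define LS where "LS H fl = {enat (card (if fst e = snd e then s else sym_diff s s') * n ^ 2 + code e) | e h s h' s'.
       (e, (h, s)) \<in> H \<and> ((snd e, fst e), (h', s')) \<in> H \<and>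
       (if fl = 1 then fst e \<noteq> snd e else fst e = snd e \<and> h = fst e)}"
      for H :: "(dart \<times> nat \<times> nat set) set" and fl :: enat
    have LSI: "enat (card (if fst e = snd e then s else sym_diff s s') * n ^ 2 + code e) \<in> LS H fl"
      if "(e, (h, s)) \<in> H" "((snd e, fst e), (h', s')) \<in> H" "if fl = 1 then fst e \<noteq> snd e else fst e = snd e \<and> h = fst e"
      for e h s h' s' H fl
      unfolding LS_def using that by blast
    have LS: "LS (?H z v) (FL z) = ?val z ` ?loc z v" if z: "ok z" for z v
    proof -
      have cand_iff: "e \<in> cand Q z \<longleftrightarrow> e \<in> tdarts Q z \<and> (if FL z = 1 then fst e \<noteq> snd e else fst e = snd e \<and> head Q z (snd e) = fst e)" for e
      proof (cases "\<forall>v<n. head Q z v = 0")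
        case True
        have "FL z = 1" by (rule trans[OF flag if_P[OF True]])
        then have fl: "(FL z = 1) = True" by blast
        show ?thesis unfolding fl cand_def using True forestD(2)[OF fr_props(1)[OF Q z]]
          by (cases e) (auto simp: tdarts_iff[OF Q])
      next
        case False
        have "FL z = 0" by (rule trans[OF flag if_not_P[OF False]])
        then have fl: "(FL z = 1) = False" by (metis zero_neq_one)
        show ?thesis unfolding fl cand_def using False forestD(2)[OF fr_props(1)[OF Q z]]
          by (cases e) (auto simp: tdarts_iff[OF Q])
      qed
      have swap: "(snd e, fst e) \<in> tdarts Q z \<and> owner Q z (snd e, fst e) = owner Q z e" if "e \<in> tdarts Q z" for e
      proof -
        obtain x y where xy: "e = (x, y)" by (cases e)
        then show ?thesis using that owner_swap[OF Q, of x y z] forestD(1)[OF fr_props(1)[OF Q z]]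
          unfolding sym_def by (auto simp: tdarts_iff[OF Q])
      qed
      show ?thesis
      proof (intro set_eqI iffI)
        fix p assume "p \<in> LS (?H z v) (FL z)"
        then obtain e h s h' s' where e: "p = enat (card (if fst e = snd e then s else sym_diff s s') * n ^ 2 + code e)"
          "(e, (h, s)) \<in> ?H z v" "((snd e, fst e), (h', s')) \<in> ?H z v"
          "if FL z = 1 then fst e \<noteq> snd e else fst e = snd e \<and> h = fst e" unfolding LS_def by blast
        have "e \<in> tdarts Q z" "owner Q z e = v" "h = head Q z (snd e)" "s = sufd Q b z e" "s' = sufd Q b z (snd e, fst e)"
          using e(2,3) unfolding hosted_iff by blast+
        moreover from this have "e \<in> cand Q z" unfolding cand_iff using e(4)
          by (cases "FL z = 1") simp_all
        ultimately show "p \<in> ?val z ` ?loc z v" by (intro image_eqI[of _ _ e]) (simp_all add: e(1) est_def)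
      next
        fix p assume "p \<in> ?val z ` ?loc z v"
        then obtain e where e: "p = ?val z e" "e \<in> cand Q z" "owner Q z e = v" by blast
        then have t: "e \<in> tdarts Q z" using cand_iff by blast
        have "(e, (head Q z (snd e), sufd Q b z e)) \<in> ?H z v" using t e(3) unfolding hosted_iff by blast
        moreover have "((snd e, fst e), (head Q z (fst e), sufd Q b z (snd e, fst e))) \<in> ?H z v"
          using swap[OF t] e(3) unfolding hosted_iff by simp
        moreover have "if FL z = 1 then fst e \<noteq> snd e else fst e = snd e \<and> head Q z (snd e) = fst e"
          using e(2) unfolding cand_iff by blast
        ultimately show "p \<in> LS (?H z v) (FL z)" unfolding e(1) est_def by (rule LSI)
      qed
    qed
    show "det (\<lambda>z v. ((X z v, ?H z v), FL z)) ?f"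
    proof (rule detI)
      fix z z' :: inst and v
      assume a: "ok z" "ok z'" "((X z v, ?H z v), FL z) = ((X z' v, ?H z' v), FL z')"
      then have "?H z v = ?H z' v" "FL z = FL z'" by blast+
      then have "LS (?H z v) (FL z) = LS (?H z' v) (FL z')" by (simp only:)
      then show "?f z v = ?f z' v" unfolding LS[OF a(1)] LS[OF a(2)] by (rule arg_cong)
    qed
    have "card ?M \<le> (K + 1) * n ^ 2 + 1" by (simp add: card_insert_if card_image inj_on_def)
    then show "n ^ 6 * card ?M \<le> msg_bound \<kappa> n" using M(3) by (meson le_trans mult_le_mono2)
    show "?f z v \<in> ?M" if z: "ok z" and v: "v < n" for z v
    proof (cases "?loc z v = {}")
      case True
      have "?f z v = (INF e\<in>{}. ?val z e)" by (simp only: True)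
      then show ?thesis by (simp add: top_enat_def)
    next
      case False
      have "?loc z v \<subseteq> {..<n} \<times> {..<n}" using cand_sub(2)[OF z] by blast
      then have "finite (?loc z v)" by (rule finite_subset) simp
      then have "Inf (?val z ` ?loc z v) \<in> ?val z ` ?loc z v"
        using False by (intro finite_Inf_in) (auto simp: inf_min min_def)
      then show ?thesis using valM[OF z] by blast
    qed
  qed simp
  moreover have "R + 1 + 8 * lg + 4 * lg + 4 * lg = R + 1 + 16 * lg" by simp
  ultimately have K3: "known (R + 1 + 16 * lg) (\<lambda>z v. (((X z v, ?H z v), FL z), INF u\<in>{..<n}. ?f z u))" by (simp add: ac_simps)
  have bst: "(INF u\<in>{..<n}. ?f z u) = best Q b z" if z: "ok z" for z
  proof -
    have un: "(\<Union>u<n. ?loc z u) = cand Q z"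
      using owner_in[OF Q z] cand_sub(1)[OF z] by blast
    have "(INF u\<in>{..<n}. ?f z u) = (INF e\<in>(\<Union>u<n. ?loc z u). ?val z e)"
    proof (rule antisym)
      show "(INF u\<in>{..<n}. ?f z u) \<le> (INF e\<in>(\<Union>u<n. ?loc z u). ?val z e)"
      proof (rule INF_greatest)
        fix e assume "e \<in> (\<Union>u<n. ?loc z u)"
        then obtain u where "u \<in> {..<n}" "e \<in> ?loc z u" by blast
        then show "(INF u\<in>{..<n}. ?f z u) \<le> ?val z e" by (intro INF_lower2[of u] INF_lower)
      qed
      show "(INF e\<in>(\<Union>u<n. ?loc z u). ?val z e) \<le> (INF u\<in>{..<n}. ?f z u)"
        by (intro INF_greatest INF_superset_mono order_refl) blast
    qed
    then show ?thesis unfolding best_def un .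
  qed
  show ?thesis
  proof (rule known_via[OF K3])
    fix z z' :: inst and v
    assume a: "ok z" "ok z'" "(((X z v, ?H z v), FL z), INF u\<in>{..<n}. ?f z u) = (((X z' v, ?H z' v), FL z'), INF u\<in>{..<n}. ?f z' u)"
    then have "X z v = X z' v" "(INF u\<in>{..<n}. ?f z u) = (INF u\<in>{..<n}. ?f z' u)" by blast+
    then show "(X z v, best Q b z) = (X z' v, best Q b z')" unfolding bst[OF a(1)] bst[OF a(2)] by simp
  qed
qed

text \<open>Every node decodes the chosen dart \<open>P\<close> from \<open>best\<close>. After its
  deletion the chosen set is the component of \<open>snd (P z)\<close>, and membership spreads as a
  component minimum of an indicator. A chosen loop deletes nothing and yields a whole
  component.\<close>

lemma known_chosen:
  fixes b :: "inst \<Rightarrow> nat \<Rightarrow> nat set"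
  assumes X: "known R X" and L: "det X (links Q)" and b: "det X b"
    and bK: "\<And>z v. ok z \<Longrightarrow> v < n \<Longrightarrow> b z v \<subseteq> {..<K}"
    and M: "n ^ 6 * (n + 1) \<le> msg_bound \<kappa> n" "n ^ 6 * 2 ^ K \<le> msg_bound \<kappa> n"
      "n ^ 6 * ((K + 1) * n ^ 2 + 1) \<le> msg_bound \<kappa> n"
  shows "known (R + 2 + 20 * lg) (\<lambda>z v. (X z v, v \<in> chosen Q b z))"
proof -
  define P where "P z = pick Q b z" for z
  define Q' where "Q' z = Q z - {(fst (P z), snd (P z)), (snd (P z), fst (P z))}" for z
  have frQ': "fr Q' z = fr Q z - {(fst (P z), snd (P z)), (snd (P z), fst (P z))}" for z
    unfolding fr_def Q'_def by blast
  have Q': "oriented Q'" unfolding oriented_def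
  proof (intro allI impI conjI)
    fix z assume z: "ok z"
    have F: "forest (fr Q z)" using fr_props(1)[OF Q z] .
    show "forest (fr Q' z)" unfolding frQ' by (rule forest_subset[OF F]) (use sym_minus[OF forestD(1)[OF F]] in blast)+
    show "0 < wt z u v" if "(u, v) \<in> Q' z" for u v
      using Q z that unfolding oriented_def Q'_def by blast
    fix v assume v: "v < n"
    have "Q z \<subseteq> {..<n} \<times> {..<n}" using fr_props(2)[OF Q z] unfolding fr_def by blast
    then have "finite (Q z `` {v})" by (meson finite_Image finite_SigmaI finite_lessThan finite_subset)
    then have "card (Q' z `` {v}) \<le> card (Q z `` {v})" by (intro card_mono) (auto simp: Q'_def)
    then show "card (Q' z `` {v}) \<le> lg" using Q z v unfolding oriented_def by (meson le_trans)
  qed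
  have K1: "known (R + 1 + 16 * lg) (\<lambda>z v. (X z v, best Q b z))" by (rule known_best[OF assms])
  have Pbest: "P z = P z'" if "best Q b z = best Q b z'" for z z' using that unfolding P_def pick_def by simp
  have two: "n ^ 6 * 3 \<le> msg_bound \<kappa> n"
    by (rule order_trans[OF _ M(1)], rule mult_le_mono2) (use n2 in simp)
  let ?f = "\<lambda>z x. if x = snd (P z) then 0 else 1 :: enat"
  have "known (R + 1 + 16 * lg + 1 + 4 * lg) (\<lambda>z v. ((X z v, best Q b z), cmin Q' ?f z v))"
    using K1 Q'
  proof (rule known_cmin[where M = "{0, 1}"])
    show "det (\<lambda>z v. (X z v, best Q b z)) (links Q')"
    proof (rule detI)
      fix z z' :: inst and v
      assume a: "ok z" "ok z'" "v < n" "wt z v = wt z' v" "rn z v = rn z' v" "(X z v, best Q b z) = (X z' v, best Q b z')"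
      then have "links Q z v = links Q z' v" by (intro detD[OF L]) auto
      moreover have "P z = P z'" using a Pbest by blast
      moreover have "links Q' z v = (fst (links Q z v) - {u. (v, u) = (fst (P z), snd (P z)) \<or> (v, u) = (snd (P z), fst (P z))},
         snd (links Q z v) - {u. (u, v) = (fst (P z), snd (P z)) \<or> (u, v) = (snd (P z), fst (P z))})" for z v
        unfolding links_def Q'_def by auto
      ultimately show "links Q' z v = links Q' z' v" by (simp only:)
    qed
    show "det (\<lambda>z v. (X z v, best Q b z)) ?f"
    proof (rule detI)
      fix z z' :: inst and v
      assume "(X z v, best Q b z) = (X z' v, best Q b z')"
      then have "P z = P z'" using Pbest by blast
      then show "?f z v = ?f z' v" by simp
    qed
    show "n ^ 6 * (card {0, 1 :: enat} + 1) \<le> msg_bound \<kappa> n" using two by simp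
  qed auto
  moreover have "R + 1 + 16 * lg + 1 + 4 * lg = R + 2 + 20 * lg" by simp
  ultimately have K2: "known (R + 2 + 20 * lg) (\<lambda>z v. ((X z v, best Q b z), cmin Q' ?f z v))" by (simp add: ac_simps)
  have ch: "v \<in> chosen Q b z \<longleftrightarrow> cmin Q' ?f z v = 0" if z: "ok z" for z v
  proof -
    have s: "sym (fr Q' z)" using forestD(1)[OF fr_props(1)[OF Q' z]] .
    have "v \<in> chosen Q b z \<longleftrightarrow> v \<in> cmp (fr Q' z) (snd (P z))"
      unfolding chosen_def side_def frQ' P_def ..
    also have "\<dots> \<longleftrightarrow> snd (P z) \<in> cmp (fr Q' z) v"
      unfolding cmp_iff using rtrancl_symD[OF s] by blast
    also have "\<dots> \<longleftrightarrow> cmin Q' ?f z v = 0"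
    proof
      assume "snd (P z) \<in> cmp (fr Q' z) v"
      then have "cmin Q' ?f z v \<le> 0" unfolding cmin_def by (intro INF_lower2[of "snd (P z)"]) auto
      then show "cmin Q' ?f z v = 0" by simp
    next
      assume a: "cmin Q' ?f z v = 0"
      show "snd (P z) \<in> cmp (fr Q' z) v"
      proof (rule ccontr)
        assume "snd (P z) \<notin> cmp (fr Q' z) v"
        then have "1 \<le> cmin Q' ?f z v" unfolding cmin_def by (intro INF_greatest) auto
        then show False using a by simp
      qed
    qed
    finally show ?thesis .
  qed
  show ?thesis
  proof (rule known_via[OF K2])
    fix z z' :: inst and v
    assume a: "ok z" "ok z'" "((X z v, best Q b z), cmin Q' ?f z v) = ((X z' v, best Q b z'), cmin Q' ?f z' v)"
    then show "(X z v, v \<in> chosen Q b z) = (X z' v, v \<in> chosen Q b z')"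
      unfolding ch[OF a(1)] ch[OF a(2)] by simp
  qed
qed

end

end

section \<open>Minimum spanning forests\<close>

definition below :: "('v \<times> 'v) set \<Rightarrow> ('v \<times> 'v \<Rightarrow> nat) \<Rightarrow> nat \<Rightarrow> ('v \<times> 'v) set" where
  "below E r t = {e \<in> E. r e < t}"

text \<open>Kruskal's result in closed form: an edge is kept unless edges of smaller rank already
  connect its endpoints.\<close>

definition msf :: "('v \<times> 'v) set \<Rightarrow> ('v \<times> 'v \<Rightarrow> nat) \<Rightarrow> ('v \<times> 'v) set" where
  "msf E r = {(u, v) \<in> E. (u, v) \<notin> (below E r (r (u, v)))\<^sup>*}"

text \<open>Ranks distinguish undirected edges, which makes the minimum spanning forest
  unique.\<close>

definition ranking :: "('v \<times> 'v) set \<Rightarrow> ('v \<times> 'v \<Rightarrow> nat) \<Rightarrow> bool" where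
  "ranking E r \<longleftrightarrow> finite E \<and> sym E \<and> (\<forall>x. (x, x) \<notin> E) \<and> (\<forall>u v. r (u, v) = r (v, u)) \<and>
     (\<forall>u v a b. (u, v) \<in> E \<longrightarrow> (a, b) \<in> E \<longrightarrow> r (u, v) = r (a, b) \<longrightarrow> (a, b) = (u, v) \<or> (a, b) = (v, u))"

lemma rankingD:
  assumes "ranking E r"
  shows "finite E" "sym E" "(x, x) \<notin> E" "r (u, v) = r (v, u)"
    "(u, v) \<in> E \<Longrightarrow> (a, b) \<in> E \<Longrightarrow> r (u, v) = r (a, b) \<Longrightarrow> (a, b) = (u, v) \<or> (a, b) = (v, u)"
  using assms unfolding ranking_def by blast+

lemma below_sym:
  assumes "ranking E r" "sym S"
  shows "sym (below S r t)"
proof (rule symI)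
  fix u v assume "(u, v) \<in> below S r t"
  then show "(v, u) \<in> below S r t"
    using symD[OF assms(2), of u v] rankingD(4)[OF assms(1), of u v] unfolding below_def by simp
qed

lemma msf_sub: "msf E r \<subseteq> E"
  unfolding msf_def by blast

lemma sym_msf: assumes "ranking E r" shows "sym (msf E r)"
proof (rule symI)
  fix u v assume a: "(u, v) \<in> msf E r"
  then have "(v, u) \<in> E" using rankingD(2)[OF assms] unfolding msf_def sym_def by blast
  moreover have "(v, u) \<notin> (below E r (r (v, u)))\<^sup>*"
    using a rankingD(4)[OF assms, of u v] rtrancl_symD[OF below_sym[OF assms rankingD(2)[OF assms]]]
    unfolding msf_def by auto
  ultimately show "(v, u) \<in> msf E r" unfolding msf_def by blast
qed

lemma below_Suc:
  assumes rk: "ranking E r" and S: "S \<subseteq> E" "sym S" and e: "(a, b) \<in> S" "r (a, b) = t"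
  shows "below S r (Suc t) = below S r t \<union> {(a, b), (b, a)}"
proof -
  have ba: "(b, a) \<in> S" "r (b, a) = t" using S(2) e rankingD(4)[OF rk, of b a] unfolding sym_def by auto
  have "e' = (a, b) \<or> e' = (b, a)" if "e' \<in> S" "r e' = t" for e'
    using rankingD(5)[OF rk, of a b "fst e'" "snd e'"] that e S(1) by auto
  then show ?thesis using e ba unfolding below_def by (auto simp: less_Suc_eq)
qed

lemma below_Suc_none:
  assumes "\<And>e. e \<in> S \<Longrightarrow> r e \<noteq> t"
  shows "below S r (Suc t) = below S r t"
  using assms unfolding below_def by (auto simp: less_Suc_eq)

text \<open>An edge of largest rank on a cycle is never kept. Formally, the edges other than
  \<open>uv\<close> are inserted by increasing rank, and the edge \<open>(c, c')\<close> that first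
  connects \<open>u\<close> and \<open>v\<close> is compared with \<open>uv\<close>.\<close>

lemma forest_msf:
  assumes rk: "ranking E r"
  shows "forest (msf E r)"
  unfolding forest_def
proof (intro conjI allI impI)
  show "sym (msf E r)" by (rule sym_msf[OF rk])
  show "(x, x) \<notin> msf E r" for x using rankingD(3)[OF rk] msf_sub by blast
  fix u v assume uv: "(u, v) \<in> msf E r"
  let ?S = "msf E r - {(u, v), (v, u)}"
  have S: "?S \<subseteq> E" "sym ?S" using msf_sub sym_minus[OF sym_msf[OF rk]] by blast+
  have vu: "r (v, u) = r (u, v)" by (rule rankingD(4)[OF rk])
  have no: "(u, v) \<notin> (below ?S r t)\<^sup>*" for t
  proof (induction t)
    case 0
    have "u \<noteq> v" using uv rankingD(3)[OF rk] msf_sub by blast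
    then show ?case by (simp add: below_def)
  next
    case (Suc t)
    show ?case
    proof (cases "\<exists>e\<in>?S. r e = t")
      case False
      then show ?thesis using Suc below_Suc_none[of ?S r t] by auto
    next
      case True
      then obtain a b where ab: "(a, b) \<in> ?S" "r (a, b) = t" by auto
      have symb: "sym (below ?S r t)" by (rule below_sym[OF rk S(2)])
      show ?thesis
      proof
        assume "(u, v) \<in> (below ?S r (Suc t))\<^sup>*"
        then have "(u, v) \<in> (below ?S r t \<union> {(a, b), (b, a)})\<^sup>*" using below_Suc[OF rk S ab] by simp
        from add_edge_rtrancl[OF this] Suc
        consider "(u, a) \<in> (below ?S r t)\<^sup>*" "(b, v) \<in> (below ?S r t)\<^sup>*"
          | "(u, b) \<in> (below ?S r t)\<^sup>*" "(a, v) \<in> (below ?S r t)\<^sup>*" by blast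
        then obtain c c' where c: "(u, c) \<in> (below ?S r t)\<^sup>*" "(c', v) \<in> (below ?S r t)\<^sup>*"
          "(c, c') \<in> ?S" "r (c, c') = t"
        proof cases
          case 1
          show ?thesis by (rule that[OF 1]) (use ab in auto)
        next
          case 2
          show ?thesis by (rule that[OF 2]) (use ab S(2) rankingD(4)[OF rk, of b a] in \<open>auto simp: sym_def\<close>)
        qed
        have sub: "(below ?S r t)\<^sup>* \<subseteq> (below E r t)\<^sup>*"
          using S(1) by (intro rtrancl_mono) (auto simp: below_def)
        \<comment> \<open>If \<open>(c, c')\<close> ranks below \<open>uv\<close>, edges below
          \<open>uv\<close> connect \<open>u\<close> and \<open>v\<close>; otherwise
          \<open>uv\<close> together with edges below \<open>(c, c')\<close> connects
          \<open>c\<close> and \<open>c'\<close>. Either contradicts membership in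
          \<open>msf\<close>.\<close>
        show False
        proof (cases "t \<le> r (u, v)")
          case True
          have "t \<noteq> r (u, v)"
          proof
            assume "t = r (u, v)"
            then have "(c, c') = (u, v) \<or> (c, c') = (v, u)"
              using rankingD(5)[OF rk, of u v c c'] c S(1) uv msf_sub by auto
            then show False using c(3) by blast
          qed
          then have "t < r (u, v)" using True by simp
          then have "below ?S r t \<union> {(c, c')} \<subseteq> below E r (r (u, v))" using S(1) c(3,4) by (auto simp: below_def)
          then have "(u, c) \<in> (below E r (r (u, v)))\<^sup>*" "(c, c') \<in> below E r (r (u, v))" "(c', v) \<in> (below E r (r (u, v)))\<^sup>*"
            using c rtrancl_mono[of "below ?S r t" "below E r (r (u, v))"] by blast+
          then have "(u, v) \<in> (below E r (r (u, v)))\<^sup>*" by (meson rtrancl_into_rtrancl rtrancl_trans)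
          then show False using uv unfolding msf_def by blast
        next
          case False
          have symE: "sym (below E r t)" by (rule below_sym[OF rk rankingD(2)[OF rk]])
          have "(v, u) \<in> below E r t" "(u, v) \<in> below E r t"
            using False uv vu msf_sub[of E r] rankingD(2)[OF rk] unfolding below_def sym_def by auto
          then have "(c, c') \<in> (below E r t)\<^sup>*"
            using c sub rtrancl_symD[OF symE] by (meson rtrancl_trans r_into_rtrancl subsetD)
          moreover have "(c, c') \<in> msf E r" using c(3) by blast
          ultimately show False using c(4) unfolding msf_def by blast
        qed
      qed
    qed
  qed
  show "(u, v) \<notin> ?S\<^sup>*"
  proof
    assume a: "(u, v) \<in> ?S\<^sup>*"
    have "finite ?S" using finite_subset[OF S(1) rankingD(1)[OF rk]] .
    then obtain t where "\<forall>e\<in>?S. r e < t" using finite_nat_set_iff_bounded[of "r ` ?S"] by auto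
    then have "below ?S r t = ?S" by (auto simp: below_def)
    then show False using no[of t] a by simp
  qed
qed

text \<open>An edge outside the forest can be replaced by edges of smaller rank connecting its
  endpoints, and these by forest edges by induction on the threshold.\<close>

lemma kruskal:
  assumes rk: "ranking E r"
  shows "(below (msf E r) r t)\<^sup>* = (below E r t)\<^sup>*"
proof
  show "(below (msf E r) r t)\<^sup>* \<subseteq> (below E r t)\<^sup>*"
    using msf_sub[of E r] by (intro rtrancl_mono) (auto simp: below_def)
  have "below E r t \<subseteq> (below (msf E r) r t)\<^sup>*"
  proof (induction t rule: less_induct)
    case (less t)
    show ?case
    proof
      fix e assume e: "e \<in> below E r t"
      obtain u v where uv: "e = (u, v)" by (cases e)
      show "e \<in> (below (msf E r) r t)\<^sup>*"
      proof (cases "e \<in> msf E r")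
        case True
        then show ?thesis using e unfolding below_def by auto
      next
        case False
        then have "(u, v) \<in> (below E r (r (u, v)))\<^sup>*" using e unfolding uv below_def msf_def by blast
        also have "\<dots> \<subseteq> (below (msf E r) r (r (u, v)))\<^sup>*"
        proof (rule rtrancl_subset_rtrancl, rule less)
          show "r (u, v) < t" using e unfolding uv below_def by simp
        qed
        also have "\<dots> \<subseteq> (below (msf E r) r t)\<^sup>*"
          using e unfolding uv below_def by (intro rtrancl_mono) auto
        finally show ?thesis unfolding uv .
      qed
    qed
  qed
  then show "(below E r t)\<^sup>* \<subseteq> (below (msf E r) r t)\<^sup>*"
    by (rule rtrancl_subset_rtrancl)
qed

text \<open>Edges are oriented away from the component that selects them; this orientation is what
  later bounds the outdegree.\<close>

definition sel :: "('v \<times> 'v) set \<Rightarrow> ('v \<times> 'v \<Rightarrow> nat) \<Rightarrow> ('v \<times> 'v) set \<Rightarrow> ('v \<times> 'v) set" where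
  "sel E r F = {(u, v) \<in> E. v \<notin> cmp F u \<and>
     (\<forall>a b. (a, b) \<in> E \<longrightarrow> a \<in> cmp F u \<longrightarrow> b \<notin> cmp F u \<longrightarrow> r (u, v) \<le> r (a, b))}"

fun boruvka :: "('v \<times> 'v) set \<Rightarrow> ('v \<times> 'v \<Rightarrow> nat) \<Rightarrow> nat \<Rightarrow> ('v \<times> 'v) set" where
  "boruvka E r 0 = {}"
| "boruvka E r (Suc p) = boruvka E r p \<union> sel E r (boruvka E r p \<union> (boruvka E r p)\<inverse>)"

lemma sel_msf: "sel E r F \<subseteq> msf E r"
proof
  fix e assume "e \<in> sel E r F"
  then obtain u v where e: "e = (u, v)" "(u, v) \<in> E" "v \<notin> cmp F u"
    "\<And>a b. (a, b) \<in> E \<Longrightarrow> a \<in> cmp F u \<Longrightarrow> b \<notin> cmp F u \<Longrightarrow> r (u, v) \<le> r (a, b)"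
    unfolding sel_def by auto
  have "y \<in> cmp F u" if "(u, y) \<in> (below E r (r (u, v)))\<^sup>*" for y
    using that
  proof (induction rule: rtrancl_induct)
    case (step a b)
    then show ?case using e(4)[of a b] unfolding below_def by auto
  qed simp
  then show "e \<in> msf E r" using e unfolding msf_def by blast
qed

lemma boruvka_msf:
  assumes rk: "ranking E r"
  shows "boruvka E r p \<subseteq> msf E r" "boruvka E r p \<union> (boruvka E r p)\<inverse> \<subseteq> msf E r"
proof -
  show 1: "boruvka E r p \<subseteq> msf E r"
  proof (induction p)
    case (Suc p)
    then show ?case using sel_msf[of E r "boruvka E r p \<union> (boruvka E r p)\<inverse>"] by simp
  qed simp
  then show "boruvka E r p \<union> (boruvka E r p)\<inverse> \<subseteq> msf E r" using sym_msf[OF rk] unfolding sym_def by blast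
qed

text \<open>As ranks identify edges, a vertex is the tail of at most one selected edge per
  phase.\<close>

lemma boruvka_out:
  assumes rk: "ranking E r"
  shows "finite (boruvka E r p `` {v})" "card (boruvka E r p `` {v}) \<le> p"
proof -
  have one: "a = b" if "(v, a) \<in> sel E r F" "(v, b) \<in> sel E r F" for a b F
  proof -
    have "r (v, a) = r (v, b)" using that unfolding sel_def by (auto intro!: antisym)
    then show ?thesis using rankingD(5)[OF rk, of v a v b] rankingD(3)[OF rk] that unfolding sel_def by auto
  qed
  have c1: "finite (sel E r F `` {v}) \<and> card (sel E r F `` {v}) \<le> 1" for F
  proof (cases "sel E r F `` {v} = {}")
    case False
    then obtain a where "sel E r F `` {v} = {a}" using one[of _ F] by blast
    then show ?thesis by simp
  qed simp
  have "finite (boruvka E r p `` {v}) \<and> card (boruvka E r p `` {v}) \<le> p"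
  proof (induction p)
    case (Suc p)
    let ?F = "boruvka E r p \<union> (boruvka E r p)\<inverse>"
    have "card (boruvka E r (Suc p) `` {v}) \<le> card (boruvka E r p `` {v}) + card (sel E r ?F `` {v})"
      by (simp add: Un_Image card_Un_le)
    also have "\<dots> \<le> Suc p" using Suc c1[of ?F] by linarith
    finally show ?case using Suc c1[of ?F] by (simp add: Un_Image)
  qed simp
  then show "finite (boruvka E r p `` {v})" "card (boruvka E r p `` {v}) \<le> p" by blast+
qed

lemma closed_cmp:
  assumes "sym F" "F \<subseteq> E" "\<And>a b. (a, b) \<in> E \<Longrightarrow> a \<in> cmp F x \<Longrightarrow> b \<in> cmp F x"
  shows "cmp F x = cmp E x"
proof
  show "cmp F x \<subseteq> cmp E x" by (rule cmp_mono) fact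
  show "cmp E x \<subseteq> cmp F x"
  proof
    fix y assume "y \<in> cmp E x"
    then have "(x, y) \<in> E\<^sup>*" by (simp add: cmp_iff)
    then show "y \<in> cmp F x" by (induction rule: rtrancl_induct) (use assms(3) in auto)
  qed
qed

text \<open>An unfinished component merges with the component at the other end of its selected edge.
  That one is unfinished as well, hence also has at least \<open>2 ^ p\<close> vertices.\<close>

lemma boruvka_grow:
  assumes rk: "ranking E r" and V: "finite V" "E \<subseteq> V \<times> V" and x: "x \<in> V"
  defines "F \<equiv> \<lambda>p. boruvka E r p \<union> (boruvka E r p)\<inverse>"
  shows "cmp (F p) x = cmp E x \<or> 2 ^ p \<le> card (cmp (F p) x)"
  using x
proof (induction p arbitrary: x)
  case 0
  have "finite (cmp (F 0) x)" using V 0 finite_subset[OF cmp_subset[of "F 0" V x]] by (simp add: F_def)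
  moreover have "cmp (F 0) x \<noteq> {}" using cmp_self[of x "F 0"] by blast
  ultimately have "0 < card (cmp (F 0) x)" by (simp add: card_gt_0_iff)
  then show ?case by simp
next
  case (Suc p)
  have FE: "F p \<subseteq> E" "F (Suc p) \<subseteq> E" for p
    using boruvka_msf(2)[OF rk] msf_sub[of E r] unfolding F_def by blast+
  have symF: "sym (F p)" for p unfolding F_def sym_def by blast
  have mono: "F p \<subseteq> F (Suc p)" unfolding F_def by auto
  have fin: "finite (cmp (F q) y)" if "y \<in> V" for q y
    using finite_subset[OF cmp_subset[of "F q" V y] V(1)] FE(1)[of q] V(2) that by blast
  show ?case
  proof (cases "cmp (F (Suc p)) x = cmp E x")
    case False
    have ne: "cmp (F p) x \<noteq> cmp E x"
    proof
      assume "cmp (F p) x = cmp E x"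
      then have "cmp E x \<subseteq> cmp (F (Suc p)) x" using cmp_mono[OF mono, of x] by simp
      then show False using False cmp_mono[OF FE(2), of p x] by blast
    qed
    then have cx: "2 ^ p \<le> card (cmp (F p) x)" using Suc by blast
    let ?X = "cmp (F p) x"
    let ?out = "{e \<in> E. fst e \<in> ?X \<and> snd e \<notin> ?X}"
    have "?out \<noteq> {}"
    proof
      assume "?out = {}"
      then have "b \<in> ?X" if "(a, b) \<in> E" "a \<in> ?X" for a b using that by force
      then show False using closed_cmp[OF symF FE(1)] ne by blast
    qed
    moreover have fo: "finite ?out" using rankingD(1)[OF rk] by simp
    ultimately have "Min (r ` ?out) \<in> r ` ?out" by (intro Min_in finite_imageI) simp_all
    then obtain e where e0: "Min (r ` ?out) = r e" and e1: "e \<in> ?out" by (rule imageE)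
    have e2: "r e \<le> r e'" if "e' \<in> ?out" for e'
      unfolding e0[symmetric] using fo that by (intro Min_le finite_imageI imageI)
    obtain u v where uv: "e = (u, v)" by (cases e)
    have u: "u \<in> ?X" "v \<notin> ?X" "(u, v) \<in> E" using e1 uv by auto
    have cu: "cmp (F p) u = ?X" using u(1) cmp_eq[OF symF, of x u] by (simp add: cmp_iff)
    have "r (u, v) \<le> r (a, b)" if "(a, b) \<in> E" "a \<in> ?X" "b \<notin> ?X" for a b
      using e2[of "(a, b)"] that uv by simp
    then have "(u, v) \<in> sel E r (F p)" unfolding sel_def mem_Collect_eq prod.case cu
      using u by blast
    then have se: "(u, v) \<in> F (Suc p)" unfolding F_def by simp
    have vV: "v \<in> V" using u(3) V(2) by blast
    have unv: "u \<notin> cmp (F p) v"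
    proof
      assume "u \<in> cmp (F p) v"
      then have "cmp (F p) v = cmp (F p) u" using cmp_eq[OF symF] by (simp only: cmp_iff)
      then show False using cu u(2) cmp_self[of v "F p"] by simp
    qed
    have "u \<in> cmp E v" using u(3) rankingD(2)[OF rk] by (auto simp: cmp_iff sym_def)
    then have "cmp (F p) v \<noteq> cmp E v" using unv by blast
    then have cv: "2 ^ p \<le> card (cmp (F p) v)" using Suc.IH[OF vV] by blast
    have disj: "?X \<inter> cmp (F p) v = {}"
    proof (rule ccontr)
      assume "?X \<inter> cmp (F p) v \<noteq> {}"
      then obtain w where "(x, w) \<in> (F p)\<^sup>*" "(v, w) \<in> (F p)\<^sup>*" by (auto simp: cmp_iff)
      then have "(x, v) \<in> (F p)\<^sup>*" using rtrancl_symD[OF symF] by (meson rtrancl_trans)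
      then show False using u(2) by (simp add: cmp_iff)
    qed
    have "?X \<subseteq> cmp (F (Suc p)) x" by (rule cmp_mono[OF mono])
    moreover have "cmp (F p) v \<subseteq> cmp (F (Suc p)) x"
    proof -
      have "(x, u) \<in> (F (Suc p))\<^sup>*" using u(1) cmp_mono[OF mono, of x] by (auto simp: cmp_iff)
      then have "(x, v) \<in> (F (Suc p))\<^sup>*" using se by simp
      then have "cmp (F (Suc p)) v = cmp (F (Suc p)) x" using cmp_eq[OF symF] by blast
      then show ?thesis using cmp_mono[OF mono, of v] by blast
    qed
    ultimately have "card (?X \<union> cmp (F p) v) \<le> card (cmp (F (Suc p)) x)" by (intro card_mono fin Suc.prems) blast
    also have "card (?X \<union> cmp (F p) v) = card ?X + card (cmp (F p) v)"
      by (rule card_Un_disjoint[OF fin[OF Suc.prems] fin[OF vV] disj])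
    finally show ?thesis using cx cv by simp
  qed simp
qed

text \<open>Once the components are those of \<open>E\<close>, an edge of \<open>msf\<close> missing
  from the selected ones would close a cycle in \<open>msf\<close>.\<close>

lemma boruvka_done:
  assumes rk: "ranking E r" and V: "finite V" "E \<subseteq> V \<times> V" and p: "card V < 2 ^ p"
  shows "boruvka E r p \<union> (boruvka E r p)\<inverse> = msf E r"
proof
  let ?F = "boruvka E r p \<union> (boruvka E r p)\<inverse>"
  show sub: "?F \<subseteq> msf E r" by (rule boruvka_msf[OF rk])
  show "msf E r \<subseteq> ?F"
  proof
    fix e assume e: "e \<in> msf E r"
    obtain u v where uv: "e = (u, v)" by (cases e)
    have uV: "u \<in> V" using e uv msf_sub[of E r] V by blast
    have "card (cmp ?F u) \<le> card V"
      using cmp_subset[of ?F V u] sub msf_sub[of E r] V uV by (intro card_mono) auto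
    then have "cmp ?F u = cmp E u" using boruvka_grow[OF rk V uV, of p] p by simp
    moreover have "v \<in> cmp E u" using e uv msf_sub[of E r] by (auto simp: cmp_iff)
    ultimately have conn: "(u, v) \<in> ?F\<^sup>*" by (simp flip: cmp_iff)
    show "e \<in> ?F"
    proof (rule ccontr)
      assume "e \<notin> ?F"
      then have "?F \<subseteq> msf E r - {(u, v), (v, u)}" using sub uv by auto
      then have "(u, v) \<in> (msf E r - {(u, v), (v, u)})\<^sup>*" using conn rtrancl_mono by blast
      then show False using forestD(3)[OF forest_msf[OF rk]] e uv by blast
    qed
  qed
qed

section \<open>Boruvka's method in the network\<close>

context big_network
begin

definition ledges :: "(inst \<Rightarrow> (nat \<times> nat) set) \<Rightarrow> (inst \<Rightarrow> nat \<times> nat \<Rightarrow> nat) \<Rightarrow> inst \<Rightarrow> nat \<Rightarrow> (nat \<times> nat) set" where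
  "ledges E r z v = {(u, r z (v, u)) | u. (v, u) \<in> E z}"

definition bor :: "(inst \<Rightarrow> (nat \<times> nat) set) \<Rightarrow> (inst \<Rightarrow> nat \<times> nat \<Rightarrow> nat) \<Rightarrow> nat \<Rightarrow> inst \<Rightarrow> (nat \<times> nat) set" where
  "bor E r p z = boruvka (E z) (r z) p"

context
  fixes E :: "inst \<Rightarrow> (nat \<times> nat) set" and r :: "inst \<Rightarrow> nat \<times> nat \<Rightarrow> nat" and B :: nat
  assumes rk: "\<And>z. ok z \<Longrightarrow> ranking (E z) (r z)"
    and Ewt: "\<And>z u v. ok z \<Longrightarrow> (u, v) \<in> E z \<Longrightarrow> 0 < wt z u v"
    and rB: "\<And>z u v. ok z \<Longrightarrow> (u, v) \<in> E z \<Longrightarrow> r z (u, v) < B"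
    and msgB: "n ^ 6 * (B + 2) \<le> msg_bound \<kappa> n" and msgn: "n ^ 6 * (n + 1) \<le> msg_bound \<kappa> n"
begin

lemma bor_msf: "ok z \<Longrightarrow> fr (bor E r p) z \<subseteq> msf (E z) (r z)"
  using boruvka_msf(2)[OF rk] unfolding fr_def bor_def .

lemma E_lt: "ok z \<Longrightarrow> (u, v) \<in> E z \<Longrightarrow> u < n \<and> v < n"
  using wt_lt[OF _ Ewt] .

lemma E_sub: "ok z \<Longrightarrow> E z \<subseteq> {..<n} \<times> {..<n}"
  using E_lt by auto

lemma oriented_bor: "p \<le> lg \<Longrightarrow> oriented (bor E r p)"
  unfolding oriented_def
proof (intro allI impI conjI)
  fix z assume p: "p \<le> lg" and z: "ok z"
  show "forest (fr (bor E r p) z)"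
    by (rule forest_subset[OF forest_msf[OF rk[OF z]] bor_msf[OF z]]) (auto simp: fr_def sym_def)
  show "0 < wt z u v" if "(u, v) \<in> bor E r p z" for u v
    using that bor_msf[OF z, of p] msf_sub[of "E z" "r z"] Ewt[OF z] unfolding fr_def by blast
  show "card (bor E r p z `` {v}) \<le> lg" for v
    using boruvka_out(2)[OF rk[OF z], of p v] p unfolding bor_def by simp
qed

text \<open>One phase: components are named by \<open>cmin\<close>, neighbours exchange names to
  recognise outgoing edges, a second \<open>cmin\<close> finds the least outgoing rank, and the
  endpoint inside the component that has this edge informs the other endpoint.\<close>

lemma known_bor_step:
  assumes X: "known R X" and p: "p < lg" and L: "det X (links (bor E r p))" and LE: "det X (ledges E r)"
  shows "known (R + 4 + 8 * lg) (\<lambda>z v. (X z v, links (bor E r (Suc p)) z v))"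
proof -
  let ?Q = "bor E r p"
  have Q: "oriented ?Q" using oriented_bor p by simp
  have "n \<le> n ^ 4" using n2 power_increasing[of 1 4 n] by simp
  then have nmsg: "n \<le> msg_bound \<kappa> n" "2 \<le> msg_bound \<kappa> n" using msg4 n2 by linarith+
  have K1: "known (R + 1 + 4 * lg) (\<lambda>z v. (X z v, cmin ?Q (\<lambda>z v. enat v) z v))"
    using X Q L
  proof (rule known_cmin[where M = "enat ` {..<n}"])
    show "det X (\<lambda>z v. enat v)" by (rule detI) simp
    show "n ^ 6 * (card (enat ` {..<n}) + 1) \<le> msg_bound \<kappa> n" using msgn by (simp add: card_image inj_on_def)
  qed auto
  let ?hd = "head ?Q"
  have K2: "known (Suc (R + 1 + 4 * lg)) (\<lambda>z v. ((X z v, cmin ?Q (\<lambda>z v. enat v) z v),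
     \<lambda>u. if u < n \<and> 0 < wt z v u then Some (?hd z u) else None))"
    using K1
  proof (rule known_local[where LM = "{..<n}"])
    show "det (\<lambda>z v. (X z v, cmin ?Q (\<lambda>z v. enat v) z v)) (\<lambda>z v u. ?hd z v)"
      unfolding cmin_id by (rule detI) simp
    show "?hd z v \<in> {..<n}" if "ok z" "v < n" for z v using head_lt[OF Q that] by simp
  qed (use nmsg in simp_all)
  let ?Y = "\<lambda>z v. ((X z v, cmin ?Q (\<lambda>z v. enat v) z v), \<lambda>u. if u < n \<and> 0 < wt z v u then Some (?hd z u) else None)"
  define outs where "outs z v = {(u, r z (v, u)) | u. (v, u) \<in> E z \<and> ?hd z u \<noteq> ?hd z v}" for z v
  have outs_det: "det ?Y outs"
  proof (rule detI)
    fix z z' :: inst and v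
    assume a: "ok z" "ok z'" "v < n" "wt z v = wt z' v" "rn z v = rn z' v" "?Y z v = ?Y z' v"
    have le: "(ledges E r) z v = (ledges E r) z' v" using a by (intro detD[OF LE]) auto
    have hd: "?hd z v = ?hd z' v" using a(6) unfolding cmin_id by simp
    have nb: "(if u < n \<and> 0 < wt z v u then Some (?hd z u) else None) = (if u < n \<and> 0 < wt z' v u then Some (?hd z' u) else None)" for u
      using a(6) by (simp add: fun_eq_iff)
    have alt: "outs w v = {(u, x) \<in> (ledges E r) w v. (if u < n \<and> 0 < wt w v u then Some (?hd w u) else None) \<noteq> Some (?hd w v)}"
      if "ok w" for w
      using Ewt[OF that, of v] E_lt[OF that, of v] unfolding outs_def ledges_def by auto
    show "outs z v = outs z' v" unfolding alt[OF a(1)] alt[OF a(2)] le hd nb ..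
  qed
  have hd_cmp: "?hd z u = ?hd z v \<longleftrightarrow> u \<in> cmp (fr ?Q z) v" if "ok z" "u < n" "v < n" for z u v
  proof
    assume "?hd z u = ?hd z v"
    then have "cmp (fr ?Q z) u = cmp (fr ?Q z) v"
      using cmp_cong[OF Q that(1) head_in[OF Q, of z u]] cmp_cong[OF Q that(1) head_in[OF Q, of z v]] by metis
    then show "u \<in> cmp (fr ?Q z) v" using cmp_self[of u "fr ?Q z"] by simp
  qed (rule head_cong[OF Q that(1)])
  define f where "f z v = (INF e\<in>outs z v. enat (snd e))" for z v
  have outs_fin: "finite (outs z v)" if "ok z" for z v
  proof -
    have "outs z v \<subseteq> (\<lambda>u. (u, r z (v, u))) ` {..<n}" using E_sub[OF that] unfolding outs_def by auto
    then show ?thesis by (rule finite_subset) simp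
  qed
  have K3: "known (Suc (R + 1 + 4 * lg) + 1 + 4 * lg) (\<lambda>z v. (?Y z v, cmin ?Q f z v))"
    using K2 Q
  proof (rule known_cmin[where M = "insert \<infinity> (enat ` {..<B})"])
    show "det ?Y (links ?Q)" by (rule det_trans[OF _ L], rule detI) blast
    show "det ?Y f" using outs_det by (rule det_map[where f = "\<lambda>S. INF e\<in>S. enat (snd e)"]) (simp add: f_def)
    show "n ^ 6 * (card (insert \<infinity> (enat ` {..<B})) + 1) \<le> msg_bound \<kappa> n"
      using msgB by (simp add: card_insert_if card_image inj_on_def)
    show "f z v \<in> insert \<infinity> (enat ` {..<B})" if z: "ok z" and v: "v < n" for z v
    proof (cases "outs z v = {}")
      case True
      then show ?thesis by (simp add: f_def top_enat_def)
    next
      case False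
      then have "f z v \<in> (\<lambda>e. enat (snd e)) ` outs z v"
        unfolding f_def using outs_fin[OF z] by (intro finite_Inf_in) (auto simp: inf_min min_def)
      then obtain u where "(v, u) \<in> E z" "f z v = enat (r z (v, u))" unfolding outs_def by auto
      then show ?thesis using rB[OF z] by blast
    qed
  qed simp
  define pick where "pick z v = {u. (u, r z (v, u)) \<in> outs z v \<and> enat (r z (v, u)) = cmin ?Q f z v}" for z v
  have pick_sel: "u \<in> pick z v \<longleftrightarrow> (v, u) \<in> sel (E z) (r z) (fr ?Q z)" if z: "ok z" and v: "v < n" for z v u
  proof -
    have o: "(u, r z (v, u)) \<in> outs z v \<longleftrightarrow> (v, u) \<in> E z \<and> u \<notin> cmp (fr ?Q z) v" for u v
    proof -
      have "(u, r z (v, u)) \<in> outs z v \<longleftrightarrow> (v, u) \<in> E z \<and> ?hd z u \<noteq> ?hd z v" unfolding outs_def by blast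
      then show ?thesis using hd_cmp[OF z, of u v] E_lt[OF z, of v u] by blast
    qed
    have le_iff: "enat k \<le> cmin ?Q f z v \<longleftrightarrow> (\<forall>a b. (a, b) \<in> E z \<longrightarrow> a \<in> cmp (fr ?Q z) v \<longrightarrow> b \<notin> cmp (fr ?Q z) v \<longrightarrow> k \<le> r z (a, b))" for k
    proof -
      have "enat k \<le> cmin ?Q f z v \<longleftrightarrow> (\<forall>a\<in>cmp (fr ?Q z) v. \<forall>e\<in>outs z a. enat k \<le> enat (snd e))"
        unfolding cmin_def f_def le_INF_iff ..
      also have "\<dots> \<longleftrightarrow> (\<forall>a\<in>cmp (fr ?Q z) v. \<forall>b. (b, r z (a, b)) \<in> outs z a \<longrightarrow> k \<le> r z (a, b))"
        by (intro ball_cong refl) (auto simp: outs_def)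
      also have "\<dots> \<longleftrightarrow> (\<forall>a\<in>cmp (fr ?Q z) v. \<forall>b. (a, b) \<in> E z \<and> b \<notin> cmp (fr ?Q z) v \<longrightarrow> k \<le> r z (a, b))"
        by (intro ball_cong refl) (simp add: o cmp_cong[OF Q z])
      finally show ?thesis by blast
    qed
    have "cmin ?Q f z v \<le> enat (r z (v, u))" if "(u, r z (v, u)) \<in> outs z v"
    proof -
      have "f z v \<le> enat (r z (v, u))" unfolding f_def using that by (intro INF_lower2[of "(u, r z (v, u))"]) auto
      then show ?thesis unfolding cmin_def by (intro INF_lower2[of v]) auto
    qed
    then have "u \<in> pick z v \<longleftrightarrow> (u, r z (v, u)) \<in> outs z v \<and> enat (r z (v, u)) \<le> cmin ?Q f z v"
      unfolding pick_def mem_Collect_eq using order.eq_iff[of "enat (r z (v, u))" "cmin ?Q f z v"] by argo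
    then have "u \<in> pick z v \<longleftrightarrow> (v, u) \<in> E z \<and> u \<notin> cmp (fr ?Q z) v \<and>
        (\<forall>a b. (a, b) \<in> E z \<longrightarrow> a \<in> cmp (fr ?Q z) v \<longrightarrow> b \<notin> cmp (fr ?Q z) v \<longrightarrow> r z (v, u) \<le> r z (a, b))"
      unfolding o le_iff by blast
    then show ?thesis unfolding sel_def by blast
  qed
  let ?W = "\<lambda>z v. (?Y z v, cmin ?Q f z v)"
  have pick_det: "det ?W pick"
  proof (rule detI)
    fix z z' :: inst and v
    assume a: "ok z" "ok z'" "v < n" "wt z v = wt z' v" "rn z v = rn z' v" "?W z v = ?W z' v"
    have "outs z v = outs z' v" using a by (intro detD[OF outs_det]) auto
    moreover have "cmin ?Q f z v = cmin ?Q f z' v" using a(6) by blast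
    moreover have "pick w v = {u. \<exists>x. (u, x) \<in> outs w v \<and> enat x = cmin ?Q f w v}" for w
      unfolding pick_def outs_def by auto
    ultimately show "pick z v = pick z' v" by (simp only:)
  qed
  have K4: "known (Suc (Suc (R + 1 + 4 * lg) + 1 + 4 * lg)) (\<lambda>z v. (?W z v,
     \<lambda>u. if u < n \<and> 0 < wt z v u then Some (v \<in> pick z u) else None))"
    using K3
  proof (rule known_local[where LM = "UNIV :: bool set"])
    show "det ?W (\<lambda>z v u. u \<in> pick z v)" using pick_det by (rule det_via) simp
  qed (use nmsg in simp_all)
  have links: "links (bor E r (Suc p)) z v = (fst (links ?Q z v) \<union> pick z v,
      snd (links ?Q z v) \<union> {u. (if u < n \<and> 0 < wt z v u then Some (v \<in> pick z u) else None) = Some True})"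
    if z: "ok z" and v: "v < n" for z v
  proof -
    have b: "bor E r (Suc p) z = ?Q z \<union> sel (E z) (r z) (fr ?Q z)" unfolding bor_def fr_def by simp
    have "sel (E z) (r z) (fr ?Q z) `` {v} = pick z v" using pick_sel[OF z v] by blast
    moreover have "(sel (E z) (r z) (fr ?Q z))\<inverse> `` {v} =
      {u. (if u < n \<and> 0 < wt z v u then Some (v \<in> pick z u) else None) = Some True}"
    proof (intro set_eqI iffI)
      fix u assume "u \<in> (sel (E z) (r z) (fr ?Q z))\<inverse> `` {v}"
      then have s: "(u, v) \<in> sel (E z) (r z) (fr ?Q z)" by blast
      then have "0 < wt z v u" "u < n" using Ewt[OF z, of u v] wt_lt[OF z] wt_sym[OF z, of u v] unfolding sel_def by auto
      then show "u \<in> {u. (if u < n \<and> 0 < wt z v u then Some (v \<in> pick z u) else None) = Some True}"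
        using pick_sel[OF z, of u v] s by simp
    next
      fix u assume "u \<in> {u. (if u < n \<and> 0 < wt z v u then Some (v \<in> pick z u) else None) = Some True}"
      then have "u < n" "v \<in> pick z u" by (auto split: if_splits)
      then show "u \<in> (sel (E z) (r z) (fr ?Q z))\<inverse> `` {v}" using pick_sel[OF z, of u v] by blast
    qed
    ultimately show ?thesis unfolding links_def b converse_Un Un_Image by simp
  qed
  have "Suc (Suc (R + 1 + 4 * lg) + 1 + 4 * lg) = R + 4 + 8 * lg" by simp
  with K4 have K5: "known (R + 4 + 8 * lg) (\<lambda>z v. (?W z v,
     \<lambda>u. if u < n \<and> 0 < wt z v u then Some (v \<in> pick z u) else None))" by (simp only:)
  show ?thesis
  proof (rule known_via[OF K5])
    let ?P = "\<lambda>z v u. if u < n \<and> 0 < wt z v u then Some (v \<in> pick z u) else None"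
    fix z z' :: inst and v
    assume a: "ok z" "ok z'" "v < n" "wt z v = wt z' v" "rn z v = rn z' v" "(?W z v, ?P z v) = (?W z' v, ?P z' v)"
    have x: "X z v = X z' v" using a(6) by blast
    have "links ?Q z v = links ?Q z' v" by (rule detD[OF L a(1-5) x])
    moreover have "pick z v = pick z' v" by (rule detD[OF pick_det a(1-5)]) (use a(6) in blast)
    moreover have "?P z v = ?P z' v" using a(6) by blast
    then have "?P z v u = ?P z' v u" for u by (rule fun_cong)
    ultimately show "(X z v, links (bor E r (Suc p)) z v) = (X z' v, links (bor E r (Suc p)) z' v)"
      unfolding links[OF a(1,3)] links[OF a(2,3)] x by simp
  qed
qed

lemma known_bor:
  assumes X: "known R X" and LE: "det X (ledges E r)" and p: "p \<le> lg"
  shows "known (R + p * (4 + 8 * lg)) (\<lambda>z v. (X z v, links (bor E r p) z v))"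
  using p
proof (induction p)
  case 0
  have "links (bor E r 0) z v = ({}, {})" for z v by (simp add: links_def bor_def)
  then show ?case by simp (rule known_via[OF X], simp)
next
  case (Suc p)
  let ?Y = "\<lambda>z v. (X z v, links (bor E r p) z v)"
  have "known (R + p * (4 + 8 * lg) + 4 + 8 * lg) (\<lambda>z v. (?Y z v, links (bor E r (Suc p)) z v))"
  proof (rule known_bor_step)
    show "known (R + p * (4 + 8 * lg)) ?Y" using Suc by simp
    show "det ?Y (links (bor E r p))" by (rule detI) simp
    show "det ?Y (ledges E r)" by (rule det_trans[OF _ LE], rule detI) blast
  qed (use Suc in simp)
  then have "known (R + Suc p * (4 + 8 * lg)) (\<lambda>z v. (?Y z v, links (bor E r (Suc p)) z v))" by (simp add: ac_simps)
  then show ?case by (rule known_via) simp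
qed

lemma fr_bor: "ok z \<Longrightarrow> fr (bor E r lg) z = msf (E z) (r z)"
  using boruvka_done[OF rk finite_lessThan E_sub, of z lg] lg_pow unfolding fr_def bor_def by simp

end

end

section \<open>Greedy tree packing\<close>

definition pairs :: "nat \<Rightarrow> (nat \<times> nat) set" where
  "pairs n = {(u, v). u < v \<and> v < n}"

lemma finite_pairs [simp]: "finite (pairs n)"
  by (rule finite_subset[of _ "{..<n} \<times> {..<n}"]) (auto simp: pairs_def)

definition sep :: "nat set \<Rightarrow> nat \<times> nat \<Rightarrow> bool" where
  "sep S e \<longleftrightarrow> (fst e \<in> S) \<noteq> (snd e \<in> S)"

lemma weighted_graphD:
  assumes "weighted_graph n h d"
  shows "h u v = h v u" "h v v = 0" "0 < h u v \<Longrightarrow> u < n \<and> v < n" "h u v \<le> n ^ d"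
  using assms unfolding weighted_graph_def by (blast, blast, metis not_le less_irrefl, blast)

lemma cut_weight_pairs:
  assumes sy: "\<And>u v. h u v = h v u" and S: "S \<subseteq> {..<n}"
  shows "cut_weight n h S = (\<Sum>e\<in>{e \<in> pairs n. sep S e}. h (fst e) (snd e))"
proof -
  have fin: "finite S" "finite ({0..<n} - S)" using S finite_subset by auto
  have "cut_weight n h S = (\<Sum>e\<in>S \<times> ({0..<n} - S). h (fst e) (snd e))"
    unfolding cut_weight_def by (subst sum.cartesian_product) (simp add: case_prod_unfold)
  also have "\<dots> = (\<Sum>e\<in>{e \<in> pairs n. sep S e}. h (fst e) (snd e))"
  proof (rule sum.reindex_bij_witness[of _ "\<lambda>(u, v). if u \<in> S then (u, v) else (v, u)" "\<lambda>(u, v). if u < v then (u, v) else (v, u)"])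
    fix e assume "e \<in> S \<times> ({0..<n} - S)"
    then obtain a b where e: "e = (a, b)" "a \<in> S" "b \<notin> S" "b < n" "a < n" using S by auto
    then have "a \<noteq> b" by blast
    then consider "a < b" | "b < a" by linarith
    note c = this
    show "(case case e of (u, v) \<Rightarrow> if u < v then (u, v) else (v, u) of (u, v) \<Rightarrow> if u \<in> S then (u, v) else (v, u)) = e"
      using c by cases (use e in auto)
    show "(case e of (u, v) \<Rightarrow> if u < v then (u, v) else (v, u)) \<in> {e \<in> pairs n. sep S e}"
      using c by cases (use e in \<open>auto simp: pairs_def sep_def\<close>)
    show "h (fst (case e of (u, v) \<Rightarrow> if u < v then (u, v) else (v, u))) (snd (case e of (u, v) \<Rightarrow> if u < v then (u, v) else (v, u))) = h (fst e) (snd e)"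
      using sy[of a b] e by simp
  next
    fix e assume "e \<in> {e \<in> pairs n. sep S e}"
    then obtain a b where e: "e = (a, b)" "a < b" "b < n" "(a \<in> S) \<noteq> (b \<in> S)" by (auto simp: pairs_def sep_def)
    show "(case case e of (u, v) \<Rightarrow> if u \<in> S then (u, v) else (v, u) of (u, v) \<Rightarrow> if u < v then (u, v) else (v, u)) = e"
      using e by auto
    show "(case e of (u, v) \<Rightarrow> if u \<in> S then (u, v) else (v, u)) \<in> S \<times> ({0..<n} - S)"
      using e by auto
  qed
  finally show ?thesis .
qed

section \<open>Loads, ranks and light edges\<close>

definition edges :: "(nat \<Rightarrow> nat \<Rightarrow> nat) \<Rightarrow> (nat \<times> nat) set" where
  "edges h = {(u, v). 0 < h u v}"

text \<open>The trailing part names the edge and stays below \<open>n ^ 2\<close>, so a comparison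
  with \<open>t * n ^ 2\<close> sees only the load.\<close>

definition rank :: "nat \<Rightarrow> (nat \<Rightarrow> nat \<Rightarrow> nat) \<Rightarrow> (nat \<Rightarrow> nat \<Rightarrow> nat) \<Rightarrow> nat \<times> nat \<Rightarrow> nat" where
  "rank n h L e = L (fst e) (snd e) div h (fst e) (snd e) * n ^ 2 + min (fst e) (snd e) * n + max (fst e) (snd e)"

text \<open>Greedy tree packing: every edge \<open>e\<close> stands for \<open>h e\<close> parallel unit copies, and the load of the
  least loaded copy is \<open>load e div h e\<close>. The rank breaks ties between equal loads.\<close>

fun load :: "nat \<Rightarrow> (nat \<Rightarrow> nat \<Rightarrow> nat) \<Rightarrow> nat \<Rightarrow> nat \<Rightarrow> nat \<Rightarrow> nat" where
  "load n h 0 u v = 0"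
| "load n h (Suc i) u v = load n h i u v + of_bool ((u, v) \<in> msf (edges h) (rank n h (load n h i)))"

definition tree :: "nat \<Rightarrow> (nat \<Rightarrow> nat \<Rightarrow> nat) \<Rightarrow> nat \<Rightarrow> (nat \<times> nat) set" where
  "tree n h i = msf (edges h) (rank n h (load n h i))"

definition key :: "nat \<Rightarrow> (nat \<Rightarrow> nat \<Rightarrow> nat) \<Rightarrow> nat \<Rightarrow> nat \<times> nat \<Rightarrow> nat" where
  "key n h i e = load n h i (fst e) (snd e) div h (fst e) (snd e)"

definition light :: "nat \<Rightarrow> (nat \<Rightarrow> nat \<Rightarrow> nat) \<Rightarrow> nat \<Rightarrow> nat \<Rightarrow> (nat \<times> nat) set" where
  "light n h i t = {e \<in> edges h. key n h i e < t}"

definition ncomp :: "nat \<Rightarrow> (nat \<times> nat) set \<Rightarrow> nat" where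
  "ncomp n F = card (cmp F ` {..<n})"

lemma code_lt: "u < n \<Longrightarrow> v < n \<Longrightarrow> u * n + v < (n::nat) ^ 2"
proof -
  assume uv: "u < n" "v < n"
  then have "u * n + v < (u + 1) * n" unfolding add_mult_distrib mult_1 by linarith
  also have "\<dots> \<le> n * n" using uv by (intro mult_le_mono1) simp
  finally show ?thesis by (simp add: power2_eq_square)
qed

lemma code_inj: "u * n + v = a * n + b \<Longrightarrow> v < n \<Longrightarrow> b < n \<Longrightarrow> u = a \<and> v = (b::nat)"
proof -
  assume a: "u * n + v = a * n + b" "v < n" "b < n"
  have "u = (u * n + v) div n" using a(2) by (subst div_mult_self3) auto
  moreover have "a = (a * n + b) div n" using a(3) by (subst div_mult_self3) auto
  ultimately show ?thesis using a(1) by simp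
qed

context
  fixes n d :: nat and h :: "nat \<Rightarrow> nat \<Rightarrow> nat"
  assumes h: "weighted_graph n h d" and n2: "2 \<le> n"
begin

lemma edges_sub: "edges h \<subseteq> {..<n} \<times> {..<n}"
  using weighted_graphD(3)[OF h] unfolding edges_def by auto

lemma load_sym: "load n h i u v = load n h i v u" and ranking_load: "ranking (edges h) (rank n h (load n h i))"
proof -
  have rk: "ranking (edges h) (rank n h L)" if L: "\<And>u v. L u v = L v u" for L
    unfolding ranking_def
  proof (intro conjI allI impI)
    show "finite (edges h)" using edges_sub by (rule finite_subset) simp
    show "sym (edges h)"
    proof (rule symI)
      fix u v assume "(u, v) \<in> edges h"
      then show "(v, u) \<in> edges h" using weighted_graphD(1)[OF h, of u v] by (simp add: edges_def)
    qed
    show "(x, x) \<notin> edges h" for x using weighted_graphD(2)[OF h] unfolding edges_def by simp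
    show "rank n h L (u, v) = rank n h L (v, u)" for u v
      unfolding rank_def fst_conv snd_conv weighted_graphD(1)[OF h, of u v] L[of u v] min.commute[of u v] max.commute[of u v] ..
    fix u v a b assume e: "(u, v) \<in> edges h" "(a, b) \<in> edges h" "rank n h L (u, v) = rank n h L (a, b)"
    have lt: "u < n" "v < n" "a < n" "b < n" using e edges_sub by auto
    have c: "min u v * n + max u v < n ^ 2" "min a b * n + max a b < n ^ 2" using lt by (auto intro!: code_lt)
    have "L u v div h u v * n ^ 2 + (min u v * n + max u v) = L a b div h a b * n ^ 2 + (min a b * n + max a b)"
      using e(3) unfolding rank_def fst_conv snd_conv by (simp only: add.assoc)
    from code_inj[OF this c] have eq: "min u v * n + max u v = min a b * n + max a b" by blast
    have "max u v < n" "max a b < n" using lt by auto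
    from code_inj[OF eq this] have "min u v = min a b \<and> max u v = max a b" .
    then show "(a, b) = (u, v) \<or> (a, b) = (v, u)" by (auto simp: min_def max_def split: if_splits)
  qed
  have sy: "load n h i u v = load n h i v u" for i u v
  proof (induction i arbitrary: u v)
    case (Suc i)
    have "sym (msf (edges h) (rank n h (load n h i)))" by (rule sym_msf[OF rk]) (rule Suc)
    then have "(u, v) \<in> msf (edges h) (rank n h (load n h i)) \<longleftrightarrow> (v, u) \<in> msf (edges h) (rank n h (load n h i))"
      unfolding sym_def by blast
    then show ?case using Suc[of u v] by simp
  qed simp
  show "load n h i u v = load n h i v u" by (rule sy)
  show "ranking (edges h) (rank n h (load n h i))" by (rule rk) (rule sy)
qed

lemma forest_tree: "forest (tree n h i)"
  unfolding tree_def by (rule forest_msf[OF ranking_load])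

lemma tree_sub: "tree n h i \<subseteq> edges h"
  unfolding tree_def by (rule msf_sub)

lemma light_below: "S \<subseteq> edges h \<Longrightarrow> below S (rank n h (load n h i)) (t * n ^ 2) = S \<inter> light n h i t"
proof (intro set_eqI)
  fix e assume S: "S \<subseteq> edges h"
  show "e \<in> below S (rank n h (load n h i)) (t * n ^ 2) \<longleftrightarrow> e \<in> S \<inter> light n h i t"
  proof (cases "e \<in> S")
    case True
    obtain u v where e: "e = (u, v)" by (cases e)
    have uv: "u < n" "v < n" using True S edges_sub e by auto
    have c: "min u v * n + max u v < n ^ 2" using uv by (intro code_lt) auto
    have "key n h i e * n ^ 2 + (min u v * n + max u v) < t * n ^ 2 \<longleftrightarrow> key n h i e < t"
    proof
      assume "key n h i e * n ^ 2 + (min u v * n + max u v) < t * n ^ 2"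
      then have "key n h i e * n ^ 2 < t * n ^ 2" by linarith
      then show "key n h i e < t" by simp
    next
      assume "key n h i e < t"
      then have "(key n h i e + 1) * n ^ 2 \<le> t * n ^ 2" by (intro mult_le_mono1) simp
      then show "key n h i e * n ^ 2 + (min u v * n + max u v) < t * n ^ 2" using c unfolding add_mult_distrib mult_1 by linarith
    qed
    then show ?thesis using True S e unfolding below_def light_def rank_def key_def by (auto simp: add.assoc)
  qed (simp add: below_def)
qed

text \<open>Kruskal's invariant at the threshold \<open>t * n ^ 2\<close>. It makes the components
  of the light graph available as components of a subforest of the tree, hence as
  candidates.\<close>

lemma cmp_light: "cmp (tree n h i \<inter> light n h i t) v = cmp (light n h i t) v"
proof -
  have "(below (tree n h i) (rank n h (load n h i)) (t * n ^ 2))\<^sup>* = (below (edges h) (rank n h (load n h i)) (t * n ^ 2))\<^sup>*"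
    unfolding tree_def by (rule kruskal[OF ranking_load])
  then have "(tree n h i \<inter> light n h i t)\<^sup>* = (edges h \<inter> light n h i t)\<^sup>*"
    unfolding light_below[OF tree_sub] light_below[OF order_refl] .
  moreover have "edges h \<inter> light n h i t = light n h i t" unfolding light_def by blast
  ultimately show ?thesis by (simp add: cmp_def)
qed

lemma sym_light: "sym (light n h i t)"
proof -
  have "below (edges h) (rank n h (load n h i)) (t * n ^ 2) = light n h i t"
    unfolding light_below[OF order_refl] unfolding light_def by blast
  moreover have "sym (below (edges h) (rank n h (load n h i)) (t * n ^ 2))"
    using below_sym[OF ranking_load rankingD(2)[OF ranking_load]] .
  ultimately show ?thesis by simp
qed

lemma light_sub: "light n h i t \<subseteq> {..<n} \<times> {..<n}"
  using edges_sub unfolding light_def by blast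

lemma load_le: "load n h i u v \<le> i"
  by (induction i) auto

lemma load_zero: "h u v = 0 \<Longrightarrow> load n h i u v = 0"
proof (induction i)
  case (Suc i)
  have "(u, v) \<notin> msf (edges h) (rank n h (load n h i))"
    using msf_sub[of "edges h" "rank n h (load n h i)"] Suc.prems by (auto simp: edges_def)
  then show ?case using Suc by simp
qed simp

lemma key_le: "key n h i e \<le> i"
  unfolding key_def using load_le[of i "fst e" "snd e"] by (meson div_le_dividend le_trans)

lemma ncomp_add:
  assumes "sym F" "u < n" "v < n" "(u, v) \<notin> F\<^sup>*"
  shows "ncomp n (F \<union> {(u, v), (v, u)}) < ncomp n F"
proof -
  let ?G = "F \<union> {(u, v), (v, u)}"
  have G: "?G\<^sup>* `` cmp F x = cmp ?G x" for x
    using rtrancl_mono[of F ?G] unfolding cmp_def by (auto intro: rtrancl_trans)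
  have im: "cmp ?G ` {..<n} = (\<lambda>X. ?G\<^sup>* `` X) ` (cmp F ` {..<n})"
    unfolding image_image G ..
  have "sym ?G" using assms(1) unfolding sym_def by blast
  then have eq: "?G\<^sup>* `` cmp F u = ?G\<^sup>* `` cmp F v" unfolding G by (intro cmp_eq) auto
  have ne: "cmp F u \<noteq> cmp F v" using assms(4) cmp_self[of v F] unfolding cmp_iff[symmetric] by blast
  have "\<not> inj_on (\<lambda>X. ?G\<^sup>* `` X) (cmp F ` {..<n})" using eq ne assms(2,3) unfolding inj_on_def by blast
  then have "card ((\<lambda>X. ?G\<^sup>* `` X) ` (cmp F ` {..<n})) \<noteq> card (cmp F ` {..<n})"
    using eq_card_imp_inj_on by blast
  then show ?thesis using card_image_le[of "cmp F ` {..<n}" "\<lambda>X. ?G\<^sup>* `` X"] unfolding ncomp_def im by fastforce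
qed

lemma ncomp_pos: "0 < ncomp n F"
  unfolding ncomp_def using n2 by (auto simp: card_gt_0_iff lessThan_empty_iff)

text \<open>Every edge of \<open>T\<close> beyond \<open>F\<close> merges two components, and at
  least one component remains.\<close>

lemma forest_count:
  assumes "forest T" "T \<subseteq> {..<n} \<times> {..<n}" "F \<subseteq> T" "sym F"
  shows "card ((T - F) \<inter> pairs n) < ncomp n F"
  using assms(3,4)
proof (induction "card ((T - F) \<inter> pairs n)" arbitrary: F)
  case 0
  then show ?case using ncomp_pos[of F] by simp
next
  case (Suc k)
  have fin: "finite ((T - F) \<inter> pairs n)" by simp
  have "(T - F) \<inter> pairs n \<noteq> {}" using Suc.hyps(2) by (metis card.empty nat.distinct(1))
  then obtain u v where uv: "(u, v) \<in> T" "(u, v) \<notin> F" "(u, v) \<in> pairs n" by auto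
  let ?G = "F \<union> {(u, v), (v, u)}"
  have vu: "(v, u) \<in> T" "(v, u) \<notin> pairs n" using uv forestD(1)[OF assms(1)] by (auto simp: sym_def pairs_def)
  have "(T - ?G) \<inter> pairs n = (T - F) \<inter> pairs n - {(u, v)}" using vu by auto
  then have k: "card ((T - ?G) \<inter> pairs n) = k" using Suc.hyps(2) uv fin by simp
  have "card ((T - ?G) \<inter> pairs n) < ncomp n ?G"
    by (rule Suc.hyps(1)) (use k uv vu Suc.prems in \<open>auto simp: sym_def\<close>)
  moreover have "ncomp n ?G < ncomp n F"
  proof (rule ncomp_add)
    show "sym F" by fact
    have "F \<subseteq> T - {(u, v), (v, u)}" using uv(2) Suc.prems unfolding sym_def by blast
    then show "(u, v) \<notin> F\<^sup>*" using forestD(3)[OF assms(1) uv(1)] rtrancl_mono by blast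
  qed (use uv in \<open>auto simp: pairs_def\<close>)
  ultimately show ?case using k Suc.hyps(2) by simp
qed

lemma tree_heavy_count: "card {e \<in> tree n h i \<inter> pairs n. t \<le> key n h i e} < ncomp n (light n h i t)"
proof -
  let ?F = "tree n h i \<inter> light n h i t"
  have "sym ?F" using forestD(1)[OF forest_tree, of i] sym_light[of i t] unfolding sym_def by blast
  then have "card ((tree n h i - ?F) \<inter> pairs n) < ncomp n ?F"
    using edges_sub tree_sub[of i] by (intro forest_count forest_tree) auto
  moreover have "(tree n h i - ?F) \<inter> pairs n = {e \<in> tree n h i \<inter> pairs n. t \<le> key n h i e}"
    using tree_sub[of i] unfolding light_def by auto
  moreover have "ncomp n ?F = ncomp n (light n h i t)" unfolding ncomp_def cmp_light ..
  ultimately show ?thesis by simp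
qed

text \<open>An edge joining different components lies on the boundary of exactly two of
  them.\<close>

lemma sum_comp_cuts:
  assumes F: "sym F" "F \<subseteq> {..<n} \<times> {..<n}"
  shows "(\<Sum>X\<in>cmp F ` {..<n}. cut_weight n h X) = 2 * (\<Sum>e\<in>{e \<in> pairs n. e \<notin> F\<^sup>*}. h (fst e) (snd e))"
proof -
  let ?A = "cmp F ` {..<n}"
  have sub: "X \<subseteq> {..<n}" if "X \<in> ?A" for X using cmp_subset[OF F(2)] that by blast
  have "(\<Sum>X\<in>?A. cut_weight n h X) = (\<Sum>X\<in>?A. \<Sum>e\<in>pairs n. if sep X e then h (fst e) (snd e) else 0)"
    by (intro sum.cong refl) (simp add: cut_weight_pairs[OF weighted_graphD(1)[OF h] sub] sum.inter_filter)
  also have "\<dots> = (\<Sum>e\<in>pairs n. \<Sum>X\<in>?A. if sep X e then h (fst e) (snd e) else 0)" by (rule sum.swap)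
  also have "\<dots> = (\<Sum>e\<in>pairs n. if e \<notin> F\<^sup>* then 2 * h (fst e) (snd e) else 0)"
  proof (rule sum.cong[OF refl])
    fix e assume "e \<in> pairs n"
    then obtain u v where e: "e = (u, v)" "u < n" "v < n" by (auto simp: pairs_def)
    have mem: "x \<in> X \<longleftrightarrow> X = cmp F x" if "X \<in> ?A" "x < n" for X x
    proof
      assume x: "x \<in> X"
      obtain y where y: "X = cmp F y" using \<open>X \<in> ?A\<close> by blast
      then show "X = cmp F x" using x cmp_eq[OF F(1), of y x] by (simp add: cmp_iff)
    qed simp
    have cu: "cmp F u \<in> ?A" "cmp F v \<in> ?A" using e by auto
    have conn: "(u, v) \<in> F\<^sup>* \<longleftrightarrow> cmp F u = cmp F v"
      using cmp_eq[OF F(1), of u v] cmp_self[of v F] unfolding cmp_iff[symmetric] by metis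
    have sepiff: "sep X e \<longleftrightarrow> (X = cmp F u) \<noteq> (X = cmp F v)" if "X \<in> ?A" for X
      unfolding sep_def e(1) fst_conv snd_conv mem[OF that e(2)] mem[OF that e(3)] ..
    have "card {X \<in> ?A. sep X e} = (if e \<notin> F\<^sup>* then 2 else 0)"
    proof (cases "cmp F u = cmp F v")
      case True
      then have "{X \<in> ?A. sep X e} = {}" using sepiff by blast
      then show ?thesis using True conn e(1) by simp
    next
      case False
      have "{X \<in> ?A. sep X e} = {cmp F u, cmp F v}"
      proof (intro set_eqI iffI)
        fix X assume "X \<in> {X \<in> ?A. sep X e}"
        then show "X \<in> {cmp F u, cmp F v}" using sepiff[of X] by blast
      next
        fix X assume "X \<in> {cmp F u, cmp F v}"
        then have "X = cmp F u \<or> X = cmp F v" by simp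
        then have "X \<in> ?A" "(X = cmp F u) \<noteq> (X = cmp F v)" using cu False by metis+
        then show "X \<in> {X \<in> ?A. sep X e}" using sepiff[of X] by blast
      qed
      then show ?thesis using False conn e(1) by simp
    qed
    then show "(\<Sum>X\<in>?A. if sep X e then h (fst e) (snd e) else 0) = (if e \<notin> F\<^sup>* then 2 * h (fst e) (snd e) else 0)"
      by (simp add: sum.inter_filter[symmetric])
  qed
  also have "\<dots> = 2 * (\<Sum>e\<in>{e \<in> pairs n. e \<notin> F\<^sup>*}. h (fst e) (snd e))"
    by (simp add: sum.inter_filter[symmetric] sum_distrib_left)
  finally show ?thesis .
qed

text \<open>If all light components have boundary at least \<open>2 * \<rho>\<close>, the weight
  between them is at least \<open>\<rho>\<close> times their number. These edges are all heavy,
  while the tree has fewer heavy edges than there are components.\<close>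

lemma heavy_edges:
  fixes \<rho> :: real
  assumes heavy: "\<And>v. v < n \<Longrightarrow> cmp (light n h i t) v \<noteq> {..<n} \<Longrightarrow> 2 * \<rho> \<le> real (cut_weight n h (cmp (light n h i t) v))"
    and r: "0 < \<rho>"
  shows "\<rho> * real (card {e \<in> tree n h i \<inter> pairs n. t \<le> key n h i e})
    \<le> (\<Sum>e\<in>{e \<in> pairs n. t \<le> key n h i e}. real (h (fst e) (snd e)))"
proof -
  let ?F = "light n h i t"
  let ?A = "cmp ?F ` {..<n}"
  have cnt: "card {e \<in> tree n h i \<inter> pairs n. t \<le> key n h i e} < card ?A"
    using tree_heavy_count unfolding ncomp_def .
  show ?thesis
  proof (cases "\<exists>v<n. cmp ?F v = {..<n}")
    case True
    then obtain v where v: "v < n" "cmp ?F v = {..<n}" by blast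
    then have "cmp ?F u = {..<n}" if "u < n" for u
      using that cmp_eq[OF sym_light, of v u i t] by (auto simp flip: cmp_iff)
    then have "?A \<subseteq> {{..<n}}" by auto
    then have "card ?A \<le> card {{..<n}}" by (intro card_mono) auto
    also have "\<dots> = 1" by simp
    finally have "card {e \<in> tree n h i \<inter> pairs n. t \<le> key n h i e} = 0" using cnt by linarith
    then show ?thesis by (simp only: of_nat_0 mult_zero_right) (rule sum_nonneg, simp)
  next
    case False
    have "2 * \<rho> * real (card ?A) = (\<Sum>X\<in>?A. 2 * \<rho>)" by simp
    also have "\<dots> \<le> (\<Sum>X\<in>?A. real (cut_weight n h X))" using heavy False by (intro sum_mono) auto
    also have "\<dots> = real (\<Sum>X\<in>?A. cut_weight n h X)" by simp
    also have "\<dots> = 2 * (\<Sum>e\<in>{e \<in> pairs n. e \<notin> ?F\<^sup>*}. real (h (fst e) (snd e)))"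
      unfolding sum_comp_cuts[OF sym_light light_sub] by simp
    also have "(\<Sum>e\<in>{e \<in> pairs n. e \<notin> ?F\<^sup>*}. real (h (fst e) (snd e)))
       \<le> (\<Sum>e\<in>{e \<in> pairs n. t \<le> key n h i e}. real (h (fst e) (snd e)))"
    proof -
      have "(\<Sum>e\<in>{e \<in> pairs n. e \<notin> ?F\<^sup>*}. real (h (fst e) (snd e)))
        = (\<Sum>e\<in>{e \<in> pairs n. e \<notin> ?F\<^sup>* \<and> 0 < h (fst e) (snd e)}. real (h (fst e) (snd e)))"
        by (rule sum.mono_neutral_right) auto
      also have "\<dots> \<le> (\<Sum>e\<in>{e \<in> pairs n. t \<le> key n h i e}. real (h (fst e) (snd e)))"
        by (rule sum_mono2) (auto simp: light_def edges_def not_less[symmetric])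
      finally show ?thesis .
    qed
    finally have "\<rho> * real (card ?A) \<le> (\<Sum>e\<in>{e \<in> pairs n. t \<le> key n h i e}. real (h (fst e) (snd e)))" by simp
    moreover have "\<rho> * real (card {e \<in> tree n h i \<inter> pairs n. t \<le> key n h i e}) \<le> \<rho> * real (card ?A)"
      using cnt r by simp
    ultimately show ?thesis by linarith
  qed
qed

section \<open>The exponential potential of the packing\<close>

definition heavy_at :: "real \<Rightarrow> nat \<Rightarrow> nat \<Rightarrow> bool" where
  "heavy_at \<rho> i t \<longleftrightarrow> (\<forall>v<n. cmp (light n h i t) v \<noteq> {..<n} \<longrightarrow>
     2 * \<rho> \<le> real (cut_weight n h (cmp (light n h i t) v)))"

text \<open>Summation by layers: \<open>(1 + \<eta>) ^ k\<close> is the sum of the increments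
  \<open>c t\<close> for \<open>t \<le> k\<close>, and \<open>heavy_edges\<close> applies to each
  threshold. So the tree has at most a fraction \<open>1 / \<rho>\<close> of the total length when
  copies have length exponential in their load.\<close>

lemma tree_length:
  fixes \<rho> \<eta> :: real
  assumes hv: "\<And>t. t \<le> i \<Longrightarrow> heavy_at \<rho> i t" and r: "0 < \<rho>" and et: "0 \<le> \<eta>"
  shows "\<rho> * (\<Sum>e\<in>tree n h i \<inter> pairs n. (1 + \<eta>) ^ key n h i e)
    \<le> (\<Sum>e\<in>pairs n. real (h (fst e) (snd e)) * (1 + \<eta>) ^ key n h i e)"
proof -
  define c where "c t = (if t = 0 then 1 else \<eta> * (1 + \<eta>) ^ (t - 1))" for t :: nat
  have c0: "0 \<le> c t" for t using et by (simp add: c_def)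
  have pow: "(1 + \<eta>) ^ k = (\<Sum>t\<le>k. c t)" for k
    by (induction k) (simp_all add: c_def algebra_simps)
  have layer: "(\<Sum>e\<in>A. g e * (1 + \<eta>) ^ key n h i e) = (\<Sum>t\<le>i. c t * (\<Sum>e\<in>{e \<in> A. t \<le> key n h i e}. g e))"
    if "finite A" for A and g :: "nat \<times> nat \<Rightarrow> real"
  proof -
    have "(1 + \<eta>) ^ key n h i e = (\<Sum>t\<le>i. if t \<le> key n h i e then c t else 0)" for e
    proof -
      have "{t \<in> {..i}. t \<le> key n h i e} = {..key n h i e}" using key_le[of i e] by auto
      then show ?thesis unfolding pow by (simp add: sum.inter_filter[symmetric])
    qed
    then have "(\<Sum>e\<in>A. g e * (1 + \<eta>) ^ key n h i e) = (\<Sum>e\<in>A. \<Sum>t\<le>i. if t \<le> key n h i e then c t * g e else 0)"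
      by (simp add: sum_distrib_left if_distrib mult.commute cong: if_cong)
    also have "\<dots> = (\<Sum>t\<le>i. \<Sum>e\<in>A. if t \<le> key n h i e then c t * g e else 0)" by (rule sum.swap)
    finally show ?thesis using that by (simp add: sum.inter_filter[symmetric] sum_distrib_left)
  qed
  have "\<rho> * (\<Sum>e\<in>tree n h i \<inter> pairs n. (1 + \<eta>) ^ key n h i e)
      = (\<Sum>t\<le>i. c t * (\<rho> * real (card {e \<in> tree n h i \<inter> pairs n. t \<le> key n h i e})))"
    using layer[of "tree n h i \<inter> pairs n" "\<lambda>_. 1"] by (simp add: sum_distrib_left mult.left_commute)
  also have "\<dots> \<le> (\<Sum>t\<le>i. c t * (\<Sum>e\<in>{e \<in> pairs n. t \<le> key n h i e}. real (h (fst e) (snd e))))"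
  proof (intro sum_mono mult_left_mono c0)
    fix t assume "t \<in> {..i}"
    then show "\<rho> * real (card {e \<in> tree n h i \<inter> pairs n. t \<le> key n h i e})
      \<le> (\<Sum>e\<in>{e \<in> pairs n. t \<le> key n h i e}. real (h (fst e) (snd e)))"
      using hv[of t] unfolding heavy_at_def by (intro heavy_edges r) auto
  qed
  also have "\<dots> = (\<Sum>e\<in>pairs n. real (h (fst e) (snd e)) * (1 + \<eta>) ^ key n h i e)"
    by (rule layer[symmetric]) simp
  finally show ?thesis .
qed

text \<open>For \<open>c > 0\<close> this is the sum of \<open>(1 + \<eta>)\<close> to the load over
  \<open>c\<close> copies when \<open>x\<close> units are spread evenly, written by increments: unit
  number \<open>k\<close> falls on a copy of load \<open>k div c\<close>.\<close>

definition phi :: "real \<Rightarrow> nat \<Rightarrow> nat \<Rightarrow> real" where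
  "phi \<eta> c x = real c + \<eta> * (\<Sum>k<x. (1 + \<eta>) ^ (k div c))"

lemma phi_ge:
  assumes "0 \<le> \<eta>"
  shows "real c * (1 + \<eta>) ^ (x div c) \<le> phi \<eta> c x"
proof (cases "c = 0")
  case False
  have eq: "phi \<eta> c (q * c) = real c * (1 + \<eta>) ^ q" for q
  proof (induction q)
    case (Suc q)
    have "(\<Sum>k<Suc q * c. (1 + \<eta>) ^ (k div c)) = (\<Sum>k<q * c. (1 + \<eta>) ^ (k div c)) + (\<Sum>k\<in>{q * c..<q * c + c}. (1 + \<eta>) ^ (k div c))"
      unfolding lessThan_atLeast0 by (subst sum.atLeastLessThan_concat) (simp_all add: add.commute)
    also have "(\<Sum>k\<in>{q * c..<q * c + c}. (1 + \<eta>) ^ (k div c)) = (\<Sum>k\<in>{q * c..<q * c + c}. (1 + \<eta>) ^ q)"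
    proof (rule sum.cong[OF refl])
      fix k assume "k \<in> {q * c..<q * c + c}"
      then have "k div c = q" using False by (intro div_nat_eqI) (auto simp: mult.commute)
      then show "(1 + \<eta>) ^ (k div c) = (1 + \<eta>) ^ q" by simp
    qed
    finally show ?case using Suc by (simp add: phi_def algebra_simps)
  qed (simp add: phi_def)
  have "phi \<eta> c (x div c * c) \<le> phi \<eta> c x"
    unfolding phi_def using assms by (intro add_left_mono mult_left_mono sum_mono2) auto
  then show ?thesis unfolding eq .
qed (use assms in \<open>simp add: phi_def sum_nonneg\<close>)

definition pot :: "real \<Rightarrow> nat \<Rightarrow> real" where
  "pot \<eta> i = (\<Sum>e\<in>pairs n. phi \<eta> (h (fst e) (snd e)) (load n h i (fst e) (snd e)))"

text \<open>The multiplicative-weights step: the increase is \<open>\<eta>\<close> times the length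
  of the new tree, at most \<open>\<eta> / \<rho>\<close> times the potential by
  \<open>tree_length\<close>.\<close>

lemma pot_Suc:
  assumes "\<And>t. t \<le> i \<Longrightarrow> heavy_at \<rho> i t" and r: "0 < \<rho>" and et: "0 \<le> \<eta>"
  shows "pot \<eta> (Suc i) \<le> pot \<eta> i * (1 + \<eta> / \<rho>)"
proof -
  let ?S = "\<Sum>e\<in>tree n h i \<inter> pairs n. (1 + \<eta>) ^ key n h i e"
  have "phi \<eta> (h (fst e) (snd e)) (load n h (Suc i) (fst e) (snd e)) =
     phi \<eta> (h (fst e) (snd e)) (load n h i (fst e) (snd e)) + (if e \<in> tree n h i then \<eta> * (1 + \<eta>) ^ key n h i e else 0)" for e
    by (simp add: phi_def key_def tree_def algebra_simps)
  then have "pot \<eta> (Suc i) = pot \<eta> i + (\<Sum>e\<in>pairs n. if e \<in> tree n h i then \<eta> * (1 + \<eta>) ^ key n h i e else 0)"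
    unfolding pot_def by (simp add: sum.distrib)
  also have "(\<Sum>e\<in>pairs n. if e \<in> tree n h i then \<eta> * (1 + \<eta>) ^ key n h i e else 0) = \<eta> * ?S"
    by (simp add: sum.inter_filter[symmetric] sum_distrib_left Int_def conj_commute)
  finally have eq: "pot \<eta> (Suc i) = pot \<eta> i + \<eta> * ?S" .
  have "\<rho> * ?S \<le> (\<Sum>e\<in>pairs n. real (h (fst e) (snd e)) * (1 + \<eta>) ^ key n h i e)" by (rule tree_length[OF assms])
  also have "\<dots> \<le> pot \<eta> i" unfolding pot_def key_def by (intro sum_mono phi_ge et)
  finally have "?S \<le> pot \<eta> i / \<rho>" using r by (simp add: field_simps)
  then have "\<eta> * ?S \<le> \<eta> * (pot \<eta> i / \<rho>)" by (rule mult_left_mono[OF _ et])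
  then show ?thesis unfolding eq by (simp add: algebra_simps)
qed

lemma pot_bound:
  assumes hv: "\<And>i t. i < N \<Longrightarrow> t \<le> i \<Longrightarrow> heavy_at \<rho> i t" and r: "0 < \<rho>" and et: "0 \<le> \<eta>"
  shows "pot \<eta> N \<le> (\<Sum>e\<in>pairs n. real (h (fst e) (snd e))) * exp (\<eta> * real N / \<rho>)"
proof -
  have pos: "0 \<le> pot \<eta> i" for i
    unfolding pot_def phi_def using et by (intro sum_nonneg add_nonneg_nonneg mult_nonneg_nonneg) auto
  have "i \<le> N \<Longrightarrow> pot \<eta> i \<le> (\<Sum>e\<in>pairs n. real (h (fst e) (snd e))) * exp (\<eta> * real i / \<rho>)" for i
  proof (induction i)
    case 0
    then show ?case by (simp add: pot_def phi_def)
  next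
    case (Suc i)
    have "pot \<eta> (Suc i) \<le> pot \<eta> i * (1 + \<eta> / \<rho>)" using hv[of i] Suc.prems by (intro pot_Suc r et) auto
    also have "\<dots> \<le> pot \<eta> i * exp (\<eta> / \<rho>)" by (intro mult_left_mono exp_ge_add_one_self pos)
    also have "\<dots> \<le> ((\<Sum>e\<in>pairs n. real (h (fst e) (snd e))) * exp (\<eta> * real i / \<rho>)) * exp (\<eta> / \<rho>)"
      using Suc by (intro mult_right_mono) auto
    also have "\<dots> = (\<Sum>e\<in>pairs n. real (h (fst e) (snd e))) * exp (\<eta> * real (Suc i) / \<rho>)"
      by (simp add: mult.assoc add_divide_distrib algebra_simps flip: exp_add)
    finally show ?case .
  qed
  then show ?thesis by simp
qed

text \<open>Without its only crossing edge \<open>T\<close> falls into two parts, each staying on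
  one side of \<open>C\<close>; since \<open>T\<close> spans all vertices, they are exactly
  \<open>C\<close> and its complement.\<close>

lemma single_crossing:
  assumes T: "forest T" "T \<subseteq> {..<n} \<times> {..<n}" "cmp T 0 = {..<n}" and C: "C \<subseteq> {..<n}"
    and uv: "(u, v) \<in> T" "u \<notin> C" "v \<in> C" and one: "\<And>a b. (a, b) \<in> T \<Longrightarrow> a \<notin> C \<Longrightarrow> b \<in> C \<Longrightarrow> (a, b) = (u, v)"
  shows "side T u v = C"
proof -
  let ?R = "T - {(u, v), (v, u)}"
  have sT: "sym T" by (rule forestD(1)[OF T(1)])
  have stay: "(b \<in> C) = (a \<in> C)" if "(a, b) \<in> ?R" for a b
  proof (rule ccontr)
    assume ne: "(b \<in> C) \<noteq> (a \<in> C)"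
    show False
    proof (cases "b \<in> C")
      case True
      then show ?thesis using one[of a b] ne that by blast
    next
      case False
      then show ?thesis using one[of b a] ne that symD[OF sT, of a b] by blast
    qed
  qed
  have reach: "(y \<in> C) = (x \<in> C)" if "(x, y) \<in> ?R\<^sup>*" for x y
    using that by (induction rule: rtrancl_induct) (use stay in auto)
  have 1: "side T u v \<subseteq> C" using reach[of v] uv(3) by (auto simp: side_def cmp_iff)
  have "side T v u = cmp ?R u" by (simp add: side_def insert_commute)
  then have 2: "side T v u \<inter> C = {}" using reach[of u] uv(2) by (auto simp: cmp_iff)
  have "u < n" using uv(1) T(2) by auto
  then have "(0, u) \<in> T\<^sup>*" using T(3) by (simp flip: cmp_iff)
  then have "cmp T u = {..<n}" using T(3) cmp_eq[OF sT] by metis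
  then have "{..<n} = side T u v \<union> side T v u" using side_Un(1)[OF T(1) uv(1)] by simp
  then show ?thesis using 1 2 C by blast
qed

lemma cmp_tree: "cmp (tree n h i) v = cmp (edges h) v"
proof -
  have all: "light n h i (Suc i) = edges h" using key_le[of i] unfolding light_def by (auto simp: less_Suc_eq_le)
  have "tree n h i \<inter> edges h = tree n h i" using tree_sub[of i] by blast
  then show ?thesis using cmp_light[of i "Suc i" v] unfolding all by simp
qed

text \<open>If both alternatives fail, every tree crosses \<open>C\<close> at least twice, so some
  edge of \<open>C\<close> has load at least \<open>2 * N / c\<close> per copy, where
  \<open>c\<close> is the weight of \<open>C\<close>. The potential however admits only about
  \<open>2 * N / ((1 + \<epsilon>) * c)\<close>, a contradiction for large \<open>N\<close>.\<close>

theorem packing: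
  fixes \<epsilon> :: real
  assumes conn: "cmp (edges h) 0 = {..<n}" and C: "C \<subseteq> {..<n}" "C \<noteq> {}" "C \<noteq> {..<n}"
    and e: "0 < \<epsilon>" "\<epsilon> \<le> 1"
    and m: "(\<Sum>e\<in>pairs n. real (h (fst e) (snd e))) \<le> m" "1 \<le> m"
    and N: "8 * real (cut_weight n h C) * (ln m + 1) < \<epsilon> ^ 2 * real N"
  shows "(\<exists>i<N. \<exists>t\<le>i. \<exists>v<n. cmp (light n h i t) v \<noteq> {..<n} \<and>
            real (cut_weight n h (cmp (light n h i t) v)) < (1 + \<epsilon>) * real (cut_weight n h C))
      \<or> (\<exists>i<N. \<exists>u v. (u, v) \<in> tree n h i \<and> side (tree n h i) u v = C)"
proof (rule ccontr)
  assume neg: "\<not> ?thesis"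
  let ?c = "real (cut_weight n h C)"
  let ?D = "{e \<in> pairs n. sep C e}"
  have cC: "?c = (\<Sum>e\<in>?D. real (h (fst e) (snd e)))"
    using cut_weight_pairs[OF weighted_graphD(1)[OF h] C(1)] by simp
  have cross: "2 \<le> card (tree n h i \<inter> ?D)" if i: "i < N" for i
  proof (rule ccontr)
    assume lt: "\<not> 2 \<le> card (tree n h i \<inter> ?D)"
    let ?T = "tree n h i"
    have sT: "sym ?T" by (rule forestD(1)[OF forest_tree])
    have Tn: "?T \<subseteq> {..<n} \<times> {..<n}" using tree_sub edges_sub by blast
    have cT: "cmp ?T 0 = {..<n}" using conn cmp_tree by simp
    have "\<exists>a b. (a, b) \<in> ?T \<and> a \<notin> C \<and> b \<in> C"
    proof (rule ccontr)
      assume no: "\<not> ?thesis"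
      have "(y \<in> C) = (x \<in> C)" if "(x, y) \<in> ?T\<^sup>*" for x y
        using that
      proof (induction rule: rtrancl_induct)
        case (step y z)
        have "(y \<in> C) = (z \<in> C)" using no step.hyps(2) symD[OF sT, of y z] by blast
        then show ?case using step.IH by simp
      qed simp
      then have "(y \<in> C) = (0 \<in> C)" if "y < n" for y using cT that by (simp flip: cmp_iff)
      then show False using C by blast
    qed
    then obtain a b where ab: "(a, b) \<in> ?T" "a \<notin> C" "b \<in> C" by blast
    define o' where "o' x y = (if x < y then (x, y) else (y, x))" for x y :: nat
    have mem: "o' x y \<in> ?T \<inter> ?D" if "(x, y) \<in> ?T" "x \<notin> C" "y \<in> C" for x y
    proof -
      have "x \<noteq> y" "x < n" "y < n" using that Tn by auto
      then show ?thesis using that symD[OF sT, of x y] by (auto simp: o'_def pairs_def sep_def)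
    qed
    have "finite (?T \<inter> ?D)" by simp
    then have "card (?T \<inter> ?D) \<le> 1 \<Longrightarrow> p \<in> ?T \<inter> ?D \<Longrightarrow> q \<in> ?T \<inter> ?D \<Longrightarrow> p = q" for p q
      using card_le_Suc0_iff_eq[of "?T \<inter> ?D"] by simp
    then have uniq: "o' x y = o' a b" if "(x, y) \<in> ?T" "x \<notin> C" "y \<in> C" for x y
      using mem[OF that] mem[OF ab] lt by simp
    have "side ?T a b = C"
    proof (rule single_crossing[OF forest_tree Tn cT C(1) ab])
      fix x y assume xy: "(x, y) \<in> ?T" "x \<notin> C" "y \<in> C"
      show "(x, y) = (a, b)" using uniq[OF xy] xy ab by (auto simp: o'_def split: if_splits)
    qed
    then show False using neg i ab(1) by blast
  qed
  have cpos: "0 < ?c"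
  proof -
    have "0 < N"
    proof (rule ccontr)
      assume "\<not> 0 < N"
      then have "8 * ?c * (ln m + 1) < 0" using N by simp
      moreover have "0 \<le> 8 * ?c * (ln m + 1)" using m(2) by simp
      ultimately show False by simp
    qed
    then have "card (tree n h 0 \<inter> ?D) \<noteq> 0" using cross[of 0] by linarith
    then obtain e where e: "e \<in> tree n h 0 \<inter> ?D" by (metis card.empty ex_in_conv)
    then have "0 < h (fst e) (snd e)" using tree_sub[of 0] by (auto simp: edges_def)
    then show ?thesis unfolding cC using e by (intro sum_pos2[of _ e]) auto
  qed
  \<comment> \<open>The factor \<open>1 / 2\<close> compensates that component boundaries count each
    edge twice.\<close>
  define \<rho> where "\<rho> = (1 + \<epsilon>) * ?c / 2"
  define \<eta> where "\<eta> = \<epsilon> / 4"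
  have r: "0 < \<rho>" and et: "0 < \<eta>" "\<eta> \<le> 1" using e cpos by (auto simp: \<rho>_def \<eta>_def)
  have hv: "heavy_at \<rho> i t" if "i < N" "t \<le> i" for i t
    unfolding heavy_at_def
  proof (intro allI impI)
    fix v assume "v < n" "cmp (light n h i t) v \<noteq> {..<n}"
    then have "\<not> real (cut_weight n h (cmp (light n h i t) v)) < (1 + \<epsilon>) * ?c" using neg that by blast
    then show "2 * \<rho> \<le> real (cut_weight n h (cmp (light n h i t) v))" by (simp add: \<rho>_def)
  qed
  have loads: "real (2 * i) \<le> (\<Sum>e\<in>?D. real (load n h i (fst e) (snd e)))" if "i \<le> N" for i
    using that
  proof (induction i)
    case (Suc i)
    have "(\<Sum>e\<in>?D. real (load n h (Suc i) (fst e) (snd e))) =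
       (\<Sum>e\<in>?D. real (load n h i (fst e) (snd e))) + (\<Sum>e\<in>?D. if e \<in> tree n h i then 1 else 0)"
      by (subst sum.distrib[symmetric], rule sum.cong) (auto simp: tree_def)
    also have "(\<Sum>e\<in>?D. if e \<in> tree n h i then 1 else 0) = real (card (tree n h i \<inter> ?D))"
      by (subst sum.inter_filter[symmetric]) (auto simp: Int_def conj_commute intro!: arg_cong[of _ _ card])
    finally show ?case using Suc cross[of i] by simp
  qed simp
  \<comment> \<open>Averaging: the cut has total weight \<open>?c\<close> and, by
    \<open>loads\<close>, total load at least \<open>2 * N\<close>.\<close>
  have "\<exists>e\<in>?D. 0 < h (fst e) (snd e) \<and>
    2 * real N * real (h (fst e) (snd e)) \<le> real (load n h N (fst e) (snd e)) * ?c"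
  proof (rule ccontr)
    assume none: "\<not> ?thesis"
    have lt: "real (load n h N (fst e) (snd e)) * ?c < 2 * real N * real (h (fst e) (snd e))"
      if "e \<in> ?D" "0 < h (fst e) (snd e)" for e using none that not_le by blast
    obtain e0 where e0: "e0 \<in> ?D" "0 < h (fst e0) (snd e0)"
    proof -
      have "\<exists>e\<in>?D. 0 < h (fst e) (snd e)"
      proof (rule ccontr)
        assume none: "\<not> ?thesis"
        have "?c = 0" unfolding cC by (rule sum.neutral) (use none in auto)
        then show False using cpos by simp
      qed
      then show ?thesis using that by blast
    qed
    have "(\<Sum>e\<in>?D. real (load n h N (fst e) (snd e)) * ?c) < (\<Sum>e\<in>?D. 2 * real N * real (h (fst e) (snd e)))"
    proof (rule sum_strict_mono_ex1)
      show "\<forall>e\<in>?D. real (load n h N (fst e) (snd e)) * ?c \<le> 2 * real N * real (h (fst e) (snd e))"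
      proof
        fix e assume "e \<in> ?D"
        then show "real (load n h N (fst e) (snd e)) * ?c \<le> 2 * real N * real (h (fst e) (snd e))"
          using lt[of e] load_zero[of "fst e" "snd e" N] by (cases "h (fst e) (snd e) = 0") auto
      qed
      show "\<exists>e\<in>?D. real (load n h N (fst e) (snd e)) * ?c < 2 * real N * real (h (fst e) (snd e))"
        using e0 lt by blast
    qed simp
    also have "\<dots> = 2 * real N * ?c" unfolding cC by (simp add: sum_distrib_left)
    also have "\<dots> \<le> (\<Sum>e\<in>?D. real (load n h N (fst e) (snd e))) * ?c" using loads[of N] cpos by (intro mult_right_mono) auto
    also have "\<dots> = (\<Sum>e\<in>?D. real (load n h N (fst e) (snd e)) * ?c)" by (simp add: sum_distrib_right)
    finally show False by simp
  qed
  then obtain e where eD: "e \<in> ?D" "0 < h (fst e) (snd e)"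
    "2 * real N * real (h (fst e) (snd e)) \<le> real (load n h N (fst e) (snd e)) * ?c" by blast
  let ?h = "h (fst e) (snd e)" and ?L = "load n h N (fst e) (snd e)"
  have q: "2 * real N / ?c - 1 < real (?L div ?h)"
  proof -
    have "2 * real N / ?c \<le> real ?L / real ?h" using eD cpos by (simp add: field_simps)
    also have "real ?L / real ?h < real (?L div ?h) + 1"
    proof -
      have "?L < ?h + ?L div ?h * ?h" by (rule dividend_less_div_times[OF eD(2)])
      then have "real ?L < real (?h + ?L div ?h * ?h)" by (simp only: of_nat_less_iff)
      then have "real ?L < (real (?L div ?h) + 1) * real ?h" unfolding of_nat_add of_nat_mult by argo
      then show ?thesis using eD(2) by (subst pos_divide_less_eq) simp_all
    qed
    finally show ?thesis by simp
  qed
  \<comment> \<open>One overloaded edge alone is compared with the bound on the whole potential; the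
    \<open>- 1\<close> pays for the rounding in \<open>div\<close>.\<close>
  have "(1 + \<eta>) powr (2 * real N / ?c - 1) \<le> (1 + \<eta>) powr real (?L div ?h)" using q et by (intro powr_mono) auto
  also have "\<dots> = (1 + \<eta>) ^ (?L div ?h)" using et by (simp add: powr_realpow)
  also have "\<dots> \<le> real ?h * (1 + \<eta>) ^ (?L div ?h)" using eD(2) et by simp
  also have "\<dots> \<le> phi \<eta> ?h ?L" using et by (intro phi_ge) simp
  also have "\<dots> \<le> pot \<eta> N"
  proof -
    have "0 \<le> phi \<eta> a b" for a b
      unfolding phi_def using et by (intro add_nonneg_nonneg mult_nonneg_nonneg sum_nonneg) auto
    then show ?thesis unfolding pot_def using eD(1) by (intro member_le_sum[of e "pairs n" "\<lambda>e. phi \<eta> (h (fst e) (snd e)) (load n h N (fst e) (snd e))"]) auto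
  qed
  also have "\<dots> \<le> m * exp (\<eta> * real N / \<rho>)"
  proof -
    have "pot \<eta> N \<le> (\<Sum>e\<in>pairs n. real (h (fst e) (snd e))) * exp (\<eta> * real N / \<rho>)"
      by (rule pot_bound[OF hv r less_imp_le[OF et(1)]])
    also have "\<dots> \<le> m * exp (\<eta> * real N / \<rho>)" using m(1) by (intro mult_right_mono) auto
    finally show ?thesis .
  qed
  finally have "ln ((1 + \<eta>) powr (2 * real N / ?c - 1)) \<le> ln (m * exp (\<eta> * real N / \<rho>))"
    using m(2) et by (subst ln_le_cancel_iff) auto
  then have key1: "(2 * real N / ?c - 1) * ln (1 + \<eta>) \<le> ln m + \<eta> * real N / \<rho>"
    using m(2) et by (simp add: ln_powr ln_mult)
  have ln1: "\<eta> - \<eta>\<^sup>2 \<le> ln (1 + \<eta>)" using ln_one_plus_pos_lower_bound[of \<eta>] et by simp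
  have ln2: "ln (1 + \<eta>) \<le> 1" using ln_add_one_self_le_self[of \<eta>] et by simp
  have "2 * real N / ?c * (\<eta> - \<eta>\<^sup>2) \<le> 2 * real N / ?c * ln (1 + \<eta>)"
    using ln1 cpos by (intro mult_left_mono) auto
  also have "\<dots> \<le> ln m + 1 + \<eta> * real N / \<rho>" using key1 ln2 by (simp add: algebra_simps)
  finally have s1: "2 * real N / ?c * (\<eta> - \<eta>\<^sup>2) \<le> ln m + 1 + \<eta> * real N / \<rho>" .
  have s2: "\<eta> * real N / \<rho> = 2 * real N / ?c * (\<eta> / (1 + \<epsilon>))"
    unfolding \<rho>_def using e cpos by (simp add: field_simps)
  have "2 * real N / ?c * (\<eta> - \<eta>\<^sup>2 - \<eta> / (1 + \<epsilon>)) \<le> ln m + 1"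
    using s1 s2 unfolding right_diff_distrib[of _ "\<eta> - \<eta>\<^sup>2" "\<eta> / (1 + \<epsilon>)"] by linarith
  \<comment> \<open>\<open>1 / (1 + \<epsilon>) \<le> 1 - \<epsilon> / 2\<close> leaves
    \<open>\<eta> * \<epsilon> / 2 - \<eta>\<^sup>2\<close>, which is largest for
    \<open>\<eta> = \<epsilon> / 4\<close>.\<close>
  moreover have "\<epsilon>\<^sup>2 / 16 \<le> \<eta> - \<eta>\<^sup>2 - \<eta> / (1 + \<epsilon>)"
  proof -
    have "1 / (1 + \<epsilon>) \<le> 1 - \<epsilon> / 2"
    proof -
      have "1 \<le> (1 - \<epsilon> / 2) * (1 + \<epsilon>)" using e by (simp add: algebra_simps power2_eq_square[symmetric]) (simp add: power2_eq_square)
      then show ?thesis using e by (simp add: field_simps)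
    qed
    then have "\<eta> * (1 / (1 + \<epsilon>)) \<le> \<eta> * (1 - \<epsilon> / 2)" using et by (intro mult_left_mono) auto
    then show ?thesis by (simp add: \<eta>_def power2_eq_square algebra_simps)
  qed
  then have "2 * real N / ?c * (\<epsilon>\<^sup>2 / 16) \<le> 2 * real N / ?c * (\<eta> - \<eta>\<^sup>2 - \<eta> / (1 + \<epsilon>))"
    using cpos by (intro mult_left_mono) auto
  ultimately have "2 * real N / ?c * (\<epsilon>\<^sup>2 / 16) \<le> ln m + 1" by linarith
  then have "real N * \<epsilon>\<^sup>2 \<le> 8 * ?c * (ln m + 1)" using cpos by (simp add: field_simps)
  then show False using N by (simp add: mult.commute)
qed

end

section \<open>The sum over all cuts\<close>

context
  fixes n :: nat and w :: "nat \<times> nat \<Rightarrow> real" and lam :: real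
  assumes w0: "\<And>e. 0 \<le> w e" and lam0: "0 \<le> lam"
begin

definition cw :: "nat set \<Rightarrow> real" where
  "cw S = (\<Sum>e\<in>{e \<in> pairs n. sep S e}. w e)"

text \<open>Contracted graphs are represented by labellings \<open>f\<close>, the fibres being their
  vertices; these are their cuts, including the two trivial ones.\<close>

definition blocks :: "(nat \<Rightarrow> nat) \<Rightarrow> nat set set" where
  "blocks f = {S. S \<subseteq> {..<n} \<and> (\<forall>x<n. \<forall>y<n. f x = f y \<longrightarrow> (x \<in> S) = (y \<in> S))}"

text \<open>If every edge \<open>e\<close> is contracted at an exponential time of rate
  \<open>w e\<close>, then \<open>exp (- t * cw S)\<close> is the probability that \<open>S\<close>
  is still a cut at time \<open>t\<close>. The sum is the expected number of cuts left, that is of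
  \<open>2\<close> to the number of blocks.\<close>

definition cutsum :: "(nat \<Rightarrow> nat) \<Rightarrow> real \<Rightarrow> real" where
  "cutsum f t = (\<Sum>S\<in>blocks f. exp (- t * cw S))"

lemma blocksD:
  assumes "S \<in> blocks f"
  shows "S \<subseteq> {..<n}" "x < n \<Longrightarrow> y < n \<Longrightarrow> f x = f y \<Longrightarrow> (x \<in> S) = (y \<in> S)"
  using assms unfolding blocks_def by blast+

lemma blocksI:
  "S \<subseteq> {..<n} \<Longrightarrow> (\<And>x y. x < n \<Longrightarrow> y < n \<Longrightarrow> f x = f y \<Longrightarrow> (x \<in> S) = (y \<in> S)) \<Longrightarrow> S \<in> blocks f"
  unfolding blocks_def by blast

lemma finite_blocks: "finite (blocks f)"
  by (rule finite_subset[of _ "Pow {..<n}"]) (auto simp: blocks_def)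

lemma cw_nonneg: "0 \<le> cw S"
  unfolding cw_def by (intro sum_nonneg w0)

lemma card_blocks: "card (blocks f) \<le> 2 ^ card (f ` {..<n})"
proof -
  have "inj_on (\<lambda>S. f ` S) (blocks f)"
  proof (rule inj_onI)
    fix S T assume S: "S \<in> blocks f" and T: "T \<in> blocks f" and eq: "f ` S = f ` T"
    have "A \<subseteq> B" if A: "A \<in> blocks f" and B: "B \<in> blocks f" and AB: "f ` A = f ` B" for A B
    proof
      fix x assume x: "x \<in> A"
      then have "f x \<in> f ` B" unfolding AB[symmetric] by (rule imageI)
      then obtain y where y: "f x = f y" "y \<in> B" by (rule imageE)
      have "x < n" "y < n" using x y(2) A B unfolding blocks_def by blast+
      then show "x \<in> B" using B y unfolding blocks_def by blast
    qed
    from this[OF S T eq] this[OF T S eq[symmetric]] show "S = T" by (rule subset_antisym)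
  qed
  moreover have "(\<lambda>S. f ` S) ` blocks f \<subseteq> Pow (f ` {..<n})" by (auto simp: blocks_def)
  ultimately have "card (blocks f) \<le> card (Pow (f ` {..<n}))" by (intro card_inj_on_le) auto
  then show ?thesis by (simp add: card_Pow)
qed

section \<open>Contraction of an edge\<close>

definition glue :: "(nat \<Rightarrow> nat) \<Rightarrow> nat \<times> nat \<Rightarrow> nat \<Rightarrow> nat" where
  "glue f e x = (if f x = f (snd e) then f (fst e) else f x)"

lemma blocks_glue:
  assumes "e \<in> pairs n"
  shows "blocks (glue f e) = {S \<in> blocks f. \<not> sep S e}"
proof -
  obtain u v where e: "e = (u, v)" "u < n" "v < n" using assms by (auto simp: pairs_def)
  show ?thesis
  proof (intro set_eqI iffI)
    fix S assume S: "S \<in> blocks (glue f e)"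
    have "S \<in> blocks f"
    proof (rule blocksI[OF blocksD(1)[OF S]])
      fix x y assume "x < n" "y < n" "f x = f y"
      then show "(x \<in> S) = (y \<in> S)" by (intro blocksD(2)[OF S]) (simp_all add: glue_def)
    qed
    moreover have "(u \<in> S) = (v \<in> S)" by (rule blocksD(2)[OF S e(2,3)]) (simp add: glue_def e)
    then have "\<not> sep S e" by (simp add: sep_def e(1))
    ultimately show "S \<in> {S \<in> blocks f. \<not> sep S e}" by blast
  next
    fix S assume "S \<in> {S \<in> blocks f. \<not> sep S e}"
    then have Sb: "S \<in> blocks f" and Se: "(u \<in> S) = (v \<in> S)" unfolding sep_def e(1) by auto
    note S = blocksD[OF Sb] Se
    have "(x \<in> S) = (y \<in> S)" if xy: "x < n" "y < n" and g: "glue f e x = glue f e y" for x y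
    proof (cases "f x = f v"; cases "f y = f v")
      assume a: "f x = f v" "f y \<noteq> f v"
      then have "f y = f u" using g by (simp add: glue_def e)
      then show ?thesis using S(2)[OF xy(1) e(3) a(1)] S(2)[OF xy(2) e(2)] S(3) by blast
    next
      assume a: "f x \<noteq> f v" "f y = f v"
      then have "f x = f u" using g by (simp add: glue_def e)
      then show ?thesis using S(2)[OF xy(2) e(3) a(2)] S(2)[OF xy(1) e(2)] S(3) by blast
    next
      assume "f x = f v" "f y = f v"
      then have "f x = f y" by simp
      then show ?thesis by (rule S(2)[OF xy])
    next
      assume "f x \<noteq> f v" "f y \<noteq> f v"
      then have "f x = f y" using g by (simp add: glue_def e)
      then show ?thesis by (rule S(2)[OF xy])
    qed
    then show "S \<in> blocks (glue f e)" by (rule blocksI[OF S(1)])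
  qed
qed

lemma card_glue:
  assumes "e \<in> pairs n" "f (fst e) \<noteq> f (snd e)"
  shows "Suc (card (glue f e ` {..<n})) = card (f ` {..<n})"
proof -
  have "glue f e ` {..<n} = f ` {..<n} - {f (snd e)}"
    using assms by (force simp: glue_def pairs_def image_iff)
  moreover have "f (snd e) \<in> f ` {..<n}" using assms by (auto simp: pairs_def)
  ultimately show ?thesis by (metis card_Suc_Diff1 finite_imageI finite_lessThan)
qed

text \<open>The backward equation of the contraction process. Differentiation brings down
  \<open>cw S\<close>; after exchanging sums, the cuts separating \<open>e\<close> are those lost by
  contracting \<open>e\<close>.\<close>

lemma cutsum_deriv:
  "(cutsum f has_real_derivative
     (\<Sum>e\<in>{e \<in> pairs n. f (fst e) \<noteq> f (snd e)}. w e * (cutsum (glue f e) t - cutsum f t))) (at t)"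
proof -
  have "(cutsum f has_real_derivative (\<Sum>S\<in>blocks f. exp (- t * cw S) * (- cw S))) (at t)"
    unfolding cutsum_def[abs_def] by (auto intro!: derivative_eq_intros)
  moreover have "(\<Sum>S\<in>blocks f. exp (- t * cw S) * (- cw S)) =
     (\<Sum>e\<in>{e \<in> pairs n. f (fst e) \<noteq> f (snd e)}. w e * (cutsum (glue f e) t - cutsum f t))"
  proof -
    have "(\<Sum>S\<in>blocks f. exp (- t * cw S) * (- cw S)) =
      (\<Sum>S\<in>blocks f. \<Sum>e\<in>pairs n. if sep S e then - (w e * exp (- t * cw S)) else 0)"
    proof (rule sum.cong[OF refl])
      fix S
      have "x * (- cw S) = (\<Sum>e\<in>pairs n. if sep S e then - (w e * x) else 0)" for x
        by (simp add: cw_def sum.inter_filter[symmetric] sum_distrib_left sum_negf mult.commute)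
      then show "exp (- t * cw S) * (- cw S) = (\<Sum>e\<in>pairs n. if sep S e then - (w e * exp (- t * cw S)) else 0)" .
    qed
    also have "\<dots> = (\<Sum>e\<in>pairs n. \<Sum>S\<in>blocks f. if sep S e then - (w e * exp (- t * cw S)) else 0)" by (rule sum.swap)
    also have "\<dots> = (\<Sum>e\<in>pairs n. w e * (cutsum (glue f e) t - cutsum f t))"
    proof (rule sum.cong[OF refl])
      fix e assume e: "e \<in> pairs n"
      have "cutsum f t = cutsum (glue f e) t + (\<Sum>S\<in>{S \<in> blocks f. sep S e}. exp (- t * cw S))"
        unfolding cutsum_def blocks_glue[OF e] using finite_blocks
        by (subst sum.union_disjoint[symmetric]) (auto intro!: sum.cong)
      then show "(\<Sum>S\<in>blocks f. if sep S e then - (w e * exp (- t * cw S)) else 0) = w e * (cutsum (glue f e) t - cutsum f t)"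
        using finite_blocks by (simp add: sum.inter_filter[symmetric] sum_distrib_left sum_negf)
    qed
    also have "\<dots> = (\<Sum>e\<in>{e \<in> pairs n. f (fst e) \<noteq> f (snd e)}. w e * (cutsum (glue f e) t - cutsum f t))"
    proof (rule sum.mono_neutral_right)
      show "\<forall>e\<in>pairs n - {e \<in> pairs n. f (fst e) \<noteq> f (snd e)}. w e * (cutsum (glue f e) t - cutsum f t) = 0"
      proof
        fix e assume "e \<in> pairs n - {e \<in> pairs n. f (fst e) \<noteq> f (snd e)}"
        then have "glue f e = f" by (auto simp: glue_def fun_eq_iff)
        then show "w e * (cutsum (glue f e) t - cutsum f t) = 0" by simp
      qed
    qed auto
    finally show ?thesis .
  qed
  ultimately show ?thesis by simp
qed

context
  assumes lam: "\<And>S. S \<subseteq> {..<n} \<Longrightarrow> S \<noteq> {} \<Longrightarrow> S \<noteq> {..<n} \<Longrightarrow> lam \<le> cw S"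
begin

text \<open>Every block has boundary at least \<open>lam\<close>, and every remaining edge is
  counted at two blocks. A single block is not a proper cut, hence
  \<open>2 \<le> card\<close>.\<close>

lemma total_weight:
  assumes k: "2 \<le> card (f ` {..<n})"
  shows "real (card (f ` {..<n})) * lam / 2 \<le> (\<Sum>e\<in>{e \<in> pairs n. f (fst e) \<noteq> f (snd e)}. w e)"
proof -
  let ?L = "f ` {..<n}"
  let ?B = "\<lambda>a. {x \<in> {..<n}. f x = a}"
  have "lam \<le> cw (?B a)" if "a \<in> ?L" for a
  proof (rule lam)
    show "?B a \<noteq> {}" using that by auto
    show "?B a \<noteq> {..<n}"
    proof
      assume "?B a = {..<n}"
      then have "?L \<subseteq> {a}" by auto
      then have "card ?L \<le> card {a}" by (intro card_mono) auto
      then show False using k by simp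
    qed
  qed auto
  then have "(\<Sum>a\<in>?L. lam) \<le> (\<Sum>a\<in>?L. cw (?B a))" by (intro sum_mono)
  also have "(\<Sum>a\<in>?L. cw (?B a)) = (\<Sum>a\<in>?L. \<Sum>e\<in>pairs n. if sep (?B a) e then w e else 0)"
    unfolding cw_def by (simp add: sum.inter_filter)
  also have "\<dots> = (\<Sum>e\<in>pairs n. \<Sum>a\<in>?L. if sep (?B a) e then w e else 0)" by (rule sum.swap)
  also have "\<dots> = (\<Sum>e\<in>pairs n. if f (fst e) \<noteq> f (snd e) then 2 * w e else 0)"
  proof (rule sum.cong[OF refl])
    fix e assume "e \<in> pairs n"
    then have lt: "fst e < n" "snd e < n" by (auto simp: pairs_def)
    have "{a \<in> ?L. sep (?B a) e} = (if f (fst e) \<noteq> f (snd e) then {f (fst e), f (snd e)} else {})"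
      using lt by (auto simp: sep_def)
    then have "card {a \<in> ?L. sep (?B a) e} = (if f (fst e) \<noteq> f (snd e) then 2 else 0)" by simp
    then show "(\<Sum>a\<in>?L. if sep (?B a) e then w e else 0) = (if f (fst e) \<noteq> f (snd e) then 2 * w e else 0)"
      by (simp add: sum.inter_filter[symmetric])
  qed
  also have "\<dots> = 2 * (\<Sum>e\<in>{e \<in> pairs n. f (fst e) \<noteq> f (snd e)}. w e)"
    by (simp add: sum.inter_filter[symmetric] sum_distrib_left)
  finally show ?thesis by simp
qed

text \<open>Contracting the edges at exponential rates: the number of blocks is dominated by a process in
  which every block dies independently at rate \<open>lam / 2\<close>. The induction compares the derivatives of
  both sides.\<close>

lemma cutsum_bound:
  assumes "f ` {..<n} \<noteq> {}" "0 \<le> t"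
  shows "cutsum f t \<le> 1 + (1 + exp (- t * lam / 2)) ^ card (f ` {..<n})"
  using assms
proof (induction "card (f ` {..<n})" arbitrary: f t rule: less_induct)
  case (less f t)
  define k where "k = card (f ` {..<n})"
  have k0: "0 < k" using less.prems unfolding k_def by (auto simp: card_gt_0_iff)
  \<comment> \<open>The summand \<open>1\<close> makes up for the last block, which never
    disappears: two cuts remain, while the dominating process may lose all blocks.\<close>
  let ?g = "\<lambda>k t. 1 + (1 + exp (- t * lam / 2)) ^ k"
  have cs: "cutsum f t \<le> 2 ^ k" if "0 \<le> t" for t
  proof -
    have "cutsum f t \<le> (\<Sum>S\<in>blocks f. 1)" unfolding cutsum_def using that cw_nonneg by (intro sum_mono) simp
    also have "\<dots> = real (card (blocks f))" by simp
    also have "\<dots> \<le> real (2 ^ k)" using card_blocks[of f] unfolding k_def by (simp only: of_nat_le_iff)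
    finally show ?thesis by simp
  qed
  show ?case
  proof (cases "k = 1")
    case True
    then have "cutsum f t \<le> 1 + (1 + exp (- t * lam / 2))" using cs[OF less.prems(2)] by (simp add: add_increasing2)
    then show ?thesis using True unfolding k_def by simp
  next
    case False
    then have k2: "2 \<le> k" using k0 by simp
    define E where "E = {e \<in> pairs n. f (fst e) \<noteq> f (snd e)}"
    define W where "W = (\<Sum>e\<in>E. w e)"
    have W: "real k * lam / 2 \<le> W" unfolding W_def E_def k_def by (rule total_weight) (use k2 k_def in simp)
    let ?F' = "\<lambda>t. \<Sum>e\<in>E. w e * (cutsum (glue f e) t - cutsum f t)"
    let ?g' = "\<lambda>t. real k * (1 + exp (- t * lam / 2)) ^ (k - 1) * (exp (- t * lam / 2) * (- lam / 2))"
    \<comment> \<open>\<open>?g\<close> solves the equation of independent deaths at rate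
      \<open>lam / 2\<close>, whereas contraction acts at total rate
      \<open>W \<ge> k * lam / 2\<close>. With the integrating factor \<open>exp (W * t)\<close> the
      difference becomes monotone.\<close>
    define D where "D t = (?g k t - cutsum f t) * exp (W * t)" for t
    define D' where "D' t = (?g' t - ?F' t) * exp (W * t) + (?g k t - cutsum f t) * (exp (W * t) * W)" for t
    have dD: "(D has_real_derivative D' t) (at t)" for t
      unfolding D_def[abs_def] D'_def E_def
      by (rule derivative_eq_intros cutsum_deriv refl | simp)+
    have pos: "0 \<le> D' t" if t: "0 \<le> t" for t
    proof -
      have ih: "cutsum (glue f e) t \<le> ?g (k - 1) t" if "e \<in> E" for e
      proof -
        have c: "Suc (card (glue f e ` {..<n})) = k" using card_glue that unfolding E_def k_def by blast
        have "cutsum (glue f e) t \<le> ?g (card (glue f e ` {..<n})) t"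
          by (rule less.hyps) (use c k2 t k_def in \<open>auto simp: card_gt_0_iff\<close>)
        moreover have "card (glue f e ` {..<n}) = k - 1" using c by simp
        ultimately show ?thesis by simp
      qed
      have "?F' t \<le> (\<Sum>e\<in>E. w e * (?g (k - 1) t - cutsum f t))"
        using ih w0 by (intro sum_mono mult_left_mono) auto
      also have "\<dots> = W * (?g (k - 1) t - cutsum f t)" unfolding W_def by (simp add: sum_distrib_right)
      finally have F: "?F' t \<le> W * (?g (k - 1) t - cutsum f t)" .
      have gk: "?g k t = 1 + (1 + exp (- t * lam / 2)) ^ (k - 1) * (1 + exp (- t * lam / 2))"
        using k2 by (metis (no_types, lifting) One_nat_def Suc_pred k0 power_Suc2)
      have eq: "?g' t = real k * lam / 2 * (?g (k - 1) t - ?g k t)" unfolding gk by (simp add: algebra_simps)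
      have "?g (k - 1) t - ?g k t \<le> 0" unfolding gk by (simp add: algebra_simps)
      then have "W * (?g (k - 1) t - ?g k t) \<le> ?g' t" unfolding eq by (rule mult_right_mono_neg[OF W])
      then have "0 \<le> ?g' t - ?F' t + W * (?g k t - cutsum f t)" using F by (simp add: algebra_simps)
      then have "0 \<le> (?g' t - ?F' t + W * (?g k t - cutsum f t)) * exp (W * t)" by simp
      then show ?thesis unfolding D'_def by (simp add: algebra_simps)
    qed
    have "D 0 \<le> D t"
      by (rule DERIV_nonneg_imp_nondecreasing[OF less.prems(2)]) (use dD pos in blast)
    moreover have "0 \<le> D 0" unfolding D_def using cs[of 0] by simp
    ultimately have "0 \<le> (?g k t - cutsum f t) * exp (W * t)" unfolding D_def by simp
    then have "0 \<le> ?g k t - cutsum f t" by (simp add: zero_le_mult_iff not_le)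
    then show ?thesis unfolding k_def by simp
  qed
qed

text \<open>The bound for the uncontracted graph, less the \<open>2\<close> contributed by the
  trivial cuts.\<close>

lemma proper_cutsum:
  assumes n: "0 < n" and t: "0 \<le> t"
  shows "(\<Sum>S\<in>{S. proper_cut n S}. exp (- t * cw S)) \<le> (1 + exp (- t * lam / 2)) ^ n - 1"
proof -
  have fin: "finite {S. proper_cut n S}"
    by (rule finite_subset[of _ "Pow {..<n}"]) (auto simp: proper_cut_def)
  have b: "blocks (\<lambda>x. x) = insert {} (insert {..<n} {S. proper_cut n S})"
    unfolding blocks_def proper_cut_def by (auto simp: atLeast0LessThan)
  have "cw {} = 0" "cw {..<n} = 0" unfolding cw_def by (auto simp: sep_def pairs_def intro!: sum.neutral)
  moreover have "{} \<noteq> {..<n}" using n by auto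
  moreover have "{} \<notin> {S. proper_cut n S}" "{..<n} \<notin> {S. proper_cut n S}"
    by (auto simp: proper_cut_def atLeast0LessThan)
  ultimately have "cutsum (\<lambda>x. x) t = 2 + (\<Sum>S\<in>{S. proper_cut n S}. exp (- t * cw S))"
    unfolding cutsum_def b using fin by simp
  moreover have "cutsum (\<lambda>x. x) t \<le> 1 + (1 + exp (- t * lam / 2)) ^ n"
    using cutsum_bound[of "\<lambda>x. x" t] n t by (auto simp: lessThan_empty_iff)
  ultimately show ?thesis by simp
qed

end

end

section \<open>Concentration\<close>

lemma exp_minus_le_quadratic:
  assumes "0 \<le> (x::real)"
  shows "exp (- x) \<le> 1 - x + x\<^sup>2 / 2"
proof -
  have "1 - 0 + 0\<^sup>2 / 2 - exp (- 0) \<le> 1 - x + x\<^sup>2 / 2 - exp (- x)"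
  proof (rule DERIV_nonneg_imp_nondecreasing[OF assms, of "\<lambda>x. 1 - x + x\<^sup>2 / 2 - exp (- x)"])
    fix y :: real
    have "((\<lambda>x. 1 - x + x\<^sup>2 / 2 - exp (- x)) has_real_derivative (- 1 + y + exp (- y))) (at y)"
      by (auto intro!: derivative_eq_intros)
    moreover have "0 \<le> - 1 + y + exp (- y)" using exp_ge_add_one_self[of "- y"] by simp
    ultimately show "\<exists>d. ((\<lambda>x. 1 - x + x\<^sup>2 / 2 - exp (- x)) has_real_derivative d) (at y) \<and> 0 \<le> d" by blast
  qed
  then show ?thesis by simp
qed

definition hits :: "'b set \<Rightarrow> 'i set \<Rightarrow> ('i \<Rightarrow> 'b) \<Rightarrow> nat" where
  "hits G D \<omega> = card {e \<in> D. \<omega> e \<in> G}"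

text \<open>Probabilities over uniform functions are handled by counting: the generating function of the
  number of hits factorises over the index set.\<close>

lemma hits_generating:
  fixes c :: real
  assumes I: "finite I" and B: "finite B" "B \<noteq> {}" and G: "G \<subseteq> B" and D: "D \<subseteq> I"
  shows "(\<Sum>\<omega>\<in>PiE I (\<lambda>_. B). c ^ hits G D \<omega>)
     = real (card B) ^ card I * (1 + real (card G) / real (card B) * (c - 1)) ^ card D"
proof -
  have finD: "finite D" using D I finite_subset by blast
  have b: "0 < card B" using B by (simp add: card_gt_0_iff)
  let ?w = "\<lambda>e x. if e \<in> D \<and> x \<in> G then c else 1"
  let ?q = "1 + real (card G) / real (card B) * (c - 1)"
  have "c ^ hits G D \<omega> = (\<Prod>e\<in>I. ?w e (\<omega> e))" for \<omega>
  proof -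
    have "(\<Prod>e\<in>I. ?w e (\<omega> e)) = (\<Prod>e\<in>{e \<in> I. e \<in> D \<and> \<omega> e \<in> G}. c)"
      using I by (simp only: prod.inter_filter)
    also have "{e \<in> I. e \<in> D \<and> \<omega> e \<in> G} = {e \<in> D. \<omega> e \<in> G}" using D by blast
    finally show ?thesis by (simp add: hits_def)
  qed
  then have "(\<Sum>\<omega>\<in>PiE I (\<lambda>_. B). c ^ hits G D \<omega>) = (\<Sum>\<omega>\<in>PiE I (\<lambda>_. B). \<Prod>e\<in>I. ?w e (\<omega> e))" by simp
  also have "\<dots> = (\<Prod>e\<in>I. \<Sum>x\<in>B. ?w e x)" by (rule prod_sum_PiE[symmetric]) (use I B in auto)
  also have "\<dots> = (\<Prod>e\<in>I. real (card B) * (if e \<in> D then ?q else 1))"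
  proof (rule prod.cong[OF refl])
    fix e
    have "(\<Sum>x\<in>B. ?w e x) = (\<Sum>x\<in>B. 1 + (if e \<in> D \<and> x \<in> G then c - 1 else 0))" by (rule sum.cong) auto
    also have "\<dots> = real (card B) + (\<Sum>x\<in>B. if e \<in> D \<and> x \<in> G then c - 1 else 0)" by (simp add: sum.distrib)
    also have "(\<Sum>x\<in>B. if e \<in> D \<and> x \<in> G then c - 1 else 0) = (if e \<in> D then real (card G) * (c - 1) else 0)"
    proof (cases "e \<in> D")
      case True
      have "{x \<in> B. x \<in> G} = G" using G by blast
      then have "(\<Sum>x\<in>B. if x \<in> G then c - 1 else 0) = real (card G) * (c - 1)"
        using B by (simp add: sum.inter_filter[symmetric])
      then show ?thesis using True by simp
    qed simp
    finally show "(\<Sum>x\<in>B. ?w e x) = real (card B) * (if e \<in> D then ?q else 1)"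
      using b by (simp add: field_simps)
  qed
  also have "\<dots> = real (card B) ^ card I * (\<Prod>e\<in>I. if e \<in> D then ?q else 1)" by (simp add: prod.distrib)
  also have "(\<Prod>e\<in>I. if e \<in> D then ?q else 1) = ?q ^ card D"
  proof -
    have "{e \<in> I. e \<in> D} = D" using D by blast
    then show ?thesis using I by (simp add: prod.inter_filter[symmetric])
  qed
  finally show ?thesis .
qed

context
  fixes I :: "'i set" and B G :: "'b set" and D :: "'i set" and p :: real
  assumes I: "finite I" and B: "finite B" "B \<noteq> {}" and G: "G \<subseteq> B" and D: "D \<subseteq> I"
  defines "p \<equiv> real (card G) / real (card B)"
begin

lemma p_bounds: "0 \<le> p" "p \<le> 1"
  unfolding p_def using card_mono[OF B(1) G] by (auto simp: divide_le_eq card_gt_0_iff B)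

lemma hits_mgf:
  "(\<Sum>\<omega>\<in>PiE I (\<lambda>_. B). exp (\<theta> * real (hits G D \<omega>)))
     \<le> real (card (PiE I (\<lambda>_. B))) * exp (real (card D) * p * (exp \<theta> - 1))"
proof -
  have "(\<Sum>\<omega>\<in>PiE I (\<lambda>_. B). exp (\<theta> * real (hits G D \<omega>))) = (\<Sum>\<omega>\<in>PiE I (\<lambda>_. B). exp \<theta> ^ hits G D \<omega>)"
    by (simp add: exp_of_nat2_mult[symmetric] mult.commute)
  also have "\<dots> = real (card B) ^ card I * (1 + p * (exp \<theta> - 1)) ^ card D"
    unfolding p_def by (rule hits_generating[OF I B G D])
  also have "\<dots> \<le> real (card B) ^ card I * exp (p * (exp \<theta> - 1)) ^ card D"
  proof (intro mult_left_mono power_mono exp_ge_add_one_self)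
    have "0 \<le> (1 - p) + p * exp \<theta>" using p_bounds by simp
    then show "0 \<le> 1 + p * (exp \<theta> - 1)" by (simp add: algebra_simps)
  qed simp
  also have "exp (p * (exp \<theta> - 1)) ^ card D = exp (real (card D) * p * (exp \<theta> - 1))"
    by (simp add: exp_of_nat_mult[symmetric] mult.assoc)
  also have "real (card B) ^ card I = real (card (PiE I (\<lambda>_. B)))" using I by (simp add: card_PiE)
  finally show ?thesis .
qed

text \<open>Markov's inequality for the moment generating function; a negative
  \<open>\<theta>\<close> gives lower tails.\<close>

lemma hits_markov:
  "real (card {\<omega> \<in> PiE I (\<lambda>_. B). r \<le> \<theta> * real (hits G D \<omega>)})
     \<le> real (card (PiE I (\<lambda>_. B))) * exp (real (card D) * p * (exp \<theta> - 1) - r)"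
proof -
  let ?O = "PiE I (\<lambda>_. B)"
  let ?E = "{\<omega> \<in> ?O. r \<le> \<theta> * real (hits G D \<omega>)}"
  have fin: "finite ?O" using I B by (simp add: finite_PiE)
  have "real (card ?E) * exp r = (\<Sum>\<omega>\<in>?E. exp r)" by simp
  also have "\<dots> \<le> (\<Sum>\<omega>\<in>?E. exp (\<theta> * real (hits G D \<omega>)))" by (intro sum_mono) simp
  also have "\<dots> \<le> (\<Sum>\<omega>\<in>?O. exp (\<theta> * real (hits G D \<omega>)))" using fin by (intro sum_mono2) auto
  also have "\<dots> \<le> real (card ?O) * exp (real (card D) * p * (exp \<theta> - 1))" by (rule hits_mgf)
  finally have "real (card ?E) \<le> real (card ?O) * exp (real (card D) * p * (exp \<theta> - 1)) / exp r"
    by (simp add: pos_le_divide_eq)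
  then show ?thesis by (simp add: exp_diff)
qed

text \<open>Chernoff's bound with \<open>\<theta> = - \<delta>\<close>. The exponent is twice that
  of \<open>hits_upper\<close>, and the factor \<open>1 / 2\<close> in the exponent of
  \<open>proper_cutsum\<close> uses this up.\<close>

lemma hits_lower:
  assumes d: "0 \<le> \<delta>" "\<delta> \<le> 1"
  shows "real (card {\<omega> \<in> PiE I (\<lambda>_. B). real (hits G D \<omega>) \<le> (1 - \<delta>) * (p * real (card D))})
     \<le> real (card (PiE I (\<lambda>_. B))) * exp (- (\<delta>\<^sup>2 / 2) * p * real (card D))"
proof -
  let ?O = "PiE I (\<lambda>_. B)"
  let ?\<mu> = "p * real (card D)"
  have mu: "0 \<le> ?\<mu>" using p_bounds by simp
  have fin: "finite ?O" using I B by (simp add: finite_PiE)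
  have "exp (- \<delta>) \<le> 1 - \<delta> + \<delta>\<^sup>2 / 2"
    using exp_minus_le_quadratic[of \<delta>] d by simp
  then have "?\<mu> * (exp (- \<delta>) - 1) + \<delta> * ((1 - \<delta>) * ?\<mu>) \<le> ?\<mu> * (- \<delta> + \<delta>\<^sup>2 / 2) + \<delta> * ((1 - \<delta>) * ?\<mu>)"
    using mu by (intro add_right_mono mult_left_mono) auto
  also have "\<dots> = - (\<delta>\<^sup>2 / 2) * ?\<mu>" by (simp add: algebra_simps power2_eq_square)
  finally have ex: "real (card D) * p * (exp (- \<delta>) - 1) - (- \<delta> * ((1 - \<delta>) * ?\<mu>)) \<le> - (\<delta>\<^sup>2 / 2) * p * real (card D)"
    by (simp add: algebra_simps)
  have "{\<omega> \<in> ?O. real (hits G D \<omega>) \<le> (1 - \<delta>) * ?\<mu>} \<subseteq> {\<omega> \<in> ?O. - \<delta> * ((1 - \<delta>) * ?\<mu>) \<le> - \<delta> * real (hits G D \<omega>)}"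
    using d by (auto intro!: mult_left_mono)
  then have "real (card {\<omega> \<in> ?O. real (hits G D \<omega>) \<le> (1 - \<delta>) * ?\<mu>}) \<le>
     real (card {\<omega> \<in> ?O. - \<delta> * ((1 - \<delta>) * ?\<mu>) \<le> - \<delta> * real (hits G D \<omega>)})"
    using fin by (simp add: card_mono)
  also have "\<dots> \<le> real (card ?O) * exp (real (card D) * p * (exp (- \<delta>) - 1) - (- \<delta> * ((1 - \<delta>) * ?\<mu>)))"
    by (rule hits_markov)
  also have "\<dots> \<le> real (card ?O) * exp (- (\<delta>\<^sup>2 / 2) * p * real (card D))"
    using ex by (intro mult_left_mono) auto
  finally show ?thesis .
qed

lemma hits_upper:
  assumes d: "0 \<le> \<delta>" "\<delta> \<le> 1"
  shows "real (card {\<omega> \<in> PiE I (\<lambda>_. B). (1 + \<delta>) * (p * real (card D)) \<le> real (hits G D \<omega>)})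
     \<le> real (card (PiE I (\<lambda>_. B))) * exp (- (\<delta>\<^sup>2 / 4) * p * real (card D))"
proof -
  let ?O = "PiE I (\<lambda>_. B)"
  let ?\<mu> = "p * real (card D)" and ?\<theta> = "\<delta> / 2"
  have mu: "0 \<le> ?\<mu>" using p_bounds by simp
  have fin: "finite ?O" using I B by (simp add: finite_PiE)
  have "exp ?\<theta> \<le> 1 + ?\<theta> + ?\<theta>\<^sup>2" using d by (intro exp_bound) auto
  then have "?\<mu> * (exp ?\<theta> - 1) - ?\<theta> * ((1 + \<delta>) * ?\<mu>) \<le> ?\<mu> * (?\<theta> + ?\<theta>\<^sup>2) - ?\<theta> * ((1 + \<delta>) * ?\<mu>)"
    using mu by (intro diff_right_mono mult_left_mono) auto
  also have "\<dots> = - (\<delta>\<^sup>2 / 4) * ?\<mu>" by (simp add: algebra_simps power2_eq_square)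
  finally have ex: "real (card D) * p * (exp ?\<theta> - 1) - ?\<theta> * ((1 + \<delta>) * ?\<mu>) \<le> - (\<delta>\<^sup>2 / 4) * p * real (card D)"
    by (simp add: algebra_simps)
  have "{\<omega> \<in> ?O. (1 + \<delta>) * ?\<mu> \<le> real (hits G D \<omega>)} \<subseteq> {\<omega> \<in> ?O. ?\<theta> * ((1 + \<delta>) * ?\<mu>) \<le> ?\<theta> * real (hits G D \<omega>)}"
    using d by (auto intro!: mult_left_mono)
  then have "real (card {\<omega> \<in> ?O. (1 + \<delta>) * ?\<mu> \<le> real (hits G D \<omega>)}) \<le>
     real (card {\<omega> \<in> ?O. ?\<theta> * ((1 + \<delta>) * ?\<mu>) \<le> ?\<theta> * real (hits G D \<omega>)})"
    using fin by (simp add: card_mono)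
  also have "\<dots> \<le> real (card ?O) * exp (real (card D) * p * (exp ?\<theta> - 1) - ?\<theta> * ((1 + \<delta>) * ?\<mu>))"
    by (rule hits_markov)
  also have "\<dots> \<le> real (card ?O) * exp (- (\<delta>\<^sup>2 / 4) * p * real (card D))"
    using ex by (intro mult_left_mono) auto
  finally show ?thesis .
qed

text \<open>Both signs \<open>\<theta> = \<gamma> / 2\<close> and
  \<open>\<theta> = - \<gamma> / 2\<close>, with \<open>p \<le> 1\<close> to make the exponent
  independent of \<open>p\<close>. An additive error suffices for parities.\<close>

lemma hits_deviation:
  assumes g: "0 \<le> \<gamma>" "\<gamma> \<le> 1"
  shows "real (card {\<omega> \<in> PiE I (\<lambda>_. B). real (card D) * \<gamma> \<le> \<bar>real (hits G D \<omega>) - real (card D) * p\<bar>})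
     \<le> 2 * real (card (PiE I (\<lambda>_. B))) * exp (- real (card D) * \<gamma>\<^sup>2 / 4)"
proof -
  let ?O = "PiE I (\<lambda>_. B)"
  let ?K = "real (card D)" and ?\<theta> = "\<gamma> / 2"
  have fin: "finite ?O" using I B by (simp add: finite_PiE)
  have one: "real (card {\<omega> \<in> ?O. \<theta> * (?K * p) + ?K * (\<gamma>\<^sup>2 / 2) \<le> \<theta> * real (hits G D \<omega>)})
     \<le> real (card ?O) * exp (- ?K * \<gamma>\<^sup>2 / 4)" if "\<theta> = ?\<theta> \<or> \<theta> = - ?\<theta>" for \<theta>
  proof -
    have "exp \<theta> \<le> 1 + \<theta> + \<theta>\<^sup>2"
    proof (cases "\<theta> = ?\<theta>")
      case True
      then show ?thesis using g by (intro exp_bound) auto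
    next
      case False
      then have t: "\<theta> = - ?\<theta>" using that by blast
      have "exp (- ?\<theta>) \<le> 1 - ?\<theta> + ?\<theta>\<^sup>2 / 2" using exp_minus_le_quadratic[of ?\<theta>] g by simp
      also have "\<dots> \<le> 1 - ?\<theta> + ?\<theta>\<^sup>2" by simp
      finally show ?thesis unfolding t by simp
    qed
    moreover have "\<theta>\<^sup>2 = \<gamma>\<^sup>2 / 4" using that by (auto simp: power2_eq_square)
    ultimately have "?K * p * (exp \<theta> - 1) \<le> ?K * p * (\<theta> + \<gamma>\<^sup>2 / 4)" using p_bounds by (intro mult_left_mono) auto
    also have "\<dots> = \<theta> * (?K * p) + p * (?K * \<gamma>\<^sup>2 / 4)" by (simp add: algebra_simps)
    also have "\<dots> \<le> \<theta> * (?K * p) + 1 * (?K * \<gamma>\<^sup>2 / 4)" using p_bounds by (intro add_left_mono mult_right_mono) auto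
    finally have "?K * p * (exp \<theta> - 1) - (\<theta> * (?K * p) + ?K * (\<gamma>\<^sup>2 / 2)) \<le> - ?K * \<gamma>\<^sup>2 / 4" by simp
    then have "real (card ?O) * exp (?K * p * (exp \<theta> - 1) - (\<theta> * (?K * p) + ?K * (\<gamma>\<^sup>2 / 2))) \<le> real (card ?O) * exp (- ?K * \<gamma>\<^sup>2 / 4)"
      by (intro mult_left_mono) auto
    then show ?thesis using hits_markov[of "\<theta> * (?K * p) + ?K * (\<gamma>\<^sup>2 / 2)" \<theta>] by linarith
  qed
  let ?A = "\<lambda>\<theta>. {\<omega> \<in> ?O. \<theta> * (?K * p) + ?K * (\<gamma>\<^sup>2 / 2) \<le> \<theta> * real (hits G D \<omega>)}"
  have "{\<omega> \<in> ?O. ?K * \<gamma> \<le> \<bar>real (hits G D \<omega>) - ?K * p\<bar>} \<subseteq> ?A ?\<theta> \<union> ?A (- ?\<theta>)"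
  proof
    fix \<omega> assume a: "\<omega> \<in> {\<omega> \<in> ?O. ?K * \<gamma> \<le> \<bar>real (hits G D \<omega>) - ?K * p\<bar>}"
    have e: "?\<theta> * (?K * \<gamma>) = ?K * (\<gamma>\<^sup>2 / 2)" by (simp add: power2_eq_square)
    show "\<omega> \<in> ?A ?\<theta> \<union> ?A (- ?\<theta>)"
    proof (cases "?K * p \<le> real (hits G D \<omega>)")
      case True
      then have "?K * \<gamma> \<le> real (hits G D \<omega>) - ?K * p" using a by simp
      then have "?\<theta> * (?K * \<gamma>) \<le> ?\<theta> * (real (hits G D \<omega>) - ?K * p)" using g by (intro mult_left_mono) auto
      then have "?\<theta> * (?K * p) + ?K * (\<gamma>\<^sup>2 / 2) \<le> ?\<theta> * real (hits G D \<omega>)" unfolding e right_diff_distrib by linarith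
      then show ?thesis using a by blast
    next
      case False
      then have "?K * \<gamma> \<le> ?K * p - real (hits G D \<omega>)" using a by simp
      then have "?\<theta> * (?K * \<gamma>) \<le> ?\<theta> * (?K * p - real (hits G D \<omega>))" using g by (intro mult_left_mono) auto
      then have "- ?\<theta> * (?K * p) + ?K * (\<gamma>\<^sup>2 / 2) \<le> - ?\<theta> * real (hits G D \<omega>)"
        unfolding e right_diff_distrib mult_minus_left by linarith
      then show ?thesis using a by blast
    qed
  qed
  then have "card {\<omega> \<in> ?O. ?K * \<gamma> \<le> \<bar>real (hits G D \<omega>) - ?K * p\<bar>} \<le> card (?A ?\<theta> \<union> ?A (- ?\<theta>))"
    using fin by (intro card_mono) auto
  also have "\<dots> \<le> card (?A ?\<theta>) + card (?A (- ?\<theta>))" by (rule card_Un_le)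
  finally have "real (card {\<omega> \<in> ?O. ?K * \<gamma> \<le> \<bar>real (hits G D \<omega>) - ?K * p\<bar>}) \<le> real (card (?A ?\<theta>)) + real (card (?A (- ?\<theta>)))"
    by linarith
  then show ?thesis using one[of ?\<theta>] one[of "- ?\<theta>"] by linarith
qed

text \<open>The generating function at \<open>- 1\<close> is the number of even outcomes minus the
  number of odd ones.\<close>

lemma odd_hits:
  "real (card {\<omega> \<in> PiE I (\<lambda>_. B). odd (hits G D \<omega>)})
     = real (card (PiE I (\<lambda>_. B))) * ((1 - (1 - 2 * p) ^ card D) / 2)"
proof -
  let ?O = "PiE I (\<lambda>_. B)"
  have fin: "finite ?O" using I B by (simp add: finite_PiE)
  have "(\<Sum>\<omega>\<in>?O. (- 1) ^ hits G D \<omega>) = real (card ?O) * (1 - 2 * p) ^ card D"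
  proof -
    have "1 + p * (- 1 - 1) = 1 - 2 * p" by simp
    then show ?thesis using hits_generating[OF I B G D, of "- 1", folded p_def] I
      by (simp add: card_PiE mult.commute)
  qed
  moreover have "(\<Sum>\<omega>\<in>?O. (- 1) ^ hits G D \<omega>) = (\<Sum>\<omega>\<in>?O. 1 - 2 * (if odd (hits G D \<omega>) then 1 else 0 :: real))"
    by (rule sum.cong) auto
  moreover have "\<dots> = real (card ?O) - 2 * real (card {\<omega> \<in> ?O. odd (hits G D \<omega>)})"
    using fin by (simp add: sum_subtractf sum_distrib_left[symmetric] sum.inter_filter[symmetric])
  ultimately show ?thesis by (simp add: algebra_simps)
qed

end

section \<open>The algorithm\<close>

lemma proper_singleton: "2 \<le> n \<Longrightarrow> proper_cut n {0}"
proof -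
  assume n: "2 \<le> n"
  then have "card {0::nat} \<noteq> card {0..<n}" by simp
  then have "{0} \<noteq> {0..<n}" by metis
  then show ?thesis using n by (simp add: proper_cut_def)
qed

text \<open>\<open>N\<close> counts trees, \<open>K\<close> parity samples, and \<open>J\<close>
  limits the sampling scales. The message types to be fitted are node names (\<open>m1\<close>),
  parity vectors (\<open>m2\<close>), packed estimates (\<open>m3\<close>), edge ranks
  (\<open>m4\<close>), sampling results of an edge (\<open>m5\<close>) and exact cut weights
  (\<open>m6\<close>).\<close>

locale cut_network = big_network +
  fixes N K J :: nat and dig :: "nat \<Rightarrow> nat \<times> nat \<times> nat \<Rightarrow> nat"
  assumes m1: "n ^ 6 * (n + 1) \<le> msg_bound \<kappa> n" and m2: "n ^ 6 * 2 ^ K \<le> msg_bound \<kappa> n"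
    and m3: "n ^ 6 * ((K + 1) * n ^ 2 + 1) \<le> msg_bound \<kappa> n"
    and m4: "n ^ 6 * (N * n ^ 2 + 2) \<le> msg_bound \<kappa> n"
    and m5: "(n ^ d + 1) * 2 ^ K \<le> msg_bound \<kappa> n"
    and m6: "n ^ 6 * (n ^ 2 * n ^ d + 2) \<le> msg_bound \<kappa> n"
begin

section \<open>Exact weights of known cuts\<close>

definition cutw :: "inst \<Rightarrow> nat set \<Rightarrow> nat" where
  "cutw z S = cut_weight n (wt z) S"

definition better :: "inst \<Rightarrow> nat set \<Rightarrow> nat set \<Rightarrow> nat set" where
  "better z S T = (if cutw z S < cutw z T then S else T)"

text \<open>Restricted to neighbours, since only these tell \<open>v\<close> on which side they
  lie.\<close>

definition share :: "inst \<Rightarrow> nat set \<Rightarrow> nat \<Rightarrow> nat" where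
  "share z S v = (if v \<in> S then \<Sum>u\<in>{u. u < n \<and> 0 < wt z v u \<and> u \<notin> S}. wt z v u else 0)"

lemma cutw_share: "S \<subseteq> {..<n} \<Longrightarrow> (\<Sum>v<n. share z S v) = cutw z S"
proof -
  assume S: "S \<subseteq> {..<n}"
  have "(\<Sum>v<n. share z S v) = (\<Sum>v\<in>S. \<Sum>u\<in>{u. u < n \<and> 0 < wt z v u \<and> u \<notin> S}. wt z v u)"
    unfolding share_def using S by (intro sum.mono_neutral_cong_right) auto
  also have "\<dots> = (\<Sum>v\<in>S. \<Sum>u\<in>{0..<n} - S. wt z v u)"
    by (intro sum.cong refl sum.mono_neutral_left) auto
  finally show ?thesis unfolding cutw_def cut_weight_def .
qed

lemma share_bound: "ok z \<Longrightarrow> (\<Sum>v<n. share z S v) \<le> n ^ 2 * n ^ d"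
proof -
  assume z: "ok z"
  have "share z S v \<le> n * n ^ d" for v
  proof -
    have "share z S v \<le> (\<Sum>u\<in>{u. u < n \<and> 0 < wt z v u \<and> u \<notin> S}. n ^ d)"
    proof -
      have "wt z v u \<le> n ^ d" for u using z unfolding ok_def weighted_graph_def by blast
      then show ?thesis unfolding share_def by (cases "v \<in> S") (simp_all only: if_True if_False sum_mono zero_le)
    qed
    also have "\<dots> = card {u. u < n \<and> 0 < wt z v u \<and> u \<notin> S} * n ^ d" by simp
    also have "\<dots> \<le> card {..<n} * n ^ d" by (intro mult_le_mono1 card_mono) auto
    finally show ?thesis by simp
  qed
  then have "(\<Sum>v<n. share z S v) \<le> (\<Sum>v<n. n * n ^ d)" by (intro sum_mono)
  then show ?thesis by (simp add: power2_eq_square mult.assoc)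
qed

lemma known_cutw:
  assumes X: "known R X" and S: "det X (\<lambda>z v. v \<in> S z)" and sub: "\<And>z. ok z \<Longrightarrow> S z \<subseteq> {..<n}"
  shows "known (R + 1 + 8 * lg) (\<lambda>z v. (X z v, cutw z (S z)))"
proof -
  have "known (Suc R) (\<lambda>z v. (X z v, \<lambda>u. if u < n \<and> 0 < wt z v u then Some (v' z u v) else None))"
    if "v' = (\<lambda>z u v. u \<in> S z)" for v'
    using X
  proof (rule known_local[where LM = UNIV])
    show "det X v'" unfolding that using S by (rule det_via) simp
    have "2 \<le> n" by (rule n2)
    also have "n \<le> n ^ 4" using n2 power_increasing[of 1 4 n] by simp
    finally show "card (UNIV :: bool set) \<le> msg_bound \<kappa> n" using msg4 by simp
  qed simp_all
  then have K1: "known (Suc R) (\<lambda>z v. (X z v, \<lambda>u. if u < n \<and> 0 < wt z v u then Some (u \<in> S z) else None))" by simp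
  let ?Y = "\<lambda>z v. (X z v, \<lambda>u. if u < n \<and> 0 < wt z v u then Some (u \<in> S z) else None)"
  have "known (Suc R + 8 * lg) (\<lambda>z v. (?Y z v, \<Sum>v<n. share z (S z) v))"
    using K1
  proof (rule known_sum[where B = "n ^ 2 * n ^ d"])
    show "det ?Y (\<lambda>z v. share z (S z) v)"
    proof (rule detI)
      fix z z' :: inst and v
      assume a: "ok z" "ok z'" "v < n" "wt z v = wt z' v" "rn z v = rn z' v" "?Y z v = ?Y z' v"
      have vS: "(v \<in> S z) = (v \<in> S z')" using a by (intro detD[OF S]) auto
      have "(if u < n \<and> 0 < wt z v u then Some (u \<in> S z) else None) = (if u < n \<and> 0 < wt z' v u then Some (u \<in> S z') else None)" for u
        using a(6) by (simp add: fun_eq_iff)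
      note e = this
      have "(u \<in> S z) = (u \<in> S z')" if "u < n" "0 < wt z v u" for u using e[of u] that a(4) by simp
      then have "{u. u < n \<and> 0 < wt z v u \<and> u \<notin> S z} = {u. u < n \<and> 0 < wt z' v u \<and> u \<notin> S z'}"
        unfolding a(4)[symmetric] by blast
      then show "share z (S z) v = share z' (S z') v" unfolding share_def using vS a(4) by simp
    qed
  qed (use m6 share_bound in auto)
  then show ?thesis by simp (erule known_via, simp add: cutw_share sub)
qed

lemma known_better:
  assumes X: "known R X" and S: "det X (\<lambda>z v. v \<in> S z)" and T: "det X (\<lambda>z v. v \<in> T z)"
    and sub: "\<And>z. ok z \<Longrightarrow> S z \<subseteq> {..<n}" "\<And>z. ok z \<Longrightarrow> T z \<subseteq> {..<n}"
  shows "known (R + 2 + 16 * lg) (\<lambda>z v. (X z v, v \<in> better z (S z) (T z)))"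
proof -
  have K1: "known (R + 1 + 8 * lg) (\<lambda>z v. (X z v, cutw z (S z)))" by (rule known_cutw[OF X S sub(1)])
  have "known (R + 1 + 8 * lg + 1 + 8 * lg) (\<lambda>z v. ((X z v, cutw z (S z)), cutw z (T z)))"
  proof (rule known_cutw[OF K1 _ sub(2)])
    show "det (\<lambda>z v. (X z v, cutw z (S z))) (\<lambda>z v. v \<in> T z)" by (rule det_trans[OF _ T], rule detI) blast
  qed
  moreover have "R + 1 + 8 * lg + 1 + 8 * lg = R + 2 + 16 * lg" by simp
  ultimately have K2: "known (R + 2 + 16 * lg) (\<lambda>z v. ((X z v, cutw z (S z)), cutw z (T z)))" by (simp only:)
  show ?thesis
  proof (rule known_via[OF K2])
    fix z z' :: inst and v
    assume a: "ok z" "ok z'" "v < n" "wt z v = wt z' v" "rn z v = rn z' v"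
      "((X z v, cutw z (S z)), cutw z (T z)) = ((X z' v, cutw z' (S z')), cutw z' (T z'))"
    have "(v \<in> S z) = (v \<in> S z')" using a by (intro detD[OF S]) auto
    moreover have "(v \<in> T z) = (v \<in> T z')" using a by (intro detD[OF T]) auto
    ultimately show "(X z v, v \<in> better z (S z) (T z)) = (X z' v, v \<in> better z' (S z') (T z'))"
      using a(6) by (simp add: better_def)
  qed
qed

text \<open>The coins of the copies of \<open>uv\<close> are the digits of the random number of \<open>min u v\<close>, with first
  index \<open>0\<close> for the skeleton and \<open>Suc k\<close> for sample \<open>k\<close>; a copy survives at rate \<open>2\<^sup>-\<^sup>j\<close> when its coin
  is below \<open>2 ^ (J - j)\<close>.\<close>

definition skel :: "nat \<Rightarrow> inst \<Rightarrow> nat \<Rightarrow> nat \<Rightarrow> nat" where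
  "skel j z u v = card {i. i < wt z u v \<and> dig (rn z (min u v)) (0, max u v, i) < 2 ^ (J - j)}"

definition sketch :: "nat \<Rightarrow> inst \<Rightarrow> nat \<Rightarrow> nat \<Rightarrow> nat set" where
  "sketch l z u v = {k. k < K \<and> odd (card {i. i < wt z u v \<and> dig (rn z (min u v)) (Suc k, max u v, i) < 2 ^ (J - l)})}"

definition bits :: "nat \<Rightarrow> inst \<Rightarrow> nat \<Rightarrow> nat set" where
  "bits l z v = symdiff.F (sketch l z v) {..<n}"

lemma skel_le: "skel j z u v \<le> wt z u v"
  unfolding skel_def by (rule order_trans[OF card_mono[of "{..<wt z u v}"]]) auto

lemma skel_graph: "ok z \<Longrightarrow> weighted_graph n (skel j z) d"
  unfolding weighted_graph_def
proof (intro conjI allI impI)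
  fix u v assume z: "ok z"
  note w = z[unfolded ok_def]
  have zero: "skel j z u v = 0" if "wt z u v = 0" for u v using skel_le[of j z u v] that by simp
  show "skel j z u v = skel j z v u"
    unfolding skel_def wt_sym[OF z, of u v] min.commute[of u v] max.commute[of u v] ..
  show "skel j z v v = 0" using weighted_graphD(2)[OF w] by (rule zero)
  show "skel j z u v = 0" if "n \<le> u \<or> n \<le> v"
  proof (rule zero, rule ccontr)
    assume "wt z u v \<noteq> 0"
    then show False using wt_lt[OF z, of u v] that by simp
  qed
  show "skel j z u v \<le> n ^ d" using skel_le[of j z u v] weighted_graphD(4)[OF w, of u v] by simp
qed

lemma bits_sub: "bits l z v \<subseteq> {..<K}"
proof
  fix k assume "k \<in> bits l z v"
  then have "odd (card {u \<in> {..<n}. k \<in> sketch l z v u})" unfolding bits_def by (simp add: symdiff_mem)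
  then have "{u \<in> {..<n}. k \<in> sketch l z v u} \<noteq> {}" by (metis card.empty even_zero)
  then show "k \<in> {..<K}" unfolding sketch_def by blast
qed

text \<open>All coins of an edge belong to its smaller endpoint, which evaluates them and sends the
  outcome: a multiplicity and \<open>K\<close> bits, however many copies there are.\<close>

lemma known_sample:
  assumes X: "known R X"
  shows "known (Suc R) (\<lambda>z v. (X z v, skel j z v, bits l z v))"
proof -
  \<comment> \<open>The larger endpoint has nothing to report and sends a default.\<close>
  define SL where "SL z u v = (if u < v then (skel j z u v, sketch l z u v) else (0, {}))" for z u v
  have loc: "skel j z u v = skel j z' u v \<and> sketch l z u v = sketch l z' u v"
    if "u < v" "wt z u = wt z' u" "rn z u = rn z' u" for z z' u v
    using that by (simp add: skel_def sketch_def)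
  have K1: "known (Suc R) (\<lambda>z v. (X z v, \<lambda>u. if u < n \<and> 0 < wt z v u then Some (SL z u v) else None))"
    using X
  proof (rule known_local[where LM = "{..n ^ d} \<times> Pow {..<K}"])
    show "det X SL"
    proof (rule detI)
      fix z z' :: inst and v
      assume "wt z v = wt z' v" "rn z v = rn z' v"
      then show "SL z v = SL z' v" using loc[of v _ z z'] unfolding SL_def by (intro ext) simp
    qed
    show "card ({..n ^ d} \<times> Pow {..<K}) \<le> msg_bound \<kappa> n" using m5 by (simp add: card_cartesian_product card_Pow)
    show "SL z v u \<in> {..n ^ d} \<times> Pow {..<K}" if z: "ok z" for z v u
      using weighted_graphD(4)[OF skel_graph[OF z, of j], of v u] unfolding SL_def sketch_def by auto
  qed simp
  let ?Y = "\<lambda>z v. (X z v, \<lambda>u. if u < n \<and> 0 < wt z v u then Some (SL z u v) else None)"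
  show ?thesis
  proof (rule known_via[OF K1])
    fix z z' :: inst and v
    assume a: "ok z" "ok z'" "v < n" "wt z v = wt z' v" "rn z v = rn z' v" "?Y z v = ?Y z' v"
    have eq: "skel j z v u = skel j z' v u \<and> sketch l z v u = sketch l z' v u" for u
    proof (cases "0 < wt z v u")
      case False
      then have "wt z v u = 0" "wt z' v u = 0" using a(4) by auto
      then show ?thesis by (simp add: skel_def sketch_def)
    next
      case True
      then have u: "u < n" "u \<noteq> v" using wt_lt[OF a(1) True] weighted_graphD(2)[of n "wt z" d v] a(1) unfolding ok_def by auto
      show ?thesis
      proof (cases "v < u")
        case True
        then show ?thesis using loc a(4,5) by blast
      next
        case False
        then have uv: "u < v" using u by simp
        have "(if u < n \<and> 0 < wt z v u then Some (SL z u v) else None) = (if u < n \<and> 0 < wt z' v u then Some (SL z' u v) else None)"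
          using a(6) by (simp add: fun_eq_iff)
        then have "SL z u v = SL z' u v" using u True a(4) by simp
        then have "skel j z u v = skel j z' u v" "sketch l z u v = sketch l z' u v" using uv by (simp_all add: SL_def)
        moreover have "skel j w v u = skel j w u v" "sketch l w v u = sketch l w u v" if "ok w" for w
          unfolding skel_def sketch_def wt_sym[OF that, of v u] min.commute[of v u] max.commute[of v u] by simp_all
        ultimately show ?thesis using a(1,2) by simp
      qed
    qed
    then have "skel j z v = skel j z' v" "sketch l z v = sketch l z' v" by auto
    then show "(X z v, skel j z v, bits l z v) = (X z' v, skel j z' v, bits l z' v)"
      using a(6) unfolding bits_def by simp
  qed
qed

section \<open>Trees and subforests of the skeleton\<close>

definition gtree :: "nat \<Rightarrow> nat \<Rightarrow> inst \<Rightarrow> (nat \<times> nat) set" where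
  "gtree j i = bor (\<lambda>z. edges (skel j z)) (\<lambda>z. rank n (skel j z) (load n (skel j z) i)) lg"

text \<open>For \<open>t > i\<close> no edge is lost and this is the tree itself; smaller
  \<open>t\<close> give the light subforests. Both alternatives of \<open>packing\<close> are
  covered.\<close>

definition gforest :: "nat \<Rightarrow> nat \<Rightarrow> nat \<Rightarrow> inst \<Rightarrow> (nat \<times> nat) set" where
  "gforest j i t z = {e \<in> gtree j i z. key n (skel j z) i e < t}"

definition cho :: "nat \<Rightarrow> nat \<Rightarrow> nat \<Rightarrow> nat \<Rightarrow> inst \<Rightarrow> nat set" where
  "cho j l i t z = chosen (gforest j i t) (bits l) z"

context
  fixes j i :: nat
  assumes i: "i < N"
begin

lemma bor_assms:
  assumes z: "ok z"
  shows "ranking (edges (skel j z)) (rank n (skel j z) (load n (skel j z) i))"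
    "(u, v) \<in> edges (skel j z) \<Longrightarrow> 0 < wt z u v"
    "(u, v) \<in> edges (skel j z) \<Longrightarrow> rank n (skel j z) (load n (skel j z) i) (u, v) < N * n ^ 2"
proof -
  show "ranking (edges (skel j z)) (rank n (skel j z) (load n (skel j z) i))"
    by (rule ranking_load[OF skel_graph[OF z] n2])
  show wt: "0 < wt z u v" if "(u, v) \<in> edges (skel j z)" for u v
    using that skel_le[of j z u v] by (simp add: edges_def)
  show "rank n (skel j z) (load n (skel j z) i) (u, v) < N * n ^ 2" if e: "(u, v) \<in> edges (skel j z)"
  proof -
    have uv: "u < n" "v < n" using wt_lt[OF z wt[OF e]] by auto
    have "min u v * n + max u v < n ^ 2" using uv by (intro code_lt) auto
    moreover have "load n (skel j z) i u v div skel j z u v * n ^ 2 \<le> i * n ^ 2"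
      using key_le[OF skel_graph[OF z] n2, of j i "(u, v)"] by (intro mult_le_mono1) (simp add: key_def)
    ultimately have "rank n (skel j z) (load n (skel j z) i) (u, v) < (i + 1) * n ^ 2"
      unfolding rank_def fst_conv snd_conv add_mult_distrib mult_1 by linarith
    also have "\<dots> \<le> N * n ^ 2" using i by (intro mult_le_mono1) simp
    finally show ?thesis .
  qed
qed

lemma oriented_gtree: "oriented (gtree j i)"
  unfolding gtree_def
  by (rule oriented_bor[of "\<lambda>z. edges (skel j z)" "\<lambda>z. rank n (skel j z) (load n (skel j z) i)" "N * n ^ 2"])
    (use bor_assms m4 m1 in auto)

lemma fr_gtree: "ok z \<Longrightarrow> fr (gtree j i) z = tree n (skel j z) i"
  unfolding gtree_def tree_def
  by (rule fr_bor[of "\<lambda>z. edges (skel j z)" "\<lambda>z. rank n (skel j z) (load n (skel j z) i)" "N * n ^ 2"])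
    (use bor_assms m4 m1 in auto)

lemma key_sym: "ok z \<Longrightarrow> key n (skel j z) i (u, v) = key n (skel j z) i (v, u)"
  using load_sym[OF skel_graph n2, of z j i u v] weighted_graphD(1)[OF skel_graph, of z j u v] by (simp add: key_def)

lemma fr_gforest: "ok z \<Longrightarrow> fr (gforest j i t) z = tree n (skel j z) i \<inter> light n (skel j z) i t"
proof -
  assume z: "ok z"
  have "fr (gforest j i t) z = {e \<in> fr (gtree j i) z. key n (skel j z) i e < t}"
    unfolding fr_def gforest_def using key_sym[OF z] by auto
  then show ?thesis unfolding fr_gtree[OF z] light_def using tree_sub[OF skel_graph[OF z] n2, of j i] by blast
qed

lemma oriented_gforest: "oriented (gforest j i t)"
  unfolding oriented_def
proof (intro allI impI conjI)
  fix z assume z: "ok z"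
  have F: "forest (tree n (skel j z) i)" by (rule forest_tree[OF skel_graph[OF z] n2])
  show "forest (fr (gforest j i t) z)"
  proof (rule forest_subset[OF F])
    show "fr (gforest j i t) z \<subseteq> tree n (skel j z) i" unfolding fr_gforest[OF z] by blast
    show "sym (fr (gforest j i t) z)" unfolding fr_def sym_def by blast
  qed
  show "0 < wt z u v" if "(u, v) \<in> gforest j i t z" for u v
    using that oriented_gtree z unfolding gforest_def oriented_def by blast
  fix v assume v: "v < n"
  have "gtree j i z \<subseteq> {..<n} \<times> {..<n}" using fr_props(2)[OF oriented_gtree z] unfolding fr_def by blast
  then have "finite (gtree j i z `` {v})" by (meson finite_Image finite_SigmaI finite_lessThan finite_subset)
  then have "card (gforest j i t z `` {v}) \<le> card (gtree j i z `` {v})" by (intro card_mono) (auto simp: gforest_def)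
  then show "card (gforest j i t z `` {v}) \<le> lg" using oriented_gtree z v unfolding oriented_def by (meson le_trans)
qed

lemma known_gtree:
  assumes X: "known R X" and H: "det X (skel j)" and L: "det X (\<lambda>z v. load n (skel j z) i v)"
  shows "known (R + lg * (4 + 8 * lg)) (\<lambda>z v. (X z v, links (gtree j i) z v))"
  unfolding gtree_def
proof (rule known_bor[of "\<lambda>z. edges (skel j z)" "\<lambda>z. rank n (skel j z) (load n (skel j z) i)" "N * n ^ 2"])
  show "known R X" by fact
  show "det X (ledges (\<lambda>z. edges (skel j z)) (\<lambda>z. rank n (skel j z) (load n (skel j z) i)))"
  proof (rule detI)
    fix z z' :: inst and v
    assume a: "ok z" "ok z'" "v < n" "wt z v = wt z' v" "rn z v = rn z' v" "X z v = X z' v"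
    have "skel j z v = skel j z' v" by (rule detD[OF H a])
    moreover have "load n (skel j z) i v = load n (skel j z') i v" by (rule detD[OF L a])
    ultimately show "ledges (\<lambda>z. edges (skel j z)) (\<lambda>z. rank n (skel j z) (load n (skel j z) i)) z v
      = ledges (\<lambda>z. edges (skel j z)) (\<lambda>z. rank n (skel j z) (load n (skel j z) i)) z' v"
      by (simp add: ledges_def edges_def rank_def)
  qed
qed (use bor_assms m4 m1 in auto)

lemma known_try:
  assumes X: "known R X" and H: "det X (skel j)" and L: "det X (\<lambda>z v. load n (skel j z) i v)"
    and G: "det X (links (gtree j i))" and b: "det X (bits l)" and T: "det X (\<lambda>z v. v \<in> T z)"
    and sub: "\<And>z. ok z \<Longrightarrow> T z \<subseteq> {..<n}"
  shows "known (R + 4 + 36 * lg) (\<lambda>z v. (X z v, v \<in> better z (cho j l i t z) (T z)))"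
proof -
  have GF: "det X (links (gforest j i t))"
  proof (rule detI)
    fix z z' :: inst and v
    assume a: "ok z" "ok z'" "v < n" "wt z v = wt z' v" "rn z v = rn z' v" "X z v = X z' v"
    have h: "skel j z v = skel j z' v" by (rule detD[OF H a])
    have l: "load n (skel j z) i v = load n (skel j z') i v" by (rule detD[OF L a])
    have g: "links (gtree j i) z v = links (gtree j i) z' v" by (rule detD[OF G a])
    have k: "key n (skel j z) i (v, u) = key n (skel j z') i (v, u)" for u using h l by (simp add: key_def)
    have alt: "links (gforest j i t) w v = ({u \<in> fst (links (gtree j i) w v). key n (skel j w) i (v, u) < t},
        {u \<in> snd (links (gtree j i) w v). key n (skel j w) i (v, u) < t})" if "ok w" for w
      unfolding links_def gforest_def using key_sym[OF that, of v] by auto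
    show "links (gforest j i t) z v = links (gforest j i t) z' v"
      unfolding alt[OF a(1)] alt[OF a(2)] g k ..
  qed
  have K1: "known (R + 2 + 20 * lg) (\<lambda>z v. (X z v, v \<in> cho j l i t z))"
    unfolding cho_def by (rule known_chosen[OF oriented_gforest X GF b bits_sub m1 m2 m3])
  have "known (R + 2 + 20 * lg + 2 + 16 * lg) (\<lambda>z v. ((X z v, v \<in> cho j l i t z), v \<in> better z (cho j l i t z) (T z)))"
    using K1
  proof (rule known_better)
    show "det (\<lambda>z v. (X z v, v \<in> cho j l i t z)) (\<lambda>z v. v \<in> cho j l i t z)" by (rule detI) blast
    show "det (\<lambda>z v. (X z v, v \<in> cho j l i t z)) (\<lambda>z v. v \<in> T z)" by (rule det_trans[OF _ T], rule detI) blast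
    show "cho j l i t z \<subseteq> {..<n}" if "ok z" for z
      using chosen_proper[OF oriented_gforest that, of t "bits l"] unfolding cho_def proper_cut_def by (simp add: atLeast0LessThan)
  qed (rule sub)
  moreover have "R + 2 + 20 * lg + 2 + 16 * lg = R + 4 + 36 * lg" by simp
  ultimately have K2: "known (R + 4 + 36 * lg) (\<lambda>z v. ((X z v, v \<in> cho j l i t z), v \<in> better z (cho j l i t z) (T z)))"
    by (simp only:)
  show ?thesis by (rule known_via[OF K2]) blast
qed

lemma cho_proper: "ok z \<Longrightarrow> proper_cut n (cho j l i t z)"
  unfolding cho_def by (rule chosen_proper[OF oriented_gforest])

end

text \<open>Step \<open>s\<close> of \<open>run1\<close> uses the scales \<open>j = s div (J + 1)\<close> and \<open>l = s mod (J + 1)\<close>.\<close>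

fun run3 :: "nat \<Rightarrow> nat \<Rightarrow> nat \<Rightarrow> inst \<Rightarrow> nat set \<Rightarrow> nat \<Rightarrow> nat set" where
  "run3 j l i z T 0 = T"
| "run3 j l i z T (Suc t) = better z (cho j l i t z) (run3 j l i z T t)"

text \<open>\<open>N + 1\<close> thresholds are tried because \<open>t = Suc i\<close>, which stands
  for the whole tree, may be as large as \<open>N\<close>.\<close>

fun run2 :: "nat \<Rightarrow> nat \<Rightarrow> inst \<Rightarrow> nat set \<Rightarrow> nat \<Rightarrow> nat set" where
  "run2 j l z T 0 = T"
| "run2 j l z T (Suc i) = run3 j l i z (run2 j l z T i) (N + 1)"

fun run1 :: "inst \<Rightarrow> nat \<Rightarrow> nat set" where
  "run1 z 0 = {0}"
| "run1 z (Suc s) = run2 (s div (J + 1)) (s mod (J + 1)) z (run1 z s) N"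

lemma better_le: "cutw z (better z S T) \<le> cutw z S" "cutw z (better z S T) \<le> cutw z T"
  unfolding better_def by auto

lemma better_proper: "proper_cut n S \<Longrightarrow> proper_cut n T \<Longrightarrow> proper_cut n (better z S T)"
  unfolding better_def by simp

lemma run3_proper: "i < N \<Longrightarrow> ok z \<Longrightarrow> proper_cut n T \<Longrightarrow> proper_cut n (run3 j l i z T t)"
  by (induction t) (auto intro: better_proper cho_proper)

lemma run2_proper: "i \<le> N \<Longrightarrow> ok z \<Longrightarrow> proper_cut n T \<Longrightarrow> proper_cut n (run2 j l z T i)"
  by (induction i) (auto intro: run3_proper simp del: run3.simps)

lemma run1_proper: "ok z \<Longrightarrow> proper_cut n (run1 z s)"
proof (induction s)
  case 0
  show ?case unfolding run1.simps by (rule proper_singleton[OF n2])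
qed (auto intro: run2_proper simp del: run2.simps)

lemma run3_le: "cutw z (run3 j l i z T t) \<le> cutw z T"
  by (induction t) (auto intro: order_trans[OF better_le(2)])

lemma run3_cho: "t < t' \<Longrightarrow> cutw z (run3 j l i z T t') \<le> cutw z (cho j l i t z)"
proof (induction t')
  case (Suc t')
  then show ?case using better_le[of z "cho j l i t' z" "run3 j l i z T t'"] by (cases "t = t'") auto
qed simp

lemma run2_le: "cutw z (run2 j l z T i) \<le> cutw z T"
proof (induction i)
  case (Suc i)
  then show ?case using run3_le[of z j l i "run2 j l z T i" "N + 1"] by (simp del: run3.simps)
qed simp

lemma run2_cho: "i < i' \<Longrightarrow> t \<le> N \<Longrightarrow> cutw z (run2 j l z T i') \<le> cutw z (cho j l i t z)"
proof (induction i')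
  case (Suc i')
  show ?case
  proof (cases "i = i'")
    case True
    then show ?thesis using run3_cho[of t "N + 1" z j l i' "run2 j l z T i'"] Suc.prems by (simp del: run3.simps)
  next
    case False
    then have "cutw z (run2 j l z T i') \<le> cutw z (cho j l i t z)" using Suc by simp
    then show ?thesis using run3_le[of z j l i' "run2 j l z T i'" "N + 1"] by (simp del: run3.simps)
  qed
qed simp

text \<open>Exact weights never increase along the run, so wrong scales and bad estimates do no
  harm: a single good candidate suffices.\<close>

lemma run1_cho:
  "s < s' \<Longrightarrow> i < N \<Longrightarrow> t \<le> N \<Longrightarrow> cutw z (run1 z s') \<le> cutw z (cho (s div (J + 1)) (s mod (J + 1)) i t z)"
proof (induction s')
  case (Suc s')
  show ?case
  proof (cases "s = s'")
    case True
    then show ?thesis using run2_cho[of i N t z] Suc.prems by (simp del: run2.simps)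
  next
    case False
    then have "cutw z (run1 z s') \<le> cutw z (cho (s div (J + 1)) (s mod (J + 1)) i t z)" using Suc by simp
    then show ?thesis
      using run2_le[of z "s' div (J + 1)" "s' mod (J + 1)" "run1 z s'" N] by (simp del: run2.simps)
  qed
qed simp

lemma proper_sub: "proper_cut n S \<Longrightarrow> S \<subseteq> {..<n}"
  by (simp add: proper_cut_def atLeast0LessThan)

section \<open>Round complexity of the nested loops\<close>

lemma known_run3:
  assumes i: "i < N" and X: "known R X" and H: "det X (skel j)" and L: "det X (\<lambda>z v. load n (skel j z) i v)"
    and G: "det X (links (gtree j i))" and b: "det X (bits l)" and T: "det X (\<lambda>z v. v \<in> T z)"
    and pr: "\<And>z. ok z \<Longrightarrow> proper_cut n (T z)"
  shows "known (R + t * (4 + 36 * lg)) (\<lambda>z v. (X z v, v \<in> run3 j l i z (T z) t))"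
proof (induction t)
  case 0
  have "det X (\<lambda>z v. (X z v, v \<in> T z))"
    by (rule detI) (unfold prod.inject, rule conjI, assumption, erule (5) detD[OF T])
  then show ?case unfolding run3.simps mult_0 add_0_right by (rule known_det[OF X])
next
  case (Suc t)
  let ?Y = "\<lambda>z v. (X z v, v \<in> run3 j l i z (T z) t)"
  have XY: "det ?Y X" by (rule detI) blast
  have "known (R + t * (4 + 36 * lg) + 4 + 36 * lg) (\<lambda>z v. (?Y z v, v \<in> better z (cho j l i t z) (run3 j l i z (T z) t)))"
    by (rule known_try[OF i Suc det_trans[OF XY H] det_trans[OF XY L] det_trans[OF XY G] det_trans[OF XY b]])
      (rule detI, blast, intro proper_sub run3_proper i pr)
  then have "known (R + Suc t * (4 + 36 * lg)) (\<lambda>z v. (?Y z v, v \<in> better z (cho j l i t z) (run3 j l i z (T z) t)))"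
    by (simp add: ac_simps)
  then show ?case by (rule known_via) simp
qed

definition iter_cost :: nat where
  "iter_cost = lg * (4 + 8 * lg) + (N + 1) * (4 + 36 * lg)"

text \<open>Loads are carried along as distributed values: each node updates those of its incident
  edges from its links in the newest tree.\<close>

lemma known_run2:
  assumes X: "known R X" and H: "det X (skel j)" and b: "det X (bits l)" and T: "det X (\<lambda>z v. v \<in> T z)"
    and pr: "\<And>z. ok z \<Longrightarrow> proper_cut n (T z)" and i: "i \<le> N"
  shows "known (R + i * iter_cost) (\<lambda>z v. (X z v, load n (skel j z) i v, v \<in> run2 j l z (T z) i))"
  using i
proof (induction i)
  case 0
  have ld: "load n h 0 v = (\<lambda>_. 0)" for h v by (simp add: fun_eq_iff)
  have "det X (\<lambda>z v. (X z v, \<lambda>_. 0 :: nat, v \<in> T z))"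
    by (rule detI) (unfold prod.inject, intro conjI refl, assumption, erule (5) detD[OF T])
  then show ?case unfolding run2.simps mult_0 add_0_right ld by (rule known_det[OF X])
next
  case (Suc i)
  then have i: "i < N" by simp
  let ?Y = "\<lambda>z v. (X z v, load n (skel j z) i v, v \<in> run2 j l z (T z) i)"
  have K0: "known (R + i * iter_cost) ?Y" using Suc by simp
  have YX: "det ?Y X" by (rule detI) blast
  have YL: "det ?Y (\<lambda>z v. load n (skel j z) i v)" by (rule detI) blast
  have YT: "det ?Y (\<lambda>z v. v \<in> run2 j l z (T z) i)" by (rule detI) blast
  have K1: "known (R + i * iter_cost + lg * (4 + 8 * lg)) (\<lambda>z v. (?Y z v, links (gtree j i) z v))"
    by (rule known_gtree[OF i K0 det_trans[OF YX H] YL])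
  let ?Z = "\<lambda>z v. (?Y z v, links (gtree j i) z v)"
  have ZY: "det ?Z ?Y" by (rule detI) blast
  have ZG: "det ?Z (links (gtree j i))" by (rule detI) blast
  have "known (R + i * iter_cost + lg * (4 + 8 * lg) + (N + 1) * (4 + 36 * lg))
      (\<lambda>z v. (?Z z v, v \<in> run3 j l i z (run2 j l z (T z) i) (N + 1)))"
    by (rule known_run3[OF i K1 det_trans[OF ZY det_trans[OF YX H]] det_trans[OF ZY YL] ZG
        det_trans[OF ZY det_trans[OF YX b]] det_trans[OF ZY YT]]) (rule run2_proper[OF less_imp_le[OF i] _ pr])
  moreover have "R + i * iter_cost + lg * (4 + 8 * lg) + (N + 1) * (4 + 36 * lg) = R + Suc i * iter_cost"
    by (simp add: iter_cost_def)
  ultimately have K2: "known (R + Suc i * iter_cost) (\<lambda>z v. (?Z z v, v \<in> run3 j l i z (run2 j l z (T z) i) (N + 1)))"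
    by (simp only:)
  show ?case
  proof (rule known_via[OF K2])
    let ?W = "\<lambda>z v. (?Z z v, v \<in> run3 j l i z (run2 j l z (T z) i) (N + 1))"
    fix z z' :: inst and v
    assume a: "ok z" "ok z'" "?W z v = ?W z' v"
    have ld: "load n (skel j w) (Suc i) v = (\<lambda>u. load n (skel j w) i v u + of_bool (u \<in> fst (links (gtree j i) w v) \<union> snd (links (gtree j i) w v)))"
      if "ok w" for w
    proof -
      have "(v, u) \<in> tree n (skel j w) i \<longleftrightarrow> u \<in> fst (links (gtree j i) w v) \<union> snd (links (gtree j i) w v)" for u
        unfolding fr_gtree[OF i that, symmetric] fr_def links_def by auto
      then show ?thesis by (auto simp: fun_eq_iff tree_def)
    qed
    have "load n (skel j z) (Suc i) v = load n (skel j z') (Suc i) v"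
      unfolding ld[OF a(1)] ld[OF a(2)] using a(3) by (simp del: run3.simps)
    then show "(X z v, load n (skel j z) (Suc i) v, v \<in> run2 j l z (T z) (Suc i)) =
       (X z' v, load n (skel j z') (Suc i) v, v \<in> run2 j l z' (T z') (Suc i))"
      using a(3) unfolding run2.simps by blast
  qed
qed

lemma known_run1: "known (s * (1 + N * iter_cost)) (\<lambda>z v. v \<in> run1 z s)"
proof (induction s)
  case 0
  show ?case by simp (rule known_via[OF known_0], simp)
next
  case (Suc s)
  let ?j = "s div (J + 1)" and ?l = "s mod (J + 1)"
  let ?Y = "\<lambda>z v. (v \<in> run1 z s, skel ?j z v, bits ?l z v)"
  have K1: "known (Suc (s * (1 + N * iter_cost))) ?Y" by (rule known_sample[OF Suc])
  have "known (Suc (s * (1 + N * iter_cost)) + N * iter_cost)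
      (\<lambda>z v. (?Y z v, load n (skel ?j z) N v, v \<in> run2 ?j ?l z (run1 z s) N))"
    by (rule known_run2[OF K1]) (rule detI, blast, rule detI, blast, rule detI, blast, rule run1_proper, assumption, simp)
  moreover have "Suc (s * (1 + N * iter_cost)) + N * iter_cost = Suc s * (1 + N * iter_cost)" by simp
  ultimately have K2: "known (Suc s * (1 + N * iter_cost)) (\<lambda>z v. (?Y z v, load n (skel ?j z) N v, v \<in> run2 ?j ?l z (run1 z s) N))"
    by (simp only:)
  show ?case by (rule known_via[OF K2]) (simp only: run1.simps, blast)
qed

end

section \<open>Skeletons and parity sketches\<close>

definition units :: "nat \<Rightarrow> (nat \<Rightarrow> nat \<Rightarrow> nat) \<Rightarrow> nat set \<Rightarrow> (nat \<times> nat \<times> nat) set" where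
  "units n w S = {(a, b, i). (a, b) \<in> pairs n \<and> i < w a b \<and> sep S (a, b)}"

text \<open>The common form of the skeleton and of each parity sample: copies survive when their
  coin lies in \<open>G\<close>.\<close>

definition thin :: "(nat \<Rightarrow> nat \<Rightarrow> nat) \<Rightarrow> 'b set \<Rightarrow> (nat \<times> nat \<times> nat \<Rightarrow> 'b) \<Rightarrow> nat \<Rightarrow> nat \<Rightarrow> nat" where
  "thin w G \<omega> u v = card {i. i < w u v \<and> \<omega> (min u v, max u v, i) \<in> G}"

lemma hits_units:
  assumes w: "\<And>u v. w u v = w v u" and S: "S \<subseteq> {..<n}"
  shows "hits G (units n w S) \<omega> = cut_weight n (thin w G \<omega>) S"
proof -
  have "{e \<in> units n w S. \<omega> e \<in> G} = (\<lambda>((a, b), i). (a, b, i)) ` (SIGMA e:{e \<in> pairs n. sep S e}.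
      {i. i < w (fst e) (snd e) \<and> \<omega> (fst e, snd e, i) \<in> G})"
    by (force simp: units_def image_iff)
  moreover have "inj_on (\<lambda>((a, b), i). (a, b, i)) X" for X :: "((nat \<times> nat) \<times> nat) set" by (auto simp: inj_on_def)
  ultimately have "hits G (units n w S) \<omega> = card (SIGMA e:{e \<in> pairs n. sep S e}.
      {i. i < w (fst e) (snd e) \<and> \<omega> (fst e, snd e, i) \<in> G})"
    unfolding hits_def by (simp add: card_image)
  also have "\<dots> = (\<Sum>e\<in>{e \<in> pairs n. sep S e}. card {i. i < w (fst e) (snd e) \<and> \<omega> (fst e, snd e, i) \<in> G})"
    by (intro card_SigmaI) auto
  also have "\<dots> = (\<Sum>e\<in>{e \<in> pairs n. sep S e}. thin w G \<omega> (fst e) (snd e))"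
    by (intro sum.cong refl) (auto simp: thin_def pairs_def min_def max_def)
  also have "\<dots> = cut_weight n (thin w G \<omega>) S"
  proof (rule cut_weight_pairs[symmetric, OF _ S])
    show "thin w G \<omega> u v = thin w G \<omega> v u" for u v unfolding thin_def w[of u v] min.commute[of u v] max.commute[of u v] ..
  qed
  finally show ?thesis .
qed

lemma card_units:
  assumes w: "\<And>u v. w u v = w v u" and S: "S \<subseteq> {..<n}"
  shows "card (units n w S) = cut_weight n w S"
proof -
  have "card (units n w S) = hits UNIV (units n w S) (\<lambda>_. ())" by (simp add: hits_def)
  also have "\<dots> = cut_weight n (thin w UNIV (\<lambda>_. ())) S" by (rule hits_units[OF assms])
  also have "thin w UNIV (\<lambda>_. ()) = w" by (simp add: thin_def fun_eq_iff)
  finally show ?thesis .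
qed

lemma even_inner:
  assumes h: "\<And>u v. h u v = h v u" "\<And>v. h v v = (0::nat)" and S: "finite S"
  shows "even (\<Sum>u\<in>S. \<Sum>v\<in>S. h u v)"
  using S
proof (induction S)
  case (insert x S)
  have "(\<Sum>u\<in>insert x S. \<Sum>v\<in>insert x S. h u v) = (\<Sum>v\<in>S. h x v) + (\<Sum>u\<in>S. h u x + (\<Sum>v\<in>S. h u v))"
    using insert.hyps h(2) by simp
  also have "\<dots> = 2 * (\<Sum>v\<in>S. h x v) + (\<Sum>u\<in>S. \<Sum>v\<in>S. h u v)"
    unfolding sum.distrib using h(1)[of _ x] by simp
  finally show ?case using insert.IH by simp
qed simp

lemma odd_cut_weight:
  assumes h: "\<And>u v. h u v = h v u" "\<And>v. h v v = 0" and S: "S \<subseteq> {..<n}"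
  shows "odd (card {v \<in> S. odd (card {u \<in> {..<n}. odd (h v u)})}) \<longleftrightarrow> odd (cut_weight n h S)"
proof -
  have fin: "finite S" using S finite_subset by blast
  have "odd (card {v \<in> S. odd (card {u \<in> {..<n}. odd (h v u)})}) \<longleftrightarrow> odd (\<Sum>v\<in>S. \<Sum>u<n. h v u)"
    by (simp add: even_sum_iff fin)
  also have "(\<Sum>v\<in>S. \<Sum>u<n. h v u) = (\<Sum>v\<in>S. (\<Sum>u\<in>S. h v u) + (\<Sum>u\<in>{0..<n} - S. h v u))"
  proof (rule sum.cong[OF refl])
    fix v
    show "(\<Sum>u<n. h v u) = (\<Sum>u\<in>S. h v u) + (\<Sum>u\<in>{0..<n} - S. h v u)"
      using sum.subset_diff[of S "{0..<n}" "h v"] S by (simp add: atLeast0LessThan)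
  qed
  also have "\<dots> = (\<Sum>v\<in>S. \<Sum>u\<in>S. h v u) + cut_weight n h S" by (simp add: sum.distrib cut_weight_def)
  finally show ?thesis using even_inner[of h S, OF h fin] by simp
qed

lemma cut_cmp: "cut_weight n h (cmp (edges h) v) = 0"
proof -
  have "h a b = 0" if "a \<in> cmp (edges h) v" "b \<notin> cmp (edges h) v" for a b
  proof (rule ccontr)
    assume "h a b \<noteq> 0"
    then have "(a, b) \<in> edges h" by (simp add: edges_def)
    then show False using that unfolding cmp_iff by (meson rtrancl.rtrancl_into_rtrancl)
  qed
  then show ?thesis unfolding cut_weight_def by simp
qed

text \<open>\<open>(1 - (1 - 2 * q) ^ a) / 2\<close> is the probability that an odd number of
  \<open>a\<close> copies survives at rate \<open>q\<close>. With \<open>q * lam\<close> between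
  \<open>1 / 8\<close> and \<open>1 / 4\<close> it has not saturated yet: the lighter cut keeps
  \<open>(1 - 2 * q) ^ a \<ge> 1 / 4\<close>, and the additional copies reduce this by a factor
  \<open>exp (- (\<epsilon> / 8))\<close> or less.\<close>

lemma parity_gap:
  fixes q lam \<epsilon> :: real
  assumes e: "0 < \<epsilon>" "\<epsilon> \<le> 1" and q: "0 < q" "q \<le> 1 / 4" "1 / 8 < q * lam" "q * lam \<le> 1 / 4"
    and a: "real a \<le> (1 + \<epsilon> / 2) * lam" and b: "(1 + \<epsilon>) * lam < real b"
  shows "(1 - (1 - 2 * q) ^ a) / 2 + (1 - exp (- (\<epsilon> / 8))) / 8 \<le> (1 - (1 - 2 * q) ^ b) / 2"
proof -
  have lam: "0 < lam" using q(1,3) by (smt (verit) mult_nonneg_nonpos divide_pos_pos)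
  have "\<epsilon> / 2 * lam \<le> real b - real a" using a b by (simp add: algebra_simps)
  moreover have "0 < \<epsilon> / 2 * lam" using e lam by simp
  ultimately have ab: "a \<le> b" "\<epsilon> / 2 * lam \<le> real (b - a)" by (auto simp: of_nat_diff)
  have "\<epsilon> / 8 \<le> \<epsilon> * (q * lam)" using mult_left_mono[of "1 / 8" "q * lam" \<epsilon>] e q(3) by simp
  also have "\<dots> = 2 * q * (\<epsilon> / 2 * lam)" by simp
  also have "\<dots> \<le> 2 * q * real (b - a)" using ab(2) q(1) by (intro mult_left_mono) auto
  finally have big: "\<epsilon> / 8 \<le> 2 * q * real (b - a)" .
  have "(1 - 2 * q) ^ (b - a) \<le> exp (- (2 * q)) ^ (b - a)"
    using q exp_ge_add_one_self[of "- (2 * q)"] by (intro power_mono) auto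
  also have "\<dots> = exp (- (2 * q * real (b - a)))" by (simp add: exp_of_nat_mult[symmetric] mult.commute)
  also have "\<dots> \<le> exp (- (\<epsilon> / 8))" using big by simp
  finally have E: "(1 - 2 * q) ^ (b - a) \<le> exp (- (\<epsilon> / 8))" .
  have "(1 + \<epsilon> / 2) * lam \<le> 3 / 2 * lam" using e lam by (intro mult_right_mono) auto
  then have "real a \<le> 3 / 2 * lam" using a by (rule order_trans[rotated])
  then have "q * real a \<le> q * (3 / 2 * lam)" using q(1) by (intro mult_left_mono) auto
  then have "q * real a \<le> 3 / 8" using q(4) by simp
  then have "1 / 4 \<le> 1 + real a * (- (2 * q))" by (simp add: mult.commute mult.left_commute)
  also have "\<dots> \<le> (1 + - (2 * q)) ^ a" by (rule Bernoulli_inequality) (use q in simp)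
  finally have A: "1 / 4 \<le> (1 - 2 * q) ^ a" by simp
  have "1 / 4 * (1 - exp (- (\<epsilon> / 8))) \<le> (1 - 2 * q) ^ a * (1 - (1 - 2 * q) ^ (b - a))"
    using A E e by (intro mult_mono) auto
  also have "\<dots> = (1 - 2 * q) ^ a - (1 - 2 * q) ^ b"
    using ab(1) by (simp add: right_diff_distrib power_add[symmetric])
  finally have "1 / 4 * (1 - exp (- (\<epsilon> / 8))) \<le> (1 - 2 * q) ^ a - (1 - 2 * q) ^ b" .
  moreover have "(1 - x) / 2 + y / 8 \<le> (1 - z) / 2" if "1 / 4 * y \<le> x - z" for x y z :: real
    using that by (simp add: field_simps)
  ultimately show ?thesis by blast
qed

context cut_network
begin

definition sample :: "nat \<Rightarrow> inst \<Rightarrow> nat \<times> nat \<times> nat \<Rightarrow> nat" where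
  "sample k z e = dig (rn z (fst e)) (k, snd e)"

lemma skel_thin: "skel j z = thin (wt z) {..<2 ^ (J - j)} (sample 0 z)"
  by (simp add: fun_eq_iff skel_def thin_def sample_def)

lemma sketch_thin: "sketch l z u v = {k. k < K \<and> odd (thin (wt z) {..<2 ^ (J - l)} (sample (Suc k) z) u v)}"
  by (simp add: sketch_def thin_def sample_def)

text \<open>An edge inside \<open>S\<close> contributes to the bits of both endpoints and cancels.\<close>

lemma bits_cut:
  assumes z: "ok z" and S: "S \<subseteq> {..<n}"
  shows "symdiff.F (bits l z) S = {k. k < K \<and> odd (cut_weight n (thin (wt z) {..<2 ^ (J - l)} (sample (Suc k) z)) S)}"
proof (rule set_eqI)
  fix k
  let ?h = "thin (wt z) {..<2 ^ (J - l)} (sample (Suc k) z)"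
  have h: "?h u v = ?h v u" for u v
    unfolding thin_def wt_sym[OF z, of u v] min.commute[of u v] max.commute[of u v] ..
  have h0: "?h v v = 0" for v using weighted_graphD(2)[of n "wt z" d v] z by (simp add: thin_def ok_def)
  have fin: "finite S" using S finite_subset by blast
  have "k \<in> bits l z v \<longleftrightarrow> k < K \<and> odd (card {u \<in> {..<n}. odd (?h v u)})" for v
  proof (cases "k < K")
    case True
    then show ?thesis unfolding bits_def by (simp add: symdiff_mem sketch_thin)
  next
    case False
    then show ?thesis using bits_sub[of l z v] by auto
  qed
  then have "k \<in> symdiff.F (bits l z) S \<longleftrightarrow> k < K \<and> odd (card {v \<in> S. odd (card {u \<in> {..<n}. odd (?h v u)})})"
    by (cases "k < K") (simp_all add: symdiff_mem fin)
  then show "k \<in> symdiff.F (bits l z) S \<longleftrightarrow> k \<in> {k. k < K \<and> odd (cut_weight n (thin (wt z) {..<2 ^ (J - l)} (sample (Suc k) z)) S)}"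
    using odd_cut_weight[of ?h, OF h h0 S] by simp
qed

lemma bits_total: "ok z \<Longrightarrow> symdiff.F (bits l z) {..<n} = {}"
  using bits_cut[of z "{..<n}" l] by (simp add: cut_weight_def atLeast0LessThan)

text \<open>A family of polynomial size containing every cut that can be chosen. It depends on the
  skeleton but not on the sketches, as the union bound over sketches requires.\<close>

definition sides :: "nat \<Rightarrow> (nat \<Rightarrow> nat \<Rightarrow> nat) \<Rightarrow> nat set set" where
  "sides M h = (\<lambda>(i, t, u, v). side (tree n h i \<inter> light n h i t) u v) ` ({..<M} \<times> {..M} \<times> {..<n} \<times> {..<n})"

lemma card_sides: "finite (sides M h)" "card (sides M h) \<le> M * (M + 1) * n ^ 2"
proof -
  show "finite (sides M h)" unfolding sides_def by simp
  have "card (sides M h) \<le> card ({..<M} \<times> {..M} \<times> {..<n} \<times> {..<n})" unfolding sides_def by (rule card_image_le) simp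
  then show "card (sides M h) \<le> M * (M + 1) * n ^ 2"
    by (simp only: card_cartesian_product card_lessThan card_atMost power2_eq_square mult.assoc Suc_eq_plus1)
qed

lemma side_sub: "weighted_graph n h d \<Longrightarrow> S \<in> sides M h \<Longrightarrow> S \<subseteq> {..<n}"
proof -
  assume h: "weighted_graph n h d" and S: "S \<in> sides M h"
  then obtain i t u v where S: "S = side (tree n h i \<inter> light n h i t) u v" and v: "v < n"
    unfolding sides_def by auto
  show ?thesis unfolding S side_def using light_sub[OF h n2, of i t] v by (intro cmp_subset) auto
qed

lemma cand_side:
  assumes z: "ok z" and i: "i < N" and t: "t \<le> N" and e: "(u, v) \<in> cand (gforest j i t) z"
  shows "side (fr (gforest j i t) z) u v \<in> sides N (skel j z)"
proof -
  have "u < n" "v < n" using cand_sub(2)[OF oriented_gforest[OF i] z] e by auto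
  then show ?thesis unfolding fr_gforest[OF i z] sides_def using i t
    by (intro image_eqI[of _ _ "(i, t, u, v)"]) auto
qed

lemma cho_est:
  assumes z: "ok z" and i: "i < N" and t: "t \<le> N" and e: "(u, v) \<in> cand (gforest j i t) z"
  shows "cho j l i t z \<in> sides N (skel j z)"
    "card (symdiff.F (bits l z) (cho j l i t z)) \<le> card (symdiff.F (bits l z) (side (fr (gforest j i t) z) u v))"
proof -
  let ?Q = "gforest j i t"
  note Q = oriented_gforest[OF i, of j t]
  obtain a b where ab: "pick ?Q (bits l) z = (a, b)" by (cases "pick ?Q (bits l) z")
  have c: "(a, b) \<in> cand ?Q z" using pick_props(1)[OF Q z, of "bits l"] unfolding ab .
  have ch: "cho j l i t z = side (fr ?Q z) a b" unfolding cho_def chosen_def ab by simp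
  show "cho j l i t z \<in> sides N (skel j z)" unfolding ch by (rule cand_side[OF z i t c])
  show "card (symdiff.F (bits l z) (cho j l i t z)) \<le> card (symdiff.F (bits l z) (side (fr ?Q z) u v))"
    using pick_props(2)[OF Q z e, of "bits l"]
    unfolding ch ab est_cand[OF Q z c, of "bits l", OF bits_total[OF z]] est_cand[OF Q z e, of "bits l", OF bits_total[OF z]] .
qed

lemma head_cand:
  assumes z: "ok z" and i: "i < N" and v: "v < n" and dis: "cmp (fr (gforest j i t) z) v \<noteq> {..<n}"
  shows "\<exists>m. (m, m) \<in> cand (gforest j i t) z \<and> side (fr (gforest j i t) z) m m = cmp (fr (gforest j i t) z) v"
proof -
  let ?Q = "gforest j i t"
  note Q = oriented_gforest[OF i, of j t]
  let ?m = "head ?Q z v"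
  have F: "forest (fr ?Q z)" by (rule fr_props(1)[OF Q z])
  have m: "?m \<in> cmp (fr ?Q z) v" by (rule head_in[OF Q])
  then have eq: "cmp (fr ?Q z) ?m = cmp (fr ?Q z) v" by (rule cmp_cong[OF Q z])
  have dis0: "cmp (fr ?Q z) 0 \<noteq> {..<n}"
  proof
    assume a: "cmp (fr ?Q z) 0 = {..<n}"
    then have "v \<in> cmp (fr ?Q z) 0" using v by simp
    then have "cmp (fr ?Q z) v = cmp (fr ?Q z) 0" by (rule cmp_cong[OF Q z])
    then show False using a dis by simp
  qed
  have "head ?Q z ?m = ?m" by (rule head_cong[OF Q z m])
  then have "(?m, ?m) \<in> cand ?Q z" unfolding cand_disconn[OF Q z dis0] using head_lt[OF Q z v] by blast
  moreover have "(?m, ?m) \<notin> fr ?Q z" using F unfolding forest_def by blast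
  then have "side (fr ?Q z) ?m ?m = cmp (fr ?Q z) v" unfolding side_def eq[symmetric] by simp
  ultimately show ?thesis by blast
qed


text \<open>Keys are at most \<open>i\<close>, so the threshold \<open>Suc i\<close> excludes
  nothing.\<close>

lemma gforest_full: "ok z \<Longrightarrow> i < N \<Longrightarrow> fr (gforest j i (Suc i)) z = tree n (skel j z) i"
  using fr_gforest[of i z j "Suc i"] key_le[OF skel_graph n2, of z j i] tree_sub[OF skel_graph n2, of z j i]
  unfolding light_def by (auto simp: less_Suc_eq_le)

text \<open>For minimum cut \<open>0\<close>, where \<open>packing\<close> does not apply: all
  candidates are components then.\<close>

lemma attained_disconnected:
  assumes z: "ok z" and N: "0 < N" and dis: "cmp (edges (skel j z)) 0 \<noteq> {..<n}"
  shows "\<exists>u v. (u, v) \<in> cand (gforest j 0 1) z"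
    "(u, v) \<in> cand (gforest j 0 1) z \<Longrightarrow> cut_weight n (skel j z) (side (fr (gforest j 0 1) z) u v) = 0"
proof -
  let ?h = "skel j z" and ?Q = "gforest j 0 1"
  note h = skel_graph[OF z, of j] and Q = oriented_gforest[OF N, of j 1]
  have F: "fr ?Q z = tree n ?h 0" using gforest_full[OF z N, of j] by simp
  have c: "cmp (fr ?Q z) v = cmp (edges ?h) v" for v unfolding F by (rule cmp_tree[OF h n2])
  then have dis': "cmp (fr ?Q z) 0 \<noteq> {..<n}" using dis by simp
  have "0 < n" using n2 by simp
  then show "\<exists>u v. (u, v) \<in> cand ?Q z" using head_cand[OF z N _ dis'] by blast
  assume "(u, v) \<in> cand ?Q z"
  then have uv: "u = v" "v < n" unfolding cand_disconn[OF Q z dis'] by auto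
  have "(v, v) \<notin> fr ?Q z" using fr_props(1)[OF Q z] unfolding forest_def by blast
  then have sd: "side (fr ?Q z) u v = cmp (edges ?h) v" unfolding side_def uv(1) c[symmetric] by simp
  show "cut_weight n ?h (side (fr ?Q z) u v) = 0" unfolding sd by (rule cut_cmp)
qed

text \<open>Turns the alternatives of \<open>packing\<close> into candidates: a light component
  belongs to a disconnected subforest, a side of a tree to the threshold \<open>Suc i\<close>. The
  total weight of the skeleton is at most \<open>n ^ (d + 2)\<close>.\<close>

lemma attained:
  fixes \<epsilon> :: real
  assumes z: "ok z" and C: "C \<subseteq> {..<n}" "C \<noteq> {}" "C \<noteq> {..<n}" and e: "0 < \<epsilon>" "\<epsilon> \<le> 1"
    and conn: "cmp (edges (skel j z)) 0 = {..<n}"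
    and NC: "8 * real (cut_weight n (skel j z) C) * (ln (real n ^ (d + 2)) + 1) < \<epsilon> ^ 2 * real N"
  shows "\<exists>i<N. \<exists>t\<le>N. \<exists>u v. (u, v) \<in> cand (gforest j i t) z \<and>
    real (cut_weight n (skel j z) (side (fr (gforest j i t) z) u v)) \<le> (1 + \<epsilon>) * real (cut_weight n (skel j z) C)"
proof -
  let ?h = "skel j z"
  note h = skel_graph[OF z, of j]
  have fp: "finite (pairs n)" "card (pairs n) \<le> n * n"
  proof -
    have "pairs n \<subseteq> {..<n} \<times> {..<n}" by (auto simp: pairs_def)
    then have "card (pairs n) \<le> card ({..<n} \<times> {..<n})" by (rule card_mono[rotated]) simp
    then show "card (pairs n) \<le> n * n" by simp
  qed simp
  have "(\<Sum>e\<in>pairs n. ?h (fst e) (snd e)) \<le> (\<Sum>e\<in>pairs n. n ^ d)" by (intro sum_mono weighted_graphD(4)[OF h])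
  also have "\<dots> \<le> n ^ (d + 2)" using fp(2) by (simp add: power_add power2_eq_square mult.commute)
  finally have "(\<Sum>e\<in>pairs n. real (?h (fst e) (snd e))) \<le> real n ^ (d + 2)"
    unfolding of_nat_power[symmetric] of_nat_sum[symmetric] of_nat_le_iff .
  moreover have "1 \<le> real n ^ (d + 2)" using n2 by (intro one_le_power) simp
  ultimately consider i t v where "i < N" "t \<le> i" "v < n" "cmp (light n ?h i t) v \<noteq> {..<n}"
      "real (cut_weight n ?h (cmp (light n ?h i t) v)) < (1 + \<epsilon>) * real (cut_weight n ?h C)"
    | i u v where "i < N" "(u, v) \<in> tree n ?h i" "side (tree n ?h i) u v = C"
    using packing[OF h n2 conn C e _ _ NC] by blast
  then show ?thesis
  proof cases
    case 1
    have c: "cmp (fr (gforest j i t) z) v = cmp (light n ?h i t) v"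
      unfolding fr_gforest[OF 1(1) z] by (rule cmp_light[OF h n2])
    then obtain m where "(m, m) \<in> cand (gforest j i t) z" "side (fr (gforest j i t) z) m m = cmp (light n ?h i t) v"
      using head_cand[OF z 1(1) 1(3), of j t] 1(4) by auto
    then show ?thesis using 1(1,2,5) by (intro exI[of _ i] exI[of _ t] exI[of _ m] conjI) (simp_all add: less_imp_le)
  next
    case 2
    have F: "fr (gforest j i (Suc i)) z = tree n ?h i" by (rule gforest_full[OF z 2(1)])
    have "cmp (fr (gforest j i (Suc i)) z) 0 = {..<n}" unfolding F cmp_tree[OF h n2] by (rule conn)
    then have "(u, v) \<in> cand (gforest j i (Suc i)) z"
      using cand_conn[OF oriented_gforest[OF 2(1)] z] 2(2) F by simp
    moreover have "real (cut_weight n ?h C) \<le> (1 + \<epsilon>) * real (cut_weight n ?h C)" using e by (simp add: algebra_simps)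
    ultimately show ?thesis using 2 F by (intro exI[of _ i] exI[of _ "Suc i"] exI[of _ u] exI[of _ v] conjI) simp_all
  qed
qed


text \<open>The allowed estimation error is half the gap of \<open>parity_gap\<close>, so a cut
  heavier than \<open>(1 + \<epsilon>) * lam\<close> cannot be preferred to the light
  candidate.\<close>

lemma run_good:
  fixes \<epsilon> lam :: real
  assumes z: "ok z" and i: "i < N" and t: "t \<le> N" and c: "(u, v) \<in> cand (gforest j i t) z"
    and light: "real (cutw z (side (fr (gforest j i t) z) u v)) \<le> (1 + \<epsilon> / 2) * lam"
    and e: "0 < \<epsilon>" "\<epsilon> \<le> 1" and q: "2 \<le> l" "1 / 8 < lam / 2 ^ l" "lam / 2 ^ l \<le> 1 / 4"
    and est: "\<And>S. S \<in> sides N (skel j z) \<Longrightarrow> \<bar>real (card (symdiff.F (bits l z) S)) - real K * ((1 - (1 - 2 / 2 ^ l) ^ cutw z S) / 2)\<bar>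
      < real K * ((1 - exp (- (\<epsilon> / 8))) / 16)"
    and l: "l \<le> J" and s: "j * (J + 1) + l < s"
  shows "real (cutw z (run1 z s)) \<le> (1 + \<epsilon>) * lam"
proof -
  let ?S = "side (fr (gforest j i t) z) u v" and ?T = "cho j l i t z"
  let ?X = "\<lambda>S. real (card (symdiff.F (bits l z) S))" and ?p = "\<lambda>S. (1 - (1 - 2 / 2 ^ l) ^ cutw z S) / (2 :: real)"
  have "real (cutw z ?T) \<le> (1 + \<epsilon>) * lam"
  proof (rule ccontr)
    assume "\<not> ?thesis"
    then have heavy: "(1 + \<epsilon>) * lam < real (cutw z ?T)" by simp
    have "(4 :: real) \<le> 2 ^ l" using power_increasing[OF q(1), of "2 :: real"] by simp
    then have q4: "1 / 2 ^ l \<le> (1 / 4 :: real)" by (simp add: field_simps)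
    have "?p ?S + (1 - exp (- (\<epsilon> / 8))) / 8 \<le> ?p ?T"
      using parity_gap[OF e _ q4 _ _ light heavy] q(2,3) by simp
    then have "real K * (?p ?S + (1 - exp (- (\<epsilon> / 8))) / 8) \<le> real K * ?p ?T" by (rule mult_left_mono) simp
    moreover have "k * (x + y / 8) = k * x + 2 * (k * (y / 16))" for k x y :: real by (simp add: distrib_left)
    ultimately have "real K * ?p ?S + 2 * (real K * ((1 - exp (- (\<epsilon> / 8))) / 16)) \<le> real K * ?p ?T"
      by metis
    moreover have "?X ?T \<le> ?X ?S" using cho_est(2)[OF z i t c, of l] by simp
    ultimately show False
      using est[OF cand_side[OF z i t c]] est[OF cho_est(1)[OF z i t c, of l]] by linarith
  qed
  moreover have "(j * (J + 1) + l) div (J + 1) = j" "(j * (J + 1) + l) mod (J + 1) = l" 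
    using l div_mult_self3[of "J + 1" j l] mod_mult_self3[of j "J + 1" l] by (simp_all only: div_less mod_less less_Suc_eq_le Suc_eq_plus1[symmetric])
  then have "cutw z (run1 z s) \<le> cutw z ?T" using run1_cho[OF s i t, of z] by (simp only:)
  ultimately show ?thesis by (meson le_trans of_nat_le_iff order_trans)
qed

end

section \<open>Failure probabilities of skeleton and sketches\<close>

lemma units_sub:
  assumes "weighted_graph n w d"
  shows "units n w S \<subseteq> {..<n} \<times> {..<n} \<times> {..<n ^ d}"
  using weighted_graphD(4)[OF assms] unfolding units_def pairs_def by (fastforce intro: less_le_trans)

lemma finite_proper: "finite {S. proper_cut n S}"
  by (rule finite_subset[of _ "Pow {..<n}"]) (auto simp: proper_cut_def)

lemma card_PiE_pos: "finite I \<Longrightarrow> finite B \<Longrightarrow> B \<noteq> {} \<Longrightarrow> 0 < card (PiE I (\<lambda>_. B))"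
  by (simp add: card_PiE prod_constant card_gt_0_iff)

context
  fixes n d J :: nat and w :: "nat \<Rightarrow> nat \<Rightarrow> nat"
  assumes w: "weighted_graph n w d" and n2: "2 \<le> n"
begin

abbreviation coins :: "(nat \<times> nat \<times> nat \<Rightarrow> nat) set" where
  "coins \<equiv> PiE ({..<n} \<times> {..<n} \<times> {..<n ^ d}) (\<lambda>_. {..<2 ^ J})"

lemma finite_coins: "finite coins" by (intro finite_PiE) auto

lemma card_coins: "0 < card coins" by (intro card_PiE_pos) (auto simp: lessThan_empty_iff)

lemma proper_sum:
  fixes lam t :: real
  assumes lam: "0 \<le> lam" "\<And>S. proper_cut n S \<Longrightarrow> lam \<le> real (cut_weight n w S)" and t: "0 \<le> t"
  shows "(\<Sum>S\<in>{S. proper_cut n S}. exp (- t * real (cut_weight n w S))) \<le> (1 + exp (- t * lam / 2)) ^ n - 1"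
proof -
  let ?w = "\<lambda>e. real (w (fst e) (snd e))"
  have cw: "cw n ?w S = real (cut_weight n w S)" if "S \<subseteq> {..<n}" for S
    unfolding cut_weight_pairs[OF weighted_graphD(1)[OF w] that] cw_def[of ?w lam n, OF _ lam(1), simplified] by simp
  have sub: "S \<subseteq> {..<n}" if "proper_cut n S" for S using that by (simp add: proper_cut_def atLeast0LessThan)
  have "(\<Sum>S\<in>{S. proper_cut n S}. exp (- t * cw n ?w S)) \<le> (1 + exp (- t * lam / 2)) ^ n - 1"
  proof (rule proper_cutsum[of ?w lam n])
    show "lam \<le> cw n ?w S" if "S \<subseteq> {..<n}" "S \<noteq> {}" "S \<noteq> {..<n}" for S
      using lam(2)[of S] that unfolding cw[OF that(1)] proper_cut_def by (simp add: atLeast0LessThan)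
  qed (use n2 t lam in auto)
  moreover have "(\<Sum>S\<in>{S. proper_cut n S}. exp (- t * cw n ?w S)) = (\<Sum>S\<in>{S. proper_cut n S}. exp (- t * real (cut_weight n w S)))"
    using cw[OF sub] by (intro sum.cong) auto
  ultimately show ?thesis by simp
qed

text \<open>Lower tails are needed for all cuts, and \<open>proper_sum\<close> adds them up; the
  upper tail is needed only for the one cut \<open>C\<close>.\<close>

lemma skeleton_bad:
  fixes lam \<delta> :: real
  assumes lam: "0 \<le> lam" "\<And>S. proper_cut n S \<Longrightarrow> lam \<le> real (cut_weight n w S)"
    and C: "proper_cut n C" "real (cut_weight n w C) = lam" and j: "j \<le> J" and d: "0 \<le> \<delta>" "\<delta> \<le> 1"
  defines "x \<equiv> exp (- (\<delta>\<^sup>2 * (lam / 2 ^ j) / 4))"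
  shows "real (card {\<omega> \<in> coins. (\<exists>S. proper_cut n S \<and>
        real (cut_weight n (thin w {..<2 ^ (J - j)} \<omega>) S) \<le> (1 - \<delta>) * (real (cut_weight n w S) / 2 ^ j))
      \<or> (1 + \<delta>) * (lam / 2 ^ j) \<le> real (cut_weight n (thin w {..<2 ^ (J - j)} \<omega>) C)})
    \<le> real (card coins) * ((1 + x) ^ n - 1 + x)"
proof -
  let ?G = "{..<2 ^ (J - j)} :: nat set" and ?B = "{..<2 ^ J} :: nat set" and ?E = "{..<n} \<times> {..<n} \<times> {..<n ^ d}"
  have sub: "S \<subseteq> {..<n}" if "proper_cut n S" for S using that by (simp add: proper_cut_def atLeast0LessThan)
  note h = hits_units[of w, OF weighted_graphD(1)[OF w] sub] and cd = card_units[of w, OF weighted_graphD(1)[OF w] sub]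
  have p: "real (card ?G) / real (card ?B) = 1 / 2 ^ j"
    using j by (simp add: field_simps power_add[symmetric])
  have prem: "finite ?E" "finite ?B" "?B \<noteq> {}" "?G \<subseteq> ?B" "units n w S \<subseteq> ?E" for S
    using units_sub[OF w] by (auto simp: lessThan_empty_iff intro: less_le_trans power_increasing)
  define lo where "lo S = {\<omega> \<in> coins. real (cut_weight n (thin w ?G \<omega>) S) \<le> (1 - \<delta>) * (real (cut_weight n w S) / 2 ^ j)}" for S
  define hi where "hi = {\<omega> \<in> coins. (1 + \<delta>) * (lam / 2 ^ j) \<le> real (cut_weight n (thin w ?G \<omega>) C)}"
  have lo: "real (card (lo S)) \<le> real (card coins) * exp (- (\<delta>\<^sup>2 / 2 / 2 ^ j) * real (cut_weight n w S))" if "proper_cut n S" for S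
    using hits_lower[OF prem d, of S] unfolding lo_def p h[OF that] cd[OF that] by simp
  have "real (card hi) \<le> real (card coins) * exp (- (\<delta>\<^sup>2 / 4) * (1 / 2 ^ j) * lam)"
    using hits_upper[OF prem d, of C] unfolding hi_def p h[OF C(1)] cd[OF C(1)] C(2) by simp
  also have "- (\<delta>\<^sup>2 / 4) * (1 / 2 ^ j) * lam = - (\<delta>\<^sup>2 * (lam / 2 ^ j) / 4)" by simp
  finally have hi: "real (card hi) \<le> real (card coins) * x" unfolding x_def .
  have "real (card (\<Union>S\<in>{S. proper_cut n S}. lo S)) \<le> (\<Sum>S\<in>{S. proper_cut n S}. real (card (lo S)))"
    using card_UN_le[OF finite_proper, of lo] unfolding of_nat_sum[symmetric] of_nat_le_iff .
  also have "\<dots> \<le> (\<Sum>S\<in>{S. proper_cut n S}. real (card coins) * exp (- (\<delta>\<^sup>2 / 2 / 2 ^ j) * real (cut_weight n w S)))"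
    using lo by (intro sum_mono) blast
  also have "\<dots> = real (card coins) * (\<Sum>S\<in>{S. proper_cut n S}. exp (- (\<delta>\<^sup>2 / 2 / 2 ^ j) * real (cut_weight n w S)))"
    by (simp only: sum_distrib_left)
  also have "\<dots> \<le> real (card coins) * ((1 + exp (- (\<delta>\<^sup>2 / 2 / 2 ^ j) * lam / 2)) ^ n - 1)"
    by (intro mult_left_mono proper_sum lam) auto
  also have "- (\<delta>\<^sup>2 / 2 / 2 ^ j) * lam / 2 = - (\<delta>\<^sup>2 * (lam / 2 ^ j) / 4)" by simp
  finally have L: "real (card (\<Union>S\<in>{S. proper_cut n S}. lo S)) \<le> real (card coins) * ((1 + x) ^ n - 1)"
    unfolding x_def .
  have "{\<omega> \<in> coins. (\<exists>S. proper_cut n S \<and>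
        real (cut_weight n (thin w ?G \<omega>) S) \<le> (1 - \<delta>) * (real (cut_weight n w S) / 2 ^ j))
      \<or> (1 + \<delta>) * (lam / 2 ^ j) \<le> real (cut_weight n (thin w ?G \<omega>) C)} = (\<Union>S\<in>{S. proper_cut n S}. lo S) \<union> hi"
    unfolding lo_def hi_def by blast
  moreover have "real (card ((\<Union>S\<in>{S. proper_cut n S}. lo S) \<union> hi)) \<le> real (card (\<Union>S\<in>{S. proper_cut n S}. lo S)) + real (card hi)"
    unfolding of_nat_add[symmetric] of_nat_le_iff by (rule card_Un_le)
  ultimately show ?thesis using L hi by (simp add: distrib_left)
qed

text \<open>\<open>odd_hits\<close> gives the probability of odd parity within one sample. Whole
  samples then play the part of coins: \<open>hits_deviation\<close> is applied with index set
  \<open>{..<K}\<close> and outcomes \<open>coins\<close>.\<close>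

lemma sketch_bad:
  fixes \<gamma> :: real
  assumes F: "finite F" "\<And>S. S \<in> F \<Longrightarrow> S \<subseteq> {..<n}" and l: "l \<le> J" and g: "0 \<le> \<gamma>" "\<gamma> \<le> 1"
  shows "real (card {\<omega> \<in> PiE {..<K} (\<lambda>_. coins). \<exists>S\<in>F. real K * \<gamma> \<le>
      \<bar>real (card {k. k < K \<and> odd (cut_weight n (thin w {..<2 ^ (J - l)} (\<omega> k)) S)})
        - real K * ((1 - (1 - 2 / 2 ^ l) ^ cut_weight n w S) / 2)\<bar>})
    \<le> real (card (PiE {..<K} (\<lambda>_. coins))) * (real (card F) * (2 * exp (- real K * \<gamma>\<^sup>2 / 4)))"
proof -
  let ?G = "{..<2 ^ (J - l)} :: nat set" and ?B = "{..<2 ^ J} :: nat set" and ?E = "{..<n} \<times> {..<n} \<times> {..<n ^ d}"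
  let ?O = "PiE {..<K} (\<lambda>_. coins)"
  have p: "real (card ?G) / real (card ?B) = 1 / 2 ^ l"
    using l by (simp add: field_simps power_add[symmetric])
  have prem: "finite ?E" "finite ?B" "?B \<noteq> {}" "?G \<subseteq> ?B" "units n w S \<subseteq> ?E" for S
    using units_sub[OF w] by (auto simp: lessThan_empty_iff intro: less_le_trans power_increasing)
  define bad where "bad S = {\<omega> \<in> ?O. real K * \<gamma> \<le> \<bar>real (card {k. k < K \<and> odd (cut_weight n (thin w ?G (\<omega> k)) S)})
        - real K * ((1 - (1 - 2 / 2 ^ l) ^ cut_weight n w S) / 2)\<bar>}" for S
  have one: "real (card (bad S)) \<le> real (card ?O) * (2 * exp (- real K * \<gamma>\<^sup>2 / 4))" if "S \<in> F" for S
  proof -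
    note S = F(2)[OF that]
    let ?A = "{\<omega> \<in> coins. odd (hits ?G (units n w S) \<omega>)}"
    have A: "?A \<subseteq> coins" by blast
    have "real (card ?A) = real (card coins) * ((1 - (1 - 2 * (1 / 2 ^ l)) ^ cut_weight n w S) / 2)"
      using odd_hits[OF prem, of S] unfolding p card_units[of w, OF weighted_graphD(1)[OF w] S] .
    then have pA: "real (card ?A) / real (card coins) = (1 - (1 - 2 / 2 ^ l) ^ cut_weight n w S) / 2"
      using card_coins by simp
    have eq: "{k. k < K \<and> odd (cut_weight n (thin w ?G (\<omega> k)) S)} = {k \<in> {..<K}. \<omega> k \<in> ?A}" if "\<omega> \<in> ?O" for \<omega>
      using that hits_units[of w, OF weighted_graphD(1)[OF w] S, of ?G] by auto
    have beq: "bad S = {\<omega> \<in> ?O. real (card {..<K}) * \<gamma> \<le> \<bar>real (hits ?A {..<K} \<omega>) - real (card {..<K}) * (real (card ?A) / real (card coins))\<bar>}"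
      unfolding bad_def pA hits_def[of ?A "{..<K}"] card_lessThan
      by (intro Collect_cong conj_cong refl) (simp only: eq)
    have "coins \<noteq> {}" using card_coins by auto
    then have "real (card (bad S)) \<le> 2 * real (card ?O) * exp (- real (card {..<K}) * \<gamma>\<^sup>2 / 4)"
      unfolding beq by (intro hits_deviation[OF finite_lessThan finite_coins _ A subset_refl g])
    then show ?thesis by (simp only: card_lessThan mult.left_commute mult.assoc)
  qed
  have "real (card (\<Union>S\<in>F. bad S)) \<le> (\<Sum>S\<in>F. real (card (bad S)))"
    using card_UN_le[OF F(1), of bad] unfolding of_nat_sum[symmetric] of_nat_le_iff .
  also have "\<dots> \<le> (\<Sum>S\<in>F. real (card ?O) * (2 * exp (- real K * \<gamma>\<^sup>2 / 4)))" by (intro sum_mono one)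
  finally have "real (card (\<Union>S\<in>F. bad S)) \<le> real (card ?O) * (real (card F) * (2 * exp (- real K * \<gamma>\<^sup>2 / 4)))"
    by (simp add: mult.left_commute)
  moreover have "(\<Union>S\<in>F. bad S) = {\<omega> \<in> ?O. \<exists>S\<in>F. real K * \<gamma> \<le>
      \<bar>real (card {k. k < K \<and> odd (cut_weight n (thin w ?G (\<omega> k)) S)})
        - real K * ((1 - (1 - 2 / 2 ^ l) ^ cut_weight n w S) / 2)\<bar>}" unfolding bad_def by blast
  ultimately show ?thesis by simp
qed

end

section \<open>Success probability\<close>

lemma thin_restrict:
  assumes w: "weighted_graph n w d"
  shows "thin w G (restrict \<omega> ({..<n} \<times> {..<n} \<times> {..<n ^ d})) = thin w G \<omega>"
proof (intro ext)
  fix u v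
  have "(min u v, max u v, i) \<in> {..<n} \<times> {..<n} \<times> {..<n ^ d}" if "i < w u v" for i
    using weighted_graphD(3)[OF w, of u v] weighted_graphD(4)[OF w, of u v] that by (auto intro: ccontr)
  then show "thin w G (restrict \<omega> ({..<n} \<times> {..<n} \<times> {..<n ^ d})) u v = thin w G \<omega> u v"
    unfolding thin_def by (intro arg_cong[of _ _ card] Collect_cong conj_cong refl) simp
qed

lemma connected_iff:
  assumes h: "weighted_graph n h d" and n: "0 < n"
  shows "cmp (edges h) 0 = {..<n} \<longleftrightarrow> (\<forall>S. proper_cut n S \<longrightarrow> 0 < cut_weight n h S)"
proof
  assume a: "\<forall>S. proper_cut n S \<longrightarrow> 0 < cut_weight n h S"
  have "edges h \<subseteq> {..<n} \<times> {..<n}" using weighted_graphD(3)[OF h] unfolding edges_def by (force intro: ccontr)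
  then have "cmp (edges h) 0 \<subseteq> {..<n}" using n by (intro cmp_subset) auto
  moreover have "0 \<in> cmp (edges h) 0" by simp
  moreover have "\<not> proper_cut n (cmp (edges h) 0)" using a cut_cmp[of n h 0] by auto
  ultimately show "cmp (edges h) 0 = {..<n}" unfolding proper_cut_def atLeast0LessThan by blast
next
  assume a: "cmp (edges h) 0 = {..<n}"
  show "\<forall>S. proper_cut n S \<longrightarrow> 0 < cut_weight n h S"
  proof (intro allI impI, rule ccontr)
    fix S assume S: "proper_cut n S" "\<not> 0 < cut_weight n h S"
    have sub: "S \<subseteq> {..<n}" "S \<noteq> {}" "S \<noteq> {..<n}" using S(1) by (simp_all add: proper_cut_def atLeast0LessThan)
    have "finite S" using sub(1) finite_subset by blast
    then have z: "h u v = 0" if "u \<in> S" "v < n" "v \<notin> S" for u v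
      using S(2) that unfolding cut_weight_def by simp
    have step: "y \<in> S \<longleftrightarrow> x \<in> S" if "(x, y) \<in> edges h" for x y
      using that z[of x y] z[of y x] weighted_graphD(1)[OF h, of x y] weighted_graphD(3)[OF h, of x y]
      unfolding edges_def by auto
    have "y \<in> S \<longleftrightarrow> 0 \<in> S" if "(0, y) \<in> (edges h)\<^sup>*" for y
      using that by induction (auto simp: step)
    then have "y \<in> S \<longleftrightarrow> 0 \<in> S" if "y < n" for y using that a unfolding cmp_def by blast
    then show False using sub by blast
  qed
qed

lemma tail_bound:
  fixes x :: real
  assumes n: "2 \<le> n" and x: "0 \<le> x" "x \<le> 1 / (real n + 1) ^ 6"
  shows "(1 + x) ^ n - 1 + x \<le> 1 / (2 * real n)"
proof -
  let ?m = "real n"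
  have m: "2 \<le> ?m" using n by simp
  have "?m * x \<le> ?m * (1 / (?m + 1) ^ 6)" using x m by (intro mult_left_mono) auto
  also have "\<dots> \<le> 1 / (6 * ?m)"
  proof -
    have "6 * ?m * ?m \<le> (?m + 1) ^ 2 * (?m + 1) ^ 4"
    proof -
      have "(6::real) \<le> 3 ^ 4" by simp
      also have "\<dots> \<le> (?m + 1) ^ 4" using m by (intro power_mono) auto
      finally have "?m * ?m * 6 \<le> (?m + 1) ^ 2 * (?m + 1) ^ 4"
        using m by (intro mult_mono) (auto simp: power2_eq_square algebra_simps)
      then show ?thesis by (simp add: mult.commute)
    qed
    also have "\<dots> = (?m + 1) ^ 6" by (simp add: power_add[symmetric])
    finally show ?thesis using m by (simp add: divide_simps mult.commute mult.left_commute)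
  qed
  finally have y: "?m * x \<le> 1 / (6 * ?m)" .
  also have "\<dots> \<le> 1" using m by simp
  finally have y1: "?m * x \<le> 1" .
  have y0: "0 \<le> ?m * x" using x m by simp
  have "(1 + x) ^ n \<le> exp x ^ n" using x by (intro power_mono) auto
  also have "\<dots> = exp (?m * x)" by (simp add: exp_of_nat_mult)
  also have "\<dots> \<le> 1 + ?m * x + (?m * x)\<^sup>2" by (rule exp_bound[OF y0 y1])
  also have "(?m * x)\<^sup>2 \<le> ?m * x" using y0 y1 by (simp add: power2_eq_square mult_left_le)
  finally have "(1 + x) ^ n - 1 \<le> 2 * (?m * x)" by linarith
  moreover have "x \<le> ?m * x" using m x by (simp add: mult_le_cancel_right1)
  ultimately have "(1 + x) ^ n - 1 + x \<le> 3 * (?m * x)" by simp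
  also have "\<dots> \<le> 3 * (1 / (6 * ?m))" using y by simp
  finally show ?thesis by simp
qed

lemma min_cut_props:
  assumes n: "2 \<le> n"
  shows "\<exists>C. proper_cut n C \<and> cut_weight n w C = min_cut n w" "proper_cut n S \<Longrightarrow> min_cut n w \<le> cut_weight n w S"
proof -
  let ?X = "{cut_weight n w S | S. proper_cut n S}"
  have X: "?X = cut_weight n w ` {S. proper_cut n S}" by blast
  have fin: "finite ?X" unfolding X by (rule finite_imageI[OF finite_proper])
  have "?X \<noteq> {}" using proper_singleton[OF n] by blast
  then have "min_cut n w \<in> ?X" unfolding min_cut_def using Min_in[OF fin] by blast
  then show "\<exists>C. proper_cut n C \<and> cut_weight n w C = min_cut n w" by force
  show "min_cut n w \<le> cut_weight n w S" if "proper_cut n S" unfolding min_cut_def using that by (intro Min_le[OF fin]) blast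
qed

lemma min_cut_le:
  assumes w: "weighted_graph n w d" and n: "2 \<le> n"
  shows "min_cut n w \<le> n ^ (d + 1)"
proof -
  have "min_cut n w \<le> cut_weight n w {0}" by (rule min_cut_props(2)[OF n proper_singleton[OF n]])
  also have "\<dots> = (\<Sum>v\<in>{0..<n} - {0}. w 0 v)" unfolding cut_weight_def by simp
  also have "\<dots> \<le> (\<Sum>v\<in>{0..<n} - {0}. n ^ d)" by (intro sum_mono weighted_graphD(4)[OF w])
  also have "\<dots> = (n - 1) * n ^ d" using n by (simp add: card_Diff_singleton)
  also have "\<dots> \<le> n * n ^ d" by (rule mult_le_mono1) simp
  finally show ?thesis by simp
qed

text \<open>\<open>3072 * real lg / \<epsilon>\<^sup>2\<close> is the target size of the minimum cut
  in the skeleton; \<open>packing\<close> is used with accuracy \<open>\<epsilon> / 8\<close> for a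
  cut of at most twice this size, whence \<open>16\<close>. \<open>J\<close> leaves room for a scale
  with \<open>4 * lam \<le> 2 ^ l\<close>, \<open>K\<close> pays for the union over
  \<open>sides\<close>, and \<open>dig\<close> reads a random number as \<open>K + 1\<close> layers
  of coins.\<close>

locale sampled_network = cut_network +
  fixes \<epsilon> :: real and b :: nat
  assumes e: "0 < \<epsilon>" "\<epsilon> \<le> 1"
    and N: "16 * (3072 * real lg / \<epsilon>\<^sup>2) * (ln (real n ^ (d + 2)) + 1) < (\<epsilon> / 8)\<^sup>2 * real N"
    and J: "4 * n ^ (d + 1) \<le> 2 ^ J"
    and K: "real (N * (N + 1) * n ^ 2) * (2 * exp (- real K * ((1 - exp (- (\<epsilon> / 8))) / 16)\<^sup>2 / 4)) \<le> 1 / (2 * real n)"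
    and dig: "bij_betw (\<lambda>x. restrict (dig x) ({..K} \<times> {..<n} \<times> {..<n ^ d})) {..<2 ^ b}
      (PiE ({..K} \<times> {..<n} \<times> {..<n ^ d}) (\<lambda>_. {..<2 ^ J}))"
begin

definition inputs :: "(nat \<Rightarrow> nat) set" where
  "inputs = {r. (\<forall>v<n. r v < 2 ^ b) \<and> (\<forall>v\<ge>n. r v = 0)}"

abbreviation triples :: "(nat \<times> nat \<times> nat) set" where
  "triples \<equiv> {..<n} \<times> {..<n} \<times> {..<n ^ d}"

abbreviation coin :: "(nat \<times> nat \<times> nat \<Rightarrow> nat) set" where
  "coin \<equiv> PiE triples (\<lambda>_. {..<2 ^ J})"

text \<open>Regroups the coins by purpose instead of by node: one assignment for the skeleton and
  \<open>K\<close> for the samples. Its bijectivity expresses their independence and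
  uniformity.\<close>

definition coords :: "(nat \<Rightarrow> nat) \<Rightarrow> (nat \<times> nat \<times> nat \<Rightarrow> nat) \<times> (nat \<Rightarrow> nat \<times> nat \<times> nat \<Rightarrow> nat)" where
  "coords r = (restrict (\<lambda>e. dig (r (fst e)) (0, snd e)) triples,
     \<lambda>k\<in>{..<K}. restrict (\<lambda>e. dig (r (fst e)) (Suc k, snd e)) triples)"

lemma dig_lt: "x < 2 ^ b \<Longrightarrow> k \<le> K \<Longrightarrow> u < n \<Longrightarrow> i < n ^ d \<Longrightarrow> dig x (k, u, i) < 2 ^ J"
proof -
  assume a: "x < 2 ^ b" "k \<le> K" "u < n" "i < n ^ d"
  have "restrict (dig x) ({..K} \<times> {..<n} \<times> {..<n ^ d}) \<in> PiE ({..K} \<times> {..<n} \<times> {..<n ^ d}) (\<lambda>_. {..<2 ^ J})"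
    using dig a(1) unfolding bij_betw_def by blast
  then have "restrict (dig x) ({..K} \<times> {..<n} \<times> {..<n ^ d}) (k, u, i) \<in> {..<2 ^ J}"
    by (rule PiE_mem) (use a in simp)
  then show ?thesis using a by simp
qed

lemma card_inputs: "finite inputs" "card inputs = (2 ^ b) ^ n"
proof -
  have "inputs = PiE_dflt {..<n} 0 (\<lambda>_. {..<2 ^ b})"
    unfolding inputs_def PiE_dflt_def by (auto simp: not_less)
  then show "finite inputs" "card inputs = (2 ^ b) ^ n"
    by (simp_all add: finite_PiE_dflt card_PiE_dflt)
qed

lemma card_coords: "card (coin \<times> PiE {..<K} (\<lambda>_. coin)) = card inputs"
proof -
  have "card {..<2 ^ b :: nat} = card (PiE ({..K} \<times> {..<n} \<times> {..<n ^ d}) (\<lambda>_. {..<2 ^ J :: nat}))"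
    by (rule bij_betw_same_card[OF dig])
  then have b: "(2 :: nat) ^ b = (2 ^ J) ^ (Suc K * (n * n ^ d))" by (simp add: card_PiE card_cartesian_product)
  have "card coin = (2 ^ J) ^ (n * (n * n ^ d))" by (simp add: card_PiE card_cartesian_product)
  then have "card (coin \<times> PiE {..<K} (\<lambda>_. coin)) = ((2 ^ J) ^ (n * (n * n ^ d))) ^ Suc K"
    by (simp add: card_cartesian_product card_PiE)
  also have "\<dots> = ((2 ^ J) ^ (Suc K * (n * n ^ d))) ^ n"
    unfolding power_mult[symmetric] by (simp add: ac_simps)
  finally show ?thesis unfolding card_inputs b .
qed

lemma coords_bij: "bij_betw coords inputs (coin \<times> PiE {..<K} (\<lambda>_. coin))"
proof -
  have inj: "inj_on coords inputs"
  proof (rule inj_onI)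
    fix r r' assume r: "r \<in> inputs" "r' \<in> inputs" and eq: "coords r = coords r'"
    have z: "restrict (\<lambda>e. dig (r (fst e)) (0, snd e)) triples = restrict (\<lambda>e. dig (r' (fst e)) (0, snd e)) triples"
      and s: "(\<lambda>k\<in>{..<K}. restrict (\<lambda>e. dig (r (fst e)) (Suc k, snd e)) triples) = (\<lambda>k\<in>{..<K}. restrict (\<lambda>e. dig (r' (fst e)) (Suc k, snd e)) triples)"
      using eq unfolding coords_def by blast+
    have all: "dig (r v) (k, u, i) = dig (r' v) (k, u, i)" if "k \<le> K" "v < n" "u < n" "i < n ^ d" for k v u i
    proof (cases k)
      case 0
      then show ?thesis using fun_cong[OF z, of "(v, u, i)"] that by simp
    next
      case (Suc k')
      then show ?thesis using fun_cong[OF fun_cong[OF s, of k'], of "(v, u, i)"] that by simp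
    qed
    show "r = r'"
    proof
      fix v
      show "r v = r' v"
      proof (cases "v < n")
        case True
        have "restrict (dig (r v)) ({..K} \<times> {..<n} \<times> {..<n ^ d}) = restrict (dig (r' v)) ({..K} \<times> {..<n} \<times> {..<n ^ d})"
          by (rule restrict_ext) (use all True in auto)
        moreover have "r v \<in> {..<2 ^ b}" "r' v \<in> {..<2 ^ b}" using r True unfolding inputs_def by auto
        ultimately show ?thesis using bij_betw_imp_inj_on[OF dig] unfolding inj_on_def by blast
      next
        case False
        then show ?thesis using r unfolding inputs_def by simp
      qed
    qed
  qed
  have sub: "coords ` inputs \<subseteq> coin \<times> PiE {..<K} (\<lambda>_. coin)"
  proof
    fix y assume "y \<in> coords ` inputs"
    then obtain r where y: "y = coords r" and r: "r \<in> inputs" by blast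
    have "dig (r v) (k, u, i) < 2 ^ J" if "v < n" "k \<le> K" "u < n" "i < n ^ d" for v k u i
      using r that by (intro dig_lt) (auto simp: inputs_def)
    then show "y \<in> coin \<times> PiE {..<K} (\<lambda>_. coin)" unfolding y coords_def
      by (intro SigmaI PiE_I restrict_PiE_iff[THEN iffD2] ballI) auto
  qed
  have "finite (coin \<times> PiE {..<K} (\<lambda>_. coin))" by (intro finite_cartesian_product finite_PiE) auto
  then have "coords ` inputs = coin \<times> PiE {..<K} (\<lambda>_. coin)"
    by (rule card_subset_eq[OF _ sub]) (simp add: card_image[OF inj] card_coords)
  then show ?thesis unfolding bij_betw_def using inj by blast
qed


lemma skel_coords: "ok (Inst w r) \<Longrightarrow> skel j (Inst w r) = thin w {..<2 ^ (J - j)} (fst (coords r))"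
  unfolding skel_thin coords_def fst_conv ok_def inst.sel by (subst thin_restrict) (simp_all add: sample_def[abs_def])

lemma bits_coords:
  assumes z: "ok (Inst w r)" and S: "S \<subseteq> {..<n}"
  shows "symdiff.F (bits l (Inst w r)) S
    = {k. k < K \<and> odd (cut_weight n (thin w {..<2 ^ (J - l)} (snd (coords r) k)) S)}"
proof -
  have "thin w G (snd (coords r) k) = thin w G (sample (Suc k) (Inst w r))" if "k < K" for G k
    using that z unfolding coords_def snd_conv ok_def inst.sel
    by (simp add: thin_restrict sample_def[abs_def])
  then show ?thesis unfolding bits_cut[OF z S] inst.sel by (intro Collect_cong conj_cong refl) simp
qed

lemma skel_0: "ok (Inst w r) \<Longrightarrow> r \<in> inputs \<Longrightarrow> skel 0 (Inst w r) = w"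
proof (intro ext)
  fix u v
  assume z: "ok (Inst w r)" and r: "r \<in> inputs"
  have w: "weighted_graph n w d" using z by (simp add: ok_def)
  have "dig (r (min u v)) (0, max u v, i) < 2 ^ J" if "i < w u v" for i
    using weighted_graphD(3)[OF w, of u v] weighted_graphD(4)[OF w, of u v] that r
    by (intro dig_lt) (auto simp: inputs_def intro: ccontr)
  then have "{i. i < w u v \<and> dig (r (min u v)) (0, max u v, i) < 2 ^ J} = {..<w u v}" by auto
  then show "skel 0 (Inst w r) u v = w u v" unfolding skel_def by simp
qed

text \<open>At scale \<open>0\<close> the skeleton is the graph itself, and a component of it has
  weight \<open>0\<close>.\<close>

lemma zero_case:
  assumes z: "ok (Inst w r)" and r: "r \<in> inputs" and m: "min_cut n w = 0" and N0: "0 < N" and s: "0 < s"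
  shows "cutw (Inst w r) (run1 (Inst w r) s) = 0"
proof -
  let ?z = "Inst w r"
  have w: "weighted_graph n w d" using z by (simp add: ok_def)
  have n0: "0 < n" using n2 by simp
  obtain C where "proper_cut n C" "cut_weight n w C = 0" using min_cut_props(1)[OF n2, of w] m by auto
  then have "cmp (edges (skel 0 ?z)) 0 \<noteq> {..<n}" unfolding skel_0[OF z r] using connected_iff[OF w n0] by auto
  then have d: "cut_weight n (skel 0 ?z) (side (fr (gforest 0 0 1) ?z) u v) = 0" if "(u, v) \<in> cand (gforest 0 0 1) ?z" for u v
    using attained_disconnected(2)[OF z N0 _ that] by blast
  have c: "pick (gforest 0 0 1) (bits 0) ?z \<in> cand (gforest 0 0 1) ?z"
    by (rule pick_props(1)[OF oriented_gforest[OF N0] z])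
  have "cutw ?z (cho 0 0 0 1 ?z) = 0"
    using d[of "fst (pick (gforest 0 0 1) (bits 0) ?z)" "snd (pick (gforest 0 0 1) (bits 0) ?z)"] c
    unfolding cho_def chosen_def cutw_def skel_0[OF z r] by simp
  moreover have "cutw ?z (run1 ?z s) \<le> cutw ?z (cho 0 0 0 1 ?z)" using run1_cho[OF s N0, of 1 ?z] N0 by simp
  ultimately show ?thesis by simp
qed

text \<open>At rate \<open>2\<^sup>-\<^sup>j\<close> the minimum cut has \<open>O(log n)\<close> copies, which is just enough for concentration; at
  rate \<open>2\<^sup>-\<^sup>l\<close> it has about \<open>1 / 4\<close>, where parity probabilities are most sensitive to the weight.\<close>

lemma scales:
  fixes lam :: nat
  assumes lam: "1 \<le> lam" "lam \<le> n ^ (d + 1)"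
  defines "L \<equiv> 3072 * real lg / \<epsilon>\<^sup>2"
  obtains j l where "j \<le> J" "real lam / 2 ^ j \<le> L" "j = 0 \<or> L / 2 < real lam / 2 ^ j"
    "l \<le> J" "2 \<le> l" "1 / 8 < real lam / 2 ^ l" "real lam / 2 ^ l \<le> 1 / 4"
proof -
  have "\<epsilon>\<^sup>2 \<le> 1" using e by (simp add: power_le_one)
  then have "\<epsilon>\<^sup>2 \<le> 3072 * real lg" using lg_pos by linarith
  then have L: "1 \<le> L" unfolding L_def using e by (simp add: le_divide_eq)
  have J4: "4 * lam \<le> 2 ^ J" using J lam(2) by linarith
  define j where "j = (LEAST j. real lam / 2 ^ j \<le> L)"
  have "real (4 * lam) \<le> real (2 ^ J)" using J4 by (rule of_nat_mono)
  then have "4 * real lam \<le> 2 ^ J" by (simp only: of_nat_mult of_nat_numeral of_nat_power)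
  then have "real lam \<le> 2 ^ J" by linarith
  then have j0: "real lam / 2 ^ J \<le> L" using L by (simp add: divide_le_eq) (rule order_trans[of _ "1 * 2 ^ J"], simp, rule mult_right_mono, simp_all)
  have j: "real lam / 2 ^ j \<le> L" "j \<le> J" unfolding j_def by (rule LeastI[of _ J], rule j0) (rule Least_le, rule j0)
  have jm: "L / 2 < real lam / 2 ^ j" if "j \<noteq> 0"
  proof -
    have "j - 1 < j" using that by simp
    then have "\<not> real lam / 2 ^ (j - 1) \<le> L" unfolding j_def by (rule not_less_Least)
    moreover have "(2 :: real) ^ j = 2 * 2 ^ (j - 1)" using that by (simp add: power_eq_if)
    ultimately show ?thesis by (simp add: field_simps)
  qed
  define l where "l = (LEAST l. 4 * lam \<le> 2 ^ l)"
  have l: "4 * lam \<le> 2 ^ l" "l \<le> J" unfolding l_def by (rule LeastI[of _ J], rule J4) (rule Least_le, rule J4)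
  have l2: "2 \<le> l"
  proof (rule ccontr)
    assume "\<not> 2 \<le> l"
    then have "(2::nat) ^ l \<le> 2 ^ 1" by (intro power_increasing) auto
    then show False using l(1) lam(1) by simp
  qed
  then have "l - 1 < l" by simp
  then have "\<not> 4 * lam \<le> 2 ^ (l - 1)" unfolding l_def by (rule not_less_Least)
  then have "2 * 2 ^ (l - 1) < 8 * lam" by simp
  moreover have "(2 :: nat) ^ l = 2 * 2 ^ (l - 1)" using l2 by (simp add: power_eq_if)
  ultimately have "2 ^ l < 8 * lam" by simp
  then have "real (2 ^ l) < real (8 * lam)" by (rule of_nat_less_iff[THEN iffD2])
  then have "(2 :: real) ^ l < 8 * real lam" by (simp only: of_nat_mult of_nat_numeral of_nat_power)
  then have lo: "1 / 8 < real lam / 2 ^ l" by (simp add: field_simps)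
  have "real (4 * lam) \<le> real (2 ^ l)" using l(1) by (rule of_nat_mono)
  then have "4 * real lam \<le> 2 ^ l" by (simp only: of_nat_mult of_nat_numeral of_nat_power)
  then have "real lam / 2 ^ l \<le> 1 / 4" by (simp add: field_simps)
  then show ?thesis using jm by (intro that[OF j(2,1) _ l(2) l2 lo]) blast+
qed


definition good_skeleton :: "(nat \<Rightarrow> nat \<Rightarrow> nat) \<Rightarrow> nat set \<Rightarrow> nat \<Rightarrow> (nat \<Rightarrow> nat \<Rightarrow> nat) \<Rightarrow> bool" where
  "good_skeleton w C j h \<longleftrightarrow> (\<forall>S. proper_cut n S \<longrightarrow> (1 - \<epsilon> / 8) * (real (cut_weight n w S) / 2 ^ j) < real (cut_weight n h S))
     \<and> real (cut_weight n h C) < (1 + \<epsilon> / 8) * (real (cut_weight n w C) / 2 ^ j)"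

definition good_sketch :: "(nat \<Rightarrow> nat \<Rightarrow> nat) \<Rightarrow> nat \<Rightarrow> nat set set \<Rightarrow> (nat set \<Rightarrow> nat set) \<Rightarrow> bool" where
  "good_sketch w l F X \<longleftrightarrow> (\<forall>S\<in>F. \<bar>real (card (X S)) - real K * ((1 - (1 - 2 / 2 ^ l) ^ cut_weight n w S) / 2)\<bar>
      < real K * ((1 - exp (- (\<epsilon> / 8))) / 16))"

text \<open>One factor \<open>1 + \<epsilon> / 8\<close> is lost for the upper tail of
  \<open>C\<close>, one in \<open>packing\<close>, and \<open>1 - \<epsilon> / 8\<close> in the
  lower tail of the candidate; together at most \<open>1 + \<epsilon> / 2\<close>, leaving the rest
  for the sketches.\<close>

lemma good_run:
  assumes z: "ok (Inst w r)" and C: "proper_cut n C" "cut_weight n w C = min_cut n w"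
    and pos: "1 \<le> min_cut n w"
    and j: "j \<le> J" "real (min_cut n w) / 2 ^ j \<le> 3072 * real lg / \<epsilon>\<^sup>2"
    and l: "l \<le> J" "2 \<le> l" "1 / 8 < real (min_cut n w) / 2 ^ l" "real (min_cut n w) / 2 ^ l \<le> 1 / 4"
    and skel: "good_skeleton w C j (skel j (Inst w r))"
    and sketch: "good_sketch w l (sides N (skel j (Inst w r)) \<inter> Pow {..<n}) (symdiff.F (bits l (Inst w r)))"
  shows "real (cutw (Inst w r) (run1 (Inst w r) ((J + 1)\<^sup>2))) \<le> (1 + \<epsilon>) * real (min_cut n w)"
proof -
  let ?z = "Inst w r" and ?h = "skel j (Inst w r)" and ?lam = "real (min_cut n w)" and ?L = "3072 * real lg / \<epsilon>\<^sup>2"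
  let ?c = "real (cut_weight n ?h C)"
  note h = skel_graph[OF z, of j]
  have n0: "0 < n" using n2 by simp
  have d8: "0 < \<epsilon> / 8" "\<epsilon> / 8 \<le> 1" using e by simp_all
  have lo: "(1 - \<epsilon> / 8) * (real (cut_weight n w S) / 2 ^ j) < real (cut_weight n ?h S)" if "proper_cut n S" for S
    using skel that unfolding good_skeleton_def by blast
  have hi: "?c < (1 + \<epsilon> / 8) * (?lam / 2 ^ j)" using skel C(2) unfolding good_skeleton_def by simp
  have "0 < cut_weight n ?h S" if "proper_cut n S" for S
  proof -
    have "0 \<le> (1 - \<epsilon> / 8) * (real (cut_weight n w S) / 2 ^ j)" using d8 by simp
    then have "0 < real (cut_weight n ?h S)" using lo[OF that] by linarith
    then show ?thesis by simp
  qed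
  then have conn: "cmp (edges ?h) 0 = {..<n}" using connected_iff[OF h n0] by blast
  have C3: "C \<subseteq> {..<n}" "C \<noteq> {}" "C \<noteq> {..<n}" using C(1) by (simp_all add: proper_cut_def atLeast0LessThan)
  have lamj: "0 \<le> ?lam / 2 ^ j" by simp
  have "(1 + \<epsilon> / 8) * (?lam / 2 ^ j) \<le> 2 * ?L" using j(2) d8 lamj by (intro mult_mono) auto
  then have c2: "?c \<le> 2 * ?L" using hi by linarith
  have "1 \<le> real n ^ (d + 2)" using n2 by (intro one_le_power) simp
  then have "0 \<le> ln (real n ^ (d + 2))" by (rule ln_ge_zero)
  then have "8 * ?c * (ln (real n ^ (d + 2)) + 1) \<le> 8 * (2 * ?L) * (ln (real n ^ (d + 2)) + 1)"
    using c2 by (intro mult_right_mono) auto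
  then have NC: "8 * ?c * (ln (real n ^ (d + 2)) + 1) < (\<epsilon> / 8)\<^sup>2 * real N" using N by linarith
  obtain i t u v where i: "i < N" and t: "t \<le> N" and c: "(u, v) \<in> cand (gforest j i t) ?z"
    and small: "real (cut_weight n ?h (side (fr (gforest j i t) ?z) u v)) \<le> (1 + \<epsilon> / 8) * ?c"
    using attained[OF z C3 d8 conn NC] by blast
  let ?S = "side (fr (gforest j i t) ?z) u v"
  have S: "proper_cut n ?S" using cand_proper[OF oriented_gforest[OF i] z c] by (simp add: proper_cut_def atLeast0LessThan)
  have "(1 - \<epsilon> / 8) * (real (cut_weight n w ?S) / 2 ^ j) < (1 + \<epsilon> / 8) * ((1 + \<epsilon> / 8) * (?lam / 2 ^ j))"
    using lo[OF S] small mult_left_mono[OF less_imp_le[OF hi], of "1 + \<epsilon> / 8"] d8 by linarith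
  then have "(1 - \<epsilon> / 8) * real (cut_weight n w ?S) < (1 + \<epsilon> / 8) * (1 + \<epsilon> / 8) * ?lam"
    by (simp add: divide_less_cancel mult.assoc)
  also have "\<dots> \<le> (1 - \<epsilon> / 8) * (1 + \<epsilon> / 2) * ?lam"
  proof (rule mult_right_mono)
    have "\<epsilon> * (\<epsilon> * 5) \<le> \<epsilon> * 8" using e by (intro mult_left_mono) auto
    then show "(1 + \<epsilon> / 8) * (1 + \<epsilon> / 8) \<le> (1 - \<epsilon> / 8) * (1 + \<epsilon> / 2)" by (simp add: field_simps)
  qed simp
  finally have "(1 - \<epsilon> / 8) * real (cut_weight n w ?S) < (1 - \<epsilon> / 8) * ((1 + \<epsilon> / 2) * ?lam)" by (simp only: mult.assoc)
  then have light: "real (cutw ?z ?S) \<le> (1 + \<epsilon> / 2) * ?lam" using e by (simp add: cutw_def mult_less_cancel_left_pos)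
  show ?thesis
  proof (rule run_good[OF z i t c light e l(2,3,4) _ l(1)])
    show "\<bar>real (card (symdiff.F (bits l ?z) S)) - real K * ((1 - (1 - 2 / 2 ^ l) ^ cutw ?z S) / 2)\<bar>
        < real K * ((1 - exp (- (\<epsilon> / 8))) / 16)" if "S \<in> sides N ?h" for S
      using sketch that side_sub[OF h that] unfolding good_sketch_def cutw_def inst.sel by blast
    have "j * (J + 1) \<le> J * (J + 1)" using j(1) by (rule mult_le_mono1)
    then have "j * (J + 1) + l < J * (J + 1) + (J + 1)" using l(1) by linarith
    then show "j * (J + 1) + l < (J + 1)\<^sup>2" by (simp add: power2_eq_square)
  qed
qed

lemma exp_lg: "exp (- real lg) \<le> 1 / (real n + 1)"
proof -
  have "real (n + 1) \<le> real (2 ^ lg)" using lg_pow by (rule of_nat_mono)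
  then have "real n + 1 \<le> 2 ^ lg" by simp
  also have "(2::real) ^ lg \<le> exp 1 ^ lg" using exp_ge_add_one_self[of 1] by (intro power_mono) auto
  also have "\<dots> = exp (real lg)" by (simp add: exp_of_nat_mult[symmetric])
  finally show ?thesis by (simp add: exp_minus field_simps)
qed

text \<open>At \<open>j = 0\<close> nothing is thinned out. Otherwise \<open>3072 / 2\<close> turns
  the exponent, with accuracy \<open>\<epsilon> / 8\<close>, into \<open>6 * lg\<close>, which makes
  the tail at most \<open>1 / (n + 1) ^ 6\<close>.\<close>

lemma failure_skeleton:
  assumes w: "weighted_graph n w d" and C: "proper_cut n C" "cut_weight n w C = min_cut n w"
    and pos: "1 \<le> min_cut n w"
    and j: "j \<le> J" "j = 0 \<or> 3072 * real lg / \<epsilon>\<^sup>2 / 2 < real (min_cut n w) / 2 ^ j"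
  shows "real (card {\<omega> \<in> coin. \<not> good_skeleton w C j (thin w {..<2 ^ (J - j)} \<omega>)})
    \<le> real (card coin) / (2 * real n)"
proof (cases "j = 0")
  case True
  have "thin w {..<2 ^ (J - j)} \<omega> = w" if "\<omega> \<in> coin" for \<omega>
  proof -
    define \<omega>' where "\<omega>' = restrict \<omega> triples"
    have "{i. i < w u v \<and> \<omega> (min u v, max u v, i) \<in> {..<2 ^ J}} = {..<w u v}" for u v
    proof -
      have "(min u v, max u v, i) \<in> triples" if "i < w u v" for i
        using weighted_graphD(3)[OF w, of u v] weighted_graphD(4)[OF w, of u v] that by (auto intro: ccontr)
      then show ?thesis using that PiE_mem[of \<omega> triples "\<lambda>_. {..<2 ^ J}"] by blast
    qed
    then show ?thesis unfolding thin_def True by (simp add: fun_eq_iff)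
  qed
  moreover have "good_skeleton w C j w"
    unfolding good_skeleton_def True
  proof (intro conjI allI impI)
    fix S assume "proper_cut n S"
    then have "1 \<le> real (cut_weight n w S)" using min_cut_props(2)[OF n2, of S w] pos by simp
    then show "(1 - \<epsilon> / 8) * (real (cut_weight n w S) / 2 ^ 0) < real (cut_weight n w S)" using e by (simp add: algebra_simps)
  next
    have "0 < real (cut_weight n w C)" using C pos by simp
    then show "real (cut_weight n w C) < (1 + \<epsilon> / 8) * (real (cut_weight n w C) / 2 ^ 0)" using e by (simp add: algebra_simps)
  qed
  ultimately have "{\<omega> \<in> coin. \<not> good_skeleton w C j (thin w {..<2 ^ (J - j)} \<omega>)} = {}" by auto
  then show ?thesis by (simp only: card.empty) simp
next
  case False
  let ?lam = "real (min_cut n w)"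
  define x where "x = exp (- ((\<epsilon> / 8)\<^sup>2 * (?lam / 2 ^ j) / 4))"
  have d8: "0 \<le> \<epsilon> / 8" "\<epsilon> / 8 \<le> 1" using e by simp_all
  have "real (card {\<omega> \<in> coin. \<not> good_skeleton w C j (thin w {..<2 ^ (J - j)} \<omega>)})
    \<le> real (card coin) * ((1 + x) ^ n - 1 + x)"
  proof -
    have lam: "0 \<le> ?lam" "\<And>S. proper_cut n S \<Longrightarrow> ?lam \<le> real (cut_weight n w S)"
      using min_cut_props(2)[OF n2] by simp_all
    have Cl: "real (cut_weight n w C) = ?lam" using C(2) by simp
    show ?thesis using skeleton_bad[OF w n2 lam C(1) Cl j(1) d8]
      unfolding x_def good_skeleton_def Cl de_Morgan_conj not_all not_imp not_less .
  qed
  also have "\<dots> \<le> real (card coin) * (1 / (2 * real n))"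
  proof (intro mult_left_mono tail_bound n2)
    show "0 \<le> x" by (simp add: x_def)
    have "3072 * real lg / \<epsilon>\<^sup>2 / 2 \<le> ?lam / 2 ^ j" using j(2) False by simp
    then have "(\<epsilon> / 8)\<^sup>2 * (3072 * real lg / \<epsilon>\<^sup>2 / 2) / 4 \<le> (\<epsilon> / 8)\<^sup>2 * (?lam / 2 ^ j) / 4"
      by (intro divide_right_mono mult_left_mono) auto
    moreover have "(\<epsilon> / 8)\<^sup>2 * (3072 * real lg / \<epsilon>\<^sup>2 / 2) / 4 = 6 * real lg"
      using e by (simp add: power2_eq_square field_simps)
    ultimately have "x \<le> exp (- (6 * real lg))" unfolding x_def by simp
    also have "\<dots> = exp (- real lg) ^ 6" by (simp add: exp_of_nat_mult[symmetric])
    also have "\<dots> \<le> (1 / (real n + 1)) ^ 6" by (intro power_mono exp_lg) simp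
    finally show "x \<le> 1 / (real n + 1) ^ 6" by (simp add: power_one_over)
  qed simp
  finally show ?thesis by simp
qed

lemma not_good_sketch: "\<not> good_sketch w l F X \<longleftrightarrow> (\<exists>S\<in>F. real K * ((1 - exp (- (\<epsilon> / 8))) / 16)
    \<le> \<bar>real (card (X S)) - real K * ((1 - (1 - 2 / 2 ^ l) ^ cut_weight n w S) / 2)\<bar>)"
  unfolding good_sketch_def by (simp only: Ball_def Bex_def not_all not_imp not_less)

text \<open>\<open>h\<close> is arbitrary, which amounts to conditioning on the skeleton.\<close>

lemma failure_sketch:
  assumes w: "weighted_graph n w d" and l: "l \<le> J"
  shows "real (card {\<omega> \<in> PiE {..<K} (\<lambda>_. coin). \<not> good_sketch w l (sides N h \<inter> Pow {..<n})
      (\<lambda>S. {k. k < K \<and> odd (cut_weight n (thin w {..<2 ^ (J - l)} (\<omega> k)) S)})})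
    \<le> real (card (PiE {..<K} (\<lambda>_. coin))) / (2 * real n)"
proof -
  let ?F = "sides N h \<inter> Pow {..<n}" and ?g = "(1 - exp (- (\<epsilon> / 8))) / 16"
  have "0 < exp (- (\<epsilon> / 8))" by (rule exp_gt_zero)
  then have "1 - exp (- (\<epsilon> / 8)) \<le> 16" by linarith
  then have g1: "?g \<le> 1" by simp
  have g: "0 \<le> ?g" using e by simp
  have F: "finite ?F" "\<And>S. S \<in> ?F \<Longrightarrow> S \<subseteq> {..<n}" using card_sides(1) by auto
  have "card ?F \<le> N * (N + 1) * n ^ 2"
    by (rule order_trans[OF card_mono[OF card_sides(1)] card_sides(2)]) blast
  then have cF: "real (card ?F) \<le> real (N * (N + 1) * n ^ 2)" by (rule of_nat_mono)
  have "real (card {\<omega> \<in> PiE {..<K} (\<lambda>_. coin). \<not> good_sketch w l ?F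
      (\<lambda>S. {k. k < K \<and> odd (cut_weight n (thin w {..<2 ^ (J - l)} (\<omega> k)) S)})})
    \<le> real (card (PiE {..<K} (\<lambda>_. coin))) * (real (card ?F) * (2 * exp (- real K * ?g\<^sup>2 / 4)))"
    unfolding not_good_sketch by (rule sketch_bad[OF w n2 _ _ l g g1]) (fact F)+
  also have "\<dots> \<le> real (card (PiE {..<K} (\<lambda>_. coin))) * (1 / (2 * real n))"
  proof (rule mult_left_mono)
    have "real (card ?F) * (2 * exp (- real K * ?g\<^sup>2 / 4)) \<le> real (N * (N + 1) * n ^ 2) * (2 * exp (- real K * ?g\<^sup>2 / 4))"
      by (intro mult_right_mono cF) simp
    then show "real (card ?F) * (2 * exp (- real K * ?g\<^sup>2 / 4)) \<le> 1 / (2 * real n)" using K by linarith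
  qed simp
  finally show ?thesis by simp
qed


theorem success:
  assumes w: "weighted_graph n w d"
  shows "1 - 1 / real n \<le> measure_pmf.prob (random_inputs n b)
    {r. real (cutw (Inst w r) (run1 (Inst w r) ((J + 1)\<^sup>2))) \<le> (1 + \<epsilon>) * real (min_cut n w)}"
proof -
  define G where "G = {r. real (cutw (Inst w r) (run1 (Inst w r) ((J + 1)\<^sup>2))) \<le> (1 + \<epsilon>) * real (min_cut n w)}"
  let ?O = "PiE {..<K} (\<lambda>_. coin)"
  have z: "ok (Inst w r)" for r using w by (simp add: ok_def)
  have n0: "0 < real n" using n2 by simp
  have pos: "0 < card inputs" unfolding card_inputs by simp
  have bad: "real (card (inputs - G)) \<le> real (card inputs) / real n"
  proof (cases "min_cut n w = 0")
    case True
    have "1 \<le> real n ^ (d + 2)" using n2 by (intro one_le_power) simp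
    then have "0 \<le> ln (real n ^ (d + 2))" by (rule ln_ge_zero)
    then have "0 \<le> 16 * (3072 * real lg / \<epsilon>\<^sup>2) * (ln (real n ^ (d + 2)) + 1)" by (intro mult_nonneg_nonneg) simp_all
    then have "0 < (\<epsilon> / 8)\<^sup>2 * real N" using N by linarith
    then have "0 < N" by (simp add: zero_less_mult_iff)
    note N0 = this
    have "r \<in> G" if "r \<in> inputs" for r
    proof -
      have "cutw (Inst w r) (run1 (Inst w r) ((J + 1)\<^sup>2)) = 0" by (rule zero_case[OF z that True N0]) simp
      then show ?thesis unfolding G_def True mem_Collect_eq by (simp only: of_nat_0 mult_zero_right order_refl)
    qed
    then have "inputs \<subseteq> G" by (rule subsetI)
    then have "inputs - G = {}" by (rule Diff_eq_empty_iff[THEN iffD2])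
    then show ?thesis by (simp only: card.empty) simp
  next
    case False
    then have lam: "1 \<le> min_cut n w" by simp
    obtain C where C: "proper_cut n C" "cut_weight n w C = min_cut n w" using min_cut_props(1)[OF n2, of w] by blast
    obtain j l where j: "j \<le> J" "real (min_cut n w) / 2 ^ j \<le> 3072 * real lg / \<epsilon>\<^sup>2"
        "j = 0 \<or> 3072 * real lg / \<epsilon>\<^sup>2 / 2 < real (min_cut n w) / 2 ^ j"
      and l: "l \<le> J" "2 \<le> l" "1 / 8 < real (min_cut n w) / 2 ^ l" "real (min_cut n w) / 2 ^ l \<le> 1 / 4"
      by (rule scales[OF lam min_cut_le[OF w n2]])
    define h where "h a = thin w {..<2 ^ (J - j)} a" for a :: "nat \<times> nat \<times> nat \<Rightarrow> nat"
    define X where "X g S = {k. k < K \<and> odd (cut_weight n (thin w {..<2 ^ (J - l)} (g k)) S)}"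
      for g :: "nat \<Rightarrow> nat \<times> nat \<times> nat \<Rightarrow> nat" and S
    define B1 where "B1 = {a \<in> coin. \<not> good_skeleton w C j (h a)}"
    define B2 where "B2 a = {g \<in> ?O. \<not> good_sketch w l (sides N (h a) \<inter> Pow {..<n}) (X g)}" for a
    have fin: "finite coin" by (intro finite_PiE) simp_all
    then have finO: "finite coin" "finite ?O" by (simp_all add: finite_PiE)
    have good: "r \<in> G" if "good_skeleton w C j (h (fst (coords r)))"
      "good_sketch w l (sides N (h (fst (coords r))) \<inter> Pow {..<n}) (X (snd (coords r)))" for r
    proof -
      have hs: "skel j (Inst w r) = h (fst (coords r))" unfolding h_def by (rule skel_coords[OF z])
      have "symdiff.F (bits l (Inst w r)) S = X (snd (coords r)) S" if "S \<subseteq> {..<n}" for S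
        unfolding X_def by (rule bits_coords[OF z that])
      then have "good_sketch w l (sides N (skel j (Inst w r)) \<inter> Pow {..<n}) (symdiff.F (bits l (Inst w r)))"
        using that(2) unfolding good_sketch_def hs by simp
      then have "real (cutw (Inst w r) (run1 (Inst w r) ((J + 1)\<^sup>2))) \<le> (1 + \<epsilon>) * real (min_cut n w)"
        using that(1) by (intro good_run[OF z C lam j(1,2) l]) (simp_all only: hs)
      then show ?thesis unfolding G_def by (simp only: mem_Collect_eq)
    qed
    \<comment> \<open>The bad sketches depend on the skeleton, hence a dependent sum; counting its
      fibres replaces conditional probabilities.\<close>
    have "coords ` (inputs - G) \<subseteq> B1 \<times> ?O \<union> Sigma coin B2"
    proof
      fix y assume "y \<in> coords ` (inputs - G)"
      then obtain r where y: "y = coords r" and r: "r \<in> inputs" "r \<notin> G" by blast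
      have "y \<in> coin \<times> ?O" unfolding y by (rule bij_betwE[OF coords_bij, rule_format, OF r(1)])
      then have m: "fst y \<in> coin" "snd y \<in> ?O" by (simp_all add: mem_Times_iff)
      have "fst y \<in> B1 \<or> snd y \<in> B2 (fst y)" using good[of r] r(2) m unfolding B1_def B2_def y[symmetric] by blast
      then show "y \<in> B1 \<times> ?O \<union> Sigma coin B2" using m by (cases y) auto
    qed
    then have "card (coords ` (inputs - G)) \<le> card (B1 \<times> ?O \<union> Sigma coin B2)"
      using finO by (intro card_mono) (auto simp: B1_def B2_def)
    also have "\<dots> \<le> card (B1 \<times> ?O) + card (Sigma coin B2)" by (rule card_Un_le)
    also have "card (Sigma coin B2) = (\<Sum>a\<in>coin. card (B2 a))"
      using finO by (intro card_SigmaI) (auto simp: B2_def)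
    finally have "card (inputs - G) \<le> card B1 * card ?O + (\<Sum>a\<in>coin. card (B2 a))"
      using inj_on_subset[OF bij_betw_imp_inj_on[OF coords_bij], of "inputs - G"]
      by (simp add: card_image card_cartesian_product)
    then have "real (card (inputs - G)) \<le> real (card B1 * card ?O + (\<Sum>a\<in>coin. card (B2 a)))" by (rule of_nat_mono)
    also have "\<dots> = real (card B1) * real (card ?O) + (\<Sum>a\<in>coin. real (card (B2 a)))" by (simp only: of_nat_add of_nat_mult of_nat_sum)
    \<comment> \<open>Each kind of failure takes half of the allowed \<open>1 / n\<close>.\<close>
    also have "\<dots> \<le> real (card coin) / (2 * real n) * real (card ?O) + (\<Sum>a\<in>coin. real (card ?O) / (2 * real n))"
    proof (intro add_mono mult_right_mono sum_mono)
      show "real (card B1) \<le> real (card coin) / (2 * real n)"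
        unfolding B1_def h_def by (rule failure_skeleton[OF w C lam j(1,3)])
      show "real (card (B2 a)) \<le> real (card ?O) / (2 * real n)" for a
        unfolding B2_def X_def by (rule failure_sketch[OF w l(1)])
    qed simp
    also have "\<dots> = real (card (coin \<times> ?O)) / real n"
      unfolding card_cartesian_product using n0 by (simp add: field_simps)
    finally show ?thesis unfolding card_coords .
  qed
  have ne: "inputs \<noteq> {}" using pos by auto
  have "random_inputs n b = pmf_of_set inputs" unfolding random_inputs_def inputs_def ..
  then have "measure_pmf.prob (random_inputs n b) G = real (card (inputs \<inter> G)) / real (card inputs)"
    by (simp only: measure_pmf_of_set[OF ne card_inputs(1)])
  moreover have "card (inputs \<inter> G) + card (inputs - G) = card inputs"
    using card_inputs(1) by (subst card_Un_disjoint[symmetric]) (auto intro: arg_cong[of _ _ card])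
  then have "real (card (inputs \<inter> G)) + real (card (inputs - G)) = real (card inputs)" by (metis of_nat_add)
  then have "(1 - 1 / real n) * real (card inputs) \<le> real (card (inputs \<inter> G))"
    using bad by (simp add: left_diff_distrib)
  then have "1 - 1 / real n \<le> real (card (inputs \<inter> G)) / real (card inputs)"
    using pos by (simp only: pos_le_divide_eq of_nat_0_less_iff)
  ultimately show ?thesis unfolding G_def by simp
qed

end

section \<open>Parameters\<close>

context big_network
begin

lemma lg_upper: "real lg \<le> 3 * log 2 (real n)" "2 ^ lg \<le> (n + 1) ^ 2"
proof -
  have pos: "0 \<le> log 2 (real n + 1)" using n2 by simp
  have u: "real lg \<le> log 2 (real n + 1) + 1" unfolding lg_def using pos by linarith
  have "log 2 (real n + 1) \<le> log 2 (2 * real n)" using n2 by (intro log_mono) auto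
  also have "\<dots> = 1 + log 2 (real n)" using n2 by (simp add: log_mult)
  finally have "log 2 (real n + 1) \<le> 1 + log 2 (real n)" .
  moreover have "1 \<le> log 2 (real n)" using n2 by (simp add: le_log_iff)
  ultimately show "real lg \<le> 3 * log 2 (real n)" using u by linarith
  have "(2::real) ^ lg = 2 powr real lg" by (simp add: powr_realpow)
  also have "\<dots> \<le> 2 powr (log 2 (real n + 1) + 1)" using u by simp
  also have "\<dots> = 2 * (real n + 1)" by (simp add: powr_add)
  finally have "real (2 ^ lg) \<le> real (2 * (n + 1))" by simp
  then have "2 ^ lg \<le> 2 * (n + 1)" by (rule of_nat_le_iff[THEN iffD1])
  also have "\<dots> \<le> (n + 1) ^ 2" using n2 by (simp add: power2_eq_square)
  finally show "2 ^ lg \<le> (n + 1) ^ 2" .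
qed

lemma lg_less: "lg \<le> (n + 1) ^ 2"
proof -
  have "lg < 2 ^ lg" by (rule less_exp)
  then show ?thesis using lg_upper(2) by linarith
qed

lemma const_pow: "a \<le> (n + 1) ^ a"
proof -
  have "a < 2 ^ a" by (rule less_exp)
  also have "(2::nat) ^ a \<le> (n + 1) ^ a" using n2 by (intro power_mono) auto
  finally show ?thesis by simp
qed

text \<open>All quantities become powers of \<open>n + 1\<close>: constants by
  \<open>const_pow\<close>, and \<open>2 ^ (B * lg)\<close> by \<open>(n + 1) ^ (2 * B)\<close>,
  which explains the term \<open>2 * B\<close>.\<close>

lemma message_bounds:
  fixes A B :: nat
  assumes k: "20 + A + 2 * B + d \<le> \<kappa>"
  shows "n ^ 6 * (n + 1) \<le> msg_bound \<kappa> n" "n ^ 6 * 2 ^ (B * lg) \<le> msg_bound \<kappa> n"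
    "n ^ 6 * ((B * lg + 1) * n ^ 2 + 1) \<le> msg_bound \<kappa> n" "n ^ 6 * (A * lg ^ 2 * n ^ 2 + 2) \<le> msg_bound \<kappa> n"
    "(n ^ d + 1) * 2 ^ (B * lg) \<le> msg_bound \<kappa> n" "n ^ 6 * (n ^ 2 * n ^ d + 2) \<le> msg_bound \<kappa> n"
proof -
  define m where "m = n + 1"
  have m: "n \<le> m" "3 \<le> m" using n2 by (simp_all add: m_def)
  have up: "x \<le> msg_bound \<kappa> n" if "x \<le> m ^ e" "e \<le> \<kappa>" for x e
  proof -
    have "m ^ e \<le> m ^ \<kappa>" using that(2) m by (intro power_increasing) auto
    then show ?thesis using that(1) by (simp add: msg_bound_def m_def)
  qed
  have n6: "n ^ 6 \<le> m ^ 6" and np2: "n ^ 2 \<le> m ^ 2" and nd: "n ^ d \<le> m ^ d" using m by (simp_all add: power_mono)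
  have one: "1 \<le> m ^ e" for e using m by simp
  have B2: "2 ^ (B * lg) \<le> m ^ (2 * B)"
  proof -
    have "(2::nat) ^ (B * lg) = (2 ^ lg) ^ B" by (simp add: power_mult[symmetric] mult.commute)
    also have "\<dots> \<le> (m ^ 2) ^ B" using lg_upper(2) by (intro power_mono) (simp_all add: m_def)
    finally show ?thesis by (simp add: power_mult)
  qed
  have l: "lg \<le> m ^ 2" using lg_less by (simp add: m_def)
  have c: "a \<le> m ^ a" for a using const_pow by (simp add: m_def)
  have "n ^ 6 * (n + 1) \<le> m ^ 6 * m" by (rule mult_mono) (use n6 in \<open>simp_all add: m_def\<close>)
  also have "\<dots> = m ^ 7" by (simp add: power_add[symmetric] flip: power_Suc2)
  finally show "n ^ 6 * (n + 1) \<le> msg_bound \<kappa> n" by (rule up) (use k in simp)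
  have "n ^ 6 * 2 ^ (B * lg) \<le> m ^ 6 * m ^ (2 * B)" by (rule mult_mono[OF n6 B2]) simp_all
  also have "\<dots> = m ^ (6 + 2 * B)" by (simp add: power_add)
  finally show "n ^ 6 * 2 ^ (B * lg) \<le> msg_bound \<kappa> n" by (rule up) (use k in simp)
  have "(B * lg + 1) * n ^ 2 + 1 \<le> (B * m ^ 2 + m ^ 2) * m ^ 2 + m ^ 4"
    by (intro add_mono mult_mono np2 l one) simp_all
  also have "\<dots> = (B + 2) * m ^ 4" by (simp add: algebra_simps power_add[symmetric])
  also have "\<dots> \<le> m ^ (B + 2) * m ^ 4" by (rule mult_le_mono1[OF c])
  finally have "n ^ 6 * ((B * lg + 1) * n ^ 2 + 1) \<le> m ^ 6 * (m ^ (B + 2) * m ^ 4)" by (rule mult_mono[OF n6]) simp_all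
  also have "\<dots> = m ^ (12 + B)" unfolding power_add[symmetric] by (simp add: add.commute)
  finally show "n ^ 6 * ((B * lg + 1) * n ^ 2 + 1) \<le> msg_bound \<kappa> n" by (rule up) (use k in simp)
  have "lg ^ 2 \<le> m ^ 4" using power_mono[OF l, of 2] by (simp add: power_mult[symmetric])
  then have "A * lg ^ 2 * n ^ 2 + 2 \<le> A * m ^ 4 * m ^ 2 + 2 * m ^ 6"
    using one[of 6] by (intro add_mono mult_mono np2) simp_all
  also have "\<dots> = (A + 2) * m ^ 6" by (simp add: algebra_simps power_add[symmetric])
  also have "\<dots> \<le> m ^ (A + 2) * m ^ 6" by (rule mult_le_mono1[OF c])
  finally have "n ^ 6 * (A * lg ^ 2 * n ^ 2 + 2) \<le> m ^ 6 * (m ^ (A + 2) * m ^ 6)" by (rule mult_mono[OF n6]) simp_all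
  also have "\<dots> = m ^ (14 + A)" unfolding power_add[symmetric] by (simp add: add.commute)
  finally show "n ^ 6 * (A * lg ^ 2 * n ^ 2 + 2) \<le> msg_bound \<kappa> n" by (rule up) (use k in simp)
  have "n ^ d + 1 \<le> m ^ d + 2 * m ^ d" using nd one[of d] by linarith
  also have "\<dots> \<le> m * m ^ d" using mult_le_mono1[OF m(2), of "m ^ d"] by simp
  finally have "(n ^ d + 1) * 2 ^ (B * lg) \<le> m * m ^ d * m ^ (2 * B)" by (rule mult_mono[OF _ B2]) simp_all
  also have "\<dots> = m ^ (1 + d + 2 * B)" by (simp add: power_add)
  finally show "(n ^ d + 1) * 2 ^ (B * lg) \<le> msg_bound \<kappa> n" by (rule up) (use k in simp)
  have "n ^ 2 * n ^ d \<le> m ^ 2 * m ^ d" by (rule mult_mono[OF np2 nd]) simp_all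
  then have "n ^ 2 * n ^ d + 2 \<le> m ^ (2 + d) + 2 * m ^ (2 + d)" using one[of "2 + d"] unfolding power_add by linarith
  also have "\<dots> \<le> m * m ^ (2 + d)" using mult_le_mono1[OF m(2), of "m ^ (2 + d)"] by simp
  finally have "n ^ 6 * (n ^ 2 * n ^ d + 2) \<le> m ^ 6 * (m * m ^ (2 + d))" by (rule mult_mono[OF n6]) simp_all
  also have "\<dots> = m ^ (9 + d)" unfolding power_add[symmetric] power_Suc[symmetric] by (simp add: add.commute)
  finally show "n ^ 6 * (n ^ 2 * n ^ d + 2) \<le> msg_bound \<kappa> n" by (rule up) (use k in simp)
qed

text \<open>The cost of \<open>(J + 1)\<^sup>2\<close> steps in \<open>known_run1\<close> for
  \<open>J = (d + 3) * lg\<close> and \<open>N = A * lg\<^sup>2\<close>.\<close>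

definition rounds :: "nat \<Rightarrow> nat" where
  "rounds A = ((d + 3) * lg + 1)\<^sup>2 * (1 + A * lg\<^sup>2 * (lg * (4 + 8 * lg) + (A * lg\<^sup>2 + 1) * (4 + 36 * lg)))"

text \<open>\<open>J\<close> bits for each of the \<open>K + 1\<close> layers, \<open>n\<close>
  possible other endpoints and \<open>n ^ d\<close> copies.\<close>

definition coin_bits :: "nat \<Rightarrow> nat" where
  "coin_bits B = (d + 3) * lg * ((B * lg + 1) * (n * n ^ d))"

text \<open>The scales contribute \<open>lg ^ 2\<close>, the trees and thresholds
  \<open>lg ^ 5\<close>; \<open>2187 = 3 ^ 7\<close> comes from
  \<open>lg \<le> 3 * log 2 n\<close>.\<close>

lemma rounds_le:
  assumes k: "2187 * ((d + 4)\<^sup>2 * (1 + A * (40 * A + 52))) + 7 \<le> \<kappa>"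
  shows "real (rounds A) \<le> real \<kappa> * log 2 (real n) ^ \<kappa>"
proof -
  let ?Z = "(d + 4)\<^sup>2 * (1 + A * (40 * A + 52))"
  have l: "1 \<le> lg" using lg_pos by simp
  have p: "lg ^ a \<le> lg ^ b" if "a \<le> b" for a b using l that by (rule power_increasing[rotated])
  have "(d + 3) * lg + 1 \<le> (d + 4) * lg" using l by (simp add: algebra_simps)
  then have a: "((d + 3) * lg + 1)\<^sup>2 \<le> ((d + 4) * lg)\<^sup>2" by (rule power_mono) simp
  have "lg * (4 + 8 * lg) \<le> lg * (12 * lg)" using l by (intro mult_left_mono) auto
  also have "\<dots> \<le> 12 * lg ^ 3" using p[of 2 3] by (simp add: power2_eq_square)
  finally have i1: "lg * (4 + 8 * lg) \<le> 12 * lg ^ 3" .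
  have "(A * lg\<^sup>2 + 1) * (4 + 36 * lg) \<le> ((A + 1) * lg\<^sup>2) * (40 * lg)"
    using l p[of 0 2] by (intro mult_mono) (auto simp: algebra_simps)
  also have "\<dots> = (40 * A + 40) * lg ^ 3" by (simp add: algebra_simps power2_eq_square power3_eq_cube)
  finally have "lg * (4 + 8 * lg) + (A * lg\<^sup>2 + 1) * (4 + 36 * lg) \<le> 12 * lg ^ 3 + (40 * A + 40) * lg ^ 3"
    using i1 by (rule add_mono[rotated])
  also have "\<dots> = (40 * A + 52) * lg ^ 3" by (simp add: algebra_simps)
  finally have "A * lg\<^sup>2 * (lg * (4 + 8 * lg) + (A * lg\<^sup>2 + 1) * (4 + 36 * lg)) \<le> A * lg\<^sup>2 * ((40 * A + 52) * lg ^ 3)"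
    by (rule mult_left_mono) simp
  also have "\<dots> = A * (40 * A + 52) * (lg\<^sup>2 * lg ^ 3)" by (simp only: ac_simps)
  also have "lg\<^sup>2 * lg ^ 3 = lg ^ 5" by (simp flip: power_add)
  finally have "1 + A * lg\<^sup>2 * (lg * (4 + 8 * lg) + (A * lg\<^sup>2 + 1) * (4 + 36 * lg)) \<le> lg ^ 5 + A * (40 * A + 52) * lg ^ 5"
    using p[of 0 5] by (intro add_mono) simp_all
  also have "\<dots> = (1 + A * (40 * A + 52)) * lg ^ 5" by (simp only: add_mult_distrib mult_1)
  finally have "rounds A \<le> ((d + 4) * lg)\<^sup>2 * ((1 + A * (40 * A + 52)) * lg ^ 5)"
    unfolding rounds_def by (intro mult_mono a) simp_all
  also have "\<dots> = ?Z * (lg\<^sup>2 * lg ^ 5)" unfolding power_mult_distrib by (simp only: ac_simps)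
  also have "lg\<^sup>2 * lg ^ 5 = lg ^ 7" by (simp flip: power_add)
  finally have "real (rounds A) \<le> real (?Z * lg ^ 7)" by (rule of_nat_mono)
  also have "\<dots> = real ?Z * real lg ^ 7" by (simp only: of_nat_mult of_nat_power)
  also have "\<dots> \<le> real ?Z * (3 * log 2 (real n)) ^ 7" by (intro mult_left_mono power_mono lg_upper(1)) simp_all
  also have "\<dots> = real (2187 * ?Z) * log 2 (real n) ^ 7" unfolding power_mult_distrib of_nat_mult by simp
  also have "\<dots> \<le> real \<kappa> * log 2 (real n) ^ \<kappa>"
  proof (intro mult_mono power_increasing)
    show "real (2187 * ?Z) \<le> real \<kappa>" using k by (intro of_nat_mono) simp
    show "1 \<le> log 2 (real n)" using n2 by (simp add: le_log_iff)
    show "0 \<le> log 2 (real n) ^ 7" using n2 by simp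
  qed (use k in simp_all)
  finally show ?thesis .
qed


lemma ln_lg: "ln (real n) \<le> real lg"
proof -
  have "real (n + 1) \<le> real (2 ^ lg)" using lg_pow by (rule of_nat_mono)
  then have "real n + 1 \<le> 2 ^ lg" by simp
  then have "real n \<le> 2 ^ lg" by linarith
  also have "(2::real) ^ lg \<le> exp 1 ^ lg" using exp_ge_add_one_self[of 1] by (intro power_mono) auto
  also have "\<dots> = exp (real lg)" by (simp add: exp_of_nat_mult[symmetric])
  finally have "ln (real n) \<le> ln (exp (real lg))" using n2 by (intro ln_mono) auto
  then show ?thesis by simp
qed

text \<open>The skeleton cut and the logarithm of the total weight are both \<open>O(lg)\<close>,
  hence \<open>lg\<^sup>2\<close> trees; \<open>3145728 = 16 * 3072 * 64\<close>.\<close>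

lemma packing_size:
  fixes \<epsilon> :: real
  assumes e: "0 < \<epsilon>" and A: "3145728 * (real d + 3) / \<epsilon> ^ 4 < real A"
  shows "16 * (3072 * real lg / \<epsilon>\<^sup>2) * (ln (real n ^ (d + 2)) + 1) < (\<epsilon> / 8)\<^sup>2 * real (A * lg\<^sup>2)"
proof -
  have l: "1 \<le> real lg" using lg_pos by simp
  have "ln (real n ^ (d + 2)) = real (d + 2) * ln (real n)" by (rule ln_realpow)
  also have "\<dots> \<le> real (d + 2) * real lg" by (intro mult_left_mono ln_lg) simp
  finally have "ln (real n ^ (d + 2)) + 1 \<le> (real d + 3) * real lg" using l by (simp add: algebra_simps)
  then have "16 * (3072 * real lg / \<epsilon>\<^sup>2) * (ln (real n ^ (d + 2)) + 1) \<le> 16 * (3072 * real lg / \<epsilon>\<^sup>2) * ((real d + 3) * real lg)"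
    by (intro mult_left_mono) auto
  also have "\<dots> = \<epsilon>\<^sup>2 / 64 * (real lg)\<^sup>2 * (3145728 * (real d + 3) / \<epsilon> ^ 4)"
    using e by (simp add: field_simps power2_eq_square power4_eq_xxxx)
  also have "\<dots> < \<epsilon>\<^sup>2 / 64 * (real lg)\<^sup>2 * real A"
    using e l A by (intro mult_strict_left_mono mult_pos_pos) auto
  also have "\<dots> = (\<epsilon> / 8)\<^sup>2 * real (A * lg\<^sup>2)" by (simp add: power_divide)
  finally show ?thesis .
qed

lemma sample_size: "4 * n ^ (d + 1) \<le> 2 ^ ((d + 3) * lg)"
proof -
  have "4 * n ^ (d + 1) \<le> (n + 1) ^ 2 * (n + 1) ^ (d + 1)"
    using power_mono[of 2 "n + 1" 2] n2 by (intro mult_mono power_mono) auto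
  also have "\<dots> = (n + 1) ^ (2 + (d + 1))" by (rule power_add[symmetric])
  also have "2 + (d + 1) = d + 3" by simp
  also have "(n + 1) ^ (d + 3) \<le> (2 ^ lg) ^ (d + 3)" by (intro power_mono lg_pow) simp
  finally show ?thesis by (simp add: power_mult[symmetric] mult.commute)
qed

text \<open>After clearing denominators \<open>lg ^ 4\<close> and \<open>n ^ 3\<close> remain, each
  base at most \<open>2 ^ lg\<close>, which gives the \<open>7\<close>; the coefficient
  \<open>8 * A ^ 2\<close> is absorbed as an exponent.\<close>

lemma sketch_size:
  fixes \<gamma> :: real
  assumes A: "1 \<le> A" and B: "8 * real A ^ 2 + 7 \<le> real B * (\<gamma>\<^sup>2 / 4)"
  shows "real (A * lg\<^sup>2 * (A * lg\<^sup>2 + 1) * n\<^sup>2) * (2 * exp (- real (B * lg) * \<gamma>\<^sup>2 / 4)) \<le> 1 / (2 * real n)"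
proof -
  let ?c = "8 * A ^ 2 + 7" and ?q = "2 ^ lg :: nat"
  have l: "1 \<le> lg" "lg \<le> ?q" using lg_pos less_exp[of lg] by simp_all
  have nq: "n \<le> ?q" using lg_pow by simp
  have "1 \<le> A * lg\<^sup>2" using A l by simp
  then have "A * lg\<^sup>2 * (A * lg\<^sup>2 + 1) \<le> A * lg\<^sup>2 * (2 * (A * lg\<^sup>2))" by (intro mult_left_mono) auto
  also have "\<dots> = 2 * A ^ 2 * lg ^ 4" by (simp add: power2_eq_square power4_eq_xxxx)
  finally have "4 * (A * lg\<^sup>2 * (A * lg\<^sup>2 + 1)) * n ^ 3 \<le> 4 * (2 * A ^ 2 * lg ^ 4) * n ^ 3" by (intro mult_right_mono mult_left_mono) auto
  also have "\<dots> = 8 * A ^ 2 * (lg ^ 4 * n ^ 3)" by simp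
  also have "\<dots> \<le> 2 ^ (8 * A ^ 2) * (?q ^ 4 * ?q ^ 3)" using less_exp[of "8 * A ^ 2"]
    by (intro mult_mono power_mono l nq) auto
  also have "\<dots> \<le> ?q ^ (8 * A ^ 2) * (?q ^ 4 * ?q ^ 3)"
    using power_increasing[OF l(1), of "2 :: nat"] by (intro mult_right_mono power_mono) auto
  also have "\<dots> = ?q ^ ?c" unfolding power_add[symmetric] by simp
  finally have "real (4 * (A * lg\<^sup>2 * (A * lg\<^sup>2 + 1)) * n ^ 3) \<le> real (?q ^ ?c)" by (rule of_nat_mono)
  also have "\<dots> = 2 ^ (lg * ?c)" by (simp add: power_mult)
  also have "\<dots> \<le> exp 1 ^ (lg * ?c)" using exp_ge_add_one_self[of 1] by (intro power_mono) auto
  also have "\<dots> = exp (real (lg * ?c))" by (simp add: exp_of_nat_mult[symmetric])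
  finally have X: "real (4 * (A * lg\<^sup>2 * (A * lg\<^sup>2 + 1)) * n ^ 3) \<le> exp (real (lg * ?c))" .
  have "real lg * (8 * real A ^ 2 + 7) \<le> real lg * (real B * (\<gamma>\<^sup>2 / 4))" by (intro mult_left_mono B) simp
  then have "exp (- real (B * lg) * \<gamma>\<^sup>2 / 4) \<le> exp (- real (lg * ?c))" by (simp add: ac_simps)
  then have "real (4 * (A * lg\<^sup>2 * (A * lg\<^sup>2 + 1)) * n ^ 3) * exp (- real (B * lg) * \<gamma>\<^sup>2 / 4)
      \<le> exp (real (lg * ?c)) * exp (- real (lg * ?c))" by (intro mult_mono X) simp_all
  also have "\<dots> = 1" by (simp add: exp_minus)
  finally have "real (4 * (A * lg\<^sup>2 * (A * lg\<^sup>2 + 1)) * n ^ 3) * exp (- real (B * lg) * \<gamma>\<^sup>2 / 4) \<le> 1" .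
  moreover have "real (a * n\<^sup>2) * (2 * x) * (2 * real n) = real (4 * a * n ^ 3) * x" for a x
    by (simp add: power2_eq_square power3_eq_cube)
  ultimately have "real (A * lg\<^sup>2 * (A * lg\<^sup>2 + 1) * n\<^sup>2) * (2 * exp (- real (B * lg) * \<gamma>\<^sup>2 / 4)) * (2 * real n) \<le> 1"
    by (simp only:)
  then show ?thesis using n2 by (simp add: pos_le_divide_eq del: of_nat_mult)
qed

text \<open>\<open>known\<close> says only that the view determines membership. The output function
  \<open>out\<close> decodes it by asking whether some instance, node and adversary produce this
  view with the node inside the cut.\<close>

lemma simulate:
  fixes \<epsilon> :: real
  assumes k: "20 + A + 2 * B + d \<le> \<kappa>" and e: "0 < \<epsilon>" "\<epsilon> \<le> 1"
    and A: "3145728 * (real d + 3) / \<epsilon> ^ 4 < real A"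
    and B: "8 * real A ^ 2 + 7 \<le> real B * (((1 - exp (- (\<epsilon> / 8))) / 16)\<^sup>2 / 4)"
  shows "\<exists>ls gs out. (\<forall>k. length (gs k) \<le> ncc_cap \<kappa> n \<and> (\<forall>(t, m) \<in> set (gs k). m < msg_bound \<kappa> n) \<and>
       (\<forall>u m. ls k u = Some m \<longrightarrow> m < msg_bound \<kappa> n)) \<and>
     (\<forall>w adv. weighted_graph n w d \<longrightarrow> 1 - 1 / real n \<le> measure_pmf.prob (random_inputs n (coin_bits B))
        {r. approx_min_cut \<epsilon> n w {v. v < n \<and> out (exec \<kappa> (proto ls gs) adv n w r (rounds A) v)}})"
proof -
  let ?J = "(d + 3) * lg" and ?K = "B * lg" and ?N = "A * lg\<^sup>2"
  let ?I = "{..?K} \<times> {..<n} \<times> {..<n ^ d}" and ?b = "coin_bits B"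
  have "0 \<le> 3145728 * (real d + 3) / \<epsilon> ^ 4" using e by simp
  then have "0 < real A" using A by linarith
  then have A1: "1 \<le> A" by simp
  \<comment> \<open>The number of bits is exact, so uniform random numbers correspond to uniform
    coin assignments.\<close>
  have "card {..<2 ^ ?b :: nat} = card (PiE ?I (\<lambda>_. {..<2 ^ ?J :: nat}))"
    by (simp add: card_PiE card_cartesian_product coin_bits_def power_mult)
  then obtain dig where dig: "bij_betw dig {..<2 ^ ?b :: nat} (PiE ?I (\<lambda>_. {..<2 ^ ?J :: nat}))"
    using finite_same_card_bij[of "{..<2 ^ ?b :: nat}" "PiE ?I (\<lambda>_. {..<2 ^ ?J :: nat})"] by (auto simp: finite_PiE)
  have digr: "bij_betw (\<lambda>x. restrict (dig x) ?I) {..<2 ^ ?b} (PiE ?I (\<lambda>_. {..<2 ^ ?J}))"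
  proof (rule bij_betw_cong[THEN iffD1, OF _ dig])
    fix x :: nat assume "x \<in> {..<2 ^ ?b}"
    then have "dig x \<in> PiE ?I (\<lambda>_. {..<2 ^ ?J})" by (rule bij_betwE[OF dig, rule_format])
    then show "dig x = restrict (dig x) ?I" by (simp add: PiE_restrict)
  qed
  interpret S: sampled_network n d \<kappa> ?N ?K ?J dig \<epsilon> ?b
    by unfold_locales
      (fact message_bounds[OF k] e packing_size[OF e(1) A] sample_size sketch_size[OF A1 B] digr)+
  let ?s = "(?J + 1)\<^sup>2"
  have R: "?s * (1 + ?N * S.iter_cost) = rounds A" unfolding rounds_def S.iter_cost_def ..
  obtain ls gs where v: "valid_proto ls gs"
    and kn: "\<And>z z' v adv adv'. ok z \<Longrightarrow> ok z' \<Longrightarrow> v < n \<Longrightarrow>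
      view ls gs adv z (rounds A) v = view ls gs adv' z' (rounds A) v \<Longrightarrow> (v \<in> S.run1 z ?s) = (v \<in> S.run1 z' ?s)"
    using S.known_run1[of ?s] unfolding R known_def by blast
  define out where "out k \<longleftrightarrow> (\<exists>z v adv. ok z \<and> v < n \<and> view ls gs adv z (rounds A) v = k \<and> v \<in> S.run1 z ?s)" for k
  have cut: "{v. v < n \<and> out (view ls gs adv z (rounds A) v)} = S.run1 z ?s" if z: "ok z" for z adv
  proof (rule set_eqI)
    fix v
    have "out (view ls gs adv z (rounds A) v) \<longleftrightarrow> v \<in> S.run1 z ?s" if v: "v < n"
    proof
      assume "out (view ls gs adv z (rounds A) v)"
      then obtain z' v' adv' where o: "ok z'" "v' < n" "view ls gs adv' z' (rounds A) v' = view ls gs adv z (rounds A) v"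
        "v' \<in> S.run1 z' ?s" unfolding out_def by blast
      have "v' = v" using arg_cong[OF o(3), of k_id] by simp
      then show "v \<in> S.run1 z ?s" using kn[OF o(1) z v] o(3,4) by blast
    next
      assume "v \<in> S.run1 z ?s"
      then show "out (view ls gs adv z (rounds A) v)" unfolding out_def using z v by blast
    qed
    moreover have "v \<in> S.run1 z ?s \<Longrightarrow> v < n" using S.proper_sub[OF S.run1_proper[OF z]] by blast
    ultimately show "v \<in> {v. v < n \<and> out (view ls gs adv z (rounds A) v)} \<longleftrightarrow> v \<in> S.run1 z ?s" by blast
  qed
  have "1 - 1 / real n \<le> measure_pmf.prob (random_inputs n ?b)
      {r. approx_min_cut \<epsilon> n w {v. v < n \<and> out (exec \<kappa> (proto ls gs) adv n w r (rounds A) v)}}"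
    if w: "weighted_graph n w d" for w adv
  proof -
    have z: "ok (Inst w r)" for r using w by (simp add: ok_def)
    have "{v. v < n \<and> out (exec \<kappa> (proto ls gs) adv n w r (rounds A) v)} = S.run1 (Inst w r) ?s" for r
      using cut[OF z, of adv r] by simp
    then have "approx_min_cut \<epsilon> n w {v. v < n \<and> out (exec \<kappa> (proto ls gs) adv n w r (rounds A) v)} \<longleftrightarrow>
        real (S.cutw (Inst w r) (S.run1 (Inst w r) ?s)) \<le> (1 + \<epsilon>) * real (min_cut n w)" for r
      using S.run1_proper[OF z, of r ?s] unfolding approx_min_cut_def S.cutw_def by simp
    then show ?thesis using S.success[OF w] by simp
  qed
  then show ?thesis using v unfolding valid_proto_def by blast
qed

end


theorem theorem2:
  shows "\<exists>\<epsilon>0>0. \<forall>\<epsilon>::real. 0 < \<epsilon> \<and> \<epsilon> < \<epsilon>0 \<longrightarrow>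
    (\<forall>d::nat. \<exists>(A::algorithm) (\<kappa>::nat) (c::real).
       0 < \<kappa> \<and> 0 < c \<and> valid_algorithm \<kappa> A \<and>
       (\<forall>n\<ge>2. real (num_rounds A n) \<le> real \<kappa> * (log 2 (real n)) ^ \<kappa>) \<and>
       (\<forall>n w (adv::adversary). n \<ge> 2 \<and> weighted_graph n w d \<longrightarrow>
          measure_pmf.prob (random_inputs n (rand_bits A n))
            {r. approx_min_cut \<epsilon> n w (computed_cut \<kappa> A adv n w r)}
          \<ge> 1 - 1 / real n powr c))"
proof (rule exI[of _ 1], intro conjI allI impI)
  fix \<epsilon> :: real and d :: nat
  assume "0 < \<epsilon> \<and> \<epsilon> < 1"
  then have e: "0 < \<epsilon>" "\<epsilon> \<le> 1" by simp_all
  obtain M :: nat where M: "3145728 * (real d + 3) / \<epsilon> ^ 4 < real M" using reals_Archimedean2 by blast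
  let ?g = "((1 - exp (- (\<epsilon> / 8))) / 16)\<^sup>2 / 4"
  have g: "0 < ?g" using e by simp
  obtain B :: nat where B: "(8 * real M ^ 2 + 7) / ?g < real B" using reals_Archimedean2 by blast
  then have B: "8 * real M ^ 2 + 7 \<le> real B * ?g" using g by (simp only: pos_divide_less_eq less_imp_le)
  \<comment> \<open>One constant serves as message exponent, as capacity factor, and as coefficient
    and exponent of the round bound.\<close>
  define \<kappa> where "\<kappa> = 20 + M + 2 * B + d + 2187 * ((d + 4)\<^sup>2 * (1 + M * (40 * M + 52))) + 7"
  have big: "big_network n \<kappa>" if "2 \<le> n" for n
    using that by unfold_locales (simp_all add: \<kappa>_def)
  define R where "R n = (if 2 \<le> n then big_network.rounds n d M else 0)" for n
  define bits where "bits n = big_network.coin_bits n d B" for n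
  define spec where "spec n ls gs out \<longleftrightarrow> (\<forall>k. length (gs k) \<le> ncc_cap \<kappa> n \<and> (\<forall>(t, m) \<in> set (gs k). m < msg_bound \<kappa> n) \<and>
       (\<forall>u m. ls k u = Some m \<longrightarrow> m < msg_bound \<kappa> n)) \<and>
     (\<forall>w adv. weighted_graph n w d \<longrightarrow> 1 - 1 / real n \<le> measure_pmf.prob (random_inputs n (bits n))
        {r. approx_min_cut \<epsilon> n w {v. v < n \<and> out (exec \<kappa> (proto ls gs) adv n w r (R n) v)}})"
    for n ls gs and out :: "knowledge \<Rightarrow> bool"
  have "\<exists>ls gs out. spec n ls gs out" if n: "2 \<le> n" for n
    using big_network.simulate[OF big[OF n] _ e M B] n unfolding spec_def bits_def R_def by (simp add: \<kappa>_def)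
  then obtain ls gs out where spec: "\<And>n. 2 \<le> n \<Longrightarrow> spec n (ls n) (gs n) (out n)" by metis
  \<comment> \<open>The protocols chosen separately for each \<open>n\<close> form one algorithm
    because every node knows \<open>n\<close>; below \<open>2\<close> it stays silent.\<close>
  let ?A = "\<lparr>local_send = \<lambda>k u. if 2 \<le> k_n k then ls (k_n k) k u else None,
    global_send = \<lambda>k. if 2 \<le> k_n k then gs (k_n k) k else [], cut_side = \<lambda>k. out (k_n k) k,
    num_rounds = R, rand_bits = bits\<rparr>"
  have sim: "exec \<kappa> ?A adv n w r (R n) = exec \<kappa> (proto (ls n) (gs n)) adv n w r (R n)" if "2 \<le> n" for adv n w r
    by (rule exec_cong[where R = "R n"]) (use that in auto)
  have "valid_algorithm \<kappa> ?A"
    unfolding valid_algorithm_def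
  proof
    fix k
    show "length (global_send ?A k) \<le> ncc_cap \<kappa> (k_n k) \<and> (\<forall>(t, m) \<in> set (global_send ?A k). m < msg_bound \<kappa> (k_n k)) \<and>
        (\<forall>u m. local_send ?A k u = Some m \<longrightarrow> m < msg_bound \<kappa> (k_n k))"
    proof (cases "2 \<le> k_n k")
      case True
      then have "length (gs (k_n k) k) \<le> ncc_cap \<kappa> (k_n k) \<and> (\<forall>(t, m) \<in> set (gs (k_n k) k). m < msg_bound \<kappa> (k_n k)) \<and>
          (\<forall>u m. ls (k_n k) k u = Some m \<longrightarrow> m < msg_bound \<kappa> (k_n k))"
        using spec[OF True] unfolding spec_def by blast
      then show ?thesis using True by simp
    qed simp
  qed
  moreover have "real (R n) \<le> real \<kappa> * log 2 (real n) ^ \<kappa>" if n: "2 \<le> n" for n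
    using big_network.rounds_le[OF big[OF n], of d M] n unfolding R_def by (simp add: \<kappa>_def)
  moreover have "1 - 1 / real n powr 1 \<le> measure_pmf.prob (random_inputs n (bits n))
      {r. approx_min_cut \<epsilon> n w (computed_cut \<kappa> ?A adv n w r)}" if n: "2 \<le> n" and w: "weighted_graph n w d" for n w adv
  proof -
    have "computed_cut \<kappa> ?A adv n w r = {v. v < n \<and> out n (exec \<kappa> (proto (ls n) (gs n)) adv n w r (R n) v)}" for r
      unfolding computed_cut_def by (simp add: sim[OF n])
    moreover have "1 - 1 / real n \<le> measure_pmf.prob (random_inputs n (bits n))
        {r. approx_min_cut \<epsilon> n w {v. v < n \<and> out n (exec \<kappa> (proto (ls n) (gs n)) adv n w r (R n) v)}}"
      using spec[OF n] w unfolding spec_def by blast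
    ultimately show ?thesis using n by simp
  qed
  moreover have "0 < \<kappa>" by (simp add: \<kappa>_def)
  ultimately show "\<exists>(A::algorithm) (\<kappa>::nat) (c::real).
       0 < \<kappa> \<and> 0 < c \<and> valid_algorithm \<kappa> A \<and>
       (\<forall>n\<ge>2. real (num_rounds A n) \<le> real \<kappa> * (log 2 (real n)) ^ \<kappa>) \<and>
       (\<forall>n w (adv::adversary). n \<ge> 2 \<and> weighted_graph n w d \<longrightarrow>
          measure_pmf.prob (random_inputs n (rand_bits A n))
            {r. approx_min_cut \<epsilon> n w (computed_cut \<kappa> A adv n w r)}
          \<ge> 1 - 1 / real n powr c)"
    by (intro exI[of _ ?A] exI[of _ \<kappa>] exI[of _ "1::real"]) (simp only: algorithm.simps, blast intro: zero_less_one)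
qed simp

end
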